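(* Let $K_1/k$ and $K_2/k$ be two finite abelian extensions of degrees relatively prime to $q-1$. Then $$(K_1)_{\mathfrak{ge}}(K_2)_{\mathfrak{ge}}=(K_1K_2)_{\mathfrak{ge}}.$$
   Context: $k=\mathbb{F}_q(T)$ is a global rational function field and $P_\infty$ (the infinite prime) is the pole of $T$ in $k$. All extensions of $k$ are taken inside a fixed algebraic closure, and products of fields denote composites. The genus field $F_{\mathfrak{ge}}$ of a finite abelian extension $F/k$ is the maximal extension of $F$ that is abelian over $k$ and contained in the Hilbert class field of $F$, the latter being (Rosen) the maximal abelian extension of $F$ that is unramified at every prime and in which every prime of $F$ above $P_\infty$ decomposes fully. *)

theory Defs
  imports "HOL-Algebra.Algebraic_Closure_Type" "HOL-Algebra.Generated_Fields" "HOL-Library.Cardinality"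
begin

text \<open>All fields are subfields of one ambient field, given as a type of class
  \<^class>\<open>field\<close>; \<open>\<Omega>\<close> is that field in record form.\<close>

abbreviation Omega :: "'a::field ring" (\<open>\<Omega>\<close>)
  where "\<Omega> \<equiv> ring_of_type_algebra"

definition composite :: "'a::field set \<Rightarrow> 'a set \<Rightarrow> 'a set"
  where "composite K L = generate_field \<Omega> (K \<union> L)"


subsection \<open>Abelian extensions\<close>

definition field_extension :: "'a::field set \<Rightarrow> 'a set \<Rightarrow> bool"
  where "field_extension K L \<longleftrightarrow> subfield K \<Omega> \<and> subfield L \<Omega> \<and> K \<subseteq> L"

definition finite_extension :: "'a::field set \<Rightarrow> 'a set \<Rightarrow> bool"
  where "finite_extension K L \<longleftrightarrow> field_extension K L \<and> ring.finite_dimension \<Omega> K L"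

definition ext_degree :: "'a::field set \<Rightarrow> 'a set \<Rightarrow> nat"
  where "ext_degree K L = ring.dim \<Omega> K L"

text \<open>Values of an automorphism outside \<open>L\<close> are irrelevant, so automorphisms are compared
  on \<open>L\<close> only.\<close>

definition galois_auts :: "'a::field set \<Rightarrow> 'a set \<Rightarrow> ('a \<Rightarrow> 'a) set"
  where "galois_auts K L =
    {\<sigma> \<in> ring_iso (\<Omega>\<lparr>carrier := L\<rparr>) (\<Omega>\<lparr>carrier := L\<rparr>). \<forall>x\<in>K. \<sigma> x = x}"

definition galois_extension :: "'a::field set \<Rightarrow> 'a set \<Rightarrow> bool"
  where "galois_extension K L \<longleftrightarrow>
    field_extension K L \<and>
    (\<forall>x\<in>L. ring.algebraic \<Omega> K x) \<and>
    {x\<in>L. \<forall>\<sigma>\<in>galois_auts K L. \<sigma> x = x} = K"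

text \<open>Not required to be finite.\<close>

definition abelian_extension :: "'a::field set \<Rightarrow> 'a set \<Rightarrow> bool"
  where "abelian_extension K L \<longleftrightarrow>
    galois_extension K L \<and>
    (\<forall>\<sigma>\<in>galois_auts K L. \<forall>\<tau>\<in>galois_auts K L. \<forall>x\<in>L. \<sigma> (\<tau> x) = \<tau> (\<sigma> x))"


subsection \<open>Primes\<close>

text \<open>A prime of \<open>F\<close> is given by its valuation ring \<open>V\<close>. For \<open>F\<close> algebraic over a rational
  function field over a finite field, the constants need not be required to lie in \<open>V\<close>: they
  are \<open>0\<close> or roots of unity, and a ring containing each element of \<open>F\<close> or its inverse contains
  all roots of unity in \<open>F\<close>.\<close>

definition primes_of :: "'a::field set \<Rightarrow> 'a set set"
  where "primes_of F = {V. subring V \<Omega> \<and> V \<subset> F \<and> (\<forall>x\<in>F. x \<in> V \<or> inverse x \<in> V)}"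

definition max_ideal :: "'a::field set \<Rightarrow> 'a set"
  where "max_ideal V = {x\<in>V. x = 0 \<or> inverse x \<notin> V}"

definition primes_above :: "'a::field set \<Rightarrow> 'a set \<Rightarrow> 'a set \<Rightarrow> 'a set set"
  where "primes_above F P L = {V \<in> primes_of L. V \<inter> F = P}"

text \<open>With \<open>P = V \<inter> F\<close> this is \<open>\<mm>\<^sub>P V = \<mm>\<^sub>V\<close>, i.e. ramification index \<open>1\<close>, and it makes sense for
  infinite algebraic \<open>L/F\<close> as well. The residue extension is algebraic over a finite field,
  hence separable.\<close>

definition unramified_at :: "'a::field set \<Rightarrow> 'a set \<Rightarrow> bool"
  where "unramified_at F V \<longleftrightarrow> max_ideal V = {t * x | t x. t \<in> max_ideal (V \<inter> F) \<and> x \<in> V}"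

definition unramified_everywhere :: "'a::field set \<Rightarrow> 'a set \<Rightarrow> bool"
  where "unramified_everywhere F L \<longleftrightarrow> (\<forall>V\<in>primes_of L. unramified_at F V)"

text \<open>For finite \<open>L/F\<close> the condition on \<open>M = L\<close> (exactly \<open>[L:F]\<close> primes above \<open>P\<close>) implies
  the others.\<close>

definition decomposes_fully :: "'a::field set \<Rightarrow> 'a set \<Rightarrow> 'a set \<Rightarrow> bool"
  where "decomposes_fully F P L \<longleftrightarrow>
    (\<forall>M. finite_extension F M \<and> M \<subseteq> L \<longrightarrow> card (primes_above F P M) = ext_degree F M)"


subsection \<open>The rational function field and genus fields\<close>

type_synonym 'q ratfun_closure = "'q poly fract alg_closure"

definition ratfun_field :: "'q::{field,finite} ratfun_closure set"
  where "ratfun_field = range to_ac"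

text \<open>The valuation ring of \<open>-deg\<close>, the only prime of \<^term>\<open>ratfun_field\<close> at which \<open>T\<close>
  has a pole.\<close>

definition P_infinity :: "'q::{field,finite} ratfun_closure set"
  where "P_infinity = {to_ac (Fract f g) | f g. g \<noteq> 0 \<and> Polynomial.degree f \<le> Polynomial.degree g}"

text \<open>Below, ``maximal'' is rendered as greatest with respect to inclusion, inside the fixed
  algebraic closure. Infinite abelian extensions are admitted, so that the greatest element is
  the composite of all admissible extensions; that it is finite over \<open>F\<close> is a theorem.\<close>

definition hilbert_class_field :: "'q::{field,finite} ratfun_closure set \<Rightarrow> 'q ratfun_closure set"
  where "hilbert_class_field F = (GREATEST L.
    abelian_extension F L \<and> unramified_everywhere F L \<and>
    (\<forall>P \<in> primes_above ratfun_field P_infinity F. decomposes_fully F P L))"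

definition genus_field :: "'q::{field,finite} ratfun_closure set \<Rightarrow> 'q ratfun_closure set"
  where "genus_field F = (GREATEST E.
    field_extension F E \<and> abelian_extension ratfun_field E \<and> E \<subseteq> hilbert_class_field F)"

end

theory Submission
 imports Defs
begin

text \<open>Only one inclusion is hard. Let \<open>M\<close> be abelian over \<open>k\<close>, unramified over \<open>K = K1 K2\<close> and split
at infinity. Its inertia groups and its decomposition groups at infinity inject into \<open>Gal(K/k)\<close>, and
Kummer theory over \<open>k\<close> then shows that \<open>[M:k]\<close> is prime to \<open>q - 1\<close>. By explicit Kummer and
Artin--Schreier theory, \<open>M\<close> therefore lies in a composite \<open>B\<close> of abelian extensions of \<open>k\<close>, each
ramified at one prime only: in the tame part a Galois orbit of zeros contributes a multiple of the
exponent to the degree, which removes the ramification at infinity; in the wild part one uses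
partial fractions and cyclic towers. In \<open>Gal(B/k)\<close> an element of the group generated by the inertia
groups and the decomposition group at infinity inside \<open>Gal(B/K1)\<close>, and of the same group for \<open>K2\<close>,
has equal components in both decompositions (constants are added to \<open>B\<close> for the component at infinity).
These components lie in \<open>Gal(B/K)\<close>, so they are trivial on \<open>M\<close>.\<close>

text \<open>The number q - 1 enters through roots of unity: those in F_q are exactly the ones of
  order dividing q - 1. If zeta is a primitive m-th root of unity and D is the sum of the Kummer
  exponents over one Galois orbit of zeros, being abelian over \<open>k\<close> makes zeta^D Galois
  invariant, hence an element of F_q. For m prime to q - 1 this forces m to divide D; otherwise the
  tame extension attached to one finite prime would in general ramify at infinity too. The obstacle
  is infinity. An inertia group at a prime Q acts on B only through the factors attached to Q, so
  its elements can be read off factor by factor. A decomposition group acts on every factor. On a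
  factor unramified at infinity, however, its action is determined by residues, and finitely many
  residues, which are constants, suffice. This is what the added constants are for. No completions
  occur. Every prime is the trace of a valuation ring of the algebraic closure and every Galois
  group consists of restrictions of its automorphisms, so inertia and decomposition conditions in
  different fields concern the same objects.\<close>

type_synonym 'q om = "'q ratfun_closure"

abbreviation "cf \<equiv> Polynomial.coeff"
abbreviation "dg \<equiv> Polynomial.degree"
abbreviation "kk \<equiv> ratfun_field"

section \<open>Intermediate fields between k and its algebraic closure\<close>

lemma kk_0: "0 \<in> kk" and kk_1: "1 \<in> kk" unfolding ratfun_field_def by (metis rangeI to_ac_0, metis rangeI to_ac_1)

lemma kk_add: "x \<in> kk ==> y \<in> kk ==> x + y \<in> kk" and kk_mult: "x \<in> kk ==> y \<in> kk ==> x * y \<in> kk"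
 and kk_minus: "x \<in> kk ==> - x \<in> kk" and kk_inverse: "x \<in> kk ==> inverse x \<in> kk"
 by (auto simp: ratfun_field_def simp flip: to_ac_add to_ac_mult to_ac_minus to_ac_inverse)

text \<open>Negatives and inverses follow from these conditions: -1 lies in \<open>kk\<close>, and
  \<open>fld_inverse\<close> uses that every element is algebraic over \<open>kk\<close>.
  Intermediate fields are thus recognised by closure under sums and products.\<close>

definition fld :: "'q::{field,finite} om set => bool"
 where "fld K \<longleftrightarrow> kk <= K & (ALL x:K. ALL y:K. x + y \<in> K & x * y \<in> K)"

lemma fld_kk: "fld kk" by (auto simp: fld_def kk_add kk_mult)

lemma fld_kk_sub: "fld K ==> kk <= K" by (auto simp: fld_def)

lemma fld_0: "fld K ==> 0 \<in> K" and fld_1: "fld K ==> 1 \<in> K" and fld_add: "fld K ==> x \<in> K ==> y \<in> K ==> x + y \<in> K"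
 and fld_mult: "fld K ==> x \<in> K ==> y \<in> K ==> x * y \<in> K" using kk_0 kk_1 by (auto simp: fld_def)

lemma fld_minus: "fld K ==> x \<in> K ==> - x \<in> K" using kk_minus[OF kk_1] fld_mult[of K "-1" x] by (auto simp: fld_def)

lemma fld_diff: "fld K ==> x \<in> K ==> y \<in> K ==> x - y \<in> K" using fld_add[of K x "-y"] fld_minus by auto

lemma fld_power: "fld K ==> x \<in> K ==> x ^ n \<in> K" by (induction n) (auto intro: fld_1 fld_mult)

lemma fld_sum: "fld K ==> (\<And>i. i \<in> A ==> f i \<in> K) ==> sum f A \<in> K"
 by (induction A rule: infinite_finite_induct) (auto intro: fld_0 fld_add)

lemma fld_prod: "fld K ==> (\<And>i. i \<in> A ==> f i \<in> K) ==> prod f A \<in> K"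
 by (induction A rule: infinite_finite_induct) (auto intro: fld_1 fld_mult)

lemma fld_of_nat: "fld K ==> of_nat n \<in> K" by (induction n) (auto intro: fld_0 fld_add fld_1)

definition pk :: "'a::field set => 'a poly => bool" where "pk K f \<longleftrightarrow> (ALL i. cf f i \<in> K)"

lemma pk_mono: "pk K f ==> K <= L ==> pk L f" by (auto simp: pk_def)

lemma algebraic_over_kk:
 obtains f where "f ~= 0" "pk kk f" "poly f x = 0"
proof -
 obtain p where p: "p ~= 0" "poly (map_poly to_ac p) x = 0" by (rule alg_closure_algebraic)
 show thesis
 proof
  show "map_poly to_ac p ~= 0" using p(1) by (simp add: map_poly_eq_0_iff)
  show "pk kk (map_poly to_ac p)" by (auto simp: pk_def coeff_map_poly ratfun_field_def)
 qed (use p in auto)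
qed

lemma fld_poly: "fld K ==> pk K f ==> x \<in> K ==> poly f x \<in> K"
 unfolding poly_altdef pk_def by (intro fld_sum fld_mult fld_power) auto

text \<open>A relation with nonzero constant term has the form a + x g(x) = 0 and gives 1/x =
  -g(x)/a. A vanishing constant term is removed by dividing by x, which is the induction.\<close>

lemma fld_inverse:
 assumes "fld K" "x \<in> K" shows "inverse x \<in> K"
proof (cases "x = 0")
 case False
 have "f ~= 0 ==> pk kk f ==> poly f x = 0 ==> inverse x \<in> K" for f
 proof (induction f)
  case (pCons a g)
  have g: "pk kk g" and a: "a \<in> kk" using pCons.prems(2) unfolding pk_def by (metis coeff_pCons_Suc, metis coeff_pCons_0)
  show ?case
  proof (cases "a = 0")
   case True
   thus ?thesis using pCons False g by auto
  next
   case a0: False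
   have "a + x * poly g x = 0" using pCons.prems by simp
   hence "inverse x = - (poly g x * inverse a)" using a0 False by (simp add: field_simps eq_neg_iff_add_eq_0)
   moreover have "pk K g" "inverse a \<in> K" using g a kk_inverse fld_kk_sub[OF assms(1)] pk_mono by blast+
   ultimately show ?thesis using assms fld_minus fld_mult fld_poly by metis
  qed
 qed auto
 thus ?thesis using algebraic_over_kk by metis
qed (use assms fld_0 in auto)

lemma fld_divide: "fld K ==> x \<in> K ==> y \<in> K ==> x / y \<in> K" by (auto simp: divide_inverse intro: fld_mult fld_inverse)

lemma fld_power_int: "fld K ==> x \<in> K ==> x powi i \<in> K" by (auto simp: power_int_def intro: fld_power fld_inverse)

lemmas fld_intros = fld_0 fld_1 fld_add fld_mult fld_minus fld_diff fld_power fld_sum fld_prod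
 fld_of_nat fld_poly fld_inverse fld_divide fld_power_int

lemma field_Omega: "field (\<Omega> :: 'a::field ring)" by (rule field_from_type_algebra)

lemma Omega_simps [simp]:
 "carrier \<Omega> = UNIV" "x \<otimes>\<^bsub>\<Omega>\<^esub> y = x * y" "x \<oplus>\<^bsub>\<Omega>\<^esub> y = x + y" "\<one>\<^bsub>\<Omega>\<^esub> = 1" "\<zero>\<^bsub>\<Omega>\<^esub> = 0"
 by (auto simp: ring_of_type_algebra_def)

lemma Omega_minus: "\<ominus>\<^bsub>\<Omega>\<^esub> (x::'a::field) = - x"
proof -
 interpret field "\<Omega> :: 'a ring" by (rule field_Omega)
 have "\<ominus>\<^bsub>\<Omega>\<^esub> x + x = 0" using l_neg[of x] by simp
 thus ?thesis by (simp add: eq_neg_iff_add_eq_0)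
qed

lemma Omega_inv: "(x::'a::field) ~= 0 ==> inv\<^bsub>\<Omega>\<^esub> x = inverse x"
proof -
 interpret field "\<Omega> :: 'a ring" by (rule field_Omega)
 assume "x ~= 0"
 thus ?thesis using comm_inv_char[of x "inverse x"] by simp
qed

lemma subfield_Omega_iff:
 "subfield K (\<Omega> :: 'a::field ring) \<longleftrightarrow> 1 \<in> K & (ALL x:K. ALL y:K. x + y \<in> K & x * y \<in> K) &
   (ALL x:K. - x \<in> K & inverse x \<in> K)" (is "?L \<longleftrightarrow> ?R")
proof -
 interpret field "\<Omega> :: 'a ring" by (rule field_Omega)
 show ?thesis
 proof
  assume L: ?L
  have "inverse x \<in> K" if "x \<in> K" for x using subfield_m_inv(1)[OF L, of x] that Omega_inv[of x] subringE(2)[OF subfieldE(1)[OF L]]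
   by (cases "x = 0") auto
  thus ?R using subringE(3,5-7)[OF subfieldE(1)[OF L]] by (auto simp: Omega_minus)
 next
  assume R: ?R
  show ?L using R by (intro subfieldI' subringI) (auto simp: Omega_minus Omega_inv)
 qed
qed

lemma subfield_fld: "fld K ==> subfield K \<Omega>" unfolding subfield_Omega_iff by (blast intro: fld_intros)

lemma field_extension_fld2:
 assumes "fld F" shows "field_extension F K \<longleftrightarrow> fld K & F <= K" unfolding field_extension_def
 using subfield_fld[OF assms] subfield_fld[of K] assms by (auto simp: fld_def subfield_Omega_iff)

definition gen :: "'q::{field,finite} om set => 'q om set" where "gen S = \<Inter>{K. fld K & S <= K}"

lemma fld_gen: "fld (gen S)" by (auto simp: gen_def fld_def)

lemma gen_incl: "S <= gen S" by (auto simp: gen_def)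

lemma gen_least: "fld K ==> S <= K ==> gen S <= K" by (auto simp: gen_def)

lemma gen_mono: "S <= S' ==> gen S <= gen S'" by (auto simp: gen_def)

lemma gen_fld: "fld K ==> gen K = K" using gen_incl gen_least by blast

lemma composite_gen: "fld K ==> fld L ==> composite K L = gen (K Un L)"
proof -
 interpret field "\<Omega> :: 'a om ring" by (rule field_Omega)
 assume KL: "fld (K :: 'a om set)" "fld L"
 have s: "subfield (composite K L) \<Omega>" "K Un L <= composite K L"
  using generate_field_is_subfield[of "K Un L"] generate_fieldE(2)[of "K Un L"] by (auto simp: composite_def)
 hence "fld (composite K L)" using KL by (auto simp: subfield_Omega_iff fld_def)
 moreover have "composite K L <= gen (K Un L)" unfolding composite_def
  using generate_field_min_subfield1[OF _ subfield_fld[OF fld_gen] gen_incl] by auto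
 ultimately show ?thesis using s gen_least by blast
qed

text \<open>The elements generated by some finite subset already form a field, because two finite
  subsets have a finite union.\<close>

lemma gen_finite:
 assumes "x \<in> gen S"
 obtains S' where "finite S'" "S' <= S" "x \<in> gen S'"
proof -
 let ?K = "{x. EX S'. finite S' & S' <= S & x \<in> gen S'}"
 have "fld ?K" unfolding fld_def
 proof (intro conjI ballI)
  show "kk <= ?K" using fld_kk_sub[OF fld_gen[of "{}"]] by blast
 next
  fix x y assume "x \<in> ?K" "y \<in> ?K"
  then obtain A B where "finite A" "A <= S" "x \<in> gen A" "finite B" "B <= S" "y \<in> gen B" by blast
  hence "finite (A Un B)" "A Un B <= S" "x \<in> gen (A Un B)" "y \<in> gen (A Un B)"
   using gen_mono[of A "A Un B"] gen_mono[of B "A Un B"] by auto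
  thus "x + y \<in> ?K" "x * y \<in> ?K" by (blast intro: fld_intros fld_gen)+
 qed
 moreover have "S <= ?K"
 proof
  fix s assume "s \<in> S"
  thus "s \<in> ?K" using gen_incl[of "{s}"] by (intro CollectI exI[of _ "{s}"]) auto
 qed
 ultimately have "gen S <= ?K" by (rule gen_least)
 with assms that show thesis by blast
qed

section \<open>Polynomials with coefficients in a subfield\<close>

lemma pk_0: "fld K ==> pk K 0" and pk_1: "fld K ==> pk K 1" and pk_pCons: "a \<in> K ==> pk K f ==> pk K (pCons a f)"
 and pk_add: "fld K ==> pk K f ==> pk K g ==> pk K (f + g)" and pk_diff: "fld K ==> pk K f ==> pk K g ==> pk K (f - g)"
 and pk_smult: "fld K ==> a \<in> K ==> pk K f ==> pk K (Polynomial.smult a f)" and pk_mult: "fld K ==> pk K f ==> pk K g ==> pk K (f * g)"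
 and pk_monom: "fld K ==> a \<in> K ==> pk K (Polynomial.monom a n)"
 by (auto simp: pk_def coeff_pCons coeff_mult split: nat.splits intro: fld_intros)

lemma pk_prod: "fld K ==> (\<And>i. i \<in> A ==> pk K (f i)) ==> pk K (prod f A)"
 by (induction A rule: infinite_finite_induct) (auto intro: pk_1 pk_mult)

lemma pk_power: "fld K ==> pk K f ==> pk K (f ^ n)" by (induction n) (auto intro: pk_1 pk_mult)

lemmas pk_intros = pk_0 pk_1 pk_pCons pk_add pk_diff pk_smult pk_mult pk_monom pk_prod pk_power

text \<open>Long division with leading coefficients taken in K, so that quotient and remainder stay
  in K[X].\<close>

lemma pk_division:
 assumes "fld K" "pk K g" "g ~= 0" "pk K f"
 shows "EX q r. pk K q & pk K r & f = q * g + r & (r = 0 \<or> dg r < dg g)" using assms(4)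
proof (induction "dg f" arbitrary: f rule: less_induct)
 case less
 show ?case
 proof (cases "f = 0 \<or> dg f < dg g")
  case True
  thus ?thesis using less.prems pk_0[OF assms(1)] by (intro exI[of _ 0] exI[of _ f]) auto
 next
  case False
  define c where "c = Polynomial.lead_coeff f / Polynomial.lead_coeff g"
  define t where "t = Polynomial.monom c (dg f - dg g)"
  have c: "c \<in> K" "c ~= 0" using assms less.prems False unfolding c_def pk_def by (auto intro: fld_divide)
  have t: "pk K t" using c assms(1) unfolding t_def by (intro pk_monom) auto
  have tg: "dg (t * g) = dg f" "Polynomial.lead_coeff (t * g) = Polynomial.lead_coeff f"
  proof -
   have "t ~= 0" "dg t = dg f - dg g" "Polynomial.lead_coeff t = c" using c by (auto simp: t_def degree_monom_eq)
   thus "dg (t * g) = dg f" using False assms(3) by (auto simp: degree_mult_eq)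
   show "Polynomial.lead_coeff (t * g) = Polynomial.lead_coeff f"
    using \<open>Polynomial.lead_coeff t = c\<close> assms(3) by (simp only: Polynomial.lead_coeff_mult) (simp add: c_def)
  qed
  show ?thesis
  proof (cases "f - t * g = 0")
   case True
   thus ?thesis using t pk_0[OF assms(1)] by (intro exI[of _ t] exI[of _ 0]) auto
  next
   case f': False
   have "dg (f - t * g) < dg f"
   proof -
    have "dg (f - t * g) \<le> dg f" using tg by (intro degree_diff_le) auto
    moreover have "cf (f - t * g) (dg f) = 0" using tg by simp
    ultimately show ?thesis using f' leading_coeff_0_iff[of "f - t * g"] by (metis le_neq_implies_less)
   qed
   moreover have "pk K (f - t * g)" using assms less.prems t by (intro pk_intros)
   ultimately obtain q r where "pk K q" "pk K r" "f - t * g = q * g + r" "r = 0 \<or> dg r < dg g" using less.hyps by blast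
   thus ?thesis using t assms(1) by (intro exI[of _ "q + t"] exI[of _ r]) (auto intro: pk_add simp: algebra_simps)
  qed
 qed
qed

lemma minpoly_ex:
 assumes "fld K"
 obtains m where "pk K m" "Polynomial.lead_coeff m = 1" "poly m x = 0" "dg m > 0"
  "\<And>f. pk K f ==> poly f x = 0 ==> EX h. pk K h & f = m * h"
proof -
 let ?P = "%f. pk K f & f ~= 0 & poly f x = 0"
 obtain f where "?P f" using algebraic_over_kk[of x] pk_mono[OF _ fld_kk_sub[OF assms]] by metis
 then obtain g where g: "?P g" and gmin: "\<And>f. ?P f ==> dg g \<le> dg f" using ex_has_least_nat[of ?P f dg] by blast
 define m where "m = Polynomial.smult (inverse (Polynomial.lead_coeff g)) g"
 have m: "pk K m" "Polynomial.lead_coeff m = 1" "poly m x = 0" "dg m = dg g" "m ~= 0"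
  using g assms by (auto simp: m_def intro!: pk_intros fld_intros) (auto simp: pk_def)
 have "EX h. pk K h & f = m * h" if f: "pk K f" "poly f x = 0" for f
 proof -
  obtain q r where qr: "pk K q" "pk K r" "f = q * m + r" "r = 0 \<or> dg r < dg m" using pk_division[OF assms m(1) m(5) f(1)] by blast
  have "poly r x = 0" using qr(3) f(2) m(3) by simp
  hence "r = 0" using gmin[of r] qr(2,4) m(4) by (metis leD)
  thus ?thesis using qr by (auto simp: mult.commute)
 qed
 moreover have "dg m > 0"
 proof (rule ccontr)
  assume "\<not> dg m > 0"
  then obtain a where "m = [:a:]" by (metis degree_eq_zeroE gr0I)
  thus False using m(3,5) by simp
 qed
 ultimately show thesis using that m by blast
qed

text \<open>K[x] = K(x): polynomial values are closed under sums and products, and for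
  \<open>fld\<close> this is enough.\<close>

lemma gen_simple:
 assumes "fld K" shows "gen (insert x K) = {poly f x | f. pk K f}"
proof
 have "fld {poly f x | f. pk K f}" unfolding fld_def
 proof (intro conjI ballI subsetI)
  fix a :: "'a om" assume "a \<in> kk"
  thus "a \<in> {poly f x | f. pk K f}" using fld_kk_sub[OF assms] assms by (intro CollectI exI[of _ "[:a:]"]) (auto intro!: pk_intros)
 next
  fix a b assume "a \<in> {poly f x | f. pk K f}" "b \<in> {poly f x | f. pk K f}"
  then obtain f g where "pk K f" "pk K g" "a = poly f x" "b = poly g x" by blast
  thus "a + b \<in> {poly f x | f. pk K f}" "a * b \<in> {poly f x | f. pk K f}"
   using assms pk_add[of K f g] pk_mult[of K f g] by (auto intro: poly_add[symmetric] poly_mult[symmetric])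
 qed
 moreover have "insert x K <= {poly f x | f. pk K f}"
 proof
  fix y assume "y \<in> insert x K"
  thus "y \<in> {poly f x | f. pk K f}"
  proof
   assume "y = x"
   thus ?thesis using assms by (intro CollectI exI[of _ "[:0,1:]"]) (auto intro!: pk_intros fld_intros)
  next
   assume "y \<in> K"
   thus ?thesis using assms by (intro CollectI exI[of _ "[:y:]"]) (auto intro!: pk_intros)
  qed
 qed
 ultimately show "gen (insert x K) <= {poly f x | f. pk K f}" by (rule gen_least)
 show "{poly f x | f. pk K f} <= gen (insert x K)"
  using fld_poly[OF fld_gen[of "insert x K"]] gen_incl[of "insert x K"] pk_mono by blast
qed


section \<open>Automorphisms of the ambient field\<close>

definition aut :: "'a::field set => ('a => 'a) set"
 where "aut F = {sg. bij sg & (ALL x y. sg (x + y) = sg x + sg y & sg (x * y) = sg x * sg y) & (ALL x:F. sg x = x)}"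

lemma aut_mono: "F <= F' ==> sg \<in> aut F' ==> sg \<in> aut F" by (auto simp: aut_def)

lemma aut_fixes: "sg \<in> aut F ==> x \<in> F ==> sg x = x" and aut_bij: "sg \<in> aut F ==> bij sg"
 and aut_add: "sg \<in> aut F ==> sg (x + y) = sg x + sg y" and aut_mult: "sg \<in> aut F ==> sg (x * y) = sg x * sg y"
 by (auto simp: aut_def)

lemma aut_inj: "sg \<in> aut F ==> sg x = sg y \<longleftrightarrow> x = y" using aut_bij bij_is_inj by (metis injD)

lemma aut_0: "sg \<in> aut F ==> sg 0 = 0" using aut_add[of sg F 0 0] by (metis add_0_right add_left_cancel)

lemma aut_eq_0: "sg \<in> aut F ==> sg x = 0 \<longleftrightarrow> x = 0" using aut_inj[of sg F x 0] aut_0 by metis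

lemma aut_1: "sg \<in> aut F ==> sg 1 = 1" using aut_mult[of sg F 1 1] aut_eq_0[of sg F 1] by simp

lemma aut_minus: "sg \<in> aut F ==> sg (- x) = - sg x"
 using aut_add[of sg F x "-x"] aut_0[of sg F] by (simp add: eq_neg_iff_add_eq_0 add.commute)

lemma aut_diff: "sg \<in> aut F ==> sg (x - y) = sg x - sg y" using aut_add[of sg F x "-y"] aut_minus[of sg F y] by simp

lemma aut_power: "sg \<in> aut F ==> sg (x ^ n) = sg x ^ n" by (induction n) (auto simp: aut_1 aut_mult)

lemma aut_sum: "sg \<in> aut F ==> sg (sum f A) = (\<Sum>i\<in>A. sg (f i))"
 by (induction A rule: infinite_finite_induct) (auto simp: aut_0 aut_add)

lemma aut_prod: "sg \<in> aut F ==> sg (prod f A) = (\<Prod>i\<in>A. sg (f i))"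
 by (induction A rule: infinite_finite_induct) (auto simp: aut_1 aut_mult)

lemma aut_inverse: "sg \<in> aut F ==> sg (inverse x) = inverse (sg x)" using aut_mult[of sg F x "inverse x"] aut_1[of sg F] aut_0[of sg F]
 by (cases "x = 0") (auto intro: inverse_unique[symmetric])

lemma aut_divide: "sg \<in> aut F ==> sg (x / y) = sg x / sg y" by (simp add: divide_inverse aut_mult aut_inverse)

lemma aut_of_nat: "sg \<in> aut F ==> sg (of_nat n) = of_nat n" by (induction n) (auto simp: aut_0 aut_add aut_1)

lemma aut_power_int: "sg \<in> aut F ==> sg (x powi i) = sg x powi i" by (auto simp: power_int_def aut_power aut_inverse)

lemmas aut_simps = aut_0 aut_1 aut_add aut_mult aut_minus aut_diff aut_power aut_sum aut_prod
 aut_inverse aut_divide aut_of_nat aut_power_int aut_eq_0 aut_inj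

lemma aut_id: "id \<in> aut F" "(%x. x) \<in> aut F" by (auto simp: aut_def bij_def)

lemma aut_comp: "sg \<in> aut F ==> ta \<in> aut F ==> sg \<circ> ta \<in> aut F" by (auto simp: aut_def bij_comp)

lemma aut_funpow: "sg \<in> aut F ==> sg ^^ n \<in> aut F" by (induction n) (simp_all add: aut_comp aut_id)

abbreviation "ainv sg \<equiv> inv_into UNIV sg"

lemma aut_inv_apply: "sg \<in> aut F ==> sg (ainv sg x) = x" "sg \<in> aut F ==> ainv sg (sg x) = x"
 using aut_bij by (metis bij_inv_eq_iff)+

lemma aut_inv: "sg \<in> aut F ==> ainv sg \<in> aut F"
proof -
 assume s: "sg \<in> aut F"
 have "ainv sg (x + y) = ainv sg x + ainv sg y" for x y using aut_inv_apply[OF s] aut_add[OF s] by metis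
 moreover have "ainv sg (x * y) = ainv sg x * ainv sg y" for x y using aut_inv_apply[OF s] aut_mult[OF s] by metis
 moreover have "ALL x:F. ainv sg x = x" using aut_inv_apply[OF s] aut_fixes[OF s] by metis
 ultimately show ?thesis using bij_imp_bij_inv[OF aut_bij[OF s]] by (auto simp: aut_def)
qed

lemma aut_poly: "sg \<in> aut F ==> sg (poly f x) = poly (map_poly sg f) (sg x)"
proof (induction f)
 case (pCons a f)
 have "map_poly sg (pCons a f) = pCons (sg a) (map_poly sg f)" using pCons.hyps aut_0[OF pCons.prems] by (simp add: map_poly_pCons)
 thus ?case using pCons by (simp add: aut_simps[OF pCons.prems])
qed (simp add: aut_0)

lemma map_poly_aut_fixed: "sg \<in> aut F ==> pk F f ==> map_poly sg f = f"
 by (rule poly_eqI) (auto simp: coeff_map_poly aut_0 aut_fixes pk_def)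

lemma aut_poly_fixed: "sg \<in> aut F ==> pk F f ==> sg (poly f x) = poly f (sg x)" using aut_poly map_poly_aut_fixed by metis

lemma fld_equalizer:
 assumes "sg \<in> aut kk" "ta \<in> aut kk" shows "fld {x. sg x = ta x}" using assms by (auto simp: fld_def aut_simps aut_fixes)

lemma fld_fixed: "sg \<in> aut kk ==> fld {x. sg x = x}" using fld_equalizer[OF _ aut_id(2)] by auto

lemma fld_inter: "fld K ==> fld L ==> fld (K Int L)" by (auto simp: fld_def)

lemma fld_INT: "(\<And>i. i \<in> I ==> fld (K i)) ==> fld (\<Inter>i\<in>I. K i)" by (auto simp: fld_def)

lemma fld_fixed_set:
 assumes "fld B" "H <= aut kk" shows "fld {x\<in>B. ALL h:H. h x = x}"
proof -
 have "fld (B Int (\<Inter>h\<in>H. {x. h x = x}))" using assms fld_fixed by (intro fld_inter fld_INT) auto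
 moreover have "B Int (\<Inter>h\<in>H. {x. h x = x}) = {x\<in>B. ALL h:H. h x = x}" by auto
 ultimately show ?thesis by simp
qed

lemma aut_eq_gen:
 assumes "sg \<in> aut kk" "ta \<in> aut kk" "\<And>s. s \<in> S ==> sg s = ta s" "x \<in> gen S" shows "sg x = ta x"
 using gen_least[OF fld_equalizer[OF assms(1,2)], of S] assms by auto

lemma aut_gen_subset:
 assumes "sg \<in> aut kk" "\<And>s. s \<in> S ==> sg s \<in> K" "fld K" "x \<in> gen S" shows "sg x \<in> K"
proof -
 have "sg x \<in> K" if "x \<in> kk" for x using that fld_kk_sub[OF assms(3)] aut_fixes[OF assms(1)] by auto
 hence "fld {x. sg x \<in> K}" using fld_add[OF assms(3)] fld_mult[OF assms(3)]
  by (auto simp: fld_def aut_add[OF assms(1)] aut_mult[OF assms(1)])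
 moreover have "S <= {x. sg x \<in> K}" using assms(2) by blast
 ultimately have "gen S <= {x. sg x \<in> K}" by (rule gen_least)
 thus ?thesis using assms(4) by blast
qed

lemma aut_gen:
 assumes "sg \<in> aut kk" "\<And>s. s \<in> S ==> sg s = s" shows "sg \<in> aut (gen S)"
proof -
 have "ALL x:gen S. sg x = x" using aut_eq_gen[OF assms(1) aut_id(2) assms(2)] by blast
 thus ?thesis using assms(1) unfolding aut_def by blast
qed

subsection \<open>Extension of homomorphisms\<close>

definition hom_on :: "'q::{field,finite} om set => ('q om => 'q om) => bool"
 where "hom_on L sg \<longleftrightarrow> (ALL x:L. ALL y:L. sg (x + y) = sg x + sg y & sg (x * y) = sg x * sg y) & (ALL x:kk. sg x = x)"

lemma hom_on_0: "hom_on L sg ==> sg 0 = 0" using kk_0 by (auto simp: hom_on_def)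

lemma hom_on_sum:
 assumes "hom_on L sg" "fld L" "\<And>i. i \<in> A ==> f i \<in> L" shows "sg (sum f A) = (\<Sum>i\<in>A. sg (f i))" using assms(3)
proof (induction A rule: infinite_finite_induct)
 case (insert a A)
 have "sum f A \<in> L" using insert assms by (intro fld_sum) auto
 thus ?case using insert assms by (auto simp: hom_on_def)
qed (auto simp: hom_on_0[OF assms(1)])

lemma hom_on_map_poly:
 assumes "hom_on L sg" "fld L" "pk L f" "pk L g" shows "map_poly sg (f + g) = map_poly sg f + map_poly sg g"
  and "map_poly sg (f * g) = map_poly sg f * map_poly sg g"
proof -
 note [simp] = coeff_map_poly[of sg, OF hom_on_0[OF assms(1)]]
 show "map_poly sg (f + g) = map_poly sg f + map_poly sg g" using assms by (intro poly_eqI) (auto simp: hom_on_def pk_def)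
 show "map_poly sg (f * g) = map_poly sg f * map_poly sg g"
 proof (rule poly_eqI)
  fix n
  have "sg (\<Sum>i\<le>n. cf f i * cf g (n - i)) = (\<Sum>i\<le>n. sg (cf f i * cf g (n - i)))"
   using assms by (intro hom_on_sum[OF assms(1,2)] fld_mult) (auto simp: pk_def)
  also have "\<dots> = (\<Sum>i\<le>n. sg (cf f i) * sg (cf g (n - i)))" using assms by (intro sum.cong) (auto simp: hom_on_def pk_def)
  finally show "cf (map_poly sg (f * g)) n = cf (map_poly sg f * map_poly sg g) n" by (simp add: coeff_mult)
 qed
qed

text \<open>The extension sends f(x) to the value at y of the image polynomial of f. Two polynomials
  with the same value at x differ by one that vanishes at x, and hypothesis \<open>m\<close>
  transports this zero to y.\<close>

lemma hom_on_simple: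
 assumes L: "fld L" and sg: "hom_on L sg" and m: "\<And>f. pk L f ==> poly f x = 0 ==> poly (map_poly sg f) y = 0"
 obtains sg' where "hom_on (gen (insert x L)) sg'" "\<And>z. z \<in> L ==> sg' z = sg z" "sg' x = y"
proof -
 define sg' where "sg' z = poly (map_poly sg (SOME f. pk L f & poly f x = z)) y" for z
 have eq: "sg' (poly f x) = poly (map_poly sg f) y" if f: "pk L f" for f
 proof -
  define g where "g = (SOME g. pk L g & poly g x = poly f x)"
  have g: "pk L g" "poly g x = poly f x" using someI[of "%g. pk L g & poly g x = poly f x" f] f by (auto simp: g_def)
  have d: "pk L (f - g)" using f g L by (intro pk_diff)
  have "poly (map_poly sg (f - g)) y = 0" using g by (intro m d) auto
  moreover have "map_poly sg f = map_poly sg (f - g) + map_poly sg g" using hom_on_map_poly(1)[OF sg L d g(1)] by simp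
  ultimately show ?thesis by (simp add: sg'_def g_def)
 qed
 have c: "map_poly sg [:z:] = [:sg z:]" for z by (rule poly_eqI) (auto simp: coeff_map_poly hom_on_0[OF sg] coeff_pCons split: nat.splits)
 have l: "sg' z = sg z" if "z \<in> L" for z using eq[of "[:z:]"] that c pk_pCons[OF _ pk_0[OF L]] by auto
 have one: "sg 1 = 1" using sg kk_1 by (auto simp: hom_on_def)
 have "pk L [:0, 1:]" using L by (intro pk_intros fld_intros)
 moreover have "map_poly sg [:0, 1:] = [:0, 1:]"
  by (rule poly_eqI) (auto simp: coeff_map_poly hom_on_0[OF sg] one coeff_pCons split: nat.splits)
 ultimately have x: "sg' x = y" using eq[of "[:0,1:]"] by simp
 have "hom_on (gen (insert x L)) sg'" unfolding hom_on_def
 proof (intro conjI ballI)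
  fix a b assume "a \<in> gen (insert x L)" "b \<in> gen (insert x L)"
  then obtain f g where fg: "pk L f" "pk L g" "a = poly f x" "b = poly g x" by (auto simp: gen_simple[OF L])
  show "sg' (a + b) = sg' a + sg' b" using eq[OF pk_add[OF L fg(1,2)]] fg(3,4) eq[OF fg(1)] eq[OF fg(2)] hom_on_map_poly(1)[OF sg L fg(1,2)]
   by simp
  show "sg' (a * b) = sg' a * sg' b"
   using eq[OF pk_mult[OF L fg(1,2)]] fg(3,4) eq[OF fg(1)] eq[OF fg(2)] hom_on_map_poly(2)[OF sg L fg(1,2)] by simp
 qed (use l fld_kk_sub[OF L] sg in "auto simp: hom_on_def")
 thus thesis using l x by (rule that)
qed

lemma hom_on_extend_one:
 assumes L: "fld L" and sg: "hom_on L sg"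
 obtains sg' where "hom_on (gen (insert x L)) sg'" "\<And>z. z \<in> L ==> sg' z = sg z"
proof -
 obtain m where m: "pk L m" "Polynomial.lead_coeff m = 1" "dg m > 0"
  "\<And>f. pk L f ==> poly f x = 0 ==> EX h. pk L h & f = m * h" using minpoly_ex[OF L, of x] by metis
 have "sg 1 = 1" using sg kk_1 by (auto simp: hom_on_def)
 hence "cf (map_poly sg m) (dg m) = 1" using m(2) by (simp add: coeff_map_poly hom_on_0[OF sg])
 hence "dg (map_poly sg m) \<ge> dg m" by (metis le_degree zero_neq_one)
 with m(3) obtain y where y: "poly (map_poly sg m) y = 0" using alg_closed_imp_poly_has_root[of "map_poly sg m"] by auto
 have "poly (map_poly sg f) y = 0" if "pk L f" "poly f x = 0" for f using m(4)[OF that] y hom_on_map_poly(2)[OF sg L m(1)] by auto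
 from hom_on_simple[OF L sg this] obtain sg' where "hom_on (gen (insert x L)) sg'" "\<And>z. z \<in> L ==> sg' z = sg z" by metis
 thus thesis by (rule that)
qed

text \<open>Zorn's lemma is applied to graphs of partial homomorphisms, so that the union of a chain
  is again a candidate. A maximal graph is total by \<open>hom_on_extend_one\<close>, and
  surjectivity comes from algebraicity over \<open>k\<close>.\<close>

theorem hom_on_extend:
 assumes L: "fld L" and sg: "hom_on L sg"
 obtains sg' where "sg' \<in> aut kk" "\<And>z. z \<in> L ==> sg' z = sg z"
proof -
 \<comment> \<open>The last clause encodes single-valuedness: a graph closed under sums and products
   is closed under differences, since it contains the pair (-1, -1).\<close>
 define pgr where "pgr G \<longleftrightarrow> (ALL a:kk. (a, a) \<in> G) &
  (ALL a b c d. (a, b) \<in> G --> (c, d) \<in> G --> (a + c, b + d) \<in> G & (a * c, b * d) \<in> G) & (ALL b. (0, b) \<in> G --> b = 0)"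
  for G :: "('a om \<times> 'a om) set"
 have graph: "pgr ((%x. (x, ro x)) ` E)" if E: "fld E" and ro: "hom_on E ro" for E ro unfolding pgr_def
 proof (intro conjI ballI allI impI)
  fix a :: "'a om" assume "a \<in> kk"
  thus "(a, a) \<in> (%x. (x, ro x)) ` E" using ro fld_kk_sub[OF E] by (intro image_eqI[of _ _ a]) (auto simp: hom_on_def)
 next
  fix a b c d assume "(a, b) \<in> (%x. (x, ro x)) ` E" "(c, d) \<in> (%x. (x, ro x)) ` E"
  hence xy: "a \<in> E" "c \<in> E" "b = ro a" "d = ro c" by auto
  have "b + d = ro (a + c)" "b * d = ro (a * c)" using ro xy by (auto simp: hom_on_def)
  thus "(a + c, b + d) \<in> (%x. (x, ro x)) ` E" "(a * c, b * d) \<in> (%x. (x, ro x)) ` E"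
   using fld_add[OF E xy(1,2)] fld_mult[OF E xy(1,2)] by blast+
 qed (use hom_on_0[OF ro] in auto)
 define G0 where "G0 = (%x. (x, sg x)) ` L"
 have G0: "pgr G0" unfolding G0_def by (rule graph[OF L sg])
 define A where "A = {G. pgr G & G0 <= G}"
 have "EX M:A. ALL N:A. M <= N --> N = M"
 proof (rule subset_Zorn_nonempty)
  show "A ~= {}" using G0 by (auto simp: A_def)
  fix C assume C: "C ~= {}" "subset.chain A C"
  hence CA: "\<And>G. G \<in> C ==> pgr G & G0 <= G" by (auto simp: subset_chain_def A_def)
  have "pgr (\<Union>C)" unfolding pgr_def
  proof (intro conjI ballI allI impI)
   fix a :: "'a om" assume "a \<in> kk"
   thus "(a, a) \<in> \<Union>C" using C(1) CA by (auto simp: pgr_def)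
  next
   fix a b c d assume pq: "(a, b) \<in> \<Union>C" "(c, d) \<in> \<Union>C"
   then obtain G H where "G \<in> C" "H \<in> C" "(a, b) \<in> G" "(c, d) \<in> H" by blast
   then obtain G where G: "G \<in> C" "(a, b) \<in> G" "(c, d) \<in> G" using C(2) unfolding subset_chain_def by blast
   hence "(a + c, b + d) \<in> G" "(a * c, b * d) \<in> G" using CA[OF G(1)] unfolding pgr_def by blast+
   thus "(a + c, b + d) \<in> \<Union>C" "(a * c, b * d) \<in> \<Union>C" using G(1) by blast+
  next
   fix b assume "(0, b) \<in> \<Union>C"
   thus "b = 0" using CA unfolding pgr_def by blast
  qed
  thus "\<Union>C \<in> A" using C(1) CA by (auto simp: A_def)
 qed
 then obtain M where "M \<in> A" and Amax: "\<And>N. N \<in> A ==> M <= N ==> N = M" by metis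
 hence M: "pgr M" "G0 <= M" by (auto simp: A_def)
 have Mmax: "N = M" if "pgr N" "M <= N" for N using that M(2) by (intro Amax) (auto simp: A_def)
 have fn: "b = b'" if "(a, b) \<in> M" "(a, b') \<in> M" for a b b'
 proof -
  have "(-1, -1) \<in> M" using M(1) kk_minus[OF kk_1] unfolding pgr_def by blast
  hence "(-1 * a, -1 * b') \<in> M" using M(1) that unfolding pgr_def by blast
  hence "(a + -1 * a, b + -1 * b') \<in> M" using M(1) that unfolding pgr_def by blast
  moreover have "a + -1 * a = 0" by simp
  ultimately have "b + -1 * b' = 0" using M(1) unfolding pgr_def by metis
  thus ?thesis by simp
 qed
 define D where "D = Domain M"
 define ta where "ta x = (SOME y. (x, y) \<in> M)" for x
 have ta: "(x, ta x) \<in> M" if "x \<in> D" for x using that someI_ex[of "%y. (x, y) \<in> M"] by (auto simp: D_def ta_def)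
 have taI: "x \<in> D & ta x = y" if "(x, y) \<in> M" for x y using that ta[of x] fn by (auto simp: D_def)
 have D: "fld D" unfolding fld_def
 proof (intro conjI ballI subsetI)
  fix a :: "'a om" assume "a \<in> kk" thus "a \<in> D" using M(1) by (auto simp: pgr_def D_def)
 next
  fix x y assume "x \<in> D" "y \<in> D"
  hence "(x + y, ta x + ta y) \<in> M" "(x * y, ta x * ta y) \<in> M" using ta M(1) unfolding pgr_def by blast+
  thus "x + y \<in> D" "x * y \<in> D" using taI by blast+
 qed
 have tah: "hom_on D ta" unfolding hom_on_def
 proof (intro conjI ballI)
  fix x y assume "x \<in> D" "y \<in> D"
  hence "(x + y, ta x + ta y) \<in> M" "(x * y, ta x * ta y) \<in> M" using ta M(1) unfolding pgr_def by blast+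
  thus "ta (x + y) = ta x + ta y" "ta (x * y) = ta x * ta y" using taI by blast+
 qed (use M(1) taI in "auto simp: pgr_def")
 have "x \<in> D" for x
 proof -
  obtain ro where ro: "hom_on (gen (insert x D)) ro" "\<And>z. z \<in> D ==> ro z = ta z" using hom_on_extend_one[OF D tah, of x] by metis
  let ?X = "(%z. (z, ro z)) ` gen (insert x D)"
  have "pgr ?X" by (rule graph[OF fld_gen ro(1)])
  moreover have "M <= ?X"
  proof
   fix p assume "p \<in> M"
   then obtain a b where p: "p = (a, b)" "(a, b) \<in> M" by (cases p) auto
   hence "a \<in> D" "ro a = b" using taI ro(2) by auto
   thus "p \<in> ?X" using p gen_incl[of "insert x D"] by auto
  qed
  ultimately have "?X = M" by (rule Mmax)
  moreover have "x \<in> gen (insert x D)" using gen_incl by blast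
  ultimately show "x \<in> D" using taI by (metis (no_types, lifting) imageI)
 qed
 hence DU: "D = UNIV" by auto
 note hom = tah[unfolded DU hom_on_def, simplified]
 have t0: "ta 0 = 0" using hom_on_0[OF tah] .
 have z: "ta x = 0 ==> x = 0" for x
 proof (rule ccontr)
  assume "ta x = 0" "x ~= 0"
  hence "ta 1 = 0" using hom[THEN conjunct1, rule_format, of x "inverse x"] by auto
  thus False using hom kk_1 by (metis zero_neq_one)
 qed
 have "inj ta"
 proof (rule injI)
  fix x y assume "ta x = ta y"
  moreover have "ta x = ta (x - y) + ta y" using hom[THEN conjunct1, rule_format, of "x - y" y] by simp
  ultimately show "x = y" using z[of "x - y"] by simp
 qed
 have "surj ta" unfolding surj_def
 proof (rule allI)
  fix y :: "'a om"
  obtain f where f: "f ~= 0" "pk kk f" "poly f y = 0" by (rule algebraic_over_kk)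
  have "map_poly ta f = f" using f(2) hom by (intro poly_eqI) (auto simp: coeff_map_poly t0 pk_def)
  moreover have "ta (poly g x) = poly (map_poly ta g) (ta x)" for g x
  proof (induction g)
   case (pCons a g)
   thus ?case using hom by (auto simp: map_poly_pCons t0)
  qed (auto simp: t0)
  ultimately have "ta ` {x. poly f x = 0} <= {x. poly f x = 0}" using t0 by (auto) metis
  \<comment> \<open>An injection of the finite root set of f into itself is onto.\<close>
  hence "ta ` {x. poly f x = 0} = {x. poly f x = 0}"
   using poly_roots_finite[OF f(1)] \<open>inj ta\<close> by (metis endo_inj_surj inj_on_subset subset_UNIV)
  thus "EX x. y = ta x" using f(3) by blast
 qed
 hence "ta \<in> aut kk" using \<open>inj ta\<close> hom by (auto simp: aut_def bij_def)
 moreover have "ta z = sg z" if "z \<in> L" for z using that M(2) taI by (auto simp: G0_def)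
 ultimately show thesis by (rule that)
qed

lemma conjugate_aut:
 assumes K: "fld K" and m: "\<And>f. pk K f ==> poly f x = 0 ==> poly f y = 0"
 obtains sg where "sg \<in> aut K" "sg x = y"
proof -
 have h: "hom_on K (%z. z)" by (auto simp: hom_on_def)
 have "poly (map_poly (%z. z) f) y = 0" if "pk K f" "poly f x = 0" for f using m[OF that] by (simp add: map_poly_id')
 from hom_on_simple[OF K h this] obtain sg' where s: "hom_on (gen (insert x K)) sg'" "\<And>z. z \<in> K ==> sg' z = z" "sg' x = y" by metis
 obtain sg where sg: "sg \<in> aut kk" "\<And>z. z \<in> gen (insert x K) ==> sg z = sg' z" using hom_on_extend[OF fld_gen s(1)] by blast
 have "ALL z:K. sg z = z" "sg x = y"
  using sg(2) s(2,3) gen_incl[of "insert x K"] by (metis insertI2 subsetD, metis insertI1 subsetD)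
 thus thesis using sg(1) by (intro that[of sg]) (simp_all add: aut_def)
qed


lemma aut_fld: "fld F ==> aut F <= aut kk" using aut_mono[OF fld_kk_sub] by blast

section \<open>Orbits and the polynomials having them as roots\<close>

definition orb :: "'a::field set => 'a => 'a set" where "orb F x = (%sg. sg x) ` aut F"

lemma orbI: "sg \<in> aut F ==> sg x \<in> orb F x" by (auto simp: orb_def)

lemma orb_self: "x \<in> orb F x" using orbI[OF aut_id(2)] .

lemma orb_stable:
 assumes "ta \<in> aut F" "y \<in> orb F x" shows "ta y \<in> orb F x"
proof -
 obtain sg where "sg \<in> aut F" "y = sg x" using assms(2) by (auto simp: orb_def)
 thus ?thesis using orbI[OF aut_comp[OF assms(1)], of sg x] by simp
qed

lemma orb_subset:
 assumes "\<And>sg. sg \<in> aut F ==> sg x \<in> L" shows "orb F x <= L" using assms by (auto simp: orb_def)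

lemma finite_orb:
 assumes "fld F" shows "finite (orb F x)"
proof -
 obtain f where f: "f ~= 0" "pk kk f" "poly f x = 0" by (rule algebraic_over_kk)
 have "poly f (sg x) = 0" if s: "sg \<in> aut F" for sg
  using aut_poly_fixed[OF _ f(2), of sg x] aut_fld[OF assms] s f(3) aut_0[OF s] by auto
 hence "orb F x <= {y. poly f y = 0}" by (auto simp: orb_def)
 thus ?thesis using poly_roots_finite[OF f(1)] finite_subset by blast
qed

abbreviation rootpoly :: "'a::field set => 'a poly" where "rootpoly R \<equiv> \<Prod>r\<in>R. [:- r, 1:]"

lemma poly_rootpoly: "finite R ==> poly (rootpoly R) x = 0 \<longleftrightarrow> x \<in> (R :: 'a::field set)" by (auto simp: poly_prod)

lemma rootpoly_nonzero: "rootpoly R ~= (0 :: 'a::field poly)" by (cases "finite R") auto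

lemma degree_rootpoly: "finite R ==> dg (rootpoly R :: 'a::field poly) = card R" by (subst degree_prod_sum_eq) auto

lemma lead_coeff_rootpoly: "Polynomial.lead_coeff (rootpoly R :: 'a::field poly) = 1" by (subst lead_coeff_prod) auto

lemma map_poly_mult_aut: "sg \<in> aut F ==> map_poly sg (f * g) = map_poly sg f * map_poly sg g"
 by (rule poly_eqI) (simp add: coeff_map_poly coeff_mult aut_simps)

lemma map_poly_rootpoly: "sg \<in> aut F ==> map_poly sg (\<Prod>i\<in>I. [:- r i, 1:]) = (\<Prod>i\<in>I. [:- sg (r i), 1:])"
proof (induction I rule: infinite_finite_induct)
 case (insert a A)
 have "map_poly sg [:- r a, 1:] = [:- sg (r a), 1:]" using insert.prems by (simp add: map_poly_pCons aut_simps)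
 thus ?case using insert by (simp add: map_poly_mult_aut del: mult_pCons_left)
qed (simp_all add: aut_1 map_poly_1' map_poly_def[of _ 1] flip: one_pCons)

lemma rootpoly_fixed:
 assumes "sg \<in> aut F" "finite R" "sg ` R <= R" shows "sg (cf (rootpoly R) i) = cf (rootpoly R) i"
proof -
 have inj: "inj_on sg R" using aut_inj[OF assms(1)] by (auto simp: inj_on_def)
 have "sg ` R = R" using assms inj by (metis endo_inj_surj)
 hence "rootpoly R = (\<Prod>r\<in>R. [:- sg r, 1:])" using prod.reindex[OF inj, of "%r. [:- r, 1:]"] by simp
 hence "map_poly sg (rootpoly R) = rootpoly R" using map_poly_rootpoly[OF assms(1), of "%r. r" R] by simp
 thus ?thesis using coeff_map_poly[of sg, OF aut_0[OF assms(1)]] by metis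
qed

definition fixd :: "'a::field set => 'a => bool" where "fixd M x \<longleftrightarrow> (ALL sg:aut M. sg x = x)"

lemma fixdD: "fixd M x ==> sg \<in> aut M ==> sg x = x" by (simp add: fixd_def)

lemma fixd_mono: "fixd M x ==> M <= N ==> fixd N x" using aut_mono unfolding fixd_def by blast

subsection \<open>Separable elements\<close>

text \<open>Separability over M: a product over a set of roots has simple roots by construction. The
  polynomial may be any one over M, not only the minimal polynomial.\<close>

definition sepp :: "'q::{field,finite} om set => 'q om => bool"
 where "sepp M s \<longleftrightarrow> (EX R. finite R & s \<in> R & pk M (rootpoly R))"

lemma sepp_mono: "sepp M s ==> M <= M' ==> sepp M' s" using pk_mono unfolding sepp_def by blast

text \<open>The minimal polynomial of r divides a polynomial with simple roots, so it has as many
  distinct roots as its degree. Write x = g(r) with g of smaller degree. Each root is a conjugate of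
  r and x is invariant, so g takes the value x at all of them, hence g is constant.\<close>

lemma sep_fixed_simple:
 assumes M: "fld M" and r: "sepp M r" and x: "x \<in> gen (insert r M)" "fixd M x" shows "x \<in> M"
proof -
 obtain R where R: "finite R" "r \<in> R" "pk M (rootpoly R)" using r unfolding sepp_def by blast
 obtain m where m: "pk M m" "Polynomial.lead_coeff m = 1" "poly m r = 0" "dg m > 0"
  "\<And>f. pk M f ==> poly f r = 0 ==> EX h. pk M h & f = m * h" using minpoly_ex[OF M] by metis
 have m0: "m ~= 0" using m(2) by auto
 obtain h where h: "rootpoly R = m * h" using m(5)[OF R(3)] R(2) poly_rootpoly[OF R(1)] by blast
 have h0: "h ~= 0" using h rootpoly_nonzero by (metis mult_zero_right)
 define Z where "Z = {y. poly m y = 0}"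
 have finZ: "finite Z" unfolding Z_def by (rule poly_roots_finite[OF m0])
 have "R <= Z Un {y. poly h y = 0}"
 proof
  fix y assume "y \<in> R"
  hence "poly (m * h) y = 0" using poly_rootpoly[OF R(1), of y] h by simp
  thus "y \<in> Z Un {y. poly h y = 0}" by (auto simp: Z_def)
 qed
 hence "card R \<le> card (Z Un {y. poly h y = 0})" using finZ poly_roots_finite[OF h0] by (intro card_mono) auto
 also have "\<dots> \<le> card Z + dg h" using card_Un_le[of Z "{y. poly h y = 0}"] card_poly_roots_bound[OF h0] by linarith
 finally have "card R \<le> card Z + dg h" .
 moreover have "card R = dg m + dg h" using degree_rootpoly[OF R(1)] h degree_mult_eq[OF m0 h0] by metis
 ultimately have "dg m \<le> card Z" by linarith
 obtain f where f: "pk M f" "x = poly f r" using x(1) gen_simple[OF M] by auto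
 obtain q g where g: "pk M g" "f = q * m + g" "g = 0 \<or> dg g < dg m" using pk_division[OF M m(1) m0 f(1)] by blast
 have xg: "x = poly g r" using f(2) g(2) m(3) by simp
 have "poly g y = x" if "y \<in> Z" for y
 proof -
  have "poly f y = 0" if "pk M f" "poly f r = 0" for f using m(5)[OF that] \<open>y \<in> Z\<close> by (auto simp: Z_def)
  then obtain sg where sg: "sg \<in> aut M" "sg r = y" using conjugate_aut[OF M] by metis
  thus ?thesis using fixdD[OF x(2) sg(1)] aut_poly_fixed[OF sg(1) g(1), of r] xg by simp
 qed
 hence sub: "Z <= {y. poly (g - [:x:]) y = 0}" by auto
 have "g - [:x:] = 0"
 proof (rule ccontr)
  assume n: "g - [:x:] ~= 0"
  have "card Z \<le> dg (g - [:x:])" using card_mono[OF poly_roots_finite[OF n] sub] card_poly_roots_bound[OF n] by linarith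
  moreover have "dg (g - [:x:]) < dg m" using g(3) m(4) by (intro degree_diff_less) auto
  ultimately show False using \<open>dg m \<le> card Z\<close> by linarith
 qed
 hence "cf g 0 = x" by simp
 thus ?thesis using g(1) unfolding pk_def by metis
qed

text \<open>This half of the Galois correspondence holds for infinite S: x involves finitely many
  elements of S, which are adjoined one at a time, and invariance over the smaller field implies
  invariance over the larger one.\<close>

lemma sep_fixed:
 assumes M: "fld M" and S: "\<And>s. s \<in> S ==> sepp M s" and x: "x \<in> gen (M Un S)" "fixd M x" shows "x \<in> M"
proof -
 have fin: "x \<in> M" if "finite S" "fld M" "\<And>s. s \<in> S ==> sepp M s" "x \<in> gen (M Un S)"
  "fixd M x" for M S using that
 proof (induction S arbitrary: M rule: finite_induct)
  case empty
  thus ?case using gen_fld by auto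
 next
  case (insert s S)
  let ?N = "gen (insert s M)"
  have MN: "M <= ?N" using gen_incl[of "insert s M"] by blast
  have "M Un insert s S <= ?N Un S" using gen_incl[of "insert s M"] by blast
  hence "gen (M Un insert s S) <= gen (?N Un S)" by (rule gen_mono)
  hence 1: "x \<in> gen (?N Un S)" using insert.prems(3) by blast
  have 2: "sepp ?N t" if "t \<in> S" for t using insert.prems(2)[of t] that sepp_mono[OF _ MN] by blast
  have 3: "fixd ?N x" by (rule fixd_mono[OF insert.prems(4) MN])
  have "x \<in> ?N" using insert.IH[of ?N] fld_gen 1 2 3 by blast
  thus ?case using sep_fixed_simple[of M s x] insert.prems by blast
 qed
 obtain T where T: "finite T" "T <= M Un S" "x \<in> gen T" using gen_finite[OF x(1)] by blast
 have "T <= M Un (T Int S)" using T(2) by blast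
 hence "x \<in> gen (M Un (T Int S))" using gen_mono T(3) by blast
 moreover have "finite (T Int S)" using T(1) by blast
 ultimately show ?thesis using M S x(2) fin[of "T Int S" M] by blast
qed

subsection \<open>Abelian extensions\<close>

text \<open>Abelian extensions, possibly infinite, in terms of ambient automorphisms: stability of L
  is normality, the fixed field condition is separability, and commutation is tested on L
  only.\<close>

definition ab :: "'q::{field,finite} om set => 'q om set => bool"
 where "ab F L \<longleftrightarrow> fld F & fld L & F <= L & (ALL sg:aut F. sg ` L <= L) &
  (ALL x:L. fixd F x --> x \<in> F) &
  (ALL sg:aut F. ALL ta:aut F. ALL x:L. (sg \<circ> ta) x = (ta \<circ> sg) x)"

lemma ab_basic:
 assumes "ab F L" shows "fld F" "fld L" "F <= L" "x \<in> L ==> fixd F x ==> x \<in> F" using assms unfolding ab_def by blast+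

lemma ab_normal: "ab F L ==> sg \<in> aut F ==> x \<in> L ==> sg x \<in> L" unfolding ab_def by blast

lemma ab_commute:
 assumes "ab F L" "sg \<in> aut F" "ta \<in> aut F" "x \<in> L" shows "sg (ta x) = ta (sg x)"
proof -
 have "(sg \<circ> ta) x = (ta \<circ> sg) x" using assms unfolding ab_def by blast
 thus ?thesis by simp
qed

lemma abI':
 assumes "fld F" "fld L" "F <= L" "\<And>sg x. sg \<in> aut F ==> x \<in> L ==> sg x \<in> L"
  "\<And>x. x \<in> L ==> fixd F x ==> x \<in> F"
  "\<And>sg ta x. sg \<in> aut F ==> ta \<in> aut F ==> x \<in> L ==> (sg \<circ> ta) x = (ta \<circ> sg) x" shows "ab F L"
proof -
 have 1: "ALL sg:aut F. sg ` L <= L" using assms(4) by blast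
 have 2: "ALL x:L. fixd F x --> x \<in> F" using assms(5) by blast
 have 3: "ALL sg:aut F. ALL ta:aut F. ALL x:L. (sg \<circ> ta) x = (ta \<circ> sg) x" by (intro ballI assms(6))
 show ?thesis unfolding ab_def by (intro conjI; fact assms(1) assms(2) assms(3) 1 2 3)
qed

text \<open>The coefficients of the orbit polynomial are symmetric functions of the orbit, hence
  invariant.\<close>

lemma orbit_sepp:
 assumes F: "fld F" and fx: "\<And>y. y \<in> gen (orb F x) ==> fixd F y ==> y \<in> F" shows "sepp F x"
proof -
 let ?R = "orb F x"
 have fin: "finite ?R" by (rule finite_orb[OF F])
 have c: "pk (gen ?R) (rootpoly ?R)" using gen_incl[of ?R] fld_gen[of ?R] by (intro pk_prod pk_intros) (auto intro: fld_minus fld_1)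
 have st: "ta ` ?R <= ?R" if "ta \<in> aut F" for ta using orb_stable[OF that] by blast
 have "cf (rootpoly ?R) i \<in> F" for i using c rootpoly_fixed[OF _ fin st] by (intro fx) (auto simp: pk_def fixd_def)
 thus ?thesis using fin orb_self[of x F] unfolding sepp_def pk_def by blast
qed

lemma ab_orb: "ab F L ==> x \<in> L ==> orb F x <= L" by (rule orb_subset) (rule ab_normal)

lemma ab_sepp:
 assumes "ab F L" "x \<in> L" shows "sepp F x"
proof (rule orbit_sepp)
 fix y assume y: "y \<in> gen (orb F x)" "fixd F y"
 have "gen (orb F x) <= L" by (rule gen_least[OF ab_basic(2)[OF assms(1)] ab_orb[OF assms]])
 thus "y \<in> F" using ab_basic(4)[OF assms(1)] y by blast
qed (rule ab_basic(1)[OF assms(1)])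

lemma ab_fixed:
 assumes "ab F L" "fld M" "F <= M" "x \<in> gen (M Un L)" "fixd M x" shows "x \<in> M" using assms(2) _ assms(4,5)
 by (rule sep_fixed) (use ab_sepp[OF assms(1)] sepp_mono assms(3) in blast)

lemma abI:
 assumes "fld F" "F <= S" "\<And>sg s. sg \<in> aut F ==> s \<in> S ==> sg s \<in> gen S"
  "\<And>x. x \<in> gen S ==> fixd F x ==> x \<in> F"
  "\<And>sg ta s. sg \<in> aut F ==> ta \<in> aut F ==> s \<in> S ==> (sg \<circ> ta) s = (ta \<circ> sg) s" shows "ab F (gen S)"
proof (rule abI')
 show "F <= gen S" using assms(2) gen_incl by blast
next
 fix sg x assume s: "sg \<in> aut F" "x \<in> gen S"
 have "sg \<in> aut kk" using s(1) aut_fld[OF assms(1)] by blast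
 thus "sg x \<in> gen S" using assms(3)[OF s(1)] fld_gen s(2) by (rule aut_gen_subset)
next
 fix sg ta x assume s: "sg \<in> aut F" "ta \<in> aut F" "x \<in> gen S"
 have "sg \<circ> ta \<in> aut kk" "ta \<circ> sg \<in> aut kk" using s aut_comp aut_fld[OF assms(1)] by blast+
 thus "(sg \<circ> ta) x = (ta \<circ> sg) x" using assms(5)[OF s(1,2)] s(3) by (rule aut_eq_gen)
qed (fact assms(1) fld_gen | erule (1) assms(4))+

lemma ab_gen_Union:
 assumes "fld F" "\<And>L. L \<in> \<L> ==> ab F L" shows "ab F (gen (F Un \<Union>\<L>))"
proof (rule abI)
 fix sg s assume s: "sg \<in> aut F" "s \<in> F Un \<Union>\<L>"
 show "sg s \<in> gen (F Un \<Union>\<L>)"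
 proof (cases "s \<in> F")
  case True thus ?thesis using aut_fixes[OF s(1) True] gen_incl[of "F Un \<Union>\<L>"] by auto
 next
  case False
  then obtain L where L: "L \<in> \<L>" "s \<in> L" using s(2) by blast
  have "sg s \<in> L" by (rule ab_normal[OF assms(2)[OF L(1)] s(1) L(2)])
  thus ?thesis using gen_incl[of "F Un \<Union>\<L>"] L(1) by blast
 qed
next
 fix x assume x: "x \<in> gen (F Un \<Union>\<L>)" "fixd F x"
 show "x \<in> F" using assms(1) _ x by (rule sep_fixed) (use ab_sepp assms(2) in blast)
next
 fix sg ta s assume s: "sg \<in> aut F" "ta \<in> aut F" "s \<in> F Un \<Union>\<L>"
 show "(sg \<circ> ta) s = (ta \<circ> sg) s"
 proof (cases "s \<in> F")
  case True thus ?thesis using aut_fixes[OF s(1) True] aut_fixes[OF s(2) True] by simp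
 next
  case False
  then obtain L where L: "L \<in> \<L>" "s \<in> L" using s(3) by blast
  thus ?thesis using ab_commute[OF assms(2)[OF L(1)] s(1,2) L(2)] by simp
 qed
qed (use assms(1) in auto)

lemma ab_refl: "fld F ==> ab F F" by (rule abI') (auto simp: aut_fixes)

text \<open>Stability of M uses commutativity: an automorphism that fixes M also fixes the image of
  M under \<open>aut F\<close>, and the elements of L fixed by \<open>aut M\<close> lie in M by
  \<open>ab_fixed\<close>.\<close>

lemma ab_sub:
 assumes "ab F L" "fld M" "F <= M" "M <= L" shows "ab F M" "ab M L"
proof -
 have sub: "sg \<in> aut F" if "sg \<in> aut M" for sg using that aut_mono[OF assms(3)] by blast
 have fx: "x \<in> M" if "x \<in> L" "fixd M x" for x
  using that(1) gen_incl[of "M Un L"] by (intro ab_fixed[OF assms(1-3) _ that(2)]) auto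
 show "ab F M"
 proof (rule abI')
  fix sg x assume s: "sg \<in> aut F" "x \<in> M"
  show "sg x \<in> M"
  proof (rule fx)
   show "sg x \<in> L" using s assms ab_normal by blast
   have "ta (sg x) = sg x" if t: "ta \<in> aut M" for ta
    using ab_commute[OF assms(1) sub[OF t] s(1), of x] s(2) assms(4) aut_fixes[OF t s(2)] by auto
   thus "fixd M (sg x)" by (simp add: fixd_def)
  qed
 next
  show "x \<in> F" if "x \<in> M" "fixd F x" for x using that assms(4) ab_basic(4)[OF assms(1)] by blast
  show "(sg \<circ> ta) x = (ta \<circ> sg) x" if "sg \<in> aut F" "ta \<in> aut F" "x \<in> M" for sg ta x
   using ab_commute[OF assms(1) that(1,2)] that(3) assms(4) by auto
 qed (use assms ab_basic(1)[OF assms(1)] in blast)+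
 show "ab M L"
 proof (rule abI')
  show "sg x \<in> L" if "sg \<in> aut M" "x \<in> L" for sg x using ab_normal[OF assms(1) sub[OF that(1)] that(2)] .
  show "(sg \<circ> ta) x = (ta \<circ> sg) x" if "sg \<in> aut M" "ta \<in> aut M" "x \<in> L" for sg ta x
   using ab_commute[OF assms(1) sub[OF that(1)] sub[OF that(2)] that(3)] by simp
 qed (use assms ab_basic(2)[OF assms(1)] fx in blast)+
qed

lemma ab_un:
 assumes "ab F L1" "ab F L2" shows "ab F (gen (L1 Un L2))"
proof -
 have "F Un \<Union>{L1, L2} = L1 Un L2" using ab_basic(3) assms by blast
 thus ?thesis using ab_gen_Union[of F "{L1, L2}"] assms ab_basic(1) by (metis empty_iff insert_iff)
qed

lemma ab_translate:
 assumes "ab F L" "fld M" "F <= M" shows "ab M (gen (M Un L))"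
proof (rule abI)
 have sub: "sg \<in> aut F" if "sg \<in> aut M" for sg using that aut_mono[OF assms(3)] by blast
 show "sg s \<in> gen (M Un L)" if "sg \<in> aut M" "s \<in> M Un L" for sg s using that(2)
 proof
  assume "s \<in> M" thus ?thesis using aut_fixes[OF that(1)] gen_incl[of "M Un L"] by auto
 next
  assume "s \<in> L" thus ?thesis using ab_normal[OF assms(1) sub[OF that(1)]] gen_incl[of "M Un L"] by auto
 qed
 show "(sg \<circ> ta) s = (ta \<circ> sg) s" if "sg \<in> aut M" "ta \<in> aut M" "s \<in> M Un L" for sg ta s using that(3)
 proof
  assume "s \<in> M" thus ?thesis using aut_fixes[OF that(1)] aut_fixes[OF that(2)] by auto
 next
  assume "s \<in> L" thus ?thesis using ab_commute[OF assms(1) sub[OF that(1)] sub[OF that(2)]] by auto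
 qed
 show "x \<in> M" if "x \<in> gen (M Un L)" "fixd M x" for x by (rule ab_fixed[OF assms that])
qed (use assms in auto)


subsection \<open>Separating elements\<close>

lemma infinite_kk: "infinite (kk :: 'q::{field,finite} om set)"
proof -
 have "inj (%n. to_ac (Fract (Polynomial.monom (1::'q) n) 1))"
 proof (rule injI)
  fix m n
  assume "to_ac (Fract (Polynomial.monom (1::'q) m) 1) = to_ac (Fract (Polynomial.monom 1 n) 1)"
  hence "Polynomial.monom (1::'q) m = Polynomial.monom 1 n" by (simp add: eq_fract)
  thus "m = n" by (metis degree_monom_eq zero_neq_one)
 qed
 hence "infinite (range (%n. to_ac (Fract (Polynomial.monom (1::'q) n) 1)))" by (metis finite_imageD infinite_UNIV_nat)
 moreover have "range (%n. to_ac (Fract (Polynomial.monom (1::'q) n) 1)) <= kk" unfolding ratfun_field_def by blast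
 ultimately show ?thesis using finite_subset by blast
qed

lemma finite_restrict_aut:
 assumes "fld F" "finite S" shows "finite ((%sg. restrict sg S) ` aut F)"
proof (rule finite_subset)
 show "(%sg. restrict sg S) ` aut F <= PiE S (orb F)" by (auto simp: orbI)
 show "finite (PiE S (orb F))" using assms finite_orb by (intro finite_PiE) auto
qed

text \<open>A combination of the elements of S with powers of a parameter c from the infinite field
  \<open>k\<close> separates all pairs at once, since each pair excludes only the roots of a nonzero
  polynomial. The set A may be infinite, but only restrictions to the finite set S matter, and these
  are finite in number.\<close>

lemma separating_element:
 fixes S :: "'q::{field,finite} om set"
 assumes S: "finite S" and A: "A <= aut kk \<times> aut kk" and d: "ALL (sg, ta):A. EX s:S. sg s ~= ta s"
 obtains th where "th \<in> gen S" "ALL (sg, ta):A. sg th ~= ta th"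
proof -
 obtain e where e: "bij_betw e {0..<card S} S" using ex_bij_betw_nat_finite[OF S] by blast
 let ?n = "card S"
 \<comment> \<open>The polynomial whose value at c is \<open>sg th - ta th\<close> for th the sum of
   the c^i e(i).\<close>
 define q where "q sg ta = (\<Sum>i<?n. Polynomial.monom (sg (e i) - ta (e i)) i)"
  for sg ta :: "'q om => 'q om"
 have ei: "e i \<in> S" if "i < ?n" for i using e that by (auto simp: bij_betw_def)
 have "q sg ta = q (restrict sg S) (restrict ta S)" for sg ta unfolding q_def by (intro sum.cong) (auto simp: ei)
 hence "(%(sg, ta). q sg ta) ` A <=
   (%(f, g). q f g) ` ((%sg. restrict sg S) ` aut kk \<times> (%sg. restrict sg S) ` aut kk)" using A by force
 hence finQ: "finite ((%(sg, ta). q sg ta) ` A)"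
  using finite_restrict_aut[OF fld_kk S] by (meson finite_SigmaI finite_imageI finite_subset)
 have q0: "q sg ta ~= 0" if "(sg, ta) \<in> A" for sg ta
 proof -
  obtain s where s: "s \<in> S" "sg s ~= ta s" using d \<open>(sg, ta) \<in> A\<close> by blast
  then obtain i where i: "i < ?n" "e i = s" using e unfolding bij_betw_def by force
  have "cf (q sg ta) i = (\<Sum>j<?n. if j = i then sg (e j) - ta (e j) else 0)"
   unfolding q_def Polynomial.coeff_sum by (intro sum.cong) auto
  also have "\<dots> = sg s - ta s" using i by simp
  finally show ?thesis using s(2) by auto
 qed
 have "finite (\<Union>f\<in>(%(sg, ta). q sg ta) ` A. {c. poly f c = 0})"
  using finQ q0 poly_roots_finite by (intro finite_UN_I) auto
 then obtain c where c: "c \<in> kk" "c ~: (\<Union>f\<in>(%(sg, ta). q sg ta) ` A. {c. poly f c = 0})"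
  using infinite_kk by (metis finite_subset subsetI)
 define th where "th = (\<Sum>i<?n. c ^ i * e i)"
 show thesis
 proof
  show "th \<in> gen S" unfolding th_def using fld_gen[of S] c(1) fld_kk_sub[OF fld_gen[of S]] gen_incl[of S] ei
   by (intro fld_sum fld_mult fld_power) auto
  have "sg th ~= ta th" if st: "(sg, ta) \<in> A" for sg ta
  proof -
  have s: "sg \<in> aut kk" and t: "ta \<in> aut kk" using st A by auto
  have "sg th - ta th = (\<Sum>i<?n. (sg (e i) - ta (e i)) * c ^ i)"
   unfolding th_def aut_sum[OF s] aut_sum[OF t] aut_mult[OF s] aut_mult[OF t]
    aut_power[OF s] aut_power[OF t] aut_fixes[OF s c(1)] aut_fixes[OF t c(1)] sum_subtractf[symmetric] by (simp add: algebra_simps)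
  also have "\<dots> = poly (q sg ta) c" by (simp add: q_def poly_sum poly_monom)
  finally have "sg th - ta th = poly (q sg ta) c" .
  moreover have "poly (q sg ta) c ~= 0" using c(2) st by force
  ultimately show ?thesis by auto
  qed
  thus "ALL (sg, ta):A. sg th ~= ta th" by blast
 qed
qed

section \<open>Fixed fields of groups and finite Galois groups\<close>

definition subgrp :: "('a::field => 'a) set => bool"
 where "subgrp H \<longleftrightarrow> (%x. x) \<in> H & (ALL g:H. ALL h:H. g \<circ> h \<in> H)"

definition Fix :: "('a => 'a) set => 'a set => 'a set" where "Fix H B = {x\<in>B. ALL h:H. h x = x}"

lemma fld_Fix: "fld B ==> H <= aut kk ==> fld (Fix H B)" unfolding Fix_def by (rule fld_fixed_set)

lemma rootpoly_Fix:
 assumes "H <= aut kk" "fld B" "finite R" "R <= B" "\<And>h. h \<in> H ==> h ` R <= R"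
 shows "pk (Fix H B) (rootpoly R)" unfolding pk_def
proof
 fix i
 have "pk B (rootpoly R)" using assms(2,4) by (intro pk_prod pk_intros) (auto intro: fld_minus fld_1)
 moreover have "h (cf (rootpoly R) i) = cf (rootpoly R) i" if "h \<in> H" for h using assms that by (intro rootpoly_fixed[of h kk]) auto
 ultimately show "cf (rootpoly R) i \<in> Fix H B" by (auto simp: Fix_def pk_def)
qed

text \<open>If \<open>sg\<close> differed on S from every element of H, one element th would
  separate it from all of them. But the polynomial with roots the H-orbit of th has coefficients
  fixed by \<open>sg\<close>, so \<open>sg th\<close> is again in the orbit.\<close>

theorem artin:
 assumes S: "finite S" and H: "H <= aut kk" "subgrp H" and n: "\<And>h s. h \<in> H ==> s \<in> S ==> h s \<in> gen S"
  and sg: "sg \<in> aut kk" "ALL x:Fix H (gen S). sg x = x"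
 obtains h where "h \<in> H" "ALL x:gen S. sg x = h x"
proof (cases "EX h:H. ALL s:S. sg s = h s")
 case True
 then obtain h where h: "h \<in> H" "\<And>s. s \<in> S ==> sg s = h s" by blast
 have "h \<in> aut kk" using h(1) H(1) by blast
 hence "ALL x:gen S. sg x = h x" using aut_eq_gen[OF sg(1) _ h(2)] by blast
 thus thesis by (rule that[OF h(1)])
next
 case False
 have A: "{sg} \<times> H <= aut kk \<times> aut kk" using sg(1) H(1) by blast
 have d: "ALL (a, b):{sg} \<times> H. EX s:S. a s ~= b s" using False by blast
 obtain th where th: "th \<in> gen S" "ALL (a, b):{sg} \<times> H. a th ~= b th" by (rule separating_element[OF S A d])
 define R where "R = (%h. h th) ` H"
 have finR: "finite R"
 proof (rule finite_subset[OF _ finite_orb[OF fld_kk, of th]])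
  show "R <= orb kk th" unfolding R_def orb_def using H(1) by (rule image_mono)
 qed
 have RB: "R <= gen S"
 proof
  fix r assume "r \<in> R"
  then obtain h where h: "h \<in> H" "r = h th" unfolding R_def by blast
  show "r \<in> gen S" unfolding h(2) by (rule aut_gen_subset[OF _ n[OF h(1)] fld_gen th(1)]) (use h(1) H(1) in auto)
 qed
 have st: "h ` R <= R" if h: "h \<in> H" for h
 proof
  fix y assume "y \<in> h ` R"
  then obtain g where g: "g \<in> H" "y = (h \<circ> g) th" unfolding R_def by auto
  have "h \<circ> g \<in> H" using H(2) h g(1) unfolding subgrp_def by blast
  thus "y \<in> R" unfolding R_def g(2) by (rule imageI)
 qed
 have P: "pk (Fix H (gen S)) (rootpoly R)" by (rule rootpoly_Fix[OF H(1) fld_gen finR RB st])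
 have "map_poly sg (rootpoly R) = rootpoly R" using P sg(2) by (intro poly_eqI) (auto simp: coeff_map_poly aut_0[OF sg(1)] pk_def)
 moreover have "th \<in> R" using H(2) unfolding R_def subgrp_def by (intro image_eqI[of _ _ "%x. x"]) auto
 hence "poly (rootpoly R) th = 0" using poly_rootpoly[OF finR] by blast
 ultimately have "poly (rootpoly R) (sg th) = 0" using aut_poly[OF sg(1), of "rootpoly R" th] aut_0[OF sg(1)] by simp
 hence "sg th \<in> R" using poly_rootpoly[OF finR] by blast
 thus thesis using th(2) unfolding R_def by blast
qed

definition fingen :: "'q::{field,finite} om set => 'q om set => bool"
 where "fingen F M \<longleftrightarrow> (EX S. finite S & M = gen (F Un S))"

lemma fingenE:
 assumes "fingen F M"
 obtains S where "finite S" "M = gen (F Un S)" using assms unfolding fingen_def by blast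

text \<open>For normal M/F this is the Galois group, as a set of extensional functions:
  automorphisms agreeing on M are identified and the set can be counted.\<close>

definition restr :: "'a::field set => 'a set => ('a => 'a) set" where "restr F M = (%sg. restrict sg M) ` aut F"

lemma restrict_eq_iff: "restrict f M = restrict g M \<longleftrightarrow> (ALL x:M. f x = g x)"
 by (metis restrict_apply' restrict_ext)

lemma aut_eq_gen2:
 assumes "sg \<in> aut F" "ta \<in> aut F" "fld F" "\<And>s. s \<in> S ==> sg s = ta s" "x \<in> gen (F Un S)" shows "sg x = ta x"
proof (rule aut_eq_gen[of sg ta "F Un S"])
 show "sg s = ta s" if "s \<in> F Un S" for s using that assms(4) aut_fixes[OF assms(1)] aut_fixes[OF assms(2)] by auto
qed (use assms aut_fld in auto)

text \<open>Primitive elements through automorphisms: the image of \<open>th\<close> determines the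
  restriction to M. Generation of M by \<open>th\<close> follows in
  \<open>gen_primitive\<close>.\<close>

definition prim :: "'a::field set => 'a set => 'a => bool" where "prim F M th \<longleftrightarrow> th \<in> M &
  (ALL sg:aut F. ALL ta:aut F. sg th = ta th --> restrict sg M = restrict ta M)"

lemma prim_mem: "prim F M th ==> th \<in> M" by (simp add: prim_def)

lemma prim_eq:
 assumes "prim F M th" "sg \<in> aut F" "ta \<in> aut F" "sg th = ta th" "x \<in> M" shows "sg x = ta x"
proof -
 have "restrict sg M = restrict ta M" using assms unfolding prim_def by blast
 thus ?thesis using assms(5) by (metis restrict_apply')
qed

lemma primitive_element:
 assumes "fld F" "fingen F M"
 obtains th where "prim F M th"
proof -
 obtain S where S: "finite S" "M = gen (F Un S)" by (rule fingenE[OF assms(2)])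
 let ?A = "{(sg, ta). sg \<in> aut F & ta \<in> aut F & (EX s:S. sg s ~= ta s)}"
 have A: "?A <= aut kk \<times> aut kk" using aut_fld[OF assms(1)] by blast
 have d: "ALL (sg, ta):?A. EX s:S. sg s ~= ta s" by blast
 obtain th where th: "th \<in> gen S" "ALL (sg, ta):?A. sg th ~= ta th" by (rule separating_element[OF S(1) A d])
 have "restrict sg M = restrict ta M" if a: "sg \<in> aut F" "ta \<in> aut F" "sg th = ta th" for sg ta
 proof -
  have "sg s = ta s" if "s \<in> S" for s using th(2) a(1-3) that by blast
  from aut_eq_gen2[OF a(1,2) assms(1) this] show ?thesis unfolding restrict_eq_iff S(2) by blast
 qed
 moreover have "th \<in> M" using th(1) S(2) gen_mono[of S "F Un S"] by blast
 ultimately show thesis using that[of th] unfolding prim_def by blast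
qed

lemma finite_restr:
 assumes "fld F" "fingen F M" shows "finite (restr F M)"
proof -
 obtain S where S: "finite S" "M = gen (F Un S)" by (rule fingenE[OF assms(2)])
 let ?f = "%g. restrict g S"
 have "inj_on ?f (restr F M)"
 proof (rule inj_onI)
  fix g h assume "g \<in> restr F M" "h \<in> restr F M" and eq: "?f g = ?f h"
  then obtain sg ta where st: "sg \<in> aut F" "ta \<in> aut F" "g = restrict sg M" "h = restrict ta M" unfolding restr_def by blast
  have SM: "S <= M" using S(2) gen_incl[of "F Un S"] by blast
  have "sg s = ta s" if "s \<in> S" for s using eq that SM unfolding restrict_eq_iff st(3,4) by (metis restrict_apply' subsetD)
  from aut_eq_gen2[OF st(1,2) assms(1) this] show "g = h" unfolding st(3,4) restrict_eq_iff S(2) by blast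
 qed
 moreover have "?f ` restr F M <= (%sg. restrict sg S) ` aut F"
 proof -
  have "S <= M" using S(2) gen_incl[of "F Un S"] by blast
  hence e: "restrict (restrict sg M) S = restrict sg S" for sg :: "'a om => 'a om" by (auto simp: restrict_def fun_eq_iff)
  show ?thesis unfolding restr_def image_image e by (rule order_refl)
 qed
 ultimately show ?thesis using finite_restrict_aut[OF assms(1) S(1)] by (meson finite_imageD finite_subset)
qed

subsection \<open>Degrees\<close>

text \<open>The powers of \<open>th\<close> are adjoined one at a time, following the inductive
  definition of dimension; independence is the absence of nonzero relations of degree below
  d.\<close>

lemma dimension_simple:
 assumes F: "fld F" and n: "n \<le> d" and m: "\<And>f. pk F f ==> f ~= 0 ==> poly f th = 0 ==> dg f \<ge> d"
 shows "ring.dimension \<Omega> n F {poly f th | f. pk F f & (ALL i>=n. cf f i = 0)}" using n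
proof (induction n)
 interpret field "\<Omega> :: 'a om ring" by (rule field_Omega)
 case 0
 have "{poly f th | f. pk F f & (ALL i>=0. cf f i = 0)} = {0}"
 proof -
  have "f = 0" if "ALL i>=0. cf f i = 0" for f :: "'a om poly" using that by (intro poly_eqI) auto
  thus ?thesis using pk_0[OF F] by (force simp: exI[of _ 0])
 qed
 thus ?case using zero_dim by simp
next
 interpret field "\<Omega> :: 'a om ring" by (rule field_Omega)
 case (Suc n)
 let ?E = "%n. {poly f th | f. pk F f & (ALL i>=n. cf f i = 0)}"
 have "th ^ n ~: ?E n"
 proof
  assume "th ^ n \<in> ?E n"
  then obtain f where f: "th ^ n = poly f th" "pk F f" "ALL i>=n. cf f i = 0" by blast
  define g where "g = Polynomial.monom 1 n - f"
  have "pk F g" using F f(2) unfolding g_def by (intro pk_intros fld_1)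
  moreover have "cf g n = 1" using f(3) by (simp add: g_def)
  hence "g ~= 0" by auto
  moreover have "poly g th = 0" using f(1) by (simp add: g_def poly_monom)
  ultimately have "dg g \<ge> d" by (rule m)
  moreover have "dg g \<le> n" using f(3) unfolding g_def by (intro degree_le) auto
  ultimately show False using Suc.prems by simp
 qed
 moreover have "line_extension F (th ^ n) (?E n) = ?E (Suc n)"
 proof -
  have le: "line_extension F (th ^ n) (?E n) = {k * th ^ n + e | k e. k \<in> F & e \<in> ?E n}"
   by (auto simp: line_extension_def r_coset_def set_add_def' )
  have A: "EX h. k * th ^ n + poly f th = poly h th & pk F h & (ALL i>=Suc n. cf h i = 0)"
   if "k \<in> F" "pk F f" "ALL i>=n. cf f i = 0" for k f
   using that F by (intro exI[of _ "Polynomial.monom k n + f"]) (auto simp: poly_monom intro!: pk_intros)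
  have B: "EX k f. k \<in> F & poly h th = k * th ^ n + poly f th & pk F f & (ALL i>=n. cf f i = 0)"
   if "pk F h" "ALL i>=Suc n. cf h i = 0" for h
  proof (intro exI conjI)
   let ?f = "h - Polynomial.monom (cf h n) n"
   show "cf h n \<in> F" using that by (simp add: pk_def)
   show "poly h th = cf h n * th ^ n + poly ?f th" by (simp add: poly_monom)
   show "pk F ?f" using that F \<open>cf h n \<in> F\<close> by (intro pk_intros)
   show "ALL i>=n. cf ?f i = 0"
   proof (intro allI impI)
    fix i assume "n \<le> i"
    thus "cf ?f i = 0" using that(2) by (cases "i = n") auto
   qed
  qed
  show ?thesis unfolding le
  proof (intro equalityI subsetI)
   fix x assume "x \<in> {k * th ^ n + e | k e. k \<in> F & e \<in> ?E n}"
   then obtain k f where f: "k \<in> F" "pk F f" "ALL i>=n. cf f i = 0" "x = k * th ^ n + poly f th" by blast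
   from A[OF f(1-3)] show "x \<in> ?E (Suc n)" unfolding f(4) by blast
  next
   fix x assume "x \<in> ?E (Suc n)"
   then obtain h where h: "pk F h" "ALL i>=Suc n. cf h i = 0" "x = poly h th" by blast
   from B[OF h(1,2)] show "x \<in> {k * th ^ n + e | k e. k \<in> F & e \<in> ?E n}" unfolding h(3) by blast
  qed
 qed
 ultimately show ?case using Suc_dim[of "th ^ n" "?E n" n F] Suc by simp
qed

lemma gen_primitive:
 assumes "ab F M" "prim F M th" shows "M = gen (insert th F)"
proof
 show "gen (insert th F) <= M" using prim_mem[OF assms(2)] ab_basic(2,3)[OF assms(1)] by (intro gen_least) auto
 show "M <= gen (insert th F)"
 proof
  fix x assume x: "x \<in> M"
  have sub: "insert th F <= gen (insert th F)" by (rule gen_incl)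
  have "sg x = x" if s: "sg \<in> aut (gen (insert th F))" for sg
  proof -
   have "sg \<in> aut F" "sg th = th" using s sub aut_mono[of F _ sg] aut_fixes[OF s] by auto
   thus ?thesis using prim_eq[OF assms(2), of sg "%x. x" x] aut_id(2) x by blast
  qed
  hence "fixd (gen (insert th F)) x" by (simp add: fixd_def)
  moreover have "x \<in> gen (gen (insert th F) Un M)" using x gen_incl by blast
  ultimately show "x \<in> gen (insert th F)" using ab_fixed[OF assms(1) fld_gen] sub by blast
 qed
qed

text \<open>Division by the orbit polynomial of a primitive element shows that the powers below its
  degree span M, and its distinct roots bound from below the degree of any polynomial vanishing
  there. The orbit is in bijection with the Galois group.\<close>

lemma galois_dimension:
 assumes "ab F M" "fingen F M" shows "ring.dimension \<Omega> (card (restr F M)) F M"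
proof -
 interpret field "\<Omega> :: 'a om ring" by (rule field_Omega)
 have F: "fld F" by (rule ab_basic(1)[OF assms(1)])
 obtain th where prim: "prim F M th" by (rule primitive_element[OF F assms(2)])
 note th = prim_mem[OF prim]
 have M: "M = gen (insert th F)" by (rule gen_primitive[OF assms(1) prim])
 let ?R = "orb F th"
 have fin: "finite ?R" by (rule finite_orb[OF F])
 have RM: "?R <= M" by (rule ab_orb[OF assms(1) th])
 have FixF: "Fix (aut F) M <= F" using ab_basic(4)[OF assms(1)] by (auto simp: Fix_def fixd_def)
 have "pk (Fix (aut F) M) (rootpoly ?R)"
 proof (rule rootpoly_Fix[OF aut_fld[OF F] ab_basic(2)[OF assms(1)] fin RM])
  show "h ` ?R <= ?R" if "h \<in> aut F" for h using orb_stable[OF that] by blast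
 qed
 hence P: "pk F (rootpoly ?R)" using pk_mono FixF by blast
 have m: "dg f \<ge> card ?R" if f: "pk F f" "f ~= 0" "poly f th = 0" for f
 proof -
  have "poly f (sg th) = 0" if "sg \<in> aut F" for sg using aut_poly_fixed[OF that f(1), of th] f(3) aut_0[OF that] by simp
  hence sub: "?R <= {x. poly f x = 0}" by (intro orb_subset CollectI)
  show ?thesis using card_mono[OF poly_roots_finite[OF f(2)] sub] card_poly_roots_bound[OF f(2)] by simp
 qed
 have span: "{poly f th | f. pk F f & (ALL i>=card ?R. cf f i = 0)} = M"
 proof -
  have A: "EX g. poly f th = poly g th & pk F g & (ALL i>=card ?R. cf g i = 0)" if f: "pk F f" for f
  proof -
   obtain q r where qr: "pk F r" "f = q * rootpoly ?R + r" "r = 0 \<or> dg r < dg (rootpoly ?R)"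
    using pk_division[OF F P rootpoly_nonzero f] by blast
   have "poly (rootpoly ?R) th = 0" using poly_rootpoly[OF fin] orb_self by blast
   hence "poly f th = poly r th" using qr(2) by simp
   moreover have "ALL i>=card ?R. cf r i = 0" using qr(3) unfolding degree_rootpoly[OF fin] by (auto intro: coeff_eq_0)
   ultimately show ?thesis using qr(1) by blast
  qed
  have "{poly f th | f. pk F f} <= {poly f th | f. pk F f & (ALL i>=card ?R. cf f i = 0)}"
  proof
   fix x assume "x \<in> {poly f th | f. pk F f}"
   then obtain f where f: "pk F f" "x = poly f th" by blast
   from A[OF f(1)] show "x \<in> {poly f th | f. pk F f & (ALL i>=card ?R. cf f i = 0)}" unfolding f(2) by blast
  qed
  moreover have "{poly f th | f. pk F f & (ALL i>=card ?R. cf f i = 0)} <= {poly f th | f. pk F f}" by blast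
  ultimately have "{poly f th | f. pk F f & (ALL i>=card ?R. cf f i = 0)} = {poly f th | f. pk F f}"
   by (rule equalityI[rotated])
  also have "\<dots> = M" unfolding gen_simple[OF F, symmetric] by (rule M[symmetric])
  finally show ?thesis .
 qed
 have dim: "dimension (card ?R) F M" unfolding span[symmetric] by (rule dimension_simple[OF F le_refl m])
 have "card ?R = card (restr F M)"
 proof -
  have "bij_betw (%g. g th) (restr F M) ?R" unfolding bij_betw_def
  proof
   show "inj_on (%g. g th) (restr F M)"
   proof (rule inj_onI)
    fix g h assume "g \<in> restr F M" "h \<in> restr F M" "g th = h th"
    then obtain sg ta where st: "sg \<in> aut F" "ta \<in> aut F" "g = restrict sg M" "h = restrict ta M" unfolding restr_def by blast
    have eq: "sg th = ta th" using \<open>g th = h th\<close> unfolding st(3,4) restrict_apply'[OF th] .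
    show "g = h" unfolding st(3,4) restrict_eq_iff using prim_eq[OF prim st(1,2) eq] by blast
   qed
   show "(%g. g th) ` restr F M = ?R" unfolding restr_def orb_def image_image restrict_apply'[OF th] by (rule refl)
  qed
  thus ?thesis by (metis bij_betw_same_card)
 qed
 thus ?thesis using dim by simp
qed

theorem galois_degree:
 assumes "ab F M" "fingen F M" shows "finite_extension F M" "ext_degree F M = card (restr F M)"
proof -
 have F: "fld F" by (rule ab_basic(1)[OF assms(1)])
 note R = ring_from_type_algebra[where 'a = "'a om"]
 note dim = galois_dimension[OF assms]
 show "finite_extension F M" unfolding finite_extension_def field_extension_fld2[OF F]
  using ring.finite_dimensionI[OF R dim] ab_basic(2,3)[OF assms(1)] by blast
 show "ext_degree F M = card (restr F M)" unfolding ext_degree_def using ring.dimI[OF R subfield_fld[OF F] dim] by (simp add: over_def)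
qed

lemma finite_extension_fingen:
 assumes F: "fld F" and fe: "finite_extension F M" shows "fld M" "F <= M" "fingen F M"
proof -
 show M: "fld M" "F <= M" using fe unfolding finite_extension_def field_extension_fld2[OF F] by blast+
 interpret field "\<Omega> :: 'a om ring" by (rule field_Omega)
 obtain n where "dimension n F M" using fe unfolding Defs.finite_extension_def finite_dimension_def by blast
 hence "0 \<in> M & (EX S. finite S & S <= M & M <= gen (F Un S))" using F
 proof (induction n F M rule: dimension.induct)
  case (zero_dim K)
  show ?case using fld_0[OF fld_gen] by (intro conjI exI[of _ "{}"]) auto
 next
  case (Suc_dim v E n K)
  then obtain S where S: "0 \<in> E" "finite S" "S <= E" "E <= gen (K Un S)" by blast
  have le: "line_extension K v E = {k * v + e | k e. k \<in> K & e \<in> E}"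
   by (auto simp: line_extension_def r_coset_def set_add_def')
  have E: "e \<in> line_extension K v E" if "e \<in> E" for e
   unfolding le using that fld_0[OF \<open>fld K\<close>] by (intro CollectI exI[of _ 0] exI[of _ e]) auto
  have v: "v \<in> line_extension K v E"
   unfolding le using S(1) fld_1[OF \<open>fld K\<close>] by (intro CollectI exI[of _ 1] exI[of _ 0]) auto
  have "gen (K Un S) <= gen (K Un insert v S)" by (rule gen_mono) auto
  hence "k * v + e \<in> gen (K Un insert v S)" if "k \<in> K" "e \<in> E" for k e
   using that S(4) gen_incl[of "K Un insert v S"] by (intro fld_add[OF fld_gen] fld_mult[OF fld_gen]) auto
  hence "line_extension K v E <= gen (K Un insert v S)" unfolding le by blast
  thus ?case using E v S(1-3) by (intro conjI exI[of _ "insert v S"]) auto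
 qed
 then obtain S where S: "finite S" "S <= M" "M <= gen (F Un S)" by blast
 have "gen (F Un S) <= M" using M S(2) by (intro gen_least) auto
 thus "fingen F M" using S unfolding fingen_def by blast
qed


section \<open>Agreement with the notions used in the statement\<close>

lemma Omega_pow: "x [^]\<^bsub>\<Omega>\<^esub> (n::nat) = (x::'a::field) ^ n"
proof -
 interpret field "\<Omega> :: 'a ring" by (rule field_Omega)
 show ?thesis by (induction n) (auto simp: mult.commute)
qed

lemma Omega_eval: "ring.eval \<Omega> p x = poly (Poly (rev p)) (x::'a::field)"
proof -
 interpret field "\<Omega> :: 'a ring" by (rule field_Omega)
 show ?thesis by (induction p) (auto simp: Omega_pow Poly_append poly_monom)
qed

lemma algebraic_Omega:
 assumes "fld F" shows "ring.algebraic \<Omega> F x"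
proof -
 interpret field "\<Omega> :: 'a om ring" by (rule field_Omega)
 obtain f where f: "f ~= 0" "pk kk f" "poly f x = 0" by (rule algebraic_over_kk)
 let ?p = "rev (Polynomial.coeffs f)"
 have "polynomial\<^bsub>\<Omega>\<^esub> F ?p"
 proof -
  have "set (Polynomial.coeffs f) <= range (cf f)" using range_coeff[of f] by blast
  hence "set ?p <= F" using f(2) fld_kk_sub[OF assms] unfolding pk_def by auto
  thus ?thesis using f(1) by (simp add: polynomial_def hd_rev last_coeffs_eq_coeff_degree)
 qed
 hence "?p \<in> carrier (univ_poly \<Omega> F)" by (simp add: univ_poly_carrier)
 moreover have "?p ~= []" using f(1) by simp
 moreover have "eval ?p x = \<zero>\<^bsub>\<Omega>\<^esub>" using f(3) by (simp add: Omega_eval)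
 ultimately show ?thesis using algebraicI unfolding over_def by blast
qed

lemma galois_auts_iff:
 assumes "fld F" "F <= L" shows "g \<in> galois_auts F L \<longleftrightarrow> bij_betw g L L &
  (ALL x:L. ALL y:L. g (x + y) = g x + g y & g (x * y) = g x * g y) & (ALL x:F. g x = x)"
 using fld_1[OF assms(1)] bij_betw_apply unfolding galois_auts_def ring_iso_def ring_hom_def by auto

lemma galois_auts_extend:
 assumes "fld F" "fld L" "F <= L" "g \<in> galois_auts F L"
 obtains sg where "sg \<in> aut F" "ALL x:L. sg x = g x"
proof -
 note g = assms(4)[unfolded galois_auts_iff[OF assms(1,3)]]
 have "hom_on L g" using g fld_kk_sub[OF assms(1)] unfolding hom_on_def by blast
 from hom_on_extend[OF assms(2) this] obtain sg where s: "sg \<in> aut kk" "\<And>z. z \<in> L ==> sg z = g z" by metis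
 have "ALL x:F. sg x = x" using s(2) g assms(3) by (metis subsetD)
 hence "sg \<in> aut F" using s(1) unfolding aut_def by blast
 moreover have "ALL x:L. sg x = g x" using s(2) by blast
 ultimately show thesis by (rule that)
qed

lemma aut_galois_auts:
 assumes "fld F" "F <= L" "ALL sg:aut F. sg ` L <= L" "sg \<in> aut F" shows "sg \<in> galois_auts F L"
proof -
 have "inj_on sg L" using aut_inj[OF assms(4)] by (auto simp: inj_on_def)
 moreover have "sg ` L = L"
 proof
  show "L <= sg ` L"
  proof
   fix x assume "x \<in> L"
   hence "ainv sg x \<in> L" using bspec[OF assms(3) aut_inv[OF assms(4)]] by blast
   moreover have "x = sg (ainv sg x)" using aut_inv_apply(1)[OF assms(4)] by simp
   ultimately show "x \<in> sg ` L" by blast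
  qed
 qed (rule bspec[OF assms(3,4)])
 ultimately have "bij_betw sg L L" unfolding bij_betw_def by blast
 moreover have "ALL x:L. ALL y:L. sg (x + y) = sg x + sg y & sg (x * y) = sg x * sg y"
  using aut_add[OF assms(4)] aut_mult[OF assms(4)] by blast
 moreover have "ALL x:F. sg x = x" using aut_fixes[OF assms(4)] by blast
 ultimately show ?thesis unfolding galois_auts_iff[OF assms(1,2)] by blast
qed

text \<open>The definition speaks only of automorphisms of L, so stability under ambient
  automorphisms has to be derived: the images of x in L under \<open>galois_auts\<close> are the
  roots of a polynomial over F, and an ambient automorphism fixing F permutes them.\<close>

lemma abelian_extension_imp_ab:
 assumes F: "fld F" and a: "abelian_extension F L" shows "ab F L"
proof -
 have ge: "galois_extension F L"
  and cm: "ALL sg:galois_auts F L. ALL ta:galois_auts F L. ALL x:L. sg (ta x) = ta (sg x)"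
  using a unfolding abelian_extension_def by (rule conjunct1, rule conjunct2)
 have L: "fld L" "F <= L" using ge unfolding galois_extension_def field_extension_fld2[OF F] by blast+
 have fx: "{x\<in>L. ALL sg:galois_auts F L. sg x = x} = F" using ge unfolding galois_extension_def by blast
 have st: "sg ` L <= L" if s: "sg \<in> aut F" for sg
 proof
  fix z assume "z \<in> sg ` L"
  then obtain x where x: "x \<in> L" "z = sg x" by blast
  define R where "R = (%g. g x) ` galois_auts F L"
  have RL: "R <= L"
  proof
   fix r assume "r \<in> R"
   then obtain g where g: "g \<in> galois_auts F L" "r = g x" unfolding R_def by blast
   hence "bij_betw g L L" unfolding galois_auts_iff[OF F L(2)] by blast
   thus "r \<in> L" unfolding g(2) using x(1) by (rule bij_betw_apply)
  qed
  have "R <= orb F x"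
  proof
   fix r assume "r \<in> R"
   then obtain g where g: "g \<in> galois_auts F L" "r = g x" unfolding R_def by blast
   obtain ro where "ro \<in> aut F" "ALL x:L. ro x = g x" by (rule galois_auts_extend[OF F L g(1)])
   thus "r \<in> orb F x" using orbI[of ro F x] x(1) g(2) by simp
  qed
  hence fin: "finite R" using finite_orb[OF F] finite_subset by blast
  have pL: "pk L (rootpoly R)" using RL L(1) by (intro pk_prod pk_intros) (auto intro: fld_minus fld_1)
  have "cf (rootpoly R) i \<in> F" for i
  proof -
   have "g (cf (rootpoly R) i) = cf (rootpoly R) i" if g: "g \<in> galois_auts F L" for g
   proof -
    obtain ro where r: "ro \<in> aut F" "ALL x:L. ro x = g x" by (rule galois_auts_extend[OF F L g])
    have "ro ` R <= R"
    proof
     fix y assume "y \<in> ro ` R"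
     then obtain h where h: "h \<in> galois_auts F L" "y = ro (h x)" unfolding R_def by blast
     have "h x \<in> L" using RL h(1) unfolding R_def by blast
     hence y: "y = (g \<circ> h) x" using r(2) h(2) by simp
     have "g \<circ> h \<in> galois_auts F L" using g h(1) L(2) unfolding galois_auts_iff[OF F L(2)]
      by (auto simp: bij_betw_apply intro: bij_betw_trans)
     thus "y \<in> R" unfolding y R_def by (rule imageI)
    qed
    from rootpoly_fixed[OF r(1) fin this] show ?thesis using r(2) pL unfolding pk_def by metis
   qed
   hence "cf (rootpoly R) i \<in> {x\<in>L. ALL sg:galois_auts F L. sg x = x}" using pL unfolding pk_def by blast
   thus ?thesis unfolding fx .
  qed
  hence P: "pk F (rootpoly R)" by (simp add: pk_def)
  have "(%x. x) \<in> galois_auts F L" by (simp add: galois_auts_iff[OF F L(2)] bij_betw_def)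
  hence "x \<in> R" unfolding R_def by (intro image_eqI[of _ _ "%x. x"]) simp_all
  hence "poly (rootpoly R) (sg x) = 0" using aut_poly_fixed[OF s P, of x] poly_rootpoly[OF fin, of x] aut_0[OF s] by simp
  hence "sg x \<in> R" using poly_rootpoly[OF fin] by blast
  thus "z \<in> L" using RL x(2) by blast
 qed
 have st': "ALL sg:aut F. sg ` L <= L" by (intro ballI st)
 note sub = aut_galois_auts[OF F L(2) st']
 show ?thesis
 proof (rule abI'[OF F L])
  show "sg x \<in> L" if "sg \<in> aut F" "x \<in> L" for sg x using st[OF that(1)] that(2) by blast
  show "(sg \<circ> ta) x = (ta \<circ> sg) x" if "sg \<in> aut F" "ta \<in> aut F" "x \<in> L" for sg ta x
   using bspec[OF bspec[OF bspec[OF cm sub[OF that(1)]] sub[OF that(2)]] that(3)] by simp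
  show "x \<in> F" if x: "x \<in> L" "fixd F x" for x
  proof -
   have "g x = x" if g: "g \<in> galois_auts F L" for g
   proof -
    obtain ro where "ro \<in> aut F" "ALL x:L. ro x = g x" by (rule galois_auts_extend[OF F L g])
    thus ?thesis using x fixdD[of F x ro] by simp
   qed
   hence "x \<in> {x\<in>L. ALL sg:galois_auts F L. sg x = x}" using x(1) by blast
   thus ?thesis unfolding fx .
  qed
 qed
qed

lemma ab_imp_abelian_extension:
 assumes "ab F L" shows "abelian_extension F L"
proof -
 note F = ab_basic(1)[OF assms] and L = ab_basic(2,3)[OF assms]
 have st: "sg ` L <= L" if s: "sg \<in> aut F" for sg using ab_normal[OF assms s] by blast
 have st': "ALL sg:aut F. sg ` L <= L" by (intro ballI st)
 note sub = aut_galois_auts[OF F L(2) st']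
 have "{x\<in>L. ALL sg:galois_auts F L. sg x = x} = F"
 proof
  show "{x\<in>L. ALL sg:galois_auts F L. sg x = x} <= F"
  proof
   fix x assume x: "x \<in> {x\<in>L. ALL sg:galois_auts F L. sg x = x}"
   hence "fixd F x" using sub unfolding fixd_def by blast
   thus "x \<in> F" using x ab_basic(4)[OF assms] by blast
  qed
  show "F <= {x\<in>L. ALL sg:galois_auts F L. sg x = x}"
  proof
   fix x assume x: "x \<in> F"
   have "ALL g:galois_auts F L. g x = x" using x unfolding galois_auts_def by blast
   thus "x \<in> {x\<in>L. ALL sg:galois_auts F L. sg x = x}" using x L(2) by blast
  qed
 qed
 hence "galois_extension F L" unfolding galois_extension_def field_extension_fld2[OF F] using L algebraic_Omega[OF F] by blast
 moreover have "sg (ta x) = ta (sg x)" if g: "sg \<in> galois_auts F L" "ta \<in> galois_auts F L" "x \<in> L" for sg ta x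
 proof -
  obtain s where s: "s \<in> aut F" "ALL x:L. s x = sg x" by (rule galois_auts_extend[OF F L g(1)])
  obtain t where t: "t \<in> aut F" "ALL x:L. t x = ta x" by (rule galois_auts_extend[OF F L g(2)])
  have "s (t x) = t (s x)" by (rule ab_commute[OF assms s(1) t(1) g(3)])
  moreover have "t x \<in> L" "s x \<in> L" using ab_normal[OF assms _ g(3)] s(1) t(1) by auto
  ultimately show ?thesis using s(2) t(2) g(3) by simp
 qed
 ultimately show ?thesis unfolding abelian_extension_def by (intro conjI ballI)
qed

lemma abelian_extension_iff: "fld F ==> abelian_extension F L \<longleftrightarrow> ab F L"
 using abelian_extension_imp_ab ab_imp_abelian_extension by blast


subsection \<open>Constants\<close>

declare CHAR_alg_closure [simp del]

lemma prime_char: "Factorial_Ring.prime CHAR('q::{field,finite} om)"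
proof -
 let ?n = "CHAR('q)"
 have n: "?n > 0" using finite_imp_CHAR_pos[where 'a='q] by simp
 have "of_nat m = (to_ac (Fract [:of_nat m:] 1) :: 'q om)" for m
 proof -
  have "of_nat m = Fract (of_nat m :: 'q poly) 1" by (rule of_nat_fract)
  thus ?thesis by (metis of_nat_poly to_ac_of_nat)
 qed
 from this[of ?n] have "of_nat ?n = (0 :: 'q om)" by (simp add: fract_collapse)
 hence "CHAR('q om) > 0" using n CHAR_pos_iff[where 'a="'q om"] by blast
 thus ?thesis by (rule prime_CHAR_semidom)
qed

lemma charp_gt_1: "CHAR('q::{field,finite} om) > 1" using prime_gt_1_nat[OF prime_char] .

lemma charp_add:
 fixes x y :: "'q::{field,finite} om" shows "(x + y) ^ (CHAR('q om) ^ n) = x ^ (CHAR('q om) ^ n) + y ^ (CHAR('q om) ^ n)"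
 by (rule freshmans_dream'[OF prime_char refl])

lemma charp_sum:
 fixes f :: "'b => 'q::{field,finite} om" shows "(sum f A) ^ (CHAR('q om) ^ n) = (\<Sum>i\<in>A. f i ^ (CHAR('q om) ^ n))"
proof (induction A rule: infinite_finite_induct)
 case (insert a A)
 thus ?case by (simp add: charp_add)
qed (use charp_gt_1[where 'q='q] in auto)

lemma charp_minus:
 fixes x :: "'q::{field,finite} om" shows "(- x) ^ (CHAR('q om) ^ n) = - (x ^ (CHAR('q om) ^ n))"
proof -
 have p: "CHAR('q om) ^ n > 0" using charp_gt_1[where 'q='q] by simp
 have "0 = (x + - x) ^ (CHAR('q om) ^ n)" using p by simp
 also have "\<dots> = x ^ (CHAR('q om) ^ n) + (- x) ^ (CHAR('q om) ^ n)" by (rule charp_add)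
 finally show ?thesis by (metis add.inverse_unique)
qed

lemma charp_diff:
 fixes x y :: "'q::{field,finite} om" shows "(x - y) ^ (CHAR('q om) ^ n) = x ^ (CHAR('q om) ^ n) - y ^ (CHAR('q om) ^ n)"
 using charp_add[of x "-y" n] charp_minus[of y n] by simp

lemma charp_inj:
 fixes x y :: "'q::{field,finite} om"
 assumes "x ^ (CHAR('q om) ^ n) = y ^ (CHAR('q om) ^ n)" shows "x = y" using charp_diff[of x y n] assms by simp

text \<open>The algebraic closure of the prime field, as the union of the fixed fields of powers of
  Frobenius. By \<open>residue_ex\<close> it represents the residue field of every prime.\<close>

definition FF :: "'q::{field,finite} om set" where "FF = {c. EX n>0. c ^ (CHAR('q om) ^ n) = c}"

lemma charp_iterate:
 fixes c :: "'q::{field,finite} om"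
 assumes "c ^ (CHAR('q om) ^ n) = c" shows "c ^ (CHAR('q om) ^ (n * m)) = c"
proof (induction m)
 case (Suc m)
 have "c ^ (CHAR('q om) ^ (n * Suc m)) = (c ^ (CHAR('q om) ^ n)) ^ (CHAR('q om) ^ (n * m))" by (simp add: power_add flip: power_mult)
 thus ?case using Suc assms by simp
qed simp

lemma FF_common:
 fixes A :: "'q::{field,finite} om set"
 assumes "finite A" "A <= FF"
 obtains n where "n > 0" "\<And>c. c \<in> A ==> c ^ (CHAR('q om) ^ n) = c"
proof -
 have "EX n>0. ALL c:A. c ^ (CHAR('q om) ^ n) = c" using assms
 proof (induction A rule: finite_induct)
  case (insert a A)
  then obtain n where n: "n > 0" "ALL c:A. c ^ (CHAR('q om) ^ n) = c" by auto
  obtain m where m: "m > 0" "a ^ (CHAR('q om) ^ m) = a" using insert.prems unfolding FF_def by blast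
  have "c ^ (CHAR('q om) ^ (n * m)) = c" if "c \<in> insert a A" for c
  proof (cases "c = a")
   case True
   thus ?thesis using charp_iterate[OF m(2), of n] by (simp add: mult.commute)
  next
   case False
   thus ?thesis using that n(2) charp_iterate[of c n m] by blast
  qed
  thus ?case using n(1) m(1) by (intro exI[of _ "n * m"]) auto
 qed auto
 thus thesis using that by blast
qed

lemma FF_0: "0 \<in> FF" and FF_1: "1 \<in> FF"
proof -
 have "CHAR('a om) > 0" "CHAR('b om) > 0" using charp_gt_1[where 'q='a] charp_gt_1[where 'q='b] by simp_all
 thus "(0 :: 'a om) \<in> FF" "(1 :: 'b om) \<in> FF" unfolding FF_def by (auto intro!: exI[of _ 1])
qed

lemma FF_add: "x \<in> FF ==> y \<in> FF ==> x + y \<in> FF" and FF_mult: "x \<in> FF ==> y \<in> FF ==> x * y \<in> FF"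
 and FF_minus: "x \<in> FF ==> - x \<in> FF" and FF_inverse: "x \<in> FF ==> inverse x \<in> FF"
proof -
 show "x + y \<in> FF" "x * y \<in> FF" if xy: "x \<in> FF" "y \<in> FF"
 proof -
  obtain n where n: "n > 0" "\<And>c. c \<in> {x, y} ==> c ^ (CHAR('a om) ^ n) = c" using FF_common[of "{x, y}"] xy by blast
  show "x + y \<in> FF" using n(1) n(2)[of x] n(2)[of y] charp_add[of x y n] unfolding FF_def by auto
  show "x * y \<in> FF" using n(1) n(2)[of x] n(2)[of y] unfolding FF_def by (auto simp: power_mult_distrib)
 qed
 show "- x \<in> FF" "inverse x \<in> FF" if "x \<in> FF" using that charp_minus[of x] unfolding FF_def by (auto simp: power_inverse)
qed

lemma FF_power: "x \<in> FF ==> x ^ n \<in> FF" by (induction n) (auto intro: FF_1 FF_mult)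

lemma FF_diff: "x \<in> FF ==> y \<in> FF ==> x - y \<in> FF" using FF_add[of x "-y"] FF_minus by auto

lemma FF_sum: "(\<And>i. i \<in> A ==> f i \<in> FF) ==> sum f A \<in> FF"
 by (induction A rule: infinite_finite_induct) (auto intro: FF_0 FF_add)

lemma FF_divide: "x \<in> FF ==> y \<in> FF ==> x / y \<in> FF" by (simp add: divide_inverse FF_mult FF_inverse)

lemma FF_poly: "pk FF f ==> x \<in> FF ==> poly f x \<in> FF" unfolding poly_altdef pk_def by (intro FF_sum FF_mult FF_power) auto

text \<open>Two of the iterated Frobenius powers of c coincide, and injectivity of Frobenius cancels
  the smaller exponent.\<close>

lemma FF_finite_powers:
 fixes c :: "'q::{field,finite} om"
 assumes "finite S" "N > 0" "\<And>j. c ^ (CHAR('q om) ^ (N * j)) \<in> S" shows "c \<in> FF"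
proof -
 let ?f = "%j::nat. c ^ (CHAR('q om) ^ (N * j))"
 have "\<not> inj ?f" using assms(1,3) by (metis finite_imageD finite_subset image_subsetI infinite_UNIV_nat)
 then obtain i j where "i ~= j" "?f i = ?f j" unfolding inj_def by blast
 then obtain i j where ij: "i < j" "?f i = ?f j" by (metis linorder_neqE_nat)
 have "N * j = N * (j - i) + N * i" using ij(1) by (metis distrib_left le_add_diff_inverse2 less_imp_le)
 hence "?f j = c ^ (CHAR('q om) ^ (N * (j - i) + N * i))" by metis
 hence "(c ^ (CHAR('q om) ^ (N * (j - i)))) ^ (CHAR('q om) ^ (N * i)) = c ^ (CHAR('q om) ^ (N * i))"
  using ij(2) by (simp only: power_add power_mult)
 hence "c ^ (CHAR('q om) ^ (N * (j - i))) = c" by (rule charp_inj)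
 moreover have "N * (j - i) > 0" using assms(2) ij(1) by simp
 ultimately show ?thesis unfolding FF_def by blast
qed

text \<open>A power of Frobenius fixing the coefficients maps roots of f to roots of f, and there
  are finitely many.\<close>

lemma FF_root:
 fixes c :: "'q::{field,finite} om"
 assumes "pk FF f" "f ~= 0" "poly f c = 0" shows "c \<in> FF"
proof -
 let ?A = "(%i. cf f i) ` {..dg f}"
 obtain N where N: "N > 0" "\<And>c. c \<in> ?A ==> c ^ (CHAR('q om) ^ N) = c" using FF_common[of ?A] assms(1) unfolding pk_def by blast
 have cfN: "cf f i ^ (CHAR('q om) ^ (N * j)) = cf f i" if "i \<le> dg f" for i j using charp_iterate[OF N(2)] that by blast
 have "poly f (c ^ (CHAR('q om) ^ (N * j))) = 0" for j
 proof -
  let ?P = "CHAR('q om) ^ (N * j)"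
  have P: "?P > 0" using charp_gt_1[where 'q='q] by simp
  have "cf f i * (c ^ ?P) ^ i = (cf f i * c ^ i) ^ ?P" if "i \<le> dg f" for i
   using cfN[OF that, of j] by (simp add: power_mult_distrib flip: power_mult) (simp add: mult.commute)
  hence "poly f (c ^ ?P) = (\<Sum>i\<le>dg f. (cf f i * c ^ i) ^ ?P)" unfolding poly_altdef by (intro sum.cong) auto
  also have "\<dots> = (\<Sum>i\<le>dg f. cf f i * c ^ i) ^ ?P" by (rule charp_sum[symmetric])
  also have "\<dots> = 0" using assms(3) P by (simp add: poly_altdef)
  finally show ?thesis .
 qed
 hence "\<And>j. c ^ (CHAR('q om) ^ (N * j)) \<in> {x. poly f x = 0}" by blast
 thus ?thesis using FF_finite_powers[OF poly_roots_finite[OF assms(2)] N(1)] by blast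
qed

lemma FF_nth_root: "y ^ n \<in> FF ==> n > 0 ==> y \<in> FF"
proof (rule FF_root[of "Polynomial.monom 1 n - [:y ^ n:]"])
 assume "y ^ n \<in> FF" "n > 0"
 thus "pk FF (Polynomial.monom 1 n - [:y ^ n:])" by (auto simp: pk_def coeff_pCons FF_1 FF_0 FF_minus intro: FF_diff split: nat.splits)
 have "cf [:y ^ n:] n = 0" using \<open>n > 0\<close> by (intro coeff_eq_0) simp
 hence "cf (Polynomial.monom 1 n - [:y ^ n:]) n = 1" by simp
 thus "Polynomial.monom 1 n - [:y ^ n:] ~= 0" by (metis coeff_0 zero_neq_one)
qed (simp add: poly_monom)

lemma FF_unity:
 assumes "c \<in> FF" "c ~= 0"
 obtains N where "N > 0" "c ^ N = 1"
proof -
 obtain n where n: "n > 0" "c ^ (CHAR('a om) ^ n) = c" using assms(1) unfolding FF_def by blast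
 have "CHAR('a om) ^ n > 1" by (rule one_less_power[OF charp_gt_1 n(1)])
 hence "CHAR('a om) ^ n = Suc (CHAR('a om) ^ n - 1)" "CHAR('a om) ^ n - 1 > 0" by simp_all
 hence "c * c ^ (CHAR('a om) ^ n - 1) = c * 1" using n(2) by (metis mult.right_neutral power_Suc)
 hence "c ^ (CHAR('a om) ^ n - 1) = 1" using assms(2) by simp
 thus thesis using that \<open>CHAR('a om) ^ n - 1 > 0\<close> by blast
qed

subsection \<open>The rational function field\<close>

definition cst :: "'q::{field,finite} => 'q om" where "cst a = to_ac (Fract [:a:] 1)"

definition TT :: "'q::{field,finite} om" where "TT = to_ac (Fract [:0, 1:] 1)"

lemma cst_simps: "cst 0 = 0" "cst 1 = 1" "cst (a + b) = cst a + cst b" "cst (a * b) = cst a * cst b"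
 by (simp_all add: cst_def fract_collapse mult.commute flip: to_ac_add to_ac_mult one_pCons)

lemma cst_power: "cst (a ^ n) = cst a ^ n" by (induction n) (simp_all add: cst_simps)

lemma cst_eq_iff: "cst a = cst b \<longleftrightarrow> a = b" by (simp add: cst_def eq_fract)

lemma to_ac_poly: "to_ac (Fract f 1) = poly (map_poly cst f) TT"
proof (induction f)
 case (pCons a f)
 have "pCons a f = [:a:] + [:0, 1:] * f" by simp
 hence "to_ac (Fract (pCons a f) 1) = cst a + TT * to_ac (Fract f 1)" by (simp add: cst_def TT_def flip: to_ac_add to_ac_mult)
 thus ?case using pCons by (simp add: map_poly_pCons cst_simps)
qed (simp add: fract_collapse)

lemma range_cst_FF: "range cst <= FF"
proof
 fix c :: "'a om" assume "c \<in> range cst"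
 then obtain a where a: "c = cst a" by blast
 show "c \<in> FF" by (rule FF_finite_powers[of "range cst" 1]) (auto simp: a simp flip: cst_power)
qed

lemma cst_power_card: "a ~= 0 ==> cst a ^ (CARD('q) - 1) = 1" for a :: "'q::{field,finite}"
proof -
 assume a: "a ~= 0"
 have "(\<Prod>y\<in>UNIV-{0}. a * y) = \<Prod>(UNIV-{0})"
  by (rule prod.reindex_bij_witness[of _ "%y. y / a" "%y. a * y"]) (use a in auto)
 hence "a ^ (CARD('q) - 1) * \<Prod>(UNIV-{0}) = \<Prod>(UNIV-{0})" by (simp add: prod.distrib)
 hence "a ^ (CARD('q) - 1) = 1" by simp
 thus ?thesis by (simp add: cst_simps flip: cst_power)
qed

lemma TT_notin_FF: "TT ~: (FF :: 'q::{field,finite} om set)"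
proof
 assume "TT \<in> (FF :: 'q om set)"
 then obtain n where n: "n > 0" "TT ^ (CHAR('q om) ^ n) = (TT :: 'q om)" unfolding FF_def by blast
 let ?P = "CHAR('q om) ^ n"
 have "(Fract [:0, 1 :: 'q:] 1) ^ m = Fract ([:0, 1:] ^ m) 1" for m by (induction m) (auto simp: One_fract_def)
 hence "Fract ([:0, 1 :: 'q:] ^ ?P) 1 = Fract [:0, 1:] 1" using n(2) unfolding TT_def by (simp flip: to_ac_power)
 hence "[:0, 1 :: 'q:] ^ ?P = [:0, 1:]" by (simp add: eq_fract)
 hence "dg ([:0, 1 :: 'q:] ^ ?P) = 1" by simp
 hence "?P = 1" by (simp add: degree_linear_power)
 thus False using charp_gt_1[where 'q='q] n(1) by simp
qed

lemma TT_in_kk: "TT \<in> kk" by (simp add: TT_def ratfun_field_def)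

lemma cst_in_kk: "cst a \<in> kk" by (simp add: cst_def ratfun_field_def)

lemma TT_trans: "pk FF f ==> poly f TT = 0 ==> f = 0" using FF_root TT_notin_FF by blast

lemma kk_frac:
 assumes "x \<in> kk"
 obtains a b where "pk (range cst) a" "pk (range cst) b" "b ~= 0" "x = poly a TT / poly b TT"
proof -
 obtain r where r: "x = to_ac r" using assms by (auto simp: ratfun_field_def)
 obtain f g where fg: "r = Fract f g" "g ~= 0" by (cases r)
 have "to_ac (Fract f 1) / to_ac (Fract g 1) = to_ac (Fract f g)" by (simp flip: to_ac_divide)
 hence "x = poly (map_poly cst f) TT / poly (map_poly cst g) TT" unfolding r fg(1) to_ac_poly by (rule sym)
 moreover have "pk (range cst) (map_poly cst h)" for h :: "'a poly" by (auto simp: pk_def coeff_map_poly cst_simps)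
 moreover have "map_poly cst g ~= 0" using fg(2) by (metis cst_eq_iff cst_simps(1) map_poly_eq_0_iff)
 ultimately show thesis using that by blast
qed

text \<open>For c = a(T)/b(T) with coefficients in F_q, transcendence of T over the constants gives
  a = c b; the coefficients at the degree of b put c into F_q.\<close>

lemma FF_inter_kk: "FF Int kk <= range cst"
proof
 fix c :: "'a om" assume c: "c \<in> FF Int kk"
 obtain a b where ab: "pk (range cst) a" "pk (range cst) b" "b ~= 0" "c = poly a TT / poly b TT"
  by (rule kk_frac[of c]) (use c in auto)
 have F: "pk FF a" "pk FF b" using ab(1,2) pk_mono[OF _ range_cst_FF] by blast+
 have bT: "poly b TT ~= 0" using TT_trans[OF F(2)] ab(3) by blast
 have "poly (a - Polynomial.smult c b) TT = 0" using ab(4) bT by simp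
 moreover have "pk FF (a - Polynomial.smult c b)" using F c by (auto simp: pk_def intro: FF_diff FF_mult)
 ultimately have "a = Polynomial.smult c b" using TT_trans by fastforce
 hence "cf a (dg b) = c * Polynomial.lead_coeff b" by simp
 moreover obtain u v where "cf a (dg b) = cst u" "Polynomial.lead_coeff b = cst v" using ab(1,2) unfolding pk_def by blast
 ultimately have uv: "cst u = c * cst v" "v ~= 0" using ab(3) by (auto simp: cst_simps)
 have "cst (u / v) * cst v = c * cst v" using uv by (simp flip: cst_simps(4))
 moreover have "cst v ~= 0" using uv(2) cst_eq_iff cst_simps(1) by metis
 ultimately show "c \<in> range cst" by (metis mult_right_cancel rangeI)
qed


section \<open>Separable polynomials and rational functions with constant coefficients\<close>

lemma rootpoly_dvd:
 fixes f :: "'a::field poly"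
 assumes "finite R" "R <= {x. poly f x = 0}" shows "rootpoly R dvd f" using assms
proof (induction R rule: finite_induct)
 case (insert r R)
 then obtain h where h: "f = rootpoly R * h" by (auto elim: dvdE)
 have "poly (rootpoly R) r ~= 0" using poly_rootpoly[OF insert.hyps(1), of r] insert.hyps(2) by blast
 hence "poly h r = 0" using insert.prems h by auto
 then obtain g where g: "h = [:- r, 1:] * g" unfolding poly_eq_0_iff_dvd by (elim dvdE)
 have "rootpoly (insert r R) = [:- r, 1:] * rootpoly R" using insert.hyps by (rule prod.insert)
 hence "f = rootpoly (insert r R) * g" unfolding h g by (simp only: ac_simps)
 thus ?case by (rule dvdI)
qed simp

lemma separable_rootpoly:
 fixes f :: "'a::alg_closed_field poly"
 assumes "Polynomial.lead_coeff f = 1" "\<And>x. poly f x = 0 ==> poly (pderiv f) x ~= 0" shows "f = rootpoly {x. poly f x = 0}"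
proof -
 let ?R = "{x. poly f x = 0}"
 have f0: "f ~= 0" using assms(1) by auto
 have fin: "finite ?R" by (rule poly_roots_finite[OF f0])
 obtain h where h: "f = rootpoly ?R * h" using rootpoly_dvd[OF fin order_refl] by (elim dvdE)
 have "dg h = 0"
 proof (rule ccontr)
  assume "dg h ~= 0"
  then obtain x where x: "poly h x = 0" using alg_closed_imp_poly_has_root[of h] by blast
  have fx: "poly f x = 0" by (subst h) (simp add: x)
  hence "poly (rootpoly ?R) x = 0" using poly_rootpoly[OF fin, of x] by blast
  hence "poly (pderiv (rootpoly ?R * h)) x = 0" using x by (simp only: pderiv_mult poly_add poly_mult) simp
  hence "poly (pderiv f) x = 0" using h by simp
  thus False using assms(2)[OF fx] by blast
 qed
 then obtain a where a: "h = [:a:]" by (rule degree_eq_zeroE)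
 have "Polynomial.lead_coeff (rootpoly ?R * h) = 1" using assms(1) h by simp
 hence "Polynomial.lead_coeff h = 1" unfolding Polynomial.lead_coeff_mult lead_coeff_rootpoly by simp
 hence "h = 1" using a by (simp add: one_pCons)
 thus ?thesis using h by simp
qed

lemma sepp_root:
 assumes "pk M f" "Polynomial.lead_coeff f = 1" "\<And>x. poly f x = 0 ==> poly (pderiv f) x ~= 0"
  "poly f s = 0" shows "sepp M s"
proof -
 have "f ~= 0" using assms(2) by auto
 hence fin: "finite {x. poly f x = 0}" by (rule poly_roots_finite)
 have "pk M (rootpoly {x. poly f x = 0})" by (subst separable_rootpoly[OF assms(2,3), symmetric]) (auto simp: assms(1))
 moreover have "s \<in> {x. poly f x = 0}" using assms(4) by simp
 ultimately show ?thesis using fin unfolding sepp_def by blast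
qed

lemma sepp_FF:
 fixes c :: "'q::{field,finite} om"
 assumes "c \<in> FF" shows "sepp kk c"
proof -
 obtain n where n: "n > 0" "c ^ (CHAR('q om) ^ n) = c" using assms unfolding FF_def by blast
 let ?P = "CHAR('q om) ^ n"
 let ?f = "Polynomial.monom 1 ?P - [:0, 1 :: 'q om:]"
 have P: "?P > 1" by (rule one_less_power[OF charp_gt_1 n(1)])
 have z: "of_nat ?P = (0 :: 'q om)" using n(1) by simp
 have "pk kk ?f" by (auto simp: pk_def coeff_pCons kk_0 kk_1 kk_minus[OF kk_1] split: nat.splits)
 moreover have "Polynomial.lead_coeff ?f = 1"
 proof -
  have "dg [:0, 1 :: 'q om:] < dg (Polynomial.monom 1 ?P :: 'q om poly)" using P by (simp add: degree_monom_eq)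
  hence "Polynomial.lead_coeff ?f = Polynomial.lead_coeff (Polynomial.monom 1 ?P :: 'q om poly)"
   by (metis (no_types, lifting) coeff_diff coeff_eq_0 degree_add_eq_left degree_minus diff_zero uminus_add_conv_diff add_uminus_conv_diff)
  thus ?thesis by (simp add: degree_monom_eq)
 qed
 moreover have "poly (pderiv ?f) x ~= 0" for x using n(1) by (simp add: pderiv_diff pderiv_monom pderiv_pCons zero_power)
 moreover have "poly ?f c = 0" using n(2) by (simp add: poly_monom)
 ultimately show ?thesis by (intro sepp_root) blast+
qed

lemma pkF_add: "pk FF f ==> pk FF g ==> pk FF (f + g)" and pkF_smult: "a \<in> FF ==> pk FF f ==> pk FF (Polynomial.smult a f)"
 and pkF_mult: "pk FF f ==> pk FF g ==> pk FF (f * g)" and pkF_monom: "a \<in> FF ==> pk FF (Polynomial.monom a n)"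
 and pkF_1: "pk FF 1" and pkF_0: "pk FF 0" and pkF_pCons: "a \<in> FF ==> pk FF f ==> pk FF (pCons a f)"
 by (auto simp: pk_def coeff_mult coeff_pCons FF_0 FF_1 split: nat.splits intro: FF_add FF_mult FF_sum)

lemma pkF_sum: "(\<And>i. i \<in> A ==> pk FF (f i)) ==> pk FF (sum f A)"
 by (induction A rule: infinite_finite_induct) (auto intro: pkF_0 pkF_add)

lemma pkF_prod: "(\<And>i. i \<in> A ==> pk FF (f i)) ==> pk FF (prod f A)"
 by (induction A rule: infinite_finite_induct) (auto intro: pkF_1 pkF_mult)

text \<open>The coefficients of h are recovered from the top downwards, the i-th being the (i+1)-st
  coefficient of the product plus a times the (i+1)-st coefficient of h.\<close>

lemma pkF_linear_factor:
 assumes "pk FF ([:- a, 1:] * h)" "a \<in> FF" shows "pk FF h"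
proof -
 have "cf h i \<in> FF" if "i + n = Suc (dg h)" for i n using that
 proof (induction n arbitrary: i)
  case 0
  thus ?case by (simp add: coeff_eq_0 FF_0)
 next
  case (Suc n)
  have "cf h i = cf ([:- a, 1:] * h) (Suc i) + a * cf h (Suc i)" by simp
  moreover have "cf h (Suc i) \<in> FF" using Suc by simp
  moreover have "cf ([:- a, 1:] * h) (Suc i) \<in> FF" using assms(1) unfolding pk_def by blast
  ultimately show ?case using FF_add FF_mult assms(2) by metis
 qed
 hence "cf h i \<in> FF" if "i \<le> Suc (dg h)" for i using that le_Suc_ex by metis
 moreover have "cf h i \<in> FF" if "\<not> i \<le> Suc (dg h)" for i using that by (simp add: coeff_eq_0 FF_0)
 ultimately show ?thesis unfolding pk_def by blast
qed

text \<open>The field \<open>FF\<close>(t). Keeping t as a parameter lets T - c and 1/T, which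
  generate the same field, be treated alike.\<close>

definition fracs :: "'q::{field,finite} om => 'q om set"
 where "fracs t = {poly a t / poly b t | a b. pk FF a & pk FF b & poly b t ~= 0}"

lemma fracsI: "pk FF a ==> pk FF b ==> poly b t ~= 0 ==> poly a t / poly b t \<in> fracs t" unfolding fracs_def by blast

lemma fracsE:
 assumes "x \<in> fracs t"
 obtains a b where "pk FF a" "pk FF b" "poly b t ~= 0" "x = poly a t / poly b t" using assms unfolding fracs_def by blast

lemma fracs_closed:
 assumes "x \<in> fracs t" "y \<in> fracs t" shows "x + y \<in> fracs t" "x * y \<in> fracs t"
proof -
 obtain a b where ab: "pk FF a" "pk FF b" "poly b t ~= 0" "x = poly a t / poly b t" by (rule fracsE[OF assms(1)])
 obtain c d where cd: "pk FF c" "pk FF d" "poly d t ~= 0" "y = poly c t / poly d t" by (rule fracsE[OF assms(2)])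
 have "x + y = poly (a * d + c * b) t / poly (b * d) t" using ab(3) cd(3) unfolding ab(4) cd(4) by (simp add: add_frac_eq)
 also have "\<dots> \<in> fracs t" using ab cd by (intro fracsI pkF_add pkF_mult) auto
 finally show "x + y \<in> fracs t" .
 have "x * y = poly (a * c) t / poly (b * d) t" using ab(4) cd(4) by simp
 also have "\<dots> \<in> fracs t" using ab cd by (intro fracsI pkF_mult) auto
 finally show "x * y \<in> fracs t" .
qed

lemma FF_fracs: "FF <= fracs t"
proof
 fix c :: "'a om" assume "c \<in> FF"
 hence "poly [:c:] t / poly 1 t \<in> fracs t" by (intro fracsI pkF_pCons pkF_1 pkF_0) auto
 thus "c \<in> fracs t" by simp
qed

lemma self_fracs: "t \<in> fracs t"
proof -
 have "poly [:0, 1:] t / poly 1 t \<in> fracs t" by (intro fracsI pkF_pCons pkF_1 pkF_0 FF_0 FF_1) auto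
 thus ?thesis by simp
qed

lemma kk_fracs_TT: "kk <= fracs TT"
proof
 fix x :: "'a om" assume "x \<in> kk"
 then obtain a b where ab: "pk (range cst) a" "pk (range cst) b" "b ~= 0" "x = poly a TT / poly b TT" by (rule kk_frac)
 have "pk FF a" "pk FF b" using ab(1,2) pk_mono[OF _ range_cst_FF] by blast+
 thus "x \<in> fracs TT" unfolding ab(4) using TT_trans ab(3) by (intro fracsI) auto
qed

lemma fracs_inverse: "x \<in> fracs t ==> inverse x \<in> fracs t"
proof (cases "x = 0")
 case True
 thus ?thesis using FF_0 FF_fracs by auto
next
 case False
 assume "x \<in> fracs t"
 then obtain a b where ab: "pk FF a" "pk FF b" "poly b t ~= 0" "x = poly a t / poly b t" by (rule fracsE)
 hence "inverse x = poly b t / poly a t" "poly a t ~= 0" using False by auto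
 thus ?thesis using ab by (metis fracsI)
qed

lemma poly_fracs: "pk FF f ==> x \<in> fracs t ==> poly f x \<in> fracs t"
proof (induction f)
 case (pCons a f)
 have "a \<in> FF" "pk FF f" using pCons.prems(1) unfolding pk_def by (metis coeff_pCons_0, metis coeff_pCons_Suc)
 hence "a \<in> fracs t" "poly f x \<in> fracs t" using pCons FF_fracs by blast+
 thus ?case using fracs_closed(1)[OF _ fracs_closed(2)[OF pCons.prems(2)]] by simp
next
 case 0
 thus ?case using FF_0 FF_fracs by auto
qed

lemma fracs_sub:
 assumes "s \<in> fracs t" shows "fracs s <= fracs t"
proof
 fix x assume "x \<in> fracs s"
 then obtain a b where ab: "pk FF a" "pk FF b" "poly b s ~= 0" "x = poly a s / poly b s" by (rule fracsE)
 thus "x \<in> fracs t" unfolding ab(4) divide_inverse by (intro fracs_closed(2) fracs_inverse poly_fracs assms)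
qed

lemma fracs_inverse_TT: "fracs (inverse TT) = fracs TT"
 using fracs_sub[of "inverse TT" TT] fracs_sub[of TT "inverse TT"] fracs_inverse[OF self_fracs, of TT]
  fracs_inverse[OF self_fracs, of "inverse TT"] by auto

text \<open>The maximal constant field extension of \<open>k\<close>, over which every polynomial in
  T with constant coefficients splits into factors T - c.\<close>

definition kbar :: "'q::{field,finite} om set" where "kbar = fracs TT"

lemma fld_kbar: "fld kbar" unfolding fld_def kbar_def using kk_fracs_TT fracs_closed by blast

lemma FF_kbar: "FF <= kbar" unfolding kbar_def by (rule FF_fracs)

lemma kbar_gen: "(kbar :: 'q::{field,finite} om set) = gen FF"
proof
 show "gen FF <= (kbar :: 'q om set)" by (rule gen_least[OF fld_kbar FF_kbar])
 show "(kbar :: 'q om set) <= gen FF"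
 proof
  fix x :: "'q om" assume "x \<in> kbar"
  then obtain a b where ab: "pk FF a" "pk FF b" "x = poly a TT / poly b TT" unfolding kbar_def by (elim fracsE)
  have "TT \<in> gen (FF :: 'q om set)" using TT_in_kk fld_kk_sub[OF fld_gen] by blast
  moreover have "pk (gen FF) a" "pk (gen FF) b" using ab(1,2) pk_mono gen_incl by blast+
  ultimately show "x \<in> gen FF" unfolding ab(3) by (intro fld_divide fld_poly fld_gen)
 qed
qed


subsection \<open>Valuation rings\<close>

definition rng :: "'a::field set => bool"
 where "rng R \<longleftrightarrow> 1 \<in> R & (ALL x:R. ALL y:R. x + y \<in> R & x * y \<in> R) & (ALL x:R. - x \<in> R)"

lemma rng_1: "rng R ==> 1 \<in> R" and rng_add: "rng R ==> x \<in> R ==> y \<in> R ==> x + y \<in> R"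
 and rng_mult: "rng R ==> x \<in> R ==> y \<in> R ==> x * y \<in> R" and rng_minus: "rng R ==> x \<in> R ==> - x \<in> R"
 unfolding rng_def by blast+

lemma rng_diff: "rng R ==> x \<in> R ==> y \<in> R ==> x - y \<in> R" using rng_add[of R x "-y"] rng_minus by auto

lemma rng_0: "rng R ==> 0 \<in> R" using rng_diff[OF _ rng_1 rng_1, of R] by simp

lemma rng_power: "rng R ==> x \<in> R ==> x ^ n \<in> R" by (induction n) (auto intro: rng_1 rng_mult)

lemma rng_sum: "rng R ==> (\<And>i. i \<in> A ==> f i \<in> R) ==> sum f A \<in> R"
 by (induction A rule: infinite_finite_induct) (auto intro: rng_0 rng_add)

lemma rng_prod: "rng R ==> (\<And>i. i \<in> A ==> f i \<in> R) ==> prod f A \<in> R"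
 by (induction A rule: infinite_finite_induct) (auto intro: rng_1 rng_mult)

lemma rng_poly: "rng R ==> pk R f ==> x \<in> R ==> poly f x \<in> R"
 unfolding poly_altdef pk_def by (intro rng_sum rng_mult rng_power) auto

lemma subring_Omega: "subring R \<Omega> \<longleftrightarrow> rng R" for R :: "'a::field set"
proof -
 interpret field "\<Omega> :: 'a ring" by (rule field_Omega)
 show ?thesis
 proof
  assume "subring R \<Omega>"
  from subringE(3,5,6,7)[OF this] show "rng R" unfolding rng_def by (simp add: Omega_minus)
 next
  assume "rng R"
  thus "subring R \<Omega>" by (intro subringI) (auto simp: Omega_minus rng_def)
 qed
qed

text \<open>The primes of the ambient field; those of a subfield are their traces.\<close>

definition prm :: "'a::field set => bool"
 where "prm W \<longleftrightarrow> rng W & W ~= UNIV & (ALL x. x \<in> W \<or> inverse x \<in> W)"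

lemma prm_rng: "prm W ==> rng W" by (simp add: prm_def)

abbreviation "mx \<equiv> max_ideal"

lemma mx_iff: "x \<in> mx W \<longleftrightarrow> x \<in> W & (x = 0 \<or> inverse x ~: W)" by (auto simp: max_ideal_def)

lemma mx_sub: "x \<in> mx W ==> x \<in> W" by (simp add: mx_iff)

lemma prm_cases: "prm W ==> x ~: W ==> inverse x \<in> mx W" unfolding prm_def mx_iff by (metis inverse_inverse_eq)

lemma mx_0: "rng W ==> 0 \<in> mx W" by (simp add: mx_iff rng_0)

lemma mx_1: "rng W ==> 1 ~: mx W" by (simp add: mx_iff rng_1)

lemma mx_mult:
 assumes "rng W" "x \<in> mx W" "y \<in> W" shows "x * y \<in> mx W"
proof (cases "x = 0 \<or> y = 0")
 case False
 have "inverse (x * y) ~: W"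
 proof
  assume "inverse (x * y) \<in> W"
  hence "y * inverse (x * y) \<in> W" using assms rng_mult by blast
  moreover have "y * inverse (x * y) = inverse x" using False by (simp add: field_simps)
  ultimately have "inverse x \<in> W" by metis
  thus False using assms(2) False by (simp add: mx_iff)
 qed
 thus ?thesis using assms rng_mult[OF assms(1) mx_sub[OF assms(2)] assms(3)] by (simp add: mx_iff)
qed (use mx_0[OF assms(1)] in auto)

lemma mx_mult2: "rng W ==> y \<in> W ==> x \<in> mx W ==> y * x \<in> mx W" using mx_mult[of W x y] by (simp add: mult.commute)

lemma mx_minus: "rng W ==> x \<in> mx W ==> - x \<in> mx W" using mx_mult[of W x "-1"] rng_minus[OF _ rng_1, of W] by simp

text \<open>One of x/y and y/x lies in W, so x + y is an element of the maximal ideal times an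
  element of W.\<close>

lemma mx_add:
 assumes W: "prm W" and x: "x \<in> mx W" and y: "y \<in> mx W" shows "x + y \<in> mx W"
proof -
 have r: "rng W" by (rule prm_rng[OF W])
 have main: "a + b \<in> mx W" if ab: "b \<in> mx W" "b ~= 0" "a / b \<in> W" for a b
 proof -
  have "a + b = b * (a / b + 1)" using ab(2) by (simp add: field_simps)
  moreover have "a / b + 1 \<in> W" using ab(3) rng_add[OF r _ rng_1[OF r]] by blast
  ultimately show ?thesis using mx_mult[OF r ab(1)] by simp
 qed
 show ?thesis
 proof (cases "x = 0 \<or> y = 0")
  case False
  have "x / y \<in> W \<or> y / x \<in> W" using W unfolding prm_def by (metis inverse_divide)
  thus ?thesis using main[of y x] main[of x y] x y False by (auto simp: add.commute)
 qed (use x y in auto)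
qed

lemma mx_diff: "prm W ==> x \<in> mx W ==> y \<in> mx W ==> x - y \<in> mx W" using mx_add[of W x "-y"] mx_minus[OF prm_rng] by auto

lemma mx_sum: "prm W ==> (\<And>i. i \<in> A ==> f i \<in> mx W) ==> sum f A \<in> mx W"
 by (induction A rule: infinite_finite_induct) (auto intro: mx_0 prm_rng mx_add)

lemma mx_prime:
 assumes "rng W" "x \<in> W" "y \<in> W" "x * y \<in> mx W" shows "x \<in> mx W \<or> y \<in> mx W"
proof (rule ccontr)
 assume "\<not> (x \<in> mx W \<or> y \<in> mx W)"
 hence "x ~= 0" "y ~= 0" "inverse x \<in> W" "inverse y \<in> W" using assms by (auto simp: mx_iff)
 hence "inverse (x * y) \<in> W" "x * y ~= 0" using rng_mult[OF assms(1)] by auto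
 thus False using assms(4) by (simp add: mx_iff)
qed

lemma mx_power: "rng W ==> x \<in> mx W ==> n > 0 ==> x ^ n \<in> mx W" by (cases n) (simp_all add: mx_mult rng_power mx_sub)

lemma int_closed:
 assumes "prm W" "x ^ n \<in> W" "n > 0" shows "x \<in> W"
proof (rule ccontr)
 assume n: "x ~: W"
 hence "inverse x ^ n \<in> mx W" using prm_cases[OF assms(1)] mx_power[OF prm_rng[OF assms(1)]] assms(3) by blast
 hence "inverse x ^ n * x ^ n \<in> mx W" using mx_mult[OF prm_rng[OF assms(1)]] assms(2) by blast
 moreover have "x ~= 0" using n rng_0[OF prm_rng[OF assms(1)]] by blast
 ultimately show False using mx_1[OF prm_rng[OF assms(1)]] by (simp add: power_inverse)
qed

definition unt :: "'a::field set => 'a => bool" where "unt W x \<longleftrightarrow> x \<in> W & inverse x \<in> W & x ~= 0"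

lemma unt_iff: "unt W x \<longleftrightarrow> x \<in> W & x ~: mx W" using mx_0[of W] by (auto simp: unt_def mx_iff)

lemma unt_1: "rng W ==> unt W 1" by (simp add: unt_def rng_1)

lemma unt_mult: "rng W ==> unt W x ==> unt W y ==> unt W (x * y)" unfolding unt_def by (simp add: rng_mult)

lemma unt_inverse: "unt W x ==> unt W (inverse x)" unfolding unt_def by simp

lemma unt_divide: "rng W ==> unt W x ==> unt W y ==> unt W (x / y)" unfolding divide_inverse by (intro unt_mult unt_inverse)

lemma unt_power: "rng W ==> unt W x ==> unt W (x ^ n)" by (induction n) (auto intro: unt_1 unt_mult)

lemma unt_power_int: "rng W ==> unt W x ==> unt W (x powi i)" by (auto simp: power_int_def intro: unt_power unt_inverse)

lemma unt_power_iff: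
 assumes "prm W" "unt W (x ^ n)" "n > 0" shows "unt W x"
proof -
 have "x ^ n \<in> W" "inverse x ^ n \<in> W" "x ~= 0" using assms(2,3) unfolding unt_def by (auto simp: power_inverse)
 thus ?thesis using int_closed[OF assms(1) _ assms(3)] unfolding unt_def by blast
qed

lemma unt_prod: "rng W ==> (\<And>i. i \<in> A ==> unt W (f i)) ==> unt W (prod f A)"
 by (induction A rule: infinite_finite_induct) (auto intro: unt_1 unt_mult)

lemma unt_cong:
 assumes "prm W" "unt W x" "x - y \<in> mx W" shows "unt W y"
proof -
 have r: "rng W" by (rule prm_rng[OF assms(1)])
 have x: "x \<in> W" "x ~: mx W" using assms(2) unt_iff by blast+
 have "x - (x - y) \<in> W" using rng_diff[OF r x(1) mx_sub[OF assms(3)]] .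
 moreover have "y ~: mx W" using mx_add[OF assms(1,3), of y] x(2) by auto
 ultimately show ?thesis using unt_iff by auto
qed

lemma FF_sub_prm: "prm W ==> FF <= W"
proof
 fix c :: "'a om" assume W: "prm W" and c: "c \<in> FF"
 show "c \<in> W"
 proof (cases "c = 0")
  case False
  obtain N where "N > 0" "c ^ N = 1" by (rule FF_unity[OF c False])
  thus ?thesis using int_closed[OF W, of c N] rng_1[OF prm_rng[OF W]] by simp
 qed (use rng_0[OF prm_rng[OF W]] in simp)
qed

lemma FF_unt: "prm W ==> c \<in> FF ==> c ~= 0 ==> unt W c" using FF_sub_prm FF_inverse unfolding unt_def by blast

lemma FF_mx: "prm W ==> c \<in> FF ==> c \<in> mx W ==> c = 0" using FF_unt unt_iff by blast

lemma FF_cong: "prm W ==> c \<in> FF ==> d \<in> FF ==> c - d \<in> mx W ==> c = d" using FF_mx[of W "c - d"] FF_diff by auto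

lemma poly_cong:
 assumes "prm W" "pk W f" "x \<in> W" "x - y \<in> mx W" "y \<in> W" shows "poly f x - poly f y \<in> mx W" using assms(2)
proof (induction f)
 case 0 thus ?case using mx_0[OF prm_rng[OF assms(1)]] by simp
next
 case (pCons a g)
 have r: "rng W" by (rule prm_rng[OF assms(1)])
 have g: "pk W g" using pCons.prems unfolding pk_def by (metis coeff_pCons_Suc)
 have "poly (pCons a g) x - poly (pCons a g) y = y * (poly g x - poly g y) + (x - y) * poly g x" by (simp add: algebra_simps)
 moreover have "y * (poly g x - poly g y) \<in> mx W" by (rule mx_mult2[OF r assms(5) pCons.IH[OF g]])
 moreover have "(x - y) * poly g x \<in> mx W" by (rule mx_mult[OF r assms(4) rng_poly[OF r g assms(3)]])
 ultimately show ?case using mx_add[OF assms(1)] by metis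
qed

lemma mx_prod_linear:
 assumes "prm W" "x \<in> W" "\<And>a. a \<in># A ==> a \<in> W" "(\<Prod>a\<in>#A. x - a) \<in> mx W"
 shows "EX a. a \<in># A & x - a \<in> mx W" using assms(3,4)
proof (induction A)
 case empty
 thus ?case using mx_1[OF prm_rng[OF assms(1)]] by simp
next
 case (add a A)
 have r: "rng W" by (rule prm_rng[OF assms(1)])
 have "(\<Prod>a\<in>#B. x - a) \<in> W" if "\<And>a. a \<in># B ==> a \<in> W" for B
  using that by (induction B) (auto intro!: rng_mult[OF r] rng_diff[OF r] rng_1[OF r] assms(2))
 hence "x - a \<in> mx W \<or> (\<Prod>a\<in>#A. x - a) \<in> mx W"
  using add.prems by (intro mx_prime[OF r]) (auto intro: rng_diff[OF r] assms(2))
 thus ?case using add by auto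
qed

lemma poly_prod_mset_linear: "poly (\<Prod>a\<in>#A. [:- a, 1:]) x = (\<Prod>a\<in>#A. x - a)" for x :: "'a::field"
 by (induction A) (auto simp: algebra_simps)

text \<open>G splits into linear factors with constant roots, and since the maximal ideal is prime,
  x is congruent to one of these roots.\<close>

lemma residue_of_root:
 assumes W: "prm W" and x: "x \<in> W" and G: "pk FF G" "G ~= 0" "poly G x \<in> mx W"
 obtains a where "a \<in> FF" "x - a \<in> mx W"
proof -
 obtain A where A: "G = Polynomial.smult (Polynomial.lead_coeff G) (\<Prod>a\<in>#A. [:- a, 1:])"
  using alg_closed_imp_factorization[OF G(2)] by blast
 let ?c = "Polynomial.lead_coeff G"
 have c: "?c \<in> FF" "?c ~= 0" using G(1,2) unfolding pk_def by auto
 have A0: "a \<in> FF" if "a \<in># A" for a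
 proof (rule FF_root[OF G(1,2)])
  have "(\<Prod>b\<in>#A. a - b) = 0" using that by (auto simp: prod_mset_zero_iff)
  thus "poly G a = 0" by (subst A) (simp add: poly_prod_mset_linear)
 qed
 have eq: "poly G x = ?c * (\<Prod>a\<in>#A. x - a)" by (subst A) (simp add: poly_prod_mset_linear)
 have "inverse ?c * poly G x \<in> mx W" using mx_mult2[OF prm_rng[OF W] _ G(3)] FF_unt[OF W c] unfolding unt_def by blast
 moreover have "inverse ?c * (?c * (\<Prod>a\<in>#A. x - a)) = (\<Prod>a\<in>#A. x - a)" using c(2) by simp
 ultimately have "(\<Prod>a\<in>#A. x - a) \<in> mx W" unfolding eq by metis
 from mx_prod_linear[OF W x _ this] A0 FF_sub_prm[OF W] obtain a where "a \<in># A" "x - a \<in> mx W" by blast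
 thus thesis using A0 that by blast
qed


section \<open>Places of T, uniformizers and residues\<close>

lemma kk_not_sub_prm:
 assumes "prm W" shows "\<not> kk <= W"
proof
 assume "kk <= W"
 hence "fld W" using prm_rng[OF assms] by (auto simp: fld_def rng_def)
 hence "W = UNIV" using assms fld_inverse[of W] unfolding prm_def by (metis UNIV_eq_I inverse_inverse_eq)
 thus False using assms by (simp add: prm_def)
qed

lemma poly_FF_prm: "prm W ==> pk FF f ==> x \<in> W ==> poly f x \<in> W" using rng_poly[OF prm_rng pk_mono[OF _ FF_sub_prm]] .

lemma FF_shift_fracs:
 assumes "c \<in> FF" shows "fracs (t - c) = fracs t"
proof -
 have sub: "s + d \<in> fracs s" if "d \<in> FF" for s d :: "'a om" using that FF_fracs self_fracs by (intro fracs_closed) auto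
 have "fracs (t - c) <= fracs t" using sub[of "- c" t] FF_minus[OF assms] by (intro fracs_sub) simp
 moreover have "fracs t <= fracs (t - c)" using sub[of c "t - c"] assms by (intro fracs_sub) simp
 ultimately show ?thesis by blast
qed

text \<open>W does not contain \<open>k\<close>, so some denominator b(T) lies in the maximal ideal,
  and T is congruent to a root of b.\<close>

lemma place_of_TT:
 assumes W: "prm W" and T: "TT \<in> W"
 obtains c where "c \<in> FF" "TT - c \<in> mx W"
proof -
 obtain x where x: "x \<in> kk" "x ~: W" using kk_not_sub_prm[OF W] by blast
 then obtain a b where ab: "pk FF a" "pk FF b" "poly b TT ~= 0" "x = poly a TT / poly b TT" using kk_fracs_TT by (blast elim: fracsE)
 have "poly b TT \<in> mx W"
 proof (rule ccontr)
  assume "poly b TT ~: mx W"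
  hence "unt W (poly b TT)" using poly_FF_prm[OF W ab(2) T] unt_iff by blast
  hence "x \<in> W" using rng_mult[OF prm_rng[OF W] poly_FF_prm[OF W ab(1) T]] unfolding ab(4) divide_inverse unt_def by blast
  thus False using x(2) by blast
 qed
 moreover have "b ~= 0" using ab(3) by auto
 ultimately show thesis using residue_of_root[OF W T ab(2)] that by blast
qed

lemma uniformizer_ex:
 fixes W :: "'q::{field,finite} om set"
 assumes W: "prm W"
 obtains t where "t \<in> mx W" "t ~= 0" "fracs t = kbar"
proof (cases "TT \<in> W")
 case True
 obtain c where c: "c \<in> FF" "TT - c \<in> mx W" by (rule place_of_TT[OF W True])
 have "TT - c ~= 0" using c(1) TT_notin_FF by auto
 thus thesis using that[of "TT - c"] c FF_shift_fracs[OF c(1)] by (simp add: kbar_def)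
next
 case False
 have "TT ~= (0 :: 'q om)" using FF_0 TT_notin_FF by metis
 thus thesis using that[of "inverse TT"] prm_cases[OF W False] fracs_inverse_TT by (simp add: kbar_def)
qed

text \<open>The exponent is the order of x at t = 0. Its independence of W is what later shows that
  all primes with t in their maximal ideal have the same trace on \<open>kbar\<close>.\<close>

lemma kbar_unit_part_uniform:
 assumes t: "t ~= 0" "fracs t = kbar" and x: "x \<in> kbar" "x ~= 0"
 obtains e :: int where "ALL W. prm W & t \<in> mx W --> unt W (x / t powi e)"
proof -
 have p: "EX n. ALL W. prm W & t \<in> mx W --> unt W (poly f t / t ^ n)" if f: "pk FF f" "f ~= 0" for f using f
 proof (induction f)
  case (pCons a f)
  have af: "a \<in> FF" "pk FF f" using pCons.prems(1) unfolding pk_def by (metis coeff_pCons_0, metis coeff_pCons_Suc)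
  show ?case
  proof (cases "a = 0")
   case True
   then obtain n where "ALL W. prm W & t \<in> mx W --> unt W (poly f t / t ^ n)" using pCons af by blast
   hence "ALL W. prm W & t \<in> mx W --> unt W (poly (pCons a f) t / t ^ Suc n)" using True t(1) by simp
   thus ?thesis by blast
  next
   case False
   have "unt W (a + t * poly f t)" if W: "prm W" "t \<in> mx W" for W
   proof -
    have "a - (a + t * poly f t) \<in> mx W"
     using mx_minus[OF prm_rng[OF W(1)] mx_mult[OF prm_rng[OF W(1)] W(2) poly_FF_prm[OF W(1) af(2) mx_sub[OF W(2)]]]] by simp
    from unt_cong[OF W(1) FF_unt[OF W(1) af(1) False] this] show ?thesis .
   qed
   thus ?thesis by (intro exI[of _ 0]) simp
  qed
 qed simp
 obtain a b where ab: "pk FF a" "pk FF b" "poly b t ~= 0" "x = poly a t / poly b t"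
  using x(1) unfolding t(2)[symmetric] by (rule fracsE)
 have "a ~= 0" "b ~= 0" using ab x(2) by auto
 then obtain m n where mn: "ALL W. prm W & t \<in> mx W --> unt W (poly a t / t ^ m)"
   "ALL W. prm W & t \<in> mx W --> unt W (poly b t / t ^ n)" using p ab by metis
 have e: "x / t powi (int m - int n) = (poly a t / t ^ m) / (poly b t / t ^ n)" using t(1) unfolding ab(4) by (simp add: power_int_diff)
 have "ALL W. prm W & t \<in> mx W --> unt W (x / t powi (int m - int n))" unfolding e using mn unt_divide[OF prm_rng] by blast
 thus thesis by (rule that)
qed

lemma kbar_unit_part:
 assumes W: "prm W" and t: "t \<in> mx W" "t ~= 0" "fracs t = kbar" and x: "x \<in> kbar" "x ~= 0"
 obtains e :: int where "unt W (x / t powi e)" using kbar_unit_part_uniform[OF t(2,3) x] W t(1) by metis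

lemma clear_denominators:
 assumes "pk (fracs t) f" "f ~= 0" "poly f x = 0"
 obtains n g where "ALL i. pk FF (g i)" "EX i<=n. g i ~= 0" "(\<Sum>i\<le>n. poly (g i) t * x ^ i) = 0"
proof -
 have "EX a b. pk FF a & pk FF b & poly b t ~= 0 & cf f i = poly a t / poly b t" for i
  using assms(1) unfolding pk_def fracs_def by blast
 then obtain a b where ab: "\<And>i. pk FF (a i)" "\<And>i. pk FF (b i)" "\<And>i. poly (b i) t ~= 0"
  "\<And>i. cf f i = poly (a i) t / poly (b i) t" by metis
 let ?n = "dg f"
 define g where "g i = a i * (\<Prod>j\<in>{..?n}-{i}. b j)" for i
 let ?B = "poly (\<Prod>j\<in>{..?n}. b j) t"
 have B0: "?B ~= 0" using ab(3) by (simp add: poly_prod)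
 have gi: "poly (g i) t = cf f i * ?B" if "i \<le> ?n" for i
 proof -
  have "(\<Prod>j\<in>{..?n}. b j) = b i * (\<Prod>j\<in>{..?n}-{i}. b j)" using that by (intro prod.remove) auto
  thus ?thesis using ab(3,4)[of i] by (simp add: g_def)
 qed
 show thesis
 proof
  show "ALL i. pk FF (g i)" unfolding g_def by (intro allI pkF_mult pkF_prod ab)
  have "poly (g ?n) t ~= 0" using gi[of ?n] B0 assms(2) by simp
  thus "EX i<=?n. g i ~= 0" by (intro exI[of _ ?n]) auto
  have "(\<Sum>i\<le>?n. poly (g i) t * x ^ i) = (\<Sum>i\<le>?n. cf f i * x ^ i * ?B)" by (intro sum.cong) (auto simp: gi)
  also have "\<dots> = poly f x * ?B" by (simp add: poly_altdef sum_distrib_right)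
  finally show "(\<Sum>i\<le>?n. poly (g i) t * x ^ i) = 0" using assms(3) by simp
 qed
qed

text \<open>Among the algebraic relations for x with coefficients in \<open>FF\<close>[t], one of
  least total degree has a coefficient not divisible by t, since otherwise t could be cancelled.
  Setting t = 0 leaves a nonzero polynomial over \<open>FF\<close> whose value at x lies in the
  maximal ideal.\<close>

theorem residue_ex:
 assumes W: "prm W" and x: "x \<in> W"
 obtains c where "c \<in> FF" "x - c \<in> mx W"
proof -
 obtain t where t: "t \<in> mx W" "t ~= 0" "fracs t = kbar" by (rule uniformizer_ex[OF W])
 obtain f where f: "f ~= 0" "pk kk f" "poly f x = 0" by (rule algebraic_over_kk)
 have ft: "pk (fracs t) f" using pk_mono[OF f(2)] t(3) kk_fracs_TT by (simp add: kbar_def)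
 obtain n0 g0 where g0: "ALL i. pk FF (g0 i)" "EX i<=n0. g0 i ~= 0" "(\<Sum>i\<le>n0. poly (g0 i) t * x ^ i) = 0"
  by (rule clear_denominators[OF ft f(1,3)]) blast
 let ?P = "%(n, g). (ALL i. pk FF (g i)) & (EX i<=n. g i ~= 0) & (\<Sum>i\<le>n. poly (g i) t * x ^ i) = 0"
 let ?m = "%(n, g). \<Sum>i\<le>n. dg (g i)"
 have "?P (n0, g0)" using g0 by simp
 from ex_has_least_nat[of ?P, OF this, of ?m] obtain ng where ng: "?P ng" and
  min: "ALL z. ?P z --> ?m ng \<le> ?m z" by blast
 obtain n g where [simp]: "ng = (n, g)" by (cases ng)
 have g: "\<And>i. pk FF (g i)" "EX i<=n. g i ~= 0" "(\<Sum>i\<le>n. poly (g i) t * x ^ i) = 0" using ng by auto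
 have "EX i<=n. poly (g i) 0 ~= 0"
 proof (rule ccontr)
  assume "\<not> (EX i<=n. poly (g i) 0 ~= 0)"
  hence z: "poly (g i) 0 = 0" if "i \<le> n" for i using that by blast
  have "EX h. pk FF h & (i \<le> n --> g i = [:0, 1:] * h)" for i
  proof (cases "i \<le> n")
   case True
   from z[OF this] have "[:- 0, 1:] dvd g i" unfolding poly_eq_0_iff_dvd .
   then obtain h where h: "g i = [:- 0, 1:] * h" by (elim dvdE)
   have "pk FF h" using pkF_linear_factor[of 0 h] g(1)[of i] h FF_0 by metis
   thus ?thesis using h by auto
  qed (use pkF_0 in blast)
  then obtain h where h: "\<And>i. pk FF (h i)" "\<And>i. i \<le> n ==> g i = [:0, 1:] * h i" by metis
  have "(\<Sum>i\<le>n. poly (g i) t * x ^ i) = t * (\<Sum>i\<le>n. poly (h i) t * x ^ i)"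
   unfolding sum_distrib_left by (intro sum.cong) (auto simp: h(2))
  hence "(\<Sum>i\<le>n. poly (h i) t * x ^ i) = 0" using g(3) t(2) by simp
  moreover obtain i0 where i0: "i0 \<le> n" "g i0 ~= 0" using g(2) by blast
  moreover have "h i0 ~= 0" using i0(2) h(2)[OF i0(1)] by auto
  ultimately have "?P (n, h)" using h(1) by (simp only: split_conv) blast
  hence "?m ng \<le> ?m (n, h)" using min by blast
  hence "(\<Sum>i\<le>n. dg (g i)) \<le> (\<Sum>i\<le>n. dg (h i))" by simp
  moreover have "(\<Sum>i\<le>n. dg (h i)) < (\<Sum>i\<le>n. dg (g i))"
  proof (rule sum_strict_mono_ex1)
   have "dg (g i) = Suc (dg (h i))" if "i \<le> n" "h i ~= 0" for i using h(2)[OF that(1)] that(2) by simp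
   thus "ALL i:{..n}. dg (h i) \<le> dg (g i)" by (metis atMost_iff degree_0 le_SucI order_refl zero_le)
   show "EX i:{..n}. dg (h i) < dg (g i)" using i0(1) \<open>h i0 ~= 0\<close> h(2)[OF i0(1)] by (intro bexI[of _ i0]) auto
  qed simp
  ultimately show False by linarith
 qed
 then obtain i0 where i0: "i0 \<le> n" "poly (g i0) 0 ~= 0" by blast
 define G where "G = (\<Sum>i\<le>n. Polynomial.monom (poly (g i) 0) i)"
 have "pk FF G" unfolding G_def by (intro pkF_sum pkF_monom FF_poly g(1) FF_0)
 moreover have "cf G i0 = poly (g i0) 0"
 proof -
  have "cf G i0 = (\<Sum>i\<le>n. if i = i0 then poly (g i) 0 else 0)" unfolding G_def Polynomial.coeff_sum by (intro sum.cong) auto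
  thus ?thesis using i0(1) by simp
 qed
 hence "G ~= 0" using i0(2) by auto
 moreover have "poly G x \<in> mx W"
 proof -
  have "poly (g i) t * x ^ i - poly (g i) 0 * x ^ i \<in> mx W" for i
  proof -
   have "poly (g i) t - poly (g i) 0 \<in> mx W"
    using poly_cong[OF W pk_mono[OF g(1) FF_sub_prm[OF W]] mx_sub[OF t(1)], of 0] t(1) rng_0[OF prm_rng[OF W]] by simp
   from mx_mult[OF prm_rng[OF W] this rng_power[OF prm_rng[OF W] x]] show ?thesis by (simp add: left_diff_distrib)
  qed
  hence "(\<Sum>i\<le>n. poly (g i) t * x ^ i - poly (g i) 0 * x ^ i) \<in> mx W" by (intro mx_sum[OF W])
  hence "- (\<Sum>i\<le>n. poly (g i) 0 * x ^ i) \<in> mx W" by (simp add: sum_subtractf g(3))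
  from mx_minus[OF prm_rng[OF W] this] show ?thesis by (simp add: G_def poly_sum poly_monom)
 qed
 ultimately show thesis using residue_of_root[OF W x] that by blast
qed

definition res :: "'q::{field,finite} om set => 'q om => 'q om" where "res W x = (SOME c. c \<in> FF & x - c \<in> mx W)"

lemma res: assumes "prm W" "x \<in> W" shows "res W x \<in> FF" "x - res W x \<in> mx W"
proof -
 have "EX c. c \<in> FF & x - c \<in> mx W" using residue_ex[OF assms] by blast
 from someI_ex[OF this] show "res W x \<in> FF" "x - res W x \<in> mx W" unfolding res_def by auto
qed

lemma mx_power_diff: "prm W ==> x \<in> W ==> y \<in> W ==> x - y \<in> mx W ==> x ^ n - y ^ n \<in> mx W"
 using poly_cong[of W "Polynomial.monom 1 n" x y] rng_0[OF prm_rng, of W] rng_1[OF prm_rng, of W] by (auto simp: pk_def poly_monom)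

lemma unt_power_cong_1:
 fixes W :: "'q::{field,finite} om set"
 assumes W: "prm W" and u: "unt W x"
 obtains N where "N > 0" "x ^ N - 1 \<in> mx W"
proof -
 have x: "x \<in> W" "x ~: mx W" using u unt_iff by blast+
 note r = res[OF W x(1)]
 have "res W x ~= 0" using r(2) x(2) by auto
 then obtain N where N: "N > 0" "res W x ^ N = 1" by (rule FF_unity[OF r(1)])
 have "x ^ N - res W x ^ N \<in> mx W" using mx_power_diff[OF W x(1) _ r(2)] r(1) FF_sub_prm[OF W] by blast
 thus thesis using that N by simp
qed

lemma frobenius_cong:
 fixes W :: "'q::{field,finite} om set"
 assumes W: "prm W" and x: "x \<in> W"
 obtains n where "n > 0" "x - x ^ (CHAR('q om) ^ n) \<in> mx W"
proof -
 note r = res[OF W x]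
 obtain n where n: "n > 0" "res W x ^ (CHAR('q om) ^ n) = res W x" using r(1) unfolding FF_def by blast
 have "x ^ (CHAR('q om) ^ n) - res W x ^ (CHAR('q om) ^ n) \<in> mx W" using mx_power_diff[OF W x _ r(2)] r(1) FF_sub_prm[OF W] by blast
 hence "x ^ (CHAR('q om) ^ n) - res W x \<in> mx W" using n(2) by simp
 from mx_diff[OF W r(2) this] show thesis using that[OF n(1)] by simp
qed


subsection \<open>The rational valuation of a prime\<close>

definition unif :: "'q::{field,finite} om set => 'q om" where "unif W = (SOME t. t \<in> mx W & t ~= 0 & fracs t = kbar)"

lemma unif:
 assumes "prm W" shows "unif W \<in> mx W" "unif W ~= 0" "fracs (unif W) = kbar"
proof -
 have "EX t. t \<in> mx W & t ~= 0 & fracs t = kbar" using uniformizer_ex[OF assms] by blast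
 from someI_ex[OF this] show "unif W \<in> mx W" "unif W ~= 0" "fracs (unif W) = kbar" unfolding unif_def by auto
qed

lemma ex_dominant:
 fixes u :: "'b => 'a::field"
 assumes "prm W" "finite J" "J ~= {}" "\<And>i. i \<in> J ==> u i ~= 0"
 shows "EX j:J. ALL i:J. u i / u j \<in> W" using assms(2-4)
proof (induction J rule: finite_ne_induct)
 case (singleton x)
 thus ?case using rng_1[OF prm_rng[OF assms(1)]] by simp
next
 case (insert a J)
 have r: "rng W" by (rule prm_rng[OF assms(1)])
 obtain j where j: "j \<in> J" "ALL i:J. u i / u j \<in> W" using insert by auto
 have nz: "u a ~= 0" "u j ~= 0" using insert.prems j(1) by auto
 show ?case
 proof (cases "u a / u j \<in> W")
  case True
  thus ?thesis using j by blast
 next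
  case False
  hence "u j / u a \<in> W" using prm_cases[OF assms(1) False] mx_sub by (metis inverse_divide)
  hence "u i / u j * (u j / u a) \<in> W" if "i \<in> J" for i using j(2) that rng_mult[OF r] by blast
  hence "u i / u a \<in> W" if "i \<in> J" for i using that nz by simp
  moreover have "u a / u a \<in> W" using nz rng_1[OF r] by simp
  ultimately show ?thesis by blast
 qed
qed

text \<open>In f(x) = 0 two terms of least value have a unit as quotient. This expresses a power of
  x, up to a unit, by an element of \<open>kbar\<close> and hence by a power of the uniformizer. The
  bound on N by the degree later gives discreteness of values on finite extensions.\<close>

lemma fractional_value:
 assumes W: "prm W" and x: "x ~= 0" and f: "pk kk f" "f ~= 0" "poly f x = 0"
 obtains N :: nat and e :: int where "0 < N" "N \<le> dg f" "unt W (x ^ N / unif W powi e)"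
proof -
 have r: "rng W" by (rule prm_rng[OF W])
 define J where "J = {i. i \<le> dg f & cf f i ~= 0}"
 define u where "u i = cf f i * x ^ i" for i
 have J: "finite J" "J ~= {}" using f(2) by (auto simp: J_def)
 have u0: "u i ~= 0" if "i \<in> J" for i using that x by (simp add: J_def u_def)
 have "EX j:J. ALL i:J. u i / u j \<in> W" by (rule ex_dominant[OF W J u0])
 then obtain j where j: "j \<in> J" "ALL i:J. u i / u j \<in> W" by blast
 have "(\<Sum>i\<in>J. u i) = poly f x" unfolding poly_altdef u_def by (rule sum.mono_neutral_left) (auto simp: J_def)
 hence "(\<Sum>i\<in>J. u i) = 0" using f(3) by simp
 hence "u j + (\<Sum>i\<in>J-{j}. u i) = 0" using sum.remove[OF J(1) j(1), of u] by simp
 hence "(\<Sum>i\<in>J-{j}. u i / u j) = - 1"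
  unfolding sum_divide_distrib[symmetric] using u0[OF j(1)] by (simp add: field_simps eq_neg_iff_add_eq_0)
 have "EX i:J-{j}. u i / u j ~: mx W"
 proof (rule ccontr)
  assume "\<not> (EX i:J-{j}. u i / u j ~: mx W)"
  hence "(\<Sum>i\<in>J-{j}. u i / u j) \<in> mx W" by (intro mx_sum[OF W]) blast
  hence "- 1 \<in> mx W" using \<open>(\<Sum>i\<in>J-{j}. u i / u j) = - 1\<close> by simp
  thus False using mx_minus[OF r, of "-1"] mx_1[OF r] by simp
 qed
 then obtain i where i: "i \<in> J" "i ~= j" "unt W (u i / u j)" using j(2) unt_iff by blast
 have key: "EX N e. 0 < N & N \<le> dg f & unt W (x ^ N / unif W powi e)"
  if ij: "i \<in> J" "j \<in> J" "j < i" "unt W (u i / u j)" for i j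
 proof -
  define c where "c = cf f i / cf f j"
  have "c \<in> kbar" using f(1) fld_kk_sub[OF fld_kbar] unfolding pk_def c_def by (intro fld_divide fld_kbar) auto
  moreover have c0: "c ~= 0" using ij by (simp add: J_def c_def)
  ultimately obtain e where e: "unt W (c / unif W powi e)" by (rule kbar_unit_part[OF W unif[OF W]])
  have "u i / u j = c * x ^ (i - j)" using x ij(3) by (simp add: u_def power_diff c_def)
  hence "u i / u j / (c / unif W powi e) = x ^ (i - j) / unif W powi (- e)" using c0 by (simp add: power_int_minus divide_inverse)
  hence "unt W (x ^ (i - j) / unif W powi (- e))" using unt_divide[OF r ij(4) e] by simp
  moreover have "0 < i - j" "i - j \<le> dg f" using ij by (auto simp: J_def)
  ultimately show ?thesis by blast
 qed
 have "unt W (u j / u i)" using unt_inverse[OF i(3)] by simp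
 thus thesis using key[OF i(1) j(1) _ i(3)] key[OF j(1) i(1)] i(2) that by (metis linorder_neqE_nat)
qed

lemma unif_power_unt:
 assumes "prm W" "unt W (unif W powi e)" shows "e = 0"
proof (rule ccontr)
 note r = prm_rng[OF assms(1)] and t = unif[OF assms(1)]
 assume "e ~= 0"
 have "unif W ^ nat \<bar>e\<bar> \<in> mx W" using \<open>e ~= 0\<close> by (intro mx_power[OF r t(1)]) simp
 moreover have "unt W (unif W ^ nat \<bar>e\<bar>)"
  using assms(2) unt_inverse[OF assms(2)] unfolding power_int_def by (auto split: if_splits simp: power_inverse)
 ultimately show False unfolding unt_iff by blast
qed

text \<open>The valuation of an ambient prime is not discrete; but each nonzero x has a power that
  equals a power of \<open>unif W\<close> up to a unit, so values are rational, normalised to 1 at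
  \<open>unif W\<close>.\<close>

definition val :: "'q::{field,finite} om set => 'q om => rat"
 where "val W x = (THE r. EX N e. N > 0 & unt W (x ^ N / unif W powi e) & r = of_int e / of_nat N)"

lemma val_unique:
 assumes W: "prm W" and N: "N > 0" "unt W (x ^ N / unif W powi e)" and M: "M > 0" "unt W (x ^ M / unif W powi d)"
 shows "(of_int e :: rat) / of_nat N = of_int d / of_nat M"
proof -
 note r = prm_rng[OF W] and t = unif[OF W]
 have x: "x ~= 0" using N by (auto simp: unt_def zero_power)
 have "unt W ((x ^ N / unif W powi e) ^ M / (x ^ M / unif W powi d) ^ N)" by (intro unt_divide[OF r] unt_power[OF r] N M)
 moreover have "(x ^ N / unif W powi e) ^ M / (x ^ M / unif W powi d) ^ N
   = unif W powi (d * int N - e * int M)"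
 proof -
  have "(x ^ N) ^ M = (x ^ M) ^ N" by (simp add: mult.commute flip: power_mult)
  thus ?thesis using x t(2) by (simp add: power_divide power_int_diff power_int_mult power_int_of_nat divide_simps)
 qed
 ultimately have "d * int N - e * int M = 0" using unif_power_unt[OF W] by metis
 hence "(of_int (d * int N) :: rat) = of_int (e * int M)" by simp
 thus ?thesis using N(1) M(1) by (simp add: frac_eq_eq mult.commute)
qed

lemma val_eqI:
 assumes "prm W" "N > 0" "unt W (x ^ N / unif W powi e)" shows "val W x = of_int e / of_nat N"
 unfolding val_def using assms val_unique[OF assms(1)] by (intro the_equality) blast+

lemma val_ex:
 assumes W: "prm W" and x: "x ~= 0"
 obtains N e where "0 < N" "unt W (x ^ N / unif W powi e)" "val W x = of_int e / of_nat N"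
proof -
 obtain f where f: "f ~= 0" "pk kk f" "poly f x = 0" by (rule algebraic_over_kk)
 obtain N e where "0 < N" "unt W (x ^ N / unif W powi e)" using fractional_value[OF W x f(2,1,3)] by blast
 thus thesis using that val_eqI[OF W] by blast
qed

lemma val_mult:
 assumes W: "prm W" and x: "x ~= 0" and y: "y ~= 0" shows "val W (x * y) = val W x + val W y"
proof -
 note r = prm_rng[OF W] and t = unif[OF W]
 obtain N e where N: "0 < N" "unt W (x ^ N / unif W powi e)" "val W x = of_int e / of_nat N" by (rule val_ex[OF W x])
 obtain M d where M: "0 < M" "unt W (y ^ M / unif W powi d)" "val W y = of_int d / of_nat M" by (rule val_ex[OF W y])
 have "unt W ((x ^ N / unif W powi e) ^ M * (y ^ M / unif W powi d) ^ N)" by (intro unt_mult[OF r] unt_power[OF r] N M)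
 moreover have "(x ^ N / unif W powi e) ^ M * (y ^ M / unif W powi d) ^ N = (x * y) ^ (N * M) / unif W powi (e * int M + d * int N)"
  using x y t(2) by (simp add: power_divide power_int_add power_int_mult power_int_of_nat power_mult_distrib power_mult)
   (simp add: mult.commute flip: power_mult)
 ultimately have "val W (x * y) = of_int (e * int M + d * int N) / of_nat (N * M)" using N(1) M(1) by (intro val_eqI[OF W]) auto
 also have "\<dots> = val W x + val W y" using N(1,3) M(1,3) by (simp add: add_frac_eq)
 finally show ?thesis .
qed

lemma val_unt: "prm W ==> unt W x ==> val W x = 0" using val_eqI[of W 1 x 0] by simp

lemma val_1: "prm W ==> val W 1 = 0" by (rule val_unt[OF _ unt_1[OF prm_rng]])

lemma val_inverse: "prm W ==> x ~= 0 ==> val W (inverse x) = - val W x" using val_mult[of W x "inverse x"] val_1[of W] by simp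

lemma val_divide: "prm W ==> x ~= 0 ==> y ~= 0 ==> val W (x / y) = val W x - val W y"
 using val_mult[of W x "inverse y"] val_inverse[of W y] by (simp add: divide_inverse)

lemma val_power: "prm W ==> x ~= 0 ==> val W (x ^ n) = of_nat n * val W x" by (induction n) (auto simp: val_1 val_mult algebra_simps)

lemma val_power_int: "prm W ==> x ~= 0 ==> val W (x powi i) = of_int i * val W x" by (auto simp: power_int_def val_power val_inverse)

lemma val_unif: "prm W ==> val W (unif W) = 1" using val_eqI[of W 1 "unif W" 1] unif[of W] unt_1[OF prm_rng, of W] by simp

lemma val_pos:
 assumes W: "prm W" and x: "x \<in> mx W" "x ~= 0" shows "val W x > 0"
proof -
 note r = prm_rng[OF W] and t = unif[OF W]
 obtain N e where N: "0 < N" "unt W (x ^ N / unif W powi e)" "val W x = of_int e / of_nat N" by (rule val_ex[OF W x(2)])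
 have "e > 0"
 proof (rule ccontr)
  assume "\<not> e > 0"
  hence e: "x ^ N / unif W powi e = x ^ N * unif W ^ nat (- e)" by (auto simp: power_int_def divide_inverse power_inverse)
  have "x ^ N * unif W ^ nat (- e) \<in> mx W" by (intro mx_mult[OF r] mx_power[OF r] x N rng_power[OF r] mx_sub[OF t(1)])
  thus False using N(2) e unt_iff by metis
 qed
 thus ?thesis using N by simp
qed

lemma val_nonneg_iff: "prm W ==> x ~= 0 ==> val W x \<ge> 0 \<longleftrightarrow> x \<in> W"
 using val_pos[of W x] val_unt[of W x] unt_iff[of W x] prm_cases[of W x] val_pos[of W "inverse x"] val_inverse[of W x]
 by (cases "x \<in> W"; cases "x \<in> mx W") auto

lemma val_pos_iff: "prm W ==> x ~= 0 ==> val W x > 0 \<longleftrightarrow> x \<in> mx W"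
 using val_pos[of W x] val_unt[of W x] unt_iff[of W x] val_nonneg_iff[of W x]
 by (cases "x \<in> W"; cases "x \<in> mx W") (auto dest: mx_sub)

lemma val_kbar_int:
 assumes "prm W" "x \<in> kbar" "x ~= 0"
 obtains e :: int where "val W x = of_int e"
proof -
 obtain e where "unt W (x / unif W powi e)" by (rule kbar_unit_part[OF assms(1) unif[OF assms(1)] assms(2,3)])
 thus thesis using val_eqI[OF assms(1), of 1 x e] that by simp
qed

lemma val_discrete:
 assumes "prm W" "x \<in> mx W" "x ~= 0" "pk kk f" "f ~= 0" "poly f x = 0" shows "val W x \<ge> 1 / of_nat (dg f)"
proof -
 obtain N e where N: "0 < N" "N \<le> dg f" "unt W (x ^ N / unif W powi e)" by (rule fractional_value[OF assms(1,3-6)])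
 hence v: "val W x = of_int e / of_nat N" using val_eqI assms(1) by blast
 hence "e > 0" using val_pos[OF assms(1-3)] N(1) by (simp add: zero_less_divide_iff)
 hence "(1 :: rat) \<le> of_int e" by simp
 hence "1 / of_nat N \<le> (of_int e :: rat) / of_nat N" using N(1) by (intro divide_right_mono) auto
 moreover have "(1 :: rat) / of_nat (dg f) \<le> 1 / of_nat N" using N(1,2) by (intro divide_left_mono) auto
 ultimately show ?thesis using v by simp
qed


subsection \<open>Extension of primes\<close>

text \<open>Multiplied by x^n, the relation for 1/x expresses x^n through lower powers, because 1 -
  t g(0) is a unit. Substituting this for the top term of f lowers its degree.\<close>

lemma chevalley_reduce:
 assumes W: "rng W" and t: "t \<in> W" and u: "inverse (1 - t * cf g 0) \<in> W" "1 - t * cf g 0 ~= 0"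
  and x: "x ~= (0 :: 'a::field)" and n: "n > 0" and f: "pk W f" "dg f \<le> n" "t * poly f x = 1"
  and g: "pk W g" "dg g \<le> n" "t * poly g (inverse x) = 1" shows "EX h. pk W h & dg h \<le> n - 1 & t * poly h x = 1"
proof -
 let ?u = "inverse (1 - t * cf g 0)"
 define h where "h = (\<Sum>j\<in>{1..n}. Polynomial.monom (t * cf g j) (n - j))"
 have hW: "pk W h"
 proof -
  have "cf h i \<in> W" for i unfolding h_def Polynomial.coeff_sum using g(1) t rng_0[OF W]
   by (intro rng_sum[OF W]) (auto simp: pk_def intro: rng_mult[OF W])
  thus ?thesis by (simp add: pk_def)
 qed
 have dh: "dg h \<le> n - 1" unfolding h_def by (intro degree_sum_le) (auto intro: order_trans[OF degree_monom_le])
 have gx: "x ^ n * poly g (inverse x) = (\<Sum>j\<le>n. cf g j * x ^ (n - j))"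
 proof -
  have "poly g (inverse x) = (\<Sum>j\<le>n. cf g j * inverse x ^ j)"
   unfolding poly_altdef using g(2) by (intro sum.mono_neutral_left) (auto simp: coeff_eq_0)
  moreover have "x ^ n * (cf g j * inverse x ^ j) = cf g j * x ^ (n - j)" if "j \<le> n" for j
   using x that by (simp add: power_diff power_inverse divide_inverse)
  hence "(\<Sum>j\<le>n. x ^ n * (cf g j * inverse x ^ j)) = (\<Sum>j\<le>n. cf g j * x ^ (n - j))" by (intro sum.cong) auto
  ultimately show ?thesis by (simp only: sum_distrib_left)
 qed
 have "x ^ n = t * (\<Sum>j\<le>n. cf g j * x ^ (n - j))"
  using arg_cong[OF g(3), of "%y. x ^ n * y"] gx by (simp add: mult.left_commute)
 also have "(\<Sum>j\<le>n. cf g j * x ^ (n - j)) = cf g 0 * x ^ n + (\<Sum>j\<in>{1..n}. cf g j * x ^ (n - j))"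
 proof -
  have "{..n} - {0} = {1..n}" by auto
  thus ?thesis using sum.remove[of "{..n}" 0 "%j. cf g j * x ^ (n - j)"] by simp
 qed
 finally have "x ^ n * (1 - t * cf g 0) = poly h x" unfolding h_def by (simp add: poly_sum poly_monom algebra_simps sum_distrib_left)
 hence xn: "x ^ n = ?u * poly h x" using u(2) by (simp add: field_simps)
 define f' where "f' = f - Polynomial.monom (cf f n) n + Polynomial.smult (cf f n * ?u) h"
 have "pk W f'" unfolding f'_def pk_def using f(1) hW u(1) rng_0[OF W]
  by (auto simp: pk_def intro!: rng_add[OF W] rng_diff[OF W] rng_mult[OF W])
 moreover have "dg f' \<le> n - 1"
 proof -
  have "dg (f - Polynomial.monom (cf f n) n) \<le> n - 1"
  proof (rule degree_le)
   show "ALL i>n - 1. cf (f - Polynomial.monom (cf f n) n) i = 0"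
   proof (intro allI impI)
    fix i assume "n - 1 < i"
    hence "i = n \<or> i > n" using n by linarith
    thus "cf (f - Polynomial.monom (cf f n) n) i = 0" using f(2) by (auto simp: coeff_eq_0)
   qed
  qed
  thus ?thesis unfolding f'_def using dh degree_smult_le[of "cf f n * ?u" h] by (intro degree_add_le) (auto intro: order_trans)
 qed
 moreover have "poly f' x = poly f x" unfolding f'_def by (simp add: poly_monom xn)
 ultimately show ?thesis using f(3) by auto
qed

text \<open>A ring W maximal among those containing R but not 1/t is a valuation ring. If it
  contained neither x nor 1/x, adjoining either would produce 1/t, which gives relations t f(x) = 1
  and t g(1/x) = 1. With both of least degree, \<open>chevalley_reduce\<close> shortens the longer
  one.\<close>

theorem chevalley:
 fixes t :: "'a::field"
 assumes R: "rng R" and t: "t \<in> R" "t ~= 0" "inverse t ~: R"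
 obtains W where "prm W" "R <= W" "inverse t ~: W"
proof -
 define A where "A = {S. rng S & R <= S & inverse t ~: S}"
 have "EX M:A. ALL N:A. M <= N --> N = M"
 proof (rule subset_Zorn_nonempty)
  show "A ~= {}" using R t by (auto simp: A_def)
  fix C assume C: "C ~= {}" "subset.chain A C"
  hence CA: "\<And>S. S \<in> C ==> rng S & R <= S & inverse t ~: S" by (auto simp: subset_chain_def A_def)
  have "rng (\<Union>C)" unfolding rng_def
  proof (intro conjI ballI)
   show "1 \<in> \<Union>C" using C(1) CA rng_1 by blast
  next
   fix x y assume "x \<in> \<Union>C" "y \<in> \<Union>C"
   then obtain S where "S \<in> C" "x \<in> S" "y \<in> S" using C(2) unfolding subset_chain_def by blast
   thus "x + y \<in> \<Union>C" "x * y \<in> \<Union>C" using CA rng_add rng_mult by blast+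
  next
   fix x assume "x \<in> \<Union>C"
   thus "- x \<in> \<Union>C" using CA rng_minus by blast
  qed
  thus "\<Union>C \<in> A" using C(1) CA by (auto simp: A_def)
 qed
 then obtain W where "W \<in> A" and max: "\<And>N. N \<in> A ==> W <= N ==> N = W" by metis
 hence W: "rng W" "R <= W" "inverse t ~: W" by (auto simp: A_def)
 have tW: "t \<in> W" using t W by blast
 have adj: "EX f. pk W f & poly f y = inverse t" if y: "y ~: W" for y
 proof -
  let ?N = "{poly f y | f. pk W f}"
  have N: "rng ?N" unfolding rng_def
  proof (intro conjI ballI)
   have "pk W 1" using rng_0[OF W(1)] rng_1[OF W(1)] by (simp add: pk_def)
   thus "1 \<in> ?N" by (intro CollectI exI[of _ 1]) simp
  next
   fix a b assume "a \<in> ?N" "b \<in> ?N"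
   then obtain f g where fg: "pk W f" "pk W g" "a = poly f y" "b = poly g y" by blast
   have "pk W (f + g)" using fg(1,2) rng_add[OF W(1)] by (simp add: pk_def)
   thus "a + b \<in> ?N" using fg by (intro CollectI exI[of _ "f + g"]) simp
   have "pk W (f * g)" using fg(1,2) by (auto simp: pk_def coeff_mult intro!: rng_sum[OF W(1)] rng_mult[OF W(1)])
   thus "a * b \<in> ?N" using fg by (intro CollectI exI[of _ "f * g"]) simp
  next
   fix a assume "a \<in> ?N"
   then obtain f where f: "pk W f" "a = poly f y" by blast
   have "pk W (- f)" using f(1) rng_minus[OF W(1)] by (simp add: pk_def)
   thus "- a \<in> ?N" using f by (intro CollectI exI[of _ "- f"]) simp
  qed
  have WN: "W <= ?N"
  proof
   fix a assume "a \<in> W"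
   hence "pk W [:a:]" using rng_0[OF W(1)] by (auto simp: pk_def coeff_pCons split: nat.splits)
   thus "a \<in> ?N" by (intro CollectI exI[of _ "[:a:]"]) simp
  qed
  have "pk W [:0, 1:]" using rng_0[OF W(1)] rng_1[OF W(1)] by (auto simp: pk_def coeff_pCons split: nat.splits)
  hence "y \<in> ?N" by (intro CollectI exI[of _ "[:0, 1:]"]) simp
  hence "?N ~= W" using y by blast
  hence "?N ~: A" using max[OF _ WN] by blast
  hence "inverse t \<in> ?N" using N WN W(2) unfolding A_def by blast
  thus ?thesis by force
 qed
 \<comment> \<open>The element t lies in the Jacobson radical of W. If v = 1 - t d had no inverse in
   W, adjoining one would produce 1/t; clearing denominators puts v^n / t into W for some n, and v^n
   is congruent to 1 modulo t W, so 1/t would lie in W.\<close>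
 have unit: "inverse (1 - t * d) \<in> W" "1 - t * d ~= 0" if d: "d \<in> W" for d
 proof -
  let ?v = "1 - t * d"
  show v0: "?v ~= 0"
  proof
   assume "?v = 0"
   hence "inverse t = d" using t(2) by (simp add: field_simps)
   thus False using W(3) d by simp
  qed
  show "inverse ?v \<in> W"
  proof (rule ccontr)
   assume "inverse ?v ~: W"
   then obtain f where f: "pk W f" "poly f (inverse ?v) = inverse t" using adj by blast
   have vW: "?v \<in> W" using rng_diff[OF W(1) rng_1[OF W(1)] rng_mult[OF W(1) tW d]] .
   have "?v ^ dg f * poly f (inverse ?v) = (\<Sum>i\<le>dg f. cf f i * ?v ^ (dg f - i))" unfolding poly_altdef sum_distrib_left using v0
    by (intro sum.cong) (auto simp: power_diff power_inverse divide_inverse)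
   also have "\<dots> \<in> W" using f(1) vW by (intro rng_sum[OF W(1)] rng_mult[OF W(1)] rng_power[OF W(1)]) (auto simp: pk_def)
   finally have m: "?v ^ dg f * inverse t \<in> W" using f(2) by simp
   have "inverse t - ?v ^ n * inverse t \<in> W" for n
   proof (induction n)
    case (Suc n)
    have "inverse t - ?v ^ Suc n * inverse t = (inverse t - ?v ^ n * inverse t) + ?v ^ n * d" using t(2) by (simp add: algebra_simps)
    thus ?case using Suc rng_add[OF W(1)] rng_mult[OF W(1) rng_power[OF W(1) vW] d] by metis
   qed (use rng_0[OF W(1)] in simp)
   from rng_add[OF W(1) this[of "dg f"] m] show False using W(3) by simp
  qed
 qed
 have "x \<in> W \<or> inverse x \<in> W" for x
 proof (rule ccontr)
  assume n: "\<not> (x \<in> W \<or> inverse x \<in> W)"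
  hence x0: "x ~= 0" using rng_0[OF W(1)] by auto
  define P where "P y n \<longleftrightarrow> (EX f. pk W f & dg f \<le> n & t * poly f y = 1)" for y n
  have ex: "EX n. P y n" if y: "y ~: W" for y
  proof -
   obtain f where "pk W f" "poly f y = inverse t" using adj[OF y] by blast
   thus ?thesis using t(2) unfolding P_def by (intro exI[of _ "dg f"] exI[of _ f]) auto
  qed
  have P0: "\<not> P y 0" for y
  proof
   assume "P y 0"
   then obtain f where f: "pk W f" "dg f = 0" "t * poly f y = 1" unfolding P_def by auto
   obtain a where a: "f = [:a:]" using f(2) by (rule degree_eq_zeroE)
   have "a \<in> W" using f(1) a unfolding pk_def by (metis coeff_pCons_0)
   moreover have "inverse t = a" using f(3) a t(2) by (simp add: field_simps)
   ultimately show False using W(3) by simp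
  qed
  have red: "P y (n - 1)" if pp: "P y n" "P (inverse y) m" "m \<le> n" "y ~= 0" for y n m
  proof -
   have "n > 0" using pp(1) P0 by (cases n) auto
   obtain f where f: "pk W f" "dg f \<le> n" "t * poly f y = 1" using pp(1) unfolding P_def by blast
   obtain g where g: "pk W g" "dg g \<le> m" "t * poly g (inverse y) = 1" using pp(2) unfolding P_def by blast
   have "cf g 0 \<in> W" using g(1) by (simp add: pk_def)
   from chevalley_reduce[OF W(1) tW unit[OF this] pp(4) \<open>n > 0\<close> f g(1) order_trans[OF g(2) pp(3)] g(3)]
   show ?thesis unfolding P_def .
  qed
  define a where "a = (LEAST n. P x n)"
  define b where "b = (LEAST n. P (inverse x) n)"
  have a: "P x a" and amin: "\<And>n. P x n ==> a \<le> n" unfolding a_def using ex n by (metis LeastI_ex, metis Least_le)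
  have b: "P (inverse x) b" and bmin: "\<And>n. P (inverse x) n ==> b \<le> n"
   unfolding b_def using ex n by (metis LeastI_ex, metis Least_le)
  have "a > 0" "b > 0" using a b P0 by (metis gr0I)+
  moreover have "a - 1 \<ge> a" if "b \<le> a" using red[OF a b that x0] amin by blast
  moreover have "b - 1 \<ge> b" if "a \<le> b" using red[of "inverse x" b a] a b that x0 bmin by simp
  ultimately show False by linarith
 qed
 hence "prm W" using W t unfolding prm_def by blast
 thus thesis using that W by blast
qed


section \<open>Primes of subfields as traces of ambient primes\<close>

lemma trace_prime:
 assumes "prm W" "fld L" shows "W Int L \<in> primes_of L"
proof -
 have "rng (W Int L)" using prm_rng[OF assms(1)] assms(2) unfolding rng_def by (auto intro: fld_intros)
 moreover have "W Int L ~= L" using kk_not_sub_prm[OF assms(1)] fld_kk_sub[OF assms(2)] by blast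
 moreover have "ALL x:L. x \<in> W Int L \<or> inverse x \<in> W Int L"
  using assms(1) fld_inverse[OF assms(2)] unfolding prm_def by blast
 ultimately show ?thesis unfolding primes_of_def subring_Omega by blast
qed

text \<open>The residue fields are algebraic over finite fields. If x lies in the trace of W but not
  in V, then x is a unit of W and x^N - 1 lies in the maximal ideal of W for some N > 0. Then x^N -
  1 lies in V, as its inverse cannot lie in W, and x = x^N (1/x)^(N-1) lies in V.\<close>

lemma rank_one:
 assumes W: "prm W" and L: "fld L" and V: "rng V" "V <= W Int L" "ALL x:L. x \<in> V \<or> inverse x \<in> V"
 shows "V = W Int L"
proof
 show "W Int L <= V"
 proof
  fix x assume x: "x \<in> W Int L"
  show "x \<in> V"
  proof (rule ccontr)
   assume n: "x ~: V"
   hence iV: "inverse x \<in> V" using x V(3) by blast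
   have x0: "x ~= 0" using n rng_0[OF V(1)] by blast
   have "unt W x" using x iV V(2) x0 unfolding unt_def by blast
   then obtain N where N: "N > 0" "x ^ N - 1 \<in> mx W" by (rule unt_power_cong_1[OF W])
   have "x ^ N - 1 \<in> V"
   proof (rule ccontr)
    assume a: "x ^ N - 1 ~: V"
    have "x ^ N - 1 \<in> L" using x L by (intro fld_diff fld_power fld_1) auto
    hence "inverse (x ^ N - 1) \<in> W" using a V(2,3) by blast
    thus False using N(2) a rng_0[OF V(1)] by (auto simp: mx_iff)
   qed
   hence "x ^ N - 1 + 1 \<in> V" using rng_add[OF V(1) _ rng_1[OF V(1)]] by blast
   hence "x ^ N * inverse x ^ (N - 1) \<in> V" using rng_mult[OF V(1) _ rng_power[OF V(1) iV]] by simp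
   moreover have "x ^ N * inverse x ^ (N - 1) = x" using x0 N(1) by (cases N) (simp_all add: power_inverse)
   ultimately show False using n by simp
  qed
 qed
qed (rule V(2))

text \<open>Chevalley's theorem only yields a prime W containing V; equality with the trace is
  \<open>rank_one\<close>.\<close>

lemma prime_extends:
 assumes "fld L" "V \<in> primes_of L"
 obtains W where "prm W" "V = W Int L"
proof -
 have V: "rng V" "V \<subset> L" "ALL x:L. x \<in> V \<or> inverse x \<in> V"
  using assms(2) unfolding primes_of_def subring_Omega by blast+
 obtain y where y: "y \<in> L" "y ~: V" using V(2) by blast
 have t: "inverse y \<in> V" using y V(3) by blast
 have "y ~= 0" using y(2) rng_0[OF V(1)] by blast
 hence "inverse y ~= 0" "inverse (inverse y) ~: V" using y(2) by auto
 then obtain W where W: "prm W" "V <= W" using chevalley[OF V(1) t] by blast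
 thus thesis using rank_one[OF W(1) assms(1) V(1) _ V(3)] V(2) that by blast
qed

lemma primes_of_trace: "fld L ==> primes_of L = {W Int L | W. prm W}" using trace_prime prime_extends by blast

lemma trace_sub_eq:
 assumes "prm W" "prm W'" "fld L" "W' Int L <= W Int L" shows "W' Int L = W Int L"
 using trace_prime[OF assms(2,3)] assms(4) unfolding primes_of_def subring_Omega by (intro rank_one[OF assms(1,3)]) blast+

lemma max_ideal_trace:
 assumes "fld L" shows "max_ideal (W Int L) = mx W Int L" using fld_inverse[OF assms] unfolding max_ideal_def by blast

text \<open>Ramification index 1 as a divisibility: each nonzero element of the maximal ideal in L
  is divisible in W by such an element of F. Formulated with the ambient prime, the condition passes
  at once to subfields of L.\<close>

definition uram :: "'a::field set => 'a set => 'a set => bool"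
 where "uram F L W \<longleftrightarrow> (ALL x:L Int mx W. x ~= 0 --> (EX t:F Int mx W. t ~= 0 & x / t \<in> W))"

lemma unramified_at_iff:
 assumes "fld F" "fld L" "F <= L" "prm W" shows "unramified_at F (W Int L) \<longleftrightarrow> uram F L W"
proof -
 have r: "rng W" by (rule prm_rng[OF assms(4)])
 have e: "W Int L Int F = W Int F" using assms(3) by blast
 have sub: "{t * x | t x. t \<in> mx W Int F & x \<in> W Int L} <= mx W Int L"
  using mx_mult[OF r] fld_mult[OF assms(2)] assms(3) by blast
 have "unramified_at F (W Int L) \<longleftrightarrow> mx W Int L = {t * x | t x. t \<in> mx W Int F & x \<in> W Int L}"
  unfolding unramified_at_def e max_ideal_trace[OF assms(1)] max_ideal_trace[OF assms(2)] ..
 also have "\<dots> \<longleftrightarrow> mx W Int L <= {t * x | t x. t \<in> mx W Int F & x \<in> W Int L}" using sub by blast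
 also have "\<dots> \<longleftrightarrow> uram F L W"
 proof
  assume a: "mx W Int L <= {t * x | t x. t \<in> mx W Int F & x \<in> W Int L}"
  show "uram F L W" unfolding uram_def
  proof (intro ballI impI)
   fix x assume x: "x \<in> L Int mx W" "x ~= 0"
   then obtain t y where "x = t * y" "t \<in> mx W Int F" "y \<in> W" using a by blast
   thus "EX t:F Int mx W. t ~= 0 & x / t \<in> W" using x(2) by (intro bexI[of _ t]) auto
  qed
 next
  assume u: "uram F L W"
  show "mx W Int L <= {t * x | t x. t \<in> mx W Int F & x \<in> W Int L}"
  proof
   fix x assume x: "x \<in> mx W Int L"
   show "x \<in> {t * x | t x. t \<in> mx W Int F & x \<in> W Int L}"
   proof (cases "x = 0")
    case True
    have "x = 0 * 0 & 0 \<in> mx W Int F & 0 \<in> W Int L"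
     using True mx_0[OF r] rng_0[OF r] fld_0[OF assms(1)] fld_0[OF assms(2)] by simp
    thus ?thesis by blast
   next
    case False
    obtain t where t: "t \<in> F Int mx W" "t ~= 0" "x / t \<in> W" using u x False unfolding uram_def by blast
    have "x / t \<in> L" using x t(1) assms(3) by (intro fld_divide[OF assms(2)]) auto
    moreover have "x = t * (x / t)" using t(2) by simp
    ultimately show ?thesis using t by blast
   qed
  qed
 qed
 finally show ?thesis .
qed

lemma unramified_everywhere_iff:
 assumes "fld F" "fld L" "F <= L" shows "unramified_everywhere F L \<longleftrightarrow> (ALL W. prm W --> uram F L W)"
 unfolding unramified_everywhere_def primes_of_trace[OF assms(2)] using unramified_at_iff[OF assms] by blast

lemma uram_sub: "uram F L W ==> M <= L ==> uram F M W" unfolding uram_def by blast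

subsection \<open>Automorphisms and primes\<close>

text \<open>The conjugate of W under the inverse of \<open>sg\<close>, written as a
  preimage.\<close>

definition pull :: "('a => 'a) => 'a set => 'a set" where "pull sg W = {x. sg x \<in> W}"

lemma pull_iff: "x \<in> pull sg W \<longleftrightarrow> sg x \<in> W" unfolding pull_def by (rule mem_Collect_eq)

lemma pull_prm:
 assumes s: "sg \<in> aut F" and W: "prm W" shows "prm (pull sg W)"
proof -
 note r = prm_rng[OF W]
 have "rng (pull sg W)" unfolding rng_def
 proof (intro conjI ballI)
  show "1 \<in> pull sg W" unfolding pull_iff aut_1[OF s] by (rule rng_1[OF r])
  fix x assume x: "x \<in> pull sg W"
  show "- x \<in> pull sg W" unfolding pull_iff aut_minus[OF s] by (rule rng_minus[OF r x[unfolded pull_iff]])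
  fix y assume y: "y \<in> pull sg W"
  show "x + y \<in> pull sg W" unfolding pull_iff aut_add[OF s] by (rule rng_add[OF r x[unfolded pull_iff] y[unfolded pull_iff]])
  show "x * y \<in> pull sg W" unfolding pull_iff aut_mult[OF s] by (rule rng_mult[OF r x[unfolded pull_iff] y[unfolded pull_iff]])
 qed
 moreover obtain y where "y ~: W" using W unfolding prm_def by blast
 hence "ainv sg y ~: pull sg W" unfolding pull_iff aut_inv_apply(1)[OF s] .
 hence "pull sg W ~= UNIV" by blast
 moreover have "ALL x. x \<in> pull sg W \<or> inverse x \<in> pull sg W" using W unfolding pull_iff aut_inverse[OF s] prm_def by blast
 ultimately show ?thesis unfolding prm_def by blast
qed

lemma pull_mx: "sg \<in> aut F ==> x \<in> mx (pull sg W) \<longleftrightarrow> sg x \<in> mx W"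
 unfolding mx_iff pull_iff by (simp add: aut_inverse aut_eq_0)

lemma pull_pull: "pull ta (pull sg W) = pull (sg \<circ> ta) W" by (auto simp: pull_def)

lemma pull_id: "pull (%x. x) W = W" by (auto simp: pull_def)

lemma pull_fixed: "sg \<in> aut F ==> pull sg W Int F = W Int F" by (auto simp: pull_def aut_fixes)


subsection \<open>Approximation\<close>

text \<open>Distinct traces are incomparable by \<open>trace_sub_eq\<close>. With a in W but not in
  W' and b in W' but not in W, the quotient b/(a + b) is near 1 at W and near 0 at W'.\<close>

lemma approx_pair:
 assumes W: "prm W" "prm W'" and B: "fld B" and d: "W Int B ~= W' Int B"
 obtains z where "z \<in> B" "z - 1 \<in> mx W" "z \<in> mx W'"
proof -
 have "\<not> W Int B <= W' Int B" "\<not> W' Int B <= W Int B"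
  using trace_sub_eq[OF W(2,1) B] trace_sub_eq[OF W B] d by blast+
 then obtain a b where a: "a \<in> W" "a \<in> B" "a ~: W'" and b: "b \<in> W'" "b \<in> B" "b ~: W" by blast
 note r = prm_rng[OF W(1)] and r' = prm_rng[OF W(2)]
 have nz: "a ~= 0" "b ~= 0" using a(3) b(3) rng_0[OF r] rng_0[OF r'] by auto
 have ab: "a + b ~= 0" using rng_minus[OF r a(1)] b(3) by (metis add.inverse_unique)
 have 1: "a / b \<in> mx W" using mx_mult2[OF r a(1) prm_cases[OF W(1) b(3)]] by (simp add: divide_inverse)
 have 2: "b / a \<in> mx W'" using mx_mult2[OF r' b(1) prm_cases[OF W(2) a(3)]] by (simp add: divide_inverse)
 have "unt W (1 + a / b)" using unt_cong[OF W(1) unt_1[OF r], of "1 + a / b"] mx_minus[OF r 1] by simp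
 hence "(- (a / b)) * inverse (1 + a / b) \<in> mx W" using mx_mult[OF r mx_minus[OF r 1]] unfolding unt_def by blast
 moreover have "(- (a / b)) * inverse (1 + a / b) = b / (a + b) - 1" using nz ab by (simp add: field_simps)
 ultimately have m1: "b / (a + b) - 1 \<in> mx W" by metis
 have "unt W' (1 + b / a)" using unt_cong[OF W(2) unt_1[OF r'], of "1 + b / a"] mx_minus[OF r' 2] by simp
 hence "(b / a) * inverse (1 + b / a) \<in> mx W'" using mx_mult[OF r' 2] unfolding unt_def by blast
 moreover have "(b / a) * inverse (1 + b / a) = b / (a + b)" using nz ab by (simp add: field_simps)
 ultimately have m2: "b / (a + b) \<in> mx W'" by metis
 have "b / (a + b) \<in> B" using a b by (intro fld_divide[OF B] fld_add[OF B])
 thus thesis using that m1 m2 by blast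
qed

lemma common_order:
 fixes z :: "'q::{field,finite} om"
 assumes "finite \<V>" "\<And>V. V \<in> \<V> ==> prm V"
 obtains N where "N > 0" "ALL V:\<V>. unt V z --> z ^ N - 1 \<in> mx V"
proof -
 have "EX N>0. ALL V:\<V>. unt V z --> z ^ N - 1 \<in> mx V" using assms
 proof (induction \<V> rule: finite_induct)
  case (insert V \<V>)
  then obtain N where N: "N > 0" "ALL V:\<V>. unt V z --> z ^ N - 1 \<in> mx V" by auto
  obtain M where M: "M > 0" "unt V z --> z ^ M - 1 \<in> mx V"
  proof (cases "unt V z")
   case True
   thus ?thesis using unt_power_cong_1[of V z] insert.prems[of V] that by blast
  qed (use that[of 1] in auto)
  have pw: "z ^ (A * B) - 1 \<in> mx U" if "prm U" "unt U z" "z ^ A - 1 \<in> mx U" for U A B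
   using mx_power_diff[OF that(1) _ _ that(3), of B] that(2) rng_power[OF prm_rng[OF that(1)]] rng_1[OF prm_rng[OF that(1)]]
   unfolding unt_def by (simp add: power_mult)
  have "z ^ (N * M) - 1 \<in> mx U" if U: "U \<in> insert V \<V>" "unt U z" for U
  proof (cases "U = V")
   case True
   thus ?thesis using pw[of V M N] M(2) U insert.prems[of V] by (simp add: mult.commute)
  next
   case False
   thus ?thesis using pw[of U N M] N(2) U insert.prems[of U] by simp
  qed
  thus ?case using N(1) M(1) by (intro exI[of _ "N * M"]) auto
 qed auto
 thus thesis using that by blast
qed

text \<open>A suitable power w of the approximating element is near 0, near 1, or has a pole at each
  prime of the family. The expression w/(1 - w + w^2) keeps residues 0 and 1 and does not change
  when w is replaced by 1/w, so it is integral in all three cases.\<close>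

lemma approx_pair_integral:
 assumes W: "prm W" "prm W'" and B: "fld B" and d: "W Int B ~= W' Int B"
  and V: "finite \<V>" "\<And>V. V \<in> \<V> ==> prm V"
 obtains z where "z \<in> B" "z - 1 \<in> mx W" "z \<in> mx W'" "ALL V:\<V>. z \<in> V"
proof -
 obtain z where z: "z \<in> B" "z - 1 \<in> mx W" "z \<in> mx W'" by (rule approx_pair[OF W B d])
 obtain N where N: "N > 0" "ALL V:\<V>. unt V z --> z ^ N - 1 \<in> mx V" by (rule common_order[OF V])
 define w where "w = z ^ N"
 define u where "u = w / (1 - w + w ^ 2)"
 have uB: "u \<in> B" unfolding u_def w_def by (intro fld_divide[OF B] fld_add[OF B] fld_diff[OF B] fld_power[OF B] fld_1[OF B] z(1))
 have small: "u \<in> mx V" if "prm V" "w \<in> mx V" for V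
 proof -
  note r = prm_rng[OF that(1)]
  have "w * (1 - w) \<in> mx V" by (rule mx_mult[OF r that(2) rng_diff[OF r rng_1[OF r] mx_sub[OF that(2)]]])
  hence "1 - (1 - w + w ^ 2) \<in> mx V" by (simp add: algebra_simps power2_eq_square)
  hence "unt V (1 - w + w ^ 2)" using unt_cong[OF that(1) unt_1[OF r]] by blast
  thus ?thesis unfolding u_def divide_inverse using mx_mult[OF r that(2)] unfolding unt_def by blast
 qed
 have near1: "u - 1 \<in> mx V" if "prm V" "w - 1 \<in> mx V" for V
 proof -
  note r = prm_rng[OF that(1)]
  have wV: "w \<in> V" using rng_add[OF r mx_sub[OF that(2)] rng_1[OF r]] by simp
  have "- w * (w - 1) \<in> mx V" using mx_mult2[OF r rng_minus[OF r wV] that(2)] .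
  hence "1 - (1 - w + w ^ 2) \<in> mx V" by (simp add: algebra_simps power2_eq_square)
  hence n: "unt V (1 - w + w ^ 2)" using unt_cong[OF that(1) unt_1[OF r]] by blast
  have "- (w - 1) * (w - 1) \<in> mx V" using mx_mult[OF r mx_minus[OF r that(2)] mx_sub[OF that(2)]] .
  hence "(- (w - 1) * (w - 1)) * inverse (1 - w + w ^ 2) \<in> mx V" using mx_mult[OF r] n unfolding unt_def by blast
  moreover have "u - 1 = (- (w - 1) * (w - 1)) * inverse (1 - w + w ^ 2)"
   using n unfolding u_def unt_def by (simp add: field_simps power2_eq_square)
  ultimately show ?thesis by metis
 qed
 have "w - 1 \<in> mx W"
 proof -
  note r = prm_rng[OF W(1)]
  have "z \<in> W" using rng_add[OF r mx_sub[OF z(2)] rng_1[OF r]] by simp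
  thus ?thesis using mx_power_diff[OF W(1) _ rng_1[OF r] z(2), of N] by (simp add: w_def)
 qed
 hence 1: "u - 1 \<in> mx W" by (rule near1[OF W(1)])
 have 2: "u \<in> mx W'" unfolding w_def using z(3) N(1) by (intro small W(2)) (simp add: w_def mx_power[OF prm_rng[OF W(2)]])
 have 3: "u \<in> V" if v: "V \<in> \<V>" for V
 proof -
  have pV: "prm V" by (rule V(2)[OF v])
  note r = prm_rng[OF pV]
  consider "z \<in> mx V" | "unt V z" | "z ~: V" unfolding unt_iff by blast
  thus ?thesis
  proof cases
   case 1
   thus ?thesis using small[OF pV] mx_power[OF r _ N(1)] mx_sub unfolding w_def by blast
  next
   case 2
   have "u - 1 \<in> mx V" by (rule near1[OF pV]) (use N(2) v 2 in "simp add: w_def")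
   from rng_add[OF r mx_sub[OF this] rng_1[OF r]] show ?thesis by simp
  next
   case 3
   define i where "i = inverse w"
   have i: "i \<in> mx V" unfolding i_def w_def power_inverse[symmetric] by (rule mx_power[OF r prm_cases[OF pV 3] N(1)])
   have z0: "w ~= 0" using 3 rng_0[OF r] N(1) unfolding w_def by auto
   have "i * (1 - i) \<in> mx V" by (rule mx_mult[OF r i rng_diff[OF r rng_1[OF r] mx_sub[OF i]]])
   hence "1 - (1 - i + i ^ 2) \<in> mx V" by (simp add: algebra_simps power2_eq_square)
   hence n: "unt V (1 - i + i ^ 2)" using unt_cong[OF pV unt_1[OF r]] by blast
   have "inverse (1 - i + i ^ 2) \<in> V" using n unfolding unt_def by blast
   hence "i * inverse (1 - i + i ^ 2) \<in> V" by (rule rng_mult[OF r mx_sub[OF i]])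
   moreover have "u = i * inverse (1 - i + i ^ 2)"
   proof -
    have "i * (i * (w * w)) = 1" "i * w = 1" unfolding i_def using z0 by (simp_all add: field_simps)
    hence "1 - i + i ^ 2 = (1 - w + w ^ 2) * i ^ 2" by (simp add: algebra_simps power2_eq_square)
    moreover have "inverse i = w" unfolding i_def by simp
    ultimately have "i * inverse (1 - i + i ^ 2) = (i * w) * w * inverse (1 - w + w ^ 2)" by (simp add: power2_eq_square)
    thus ?thesis unfolding u_def i_def using z0 by (simp add: divide_inverse)
   qed
   ultimately show ?thesis by simp
  qed
 qed
 show thesis by (rule that[OF uB 1 2]) (intro ballI 3)
qed

lemma approx:
 assumes W: "prm W" and B: "fld B" and "finite \<W>" "finite \<V>" and "\<And>V. V \<in> \<V> ==> prm V"
  and "\<And>W'. W' \<in> \<W> ==> prm W' & W Int B ~= W' Int B" and "\<W> <= \<V>"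
 obtains z where "z \<in> B" "z - 1 \<in> mx W" "ALL W':\<W>. z \<in> mx W'" "ALL V:\<V>. z \<in> V"
proof -
 have "EX z:B. z - 1 \<in> mx W & (ALL W':\<W>. z \<in> mx W') & (ALL V:\<V>. z \<in> V)"
  using assms(3,6,7)
 proof (induction \<W> rule: finite_induct)
  case empty
  show ?case using fld_1[OF B] mx_0[OF prm_rng[OF W]] rng_1[OF prm_rng[OF assms(5)]] by (intro bexI[of _ 1]) auto
 next
  case (insert W' \<W>)
  then obtain z where z: "z \<in> B" "z - 1 \<in> mx W" "ALL W':\<W>. z \<in> mx W'" "ALL V:\<V>. z \<in> V" by auto
  have W': "prm W'" "W Int B ~= W' Int B" using insert.prems(1)[of W'] by auto
  obtain y where y: "y \<in> B" "y - 1 \<in> mx W" "y \<in> mx W'" "ALL V:\<V>. y \<in> V"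
   by (rule approx_pair_integral[OF W W'(1) B W'(2) assms(4,5)])
  note r = prm_rng[OF W]
  have zW: "z \<in> W" using rng_add[OF r mx_sub[OF z(2)] rng_1[OF r]] by simp
  have "z * (y - 1) + (z - 1) \<in> mx W" by (intro mx_add[OF W] mx_mult2[OF r zW] y z)
  hence "z * y - 1 \<in> mx W" by (simp add: algebra_simps)
  moreover have "z * y \<in> B" using z y B fld_mult by blast
  moreover have "z * y \<in> V" if "V \<in> \<V>" for V using z(4) y(4) that rng_mult[OF prm_rng[OF assms(5)]] by blast
  moreover have "z * y \<in> mx U" if "U \<in> insert W' \<W>" for U
  proof -
   have "prm U" "U \<in> \<V>" using insert.prems that by auto
   thus ?thesis using that z(3,4) y(3,4) mx_mult[OF prm_rng, of U z y] mx_mult2[OF prm_rng, of U z y] by auto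
  qed
  ultimately show ?case by blast
 qed
 thus thesis using that by blast
qed

lemma power_dominates:
 fixes z c :: "'q::{field,finite} om"
 assumes "prm V" "z \<in> mx V" "z ~= 0" shows "EX n. ALL m>=n. c * z ^ m \<in> mx V"
proof (cases "c = 0")
 case True
 thus ?thesis using mx_0[OF prm_rng[OF assms(1)]] by simp
next
 case False
 have vz: "val V z > 0" by (rule val_pos[OF assms])
 obtain n :: nat where n: "of_nat n > - val V c / val V z" using reals_Archimedean2[of "- val V c / val V z"] by blast
 have "c * z ^ m \<in> mx V" if "m \<ge> n" for m
 proof -
  have "of_nat m > - val V c / val V z" using n that by (meson less_le_trans of_nat_mono)
  hence "val V c + of_nat m * val V z > 0" using vz by (simp add: field_simps)
  moreover have "val V (c * z ^ m) = val V c + of_nat m * val V z"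
   using val_mult[OF assms(1) False, of "z ^ m"] val_power[OF assms(1,3)] assms(3) by simp
  ultimately show ?thesis using val_pos_iff[OF assms(1), of "c * z ^ m"] False assms(3) by simp
 qed
 thus ?thesis by blast
qed

lemma power_dominates_all:
 fixes z c :: "'q::{field,finite} om"
 assumes "finite \<W>" "\<And>V. V \<in> \<W> ==> prm V & z \<in> mx V" "z ~= 0"
 shows "EX n. ALL V:\<W>. c * z ^ n \<in> mx V"
proof -
 have "EX n. ALL m>=n. ALL V:\<W>. c * z ^ m \<in> mx V" using assms(1,2)
 proof (induction \<W> rule: finite_induct)
  case (insert V \<W>)
  then obtain a where a: "ALL m>=a. ALL V:\<W>. c * z ^ m \<in> mx V" by auto
  obtain b where b: "ALL m>=b. c * z ^ m \<in> mx V" using power_dominates[of V z c] insert.prems[of V] assms(3) by auto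
  show ?case by (rule exI[of _ "max a b"]) (use a b in auto)
 qed auto
 thus ?thesis by blast
qed

lemma approx_value:
 assumes W: "prm W" and B: "fld B" and fin: "finite \<W>"
  and c: "c \<in> W Int B" and d: "\<And>W'. W' \<in> \<W> ==> prm W' & W Int B ~= W' Int B"
 obtains c' where "c' \<in> B" "c' - c \<in> mx W" "ALL W':\<W>. c' \<in> mx W'"
proof -
 note r = prm_rng[OF W]
 obtain z where z: "z \<in> B" "z - 1 \<in> mx W" "ALL W':\<W>. z \<in> mx W'"
  by (rule approx[OF W B fin fin _ d order_refl]) (use d in auto)
 have z0: "z ~= 0" using z(2) mx_minus[OF r, of "-1"] mx_1[OF r] by auto
 obtain n where n: "ALL V:\<W>. c * z ^ n \<in> mx V" using power_dominates_all[OF fin _ z0] d z(3) by blast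
 have zW: "z \<in> W" using rng_add[OF r mx_sub[OF z(2)] rng_1[OF r]] by simp
 have "z ^ n - 1 \<in> mx W" using mx_power_diff[OF W zW rng_1[OF r] z(2), of n] by simp
 hence "c * (z ^ n - 1) \<in> mx W" using c mx_mult2[OF r] by blast
 hence "c * z ^ n - c \<in> mx W" by (simp add: algebra_simps)
 moreover have "c * z ^ n \<in> B" using c z(1) by (intro fld_mult[OF B] fld_power[OF B]) auto
 ultimately show thesis using that n by blast
qed


subsection \<open>Primes in abelian extensions\<close>

lemma coeff_prod_linear_rng:
 fixes V :: "'a::field set"
 assumes "rng V" "finite R" "\<And>r. r \<in> R ==> f r \<in> V" shows "cf (\<Prod>r\<in>R. [:- f r, 1:]) i \<in> V" using assms(2,3)
proof (induction R arbitrary: i rule: finite_induct)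
 case empty
 thus ?case using rng_0[of V] rng_1[of V] assms(1) by simp
next
 case (insert r R)
 let ?P = "\<Prod>r\<in>R. [:- f r, 1:]"
 have r: "- f r \<in> V" using insert.prems rng_minus[OF assms(1)] by blast
 have c: "cf ?P j \<in> V" for j using insert.IH insert.prems by blast
 have "(case i of 0 => 0 | Suc j => cf ?P j) \<in> V" using c rng_0[OF assms(1)] by (simp split: nat.splits)
 from rng_add[OF assms(1) rng_mult[OF assms(1) r c[of i]] this]
 show ?case using insert.hyps by (simp add: coeff_pCons split: nat.splits)
qed

lemma orbit_image:
 assumes "H <= aut F" "subgrp H" "h \<in> H" shows "h ` (%g. g z) ` H <= (%g. g z) ` H"
proof
 fix y assume "y \<in> h ` (%g. g z) ` H"
 then obtain g where g: "g \<in> H" "y = (h \<circ> g) z" by auto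
 have "h \<circ> g \<in> H" using assms(2,3) g(1) unfolding subgrp_def by blast
 thus "y \<in> (%g. g z) ` H" using g(2) by blast
qed

lemma orbit_props:
 assumes "fld F" "H <= aut F" "subgrp H" "fld B" "ALL h:H. h ` B <= B" "z \<in> B"
 shows "finite ((%g. g z) ` H)" "(%g. g z) ` H <= B" "z \<in> (%g. g z) ` H"
  "pk (Fix H B) (rootpoly ((%g. g z) ` H))"
proof -
 show 1: "finite ((%g. g z) ` H)"
  by (rule finite_subset[OF _ finite_orb[OF assms(1), of z]]) (use assms(2) in "auto simp: orb_def")
 show 2: "(%g. g z) ` H <= B" using assms(5,6) by blast
 show "z \<in> (%g. g z) ` H" using assms(3) unfolding subgrp_def by (intro image_eqI[of _ _ "%x. x"]) auto
 show "pk (Fix H B) (rootpoly ((%g. g z) ` H))" using assms(2) aut_fld[OF assms(1)]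
  by (intro rootpoly_Fix 1 2 assms(4) orbit_image[OF assms(2,3)]) blast
qed

lemma fld_Fix': "fld F ==> fld B ==> H <= aut F ==> fld (Fix H B)" using fld_Fix aut_fld by blast

lemma representatives:
 assumes "fld F" "fingen F B" "H <= aut F"
 obtains R where "finite R" "R <= H" "ALL h:H. EX r:R. ALL x:B. h x = r x"
proof -
 have "finite ((%h. restrict h B) ` H)"
  by (rule finite_subset[OF _ finite_restr[OF assms(1,2)]]) (use assms(3) in "auto simp: restr_def")
 from finite_subset_image[OF this order_refl] obtain R where
  R: "finite R" "R <= H" "(%h. restrict h B) ` H = (%h. restrict h B) ` R" by metis
 have "EX r:R. ALL x:B. h x = r x" if "h \<in> H" for h
 proof -
  have "restrict h B \<in> (%h. restrict h B) ` R" using that R(3) by blast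
  then obtain r where "r \<in> R" "restrict h B = restrict r B" by auto
  thus ?thesis unfolding restrict_eq_iff by blast
 qed
 thus thesis using that R by blast
qed

text \<open>Otherwise approximation gives z near 1 at W, in the maximal ideal at all conjugates of
  W', and integral at all conjugates of W. The product of 1 - y over the H-orbit of z lies in the
  fixed field, is a unit at W', and is a nonunit at W, although both primes have the same trace
  there.\<close>

theorem primes_conjugate:
 assumes F: "fld F" and B: "fld B" "fingen F B" and H: "H <= aut F" "subgrp H" "ALL h:H. h ` B <= B"
  and W: "prm W" "prm W'" and agree: "W Int Fix H B = W' Int Fix H B"
 obtains h where "h \<in> H" "W Int B = pull h W' Int B"
proof (rule ccontr)
 assume "\<not> thesis"
 hence no: "ALL h:H. W Int B ~= pull h W' Int B" using that by blast
 obtain R where R: "finite R" "R <= H" "ALL h:H. EX r:R. ALL x:B. h x = r x"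
  by (rule representatives[OF F B(2) H(1)])
 note r = prm_rng[OF W(1)] and r' = prm_rng[OF W(2)]
 define \<W> where "\<W> = (%h. pull h W') ` R"
 define \<V> where "\<V> = \<W> Un (%h. pull h W) ` R"
 have pv: "prm V" if "V \<in> \<V>" for V using that R(2) H(1) pull_prm[OF _ W(1)] pull_prm[OF _ W(2)] unfolding \<V>_def \<W>_def by blast
 have dv: "prm V & W Int B ~= V Int B" if "V \<in> \<W>" for V
  using pv[of V] that R(2) no unfolding \<V>_def \<W>_def by blast
 obtain z where z: "z \<in> B" "z - 1 \<in> mx W" "ALL V:\<W>. z \<in> mx V" "ALL V:\<V>. z \<in> V"
  by (rule approx[OF W(1) B(1) _ _ pv dv, where \<V> = \<V> and \<W> = \<W>]) (use R(1) in "auto simp: \<V>_def \<W>_def")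
 let ?O = "(%g. g z) ` H"
 note O = orbit_props[OF F H(1,2) B(1) H(3) z(1)]
 have h1: "h z \<in> mx W' & h z \<in> W" if h: "h \<in> H" for h
 proof -
  obtain g where g: "g \<in> R" "ALL x:B. h x = g x" using R(3) h by blast
  have "z \<in> mx (pull g W')" "z \<in> pull g W" using z(3,4) g(1) unfolding \<V>_def \<W>_def by auto
  moreover have "g \<in> aut F" using g(1) R(2) H(1) by blast
  ultimately show ?thesis using g(2) z(1) pull_mx pull_iff by metis
 qed
 define n where "n = poly (rootpoly ?O) 1"
 have n: "n = (\<Prod>y\<in>?O. 1 - y)" unfolding n_def by (simp add: poly_prod)
 have nF: "n \<in> Fix H B" unfolding n_def by (rule fld_poly[OF fld_Fix'[OF F B(1) H(1)] O(4) fld_1[OF fld_Fix'[OF F B(1) H(1)]]])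
 have "unt W' (1 - y)" if y: "y \<in> ?O" for y
 proof -
  have "y \<in> mx W'" using h1 y by blast
  thus ?thesis using unt_cong[OF W(2) unt_1[OF r'], of "1 - y"] by simp
 qed
 hence "unt W' n" unfolding n by (rule unt_prod[OF r'])
 hence nz: "n ~= 0" "inverse n \<in> W'" unfolding unt_def by auto
 have "inverse n \<in> Fix H B" by (rule fld_inverse[OF fld_Fix'[OF F B(1) H(1)] nF])
 hence iW: "inverse n \<in> W" using nz agree by blast
 have "n = (1 - z) * (\<Prod>y\<in>?O - {z}. 1 - y)" unfolding n by (rule prod.remove[OF O(1,3)])
 moreover have "1 - z \<in> mx W" using mx_minus[OF r z(2)] by simp
 moreover have "(\<Prod>y\<in>?O - {z}. 1 - y) \<in> W" by (rule rng_prod[OF r], rule rng_diff[OF r rng_1[OF r]]) (use h1 in blast)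
 ultimately have "n \<in> mx W" using mx_mult[OF r] by metis
 thus False using iW nz unfolding mx_iff by blast
qed

definition inert :: "'a::field set => 'a set => ('a => 'a) => bool"
 where "inert W L sg \<longleftrightarrow> (ALL x:W Int L. sg x - x \<in> mx W)"

definition decomp :: "'a::field set => 'a set => ('a => 'a) => bool"
 where "decomp W L sg \<longleftrightarrow> W Int L = pull sg W Int L"

lemma decompI:
 assumes "prm W" "fld L" "sg \<in> aut F" "\<And>x. x \<in> W ==> x \<in> L ==> sg x \<in> W" shows "decomp W L sg"
 unfolding decomp_def using trace_sub_eq[OF pull_prm[OF assms(3,1)] assms(1,2)] assms(4) unfolding pull_def by blast

lemma decompD: "decomp W L sg ==> x \<in> L ==> sg x \<in> W \<longleftrightarrow> x \<in> W" unfolding decomp_def pull_def by blast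

lemma decomp_mx:
 assumes "decomp W L sg" "fld L" "sg \<in> aut F" "x \<in> L" shows "sg x \<in> mx W \<longleftrightarrow> x \<in> mx W"
proof -
 have "inverse x \<in> L" by (rule fld_inverse[OF assms(2,4)])
 hence "inverse (sg x) \<in> W \<longleftrightarrow> inverse x \<in> W"
  using decompD[OF assms(1), of "inverse x"] aut_inverse[OF assms(3), of x] by simp
 thus ?thesis using decompD[OF assms(1,4)] aut_eq_0[OF assms(3), of x] unfolding mx_iff by simp
qed

lemma decomp_mono: "decomp W L sg ==> M <= L ==> decomp W M sg" unfolding decomp_def by blast

lemma inert_mono: "inert W L sg ==> M <= L ==> inert W M sg" unfolding inert_def by blast

lemma inert_decomp:
 assumes "inert W L sg" "prm W" "fld L" "sg \<in> aut F" shows "decomp W L sg"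
proof (rule decompI[OF assms(2-4)])
 fix x assume x: "x \<in> W" "x \<in> L"
 have "sg x - x \<in> W" using assms(1) x mx_sub unfolding inert_def by blast
 from rng_add[OF prm_rng[OF assms(2)] this x(1)] show "sg x \<in> W" by simp
qed

lemma inert_id: "rng W ==> inert W L (%x. x)" unfolding inert_def using mx_0[of W] by simp

lemma decomp_id: "decomp W L (%x. x)" unfolding decomp_def pull_def by simp

lemma inert_comp:
 assumes "inert W L sg" "inert W L ta" "prm W" "fld L" "ta \<in> aut F" "ta ` L <= L" shows "inert W L (sg \<circ> ta)"
 unfolding inert_def
proof
 fix x assume x: "x \<in> W Int L"
 have "ta x \<in> W" using decompD[OF inert_decomp[OF assms(2-5)]] x by blast
 moreover have "ta x \<in> L" using x assms(6) by blast
 ultimately have "(sg (ta x) - ta x) + (ta x - x) \<in> mx W" using assms(1,2) x unfolding inert_def by (intro mx_add[OF assms(3)]) auto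
 thus "(sg \<circ> ta) x - x \<in> mx W" by simp
qed

lemma decomp_comp:
 assumes "decomp W L sg" "decomp W L ta" "ta ` L <= L" shows "decomp W L (sg \<circ> ta)"
proof -
 have "sg (ta x) \<in> W \<longleftrightarrow> x \<in> W" if "x \<in> L" for x
  using decompD[OF assms(1)] decompD[OF assms(2) that] assms(3) that by blast
 thus ?thesis unfolding decomp_def pull_def by auto
qed

lemma decomp_cong: "decomp W L sg ==> ALL x:L. sg x = ta x ==> decomp W L ta" unfolding decomp_def pull_def by auto


section \<open>Decomposition groups, discreteness of values and trivial inertia\<close>

lemma subgrp_aut: "subgrp (aut F)" unfolding subgrp_def using aut_id(2) aut_comp by blast

lemma Fix_aut: "ab F L ==> Fix (aut F) L = F" unfolding Fix_def using ab_basic(3,4)[of F L] aut_fixes unfolding fixd_def by blast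

lemma ab_stable: "ab F L ==> ALL h:aut F. h ` L <= L" unfolding ab_def by blast

lemma ab_ainv: "ab F L ==> sg \<in> aut F ==> x \<in> L ==> ainv sg x \<in> L" using ab_normal[OF _ aut_inv] .

text \<open>The primes above form one Galois orbit with the decomposition group as stabilizer, so
  their number is the degree exactly when the stabilizer is trivial.\<close>

theorem decomposed_iff:
 assumes ab: "ab F M" and fin: "fingen F M" and W: "prm W"
 shows "card (primes_above F (W Int F) M) = ext_degree F M \<longleftrightarrow>
  (ALL sg:aut F. decomp W M sg --> (ALL x:M. sg x = x))" (is "?L \<longleftrightarrow> ?R")
proof -
 note F = ab_basic(1)[OF ab] and M = ab_basic(2)[OF ab] and FM = ab_basic(3)[OF ab]
 define ph where "ph f = {x\<in>M. f x \<in> W}" for f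
 have ph: "ph (restrict g M) = pull g W Int M" for g unfolding ph_def pull_def by auto
 have "primes_above F (W Int F) M = ph ` restr F M"
 proof
  show "ph ` restr F M <= primes_above F (W Int F) M"
  proof
   fix V assume "V \<in> ph ` restr F M"
   then obtain g where g: "g \<in> aut F" "V = pull g W Int M" unfolding restr_def using ph by auto
   have "V Int F = W Int F" using pull_fixed[OF g(1), of W] g(2) FM by blast
   thus "V \<in> primes_above F (W Int F) M" unfolding primes_above_def using trace_prime[OF pull_prm[OF g(1) W] M] g(2) by blast
  qed
  show "primes_above F (W Int F) M <= ph ` restr F M"
  proof
   fix V assume "V \<in> primes_above F (W Int F) M"
   hence V: "V \<in> primes_of M" "V Int F = W Int F" unfolding primes_above_def by auto
   obtain W' where W': "prm W'" "V = W' Int M" by (rule prime_extends[OF M V(1)])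
   have "W' Int Fix (aut F) M = W Int Fix (aut F) M" unfolding Fix_aut[OF ab] using V(2) W'(2) FM by blast
   then obtain h where "h \<in> aut F" "W' Int M = pull h W Int M"
    by (rule primes_conjugate[OF F M fin order_refl subgrp_aut ab_stable[OF ab] W'(1) W])
   thus "V \<in> ph ` restr F M" using ph[of h] W'(2) unfolding restr_def by blast
  qed
 qed
 moreover have "card (ph ` restr F M) = card (restr F M) \<longleftrightarrow> inj_on ph (restr F M)"
  using finite_restr[OF F fin] card_image eq_card_imp_inj_on by blast
 moreover have "inj_on ph (restr F M) \<longleftrightarrow> ?R"
 proof
  assume i: "inj_on ph (restr F M)"
  show ?R
  proof (intro ballI impI)
   fix sg x assume s: "sg \<in> aut F" "decomp W M sg" and x: "x \<in> M"
   have "ph (restrict sg M) = ph (restrict (%x. x) M)" using s(2) unfolding ph pull_id decomp_def by simp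
   hence "restrict sg M = restrict (%x. x) M" by (rule inj_onD[OF i]) (use s(1) aut_id(2) in "auto simp: restr_def")
   thus "sg x = x" using x unfolding restrict_eq_iff by blast
  qed
 next
  assume R: ?R
  show "inj_on ph (restr F M)"
  proof (rule inj_onI)
   fix f f' assume "f \<in> restr F M" "f' \<in> restr F M" and e: "ph f = ph f'"
   then obtain g h where g: "g \<in> aut F" "f = restrict g M" and h: "h \<in> aut F" "f' = restrict h M" unfolding restr_def by blast
   define sg where "sg = g \<circ> ainv h"
   have s: "sg \<in> aut F" unfolding sg_def by (rule aut_comp[OF g(1) aut_inv[OF h(1)]])
   have gh: "g y \<in> W \<longleftrightarrow> h y \<in> W" if "y \<in> M" for y using e that unfolding g(2) h(2) ph pull_def by blast
   have "decomp W M sg" unfolding decomp_def pull_def sg_def using gh[OF ab_ainv[OF ab h(1)]] aut_inv_apply(1)[OF h(1)] by auto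
   hence fx: "sg x = x" if "x \<in> M" for x using R s that by blast
   have "g y = h y" if "y \<in> M" for y using fx[OF ab_normal[OF ab h(1) that]] aut_inv_apply(2)[OF h(1)] unfolding sg_def by simp
   thus "f = f'" unfolding g(2) h(2) restrict_eq_iff by blast
  qed
 qed
 ultimately show ?thesis using galois_degree(2)[OF ab fin] by metis
qed

text \<open>A decomposition element of M lifts to one of B: W and its conjugate agree on M, so
  \<open>primes_conjugate\<close> over M supplies a correction that fixes M.\<close>

lemma decomp_sub:
 assumes ab: "ab F B" "fingen F B" and M: "fld M" "F <= M" "M <= B" and W: "prm W"
  and dB: "ALL sg:aut F. decomp W B sg --> (ALL x:M. sg x = x)" and s: "sg \<in> aut F" "decomp W M sg" and x: "x \<in> M"
 shows "sg x = x"
proof -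
 note F = ab_basic(1)[OF ab(1)] and B = ab_basic(2)[OF ab(1)]
 have abM: "ab M B" by (rule ab_sub(2)[OF ab(1) M])
 have sub: "aut M <= aut F" using aut_mono[OF M(2)] by blast
 have "W Int Fix (aut M) B = pull sg W Int Fix (aut M) B" unfolding Fix_aut[OF abM] using s(2) unfolding decomp_def .
 then obtain h where h: "h \<in> aut M" "W Int B = pull h (pull sg W) Int B"
  by (rule primes_conjugate[OF F B ab(2) sub subgrp_aut ab_stable[OF abM] W pull_prm[OF s(1) W]])
 have "decomp W B (sg \<circ> h)" using h(2) unfolding decomp_def pull_pull .
 moreover have "sg \<circ> h \<in> aut F" using aut_comp[OF s(1)] h(1) sub by blast
 ultimately have "(sg \<circ> h) x = x" using dB x by blast
 thus ?thesis using aut_fixes[OF h(1) x] by simp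
qed

text \<open>The orbit polynomial of t over \<open>k\<close> has degree at most [F:k], so
  \<open>val_discrete\<close> gives the uniform bound 1/[F:k].\<close>

lemma value_gap:
 assumes ab: "ab kk F" "fingen kk F" and W: "prm W"
 obtains e where "e > 0" "ALL t:F Int mx W. t ~= 0 --> val W t \<ge> e"
proof -
 define D where "D = card (restr kk F)"
 have fr: "finite (restr kk F)" by (rule finite_restr[OF fld_kk ab(2)])
 have "restrict (%x. x) F \<in> restr kk F" using aut_id(2) unfolding restr_def by blast
 hence D: "D > 0" unfolding D_def using fr by (auto simp: card_gt_0_iff)
 have "val W t \<ge> 1 / of_nat D" if t: "t \<in> F" "t \<in> mx W" "t ~= 0" for t
 proof -
  let ?O = "(%g. g t) ` aut kk"
  note O = orbit_props[OF fld_kk order_refl subgrp_aut ab_basic(2)[OF ab(1)] ab_stable[OF ab(1)] t(1)]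
  have "?O = (%f. f t) ` restr kk F" unfolding restr_def image_image using t(1) by simp
  hence c: "card ?O \<le> D" unfolding D_def using card_image_le[OF fr] by simp
  have c0: "card ?O > 0" using O(1,3) by (auto simp: card_gt_0_iff)
  have "val W t \<ge> 1 / of_nat (dg (rootpoly ?O))" by (rule val_discrete[OF W t(2,3) _ rootpoly_nonzero])
    (use O(4) Fix_aut[OF ab(1)] poly_rootpoly[OF O(1)] O(3) in auto)
  moreover have "1 / (of_nat D :: rat) \<le> 1 / of_nat (card ?O)" using c c0 by (intro divide_left_mono) auto
  ultimately show ?thesis unfolding degree_rootpoly[OF O(1)] by linarith
 qed
 moreover have "1 / (of_nat D :: rat) > 0" using D by simp
 ultimately show thesis using that by blast
qed

text \<open>Put delta(x) = sg x - x. For integral x choose a power P of the characteristic such that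
  y = x - x^P lies in the maximal ideal. Then delta(y) = delta(x)(1 - delta(x)^(P-1)) has the same
  value as delta(x). Unramifiedness gives y = t z with t in F of value at least e and z integral, so
  delta(y) = t delta(z). By iteration the value of a nonzero delta(x) exceeds every multiple of e,
  so delta vanishes.\<close>

theorem uram_inert_trivial:
 fixes W :: "'q::{field,finite} om set"
 assumes L: "fld L" "F <= L" and W: "prm W" and u: "uram F L W"
  and e: "e > 0" "ALL t:F Int mx W. t ~= 0 --> val W t \<ge> e"
  and s: "sg \<in> aut F" "sg ` L <= L" "inert W L sg" and x: "x \<in> L" shows "sg x = x"
proof -
 note r = prm_rng[OF W]
 define de where "de x = sg x - x" for x
 have dm: "de x \<in> mx W" if "x \<in> W" "x \<in> L" for x using s(3) that unfolding inert_def de_def by blast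
 have big: "ALL x:W Int L. de x ~= 0 --> val W (de x) \<ge> of_nat n * e" for n
 proof (induction n)
  case 0
  show ?case using val_pos[OF W dm] by (auto intro: less_imp_le)
 next
  case (Suc n)
  show ?case
  proof (intro ballI impI)
   fix x assume x: "x \<in> W Int L" and nz: "de x ~= 0"
   obtain m where m: "m > 0" "x - x ^ (CHAR('q om) ^ m) \<in> mx W" using frobenius_cong[OF W] x by blast
   define P where "P = CHAR('q om) ^ m"
   have P: "P > 1" unfolding P_def by (rule one_less_power[OF charp_gt_1 m(1)])
   define y where "y = x - x ^ P"
   have yL: "y \<in> L" unfolding y_def using x by (intro fld_diff[OF L(1)] fld_power[OF L(1)]) auto
   have "de y = de x - de x ^ P" unfolding de_def y_def aut_diff[OF s(1)] aut_power[OF s(1)] P_def charp_diff by simp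
   also have "\<dots> = de x * (1 - de x ^ (P - 1))" using P by (simp add: algebra_simps flip: power_Suc)
   finally have dy: "de y = de x * (1 - de x ^ (P - 1))" .
   have "de x ^ (P - 1) \<in> mx W" by (rule mx_power[OF r]) (use dm x P in auto)
   hence un: "unt W (1 - de x ^ (P - 1))" using unt_cong[OF W unt_1[OF r], of "1 - de x ^ (P - 1)"] by simp
   hence dy0: "de y ~= 0" using dy nz unfolding unt_def by simp
   hence "y ~= 0" using aut_0[OF s(1)] unfolding de_def by auto
   then obtain t where t: "t \<in> F" "t \<in> mx W" "t ~= 0" "y / t \<in> W" using u yL m(2) unfolding uram_def y_def P_def by blast
   define z where "z = y / t"
   have zL: "z \<in> L" unfolding z_def using yL t(1) L by (intro fld_divide[OF L(1)]) auto
   have yz: "y = t * z" unfolding z_def using t(3) by simp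
   have dz: "de y = t * de z" unfolding de_def yz aut_mult[OF s(1)] aut_fixes[OF s(1) t(1)] by (simp add: algebra_simps)
   have z0: "de z ~= 0" using dz dy0 by auto
   have u0: "1 - de x ^ (P - 1) ~= 0" using un unfolding unt_def by blast
   have "val W (de x) = val W (de y)" unfolding dy val_mult[OF W nz u0] val_unt[OF W un] by simp
   also have "\<dots> = val W t + val W (de z)" unfolding dz by (rule val_mult[OF W t(3) z0])
   also have "\<dots> \<ge> e + of_nat n * e" using Suc.IH zL t z0 e(2) unfolding z_def by (intro add_mono) auto
   finally show "of_nat (Suc n) * e \<le> val W (de x)" by (simp add: algebra_simps)
  qed
 qed
 have int: "de x = 0" if x: "x \<in> W" "x \<in> L" for x
 proof (rule ccontr)
  assume nz: "de x ~= 0"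
  obtain n :: nat where "val W (de x) / e < of_nat n" using reals_Archimedean2 by blast
  hence "val W (de x) < of_nat n * e" using e(1) by (simp add: field_simps)
  thus False using big[of n] x nz by fastforce
 qed
 show ?thesis
 proof (cases "x \<in> W")
  case True
  thus ?thesis using int x unfolding de_def by simp
 next
  case False
  hence "inverse x \<in> W" using prm_cases[OF W] mx_sub by blast
  hence "de (inverse x) = 0" using int fld_inverse[OF L(1) x] by blast
  thus ?thesis unfolding de_def aut_inverse[OF s(1)] by simp
 qed
qed


section \<open>The inertia field is unramified\<close>

lemma trace_in:
 assumes ab: "ab F Z" and fin: "finite (restr F Z)" and y: "y \<in> Z" shows "(\<Sum>f\<in>restr F Z. f y) \<in> F"
proof -
 have Z: "fld Z" by (rule ab_basic(2)[OF ab])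
 have fz: "f y \<in> Z" if "f \<in> restr F Z" for f using that ab_normal[OF ab _ y] y unfolding restr_def by auto
 have "fixd F (\<Sum>f\<in>restr F Z. f y)" unfolding fixd_def
 proof
  fix sg assume s: "sg \<in> aut F"
  define m where "m f = restrict (sg \<circ> f) Z" for f :: "'a om => _"
  have mr: "m (restrict g Z) = restrict (sg \<circ> g) Z" for g unfolding m_def by auto
  have "m ` restr F Z <= restr F Z" unfolding restr_def image_image mr using aut_comp[OF s] by blast
  moreover have "inj_on m (restr F Z)"
  proof (rule inj_onI)
   fix f f' assume "f \<in> restr F Z" "f' \<in> restr F Z" "m f = m f'"
   then obtain g h where g: "f = restrict g Z" "f' = restrict h Z" "restrict (sg \<circ> g) Z = restrict (sg \<circ> h) Z"
    unfolding restr_def using mr by auto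
   have "ALL x:Z. g x = h x" using g(3) aut_inj[OF s] unfolding restrict_eq_iff by simp
   thus "f = f'" unfolding g restrict_eq_iff .
  qed
  ultimately have bij: "bij_betw m (restr F Z) (restr F Z)" using endo_inj_surj[OF fin] unfolding bij_betw_def by blast
  have "sg (\<Sum>f\<in>restr F Z. f y) = (\<Sum>f\<in>restr F Z. m f y)" unfolding aut_sum[OF s] m_def using y by simp
  also have "\<dots> = (\<Sum>f\<in>restr F Z. f y)" by (rule sum.reindex_bij_betw[OF bij])
  finally show "sg (\<Sum>f\<in>restr F Z. f y) = (\<Sum>f\<in>restr F Z. f y)" .
 qed
 moreover have "(\<Sum>f\<in>restr F Z. f y) \<in> Z" by (rule fld_sum[OF Z]) (rule fz)
 ultimately show ?thesis using ab_basic(4)[OF ab] by blast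
qed

text \<open>Approximation keeps c at W and moves it into the maximal ideal at the conjugate primes
  that differ from W on B. Images under decomposition elements are integral anyway.\<close>

lemma spread:
 assumes ab: "ab F B" "fingen F B" and W: "prm W" and c: "c \<in> W Int B"
 obtains c' where "c' \<in> B" "c' - c \<in> mx W" "ALL g:aut F. g c' \<in> W"
  "ALL g:aut F. \<not> decomp W B g --> g c' \<in> mx W"
proof -
 note F = ab_basic(1)[OF ab(1)] and B = ab_basic(2)[OF ab(1)]
 obtain R where R: "finite R" "R <= aut F" "ALL h:aut F. EX r:R. ALL x:B. h x = r x"
  by (rule representatives[OF F ab(2) order_refl])
 define \<W> where "\<W> = (%g. pull g W) ` {g\<in>R. \<not> decomp W B g}"
 have d: "prm V & W Int B ~= V Int B" if "V \<in> \<W>" for V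
  using that pull_prm[OF _ W] R(2) unfolding \<W>_def decomp_def by blast
 have fW: "finite \<W>" unfolding \<W>_def using R(1) by simp
 obtain c' where c': "c' \<in> B" "c' - c \<in> mx W" "ALL V:\<W>. c' \<in> mx V" by (rule approx_value[OF W B fW c d])
 have 1: "g c' \<in> mx W" if g: "g \<in> aut F" "\<not> decomp W B g" for g
 proof -
  obtain h where h: "h \<in> R" "ALL x:B. g x = h x" using R(3) g(1) by blast
  have "\<not> decomp W B h" using g(2) decomp_cong[of W B h g] h(2) by auto
  hence "c' \<in> mx (pull h W)" using c'(3) h(1) unfolding \<W>_def by blast
  moreover have "h \<in> aut F" using h(1) R(2) by blast
  ultimately show ?thesis using pull_mx h(2) c'(1) by metis
 qed
 have cW: "c' \<in> W" using rng_add[OF prm_rng[OF W] mx_sub[OF c'(2)], of c] c by simp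
 have "g c' \<in> W" if "g \<in> aut F" for g using 1[OF that] mx_sub[of "g c'" W] decompD[of W B g c'] c'(1) cW by blast
 thus thesis using that c' 1 by blast
qed

lemma mx_prod_ex:
 assumes "prm W" "finite A" "ALL i:A. f i \<in> W" "prod f A \<in> mx W" shows "EX i:A. f i \<in> mx W"
 using unt_prod[OF prm_rng[OF assms(1)], of A f] assms(3,4) unfolding unt_iff by blast

lemma poly_mx:
 assumes "prm W" "ALL i. cf h i \<in> mx W" "x \<in> W" shows "poly h x \<in> mx W" unfolding poly_altdef using assms(2,3)
 by (intro mx_sum[OF assms(1)] mx_mult[OF prm_rng[OF assms(1)]] rng_power[OF prm_rng[OF assms(1)]]) auto

definition inertia :: "'q::{field,finite} om set => 'q om set => 'q om set
  => ('q om => 'q om) set" where "inertia F B W = {sg\<in>aut F. inert W B sg}"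

lemma inertia_sub: "inertia F B W <= aut F" unfolding inertia_def by blast

lemma subgrp_inertia:
 assumes ab: "ab F B" and W: "prm W" shows "subgrp (inertia F B W)"
proof -
 have "(%x. x) \<in> inertia F B W" unfolding inertia_def by (rule CollectI, rule conjI[OF aut_id(2) inert_id[OF prm_rng[OF W]]])
 moreover have "ALL sg:inertia F B W. ALL ta:inertia F B W. sg \<circ> ta \<in> inertia F B W"
 proof (intro ballI)
  fix sg ta assume "sg \<in> inertia F B W" "ta \<in> inertia F B W"
  hence st: "sg \<in> aut F" "inert W B sg" "ta \<in> aut F" "inert W B ta" unfolding inertia_def by auto
  have "ta ` B <= B" using ab_stable[OF ab] st(3) by blast
  from inert_comp[OF st(2,4) W ab_basic(2)[OF ab] st(3) this] show "sg \<circ> ta \<in> inertia F B W"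
   unfolding inertia_def using aut_comp[OF st(1,3)] by simp
 qed
 ultimately show ?thesis unfolding subgrp_def ..
qed

lemma inertia_orbit:
 assumes ab: "ab F B" and W: "prm W" and z: "z \<in> B"
 defines "Q \<equiv> (%g. g z) ` inertia F B W"
 shows "finite Q" "Q <= B" "z \<in> Q" "pk (Fix (inertia F B W) B) (rootpoly Q)" and "y \<in> Q ==> z \<in> W ==> y - z \<in> mx W"
  and "g \<in> aut F ==> y \<in> Q ==> EX ta:inertia F B W. g y = ta (g z)"
proof -
 have st: "ALL h:inertia F B W. h ` B <= B" using ab_stable[OF ab] inertia_sub by blast
 note o = orbit_props[OF ab_basic(1)[OF ab] inertia_sub subgrp_inertia[OF ab W] ab_basic(2)[OF ab] st z]
 show "finite Q" "Q <= B" "z \<in> Q" "pk (Fix (inertia F B W) B) (rootpoly Q)" using o unfolding Q_def by auto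
 show "y - z \<in> mx W" if "y \<in> Q" "z \<in> W" using that z unfolding Q_def inertia_def inert_def by blast
 show "EX ta:inertia F B W. g y = ta (g z)" if g: "g \<in> aut F" and y: "y \<in> Q"
 proof -
  obtain ta where t: "ta \<in> inertia F B W" "y = ta z" using y unfolding Q_def by blast
  have "ta \<in> aut F" using t(1) inertia_sub by blast
  from ab_commute[OF ab g this z] show ?thesis using t by auto
 qed
qed

lemma inertia_comp_decomp:
 assumes ab: "ab F B" and W: "prm W" and x: "x \<in> B" and t: "ta \<in> inertia F B W"
 shows "ta x \<in> W \<longleftrightarrow> x \<in> W" "ta x \<in> mx W \<longleftrightarrow> x \<in> mx W"
proof -
 have t': "ta \<in> aut F" "inert W B ta" using t unfolding inertia_def by auto
 note B = ab_basic(2)[OF ab]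
 note d = inert_decomp[OF t'(2) W B t'(1)]
 show "ta x \<in> W \<longleftrightarrow> x \<in> W" by (rule decompD[OF d x])
 show "ta x \<in> mx W \<longleftrightarrow> x \<in> mx W" by (rule decomp_mx[OF d B t'(1) x])
qed

text \<open>Take b, integral at all conjugates, with \<open>sg b\<close> not congruent to b, and the
  polynomial whose roots are the inertia orbit of b. If \<open>sg\<close> preserved all its
  coefficients modulo W, then b would be congruent to some \<open>ta (sg b)\<close> with
  \<open>ta\<close> inert, hence to \<open>sg b\<close>. So some coefficient is moved.\<close>

lemma inertia_field_separates:
 assumes ab: "ab F B" "fingen F B" and W: "prm W" and s: "sg \<in> aut F" "\<not> inert W B sg"
 shows "EX c:Fix (inertia F B W) B. (ALL g:aut F. g c \<in> W) & unt W (sg c - c)"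
proof -
 note F = ab_basic(1)[OF ab(1)] and B = ab_basic(2)[OF ab(1)]
 note r = prm_rng[OF W]
 obtain b where b: "b \<in> B" "ALL g:aut F. g b \<in> W" "sg b - b ~: mx W"
 proof (cases "decomp W B sg")
  case True
  obtain x where x: "x \<in> W Int B" "sg x - x ~: mx W" using s(2) unfolding inert_def by blast
  obtain b where b: "b \<in> B" "b - x \<in> mx W" "ALL g:aut F. g b \<in> W" by (rule spread[OF ab W x(1)])
  have "b - x \<in> B" using b(1) x(1) by (intro fld_diff[OF B]) auto
  hence "sg (b - x) \<in> mx W" using decomp_mx[OF True B s(1)] b(2) by blast
  from mx_diff[OF W b(2) this] have "(sg x - x) - (sg b - b) \<in> mx W" unfolding aut_diff[OF s(1)] by (simp add: algebra_simps)
  hence "sg b - b ~: mx W" using x(2) mx_add[OF W, of "sg x - x - (sg b - b)" "sg b - b"] by auto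
  thus ?thesis using that b by blast
 next
  case False
  have 1: "1 \<in> W Int B" using rng_1[OF r] fld_1[OF B] by blast
  \<comment> \<open>Outside the decomposition group, b is near 1 and \<open>sg b\<close> near 0 at
    W, so their difference cannot lie in the maximal ideal.\<close>
  obtain b where b: "b \<in> B" "b - 1 \<in> mx W" "ALL g:aut F. g b \<in> W" "ALL g:aut F. \<not> decomp W B g --> g b \<in> mx W"
   by (rule spread[OF ab W 1])
  have sb: "sg b \<in> mx W" using b(4) s(1) False by blast
  have "sg b - b ~: mx W"
  proof
   assume "sg b - b \<in> mx W"
   from mx_diff[OF W mx_diff[OF W sb this] b(2)] show False using mx_1[OF r] by simp
  qed
  thus ?thesis using that b by blast
 qed
 note o = inertia_orbit[OF ab(1) W b(1)]
 define Q where "Q = (%g. g b) ` inertia F B W"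
 have bW: "b \<in> W" using bspec[OF b(2) aut_id(2)] by simp
 have gO: "g y \<in> W" if g: "g \<in> aut F" "y \<in> Q" for g y
 proof -
  obtain ta where t: "ta \<in> inertia F B W" "g y = ta (g b)" using o(6)[OF g(1)] g(2) unfolding Q_def by blast
  thus ?thesis using inertia_comp_decomp(1)[OF ab(1) W ab_normal[OF ab(1) g(1) b(1)] t(1)] b(2) g(1) by simp
 qed
 have cfg: "g (cf (rootpoly Q) j) = cf (\<Prod>y\<in>Q. [:- g y, 1:]) j" if "g \<in> aut F" for g j
  using map_poly_rootpoly[OF that, of "%y. y" Q] aut_0[OF that] by (simp add: coeff_map_poly flip: coeff_map_poly)
 have cW: "g (cf (rootpoly Q) j) \<in> W" if "g \<in> aut F" for g j
  unfolding cfg[OF that] by (rule coeff_prod_linear_rng[OF r]) (use gO[OF that] o(1) in "auto simp: Q_def")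
 have "EX j. sg (cf (rootpoly Q) j) - cf (rootpoly Q) j ~: mx W"
 proof (rule ccontr)
  assume no: "\<not> ?thesis"
  define h where "h = (\<Prod>y\<in>Q. [:- sg y, 1:]) - rootpoly Q"
  have "cf h j \<in> mx W" for j 
  proof -
   from no have "sg (cf (rootpoly Q) j) - cf (rootpoly Q) j \<in> mx W" by blast
   thus ?thesis unfolding h_def coeff_diff cfg[OF s(1)] .
  qed
  hence "poly h b \<in> mx W" using poly_mx[OF W] bW by blast
  moreover have "poly (rootpoly Q) b = 0" using o(1,3) poly_rootpoly unfolding Q_def by blast
  ultimately have "(\<Prod>y\<in>Q. b - sg y) \<in> mx W" unfolding h_def by (simp add: poly_prod)
  moreover have "ALL y:Q. b - sg y \<in> W" by (rule ballI, rule rng_diff[OF r bW gO[OF s(1)]])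
  ultimately have "EX y:Q. b - sg y \<in> mx W" by (intro mx_prod_ex[OF W]) (simp_all add: Q_def o(1))
  then obtain y where y: "y \<in> Q" "b - sg y \<in> mx W" by blast
  obtain ta where t: "ta \<in> inertia F B W" "sg y = ta (sg b)" using o(6)[OF s(1)] y(1) unfolding Q_def by blast
  have "sg b \<in> W Int B" using b s(1) ab_normal[OF ab(1) s(1) b(1)] by blast
  hence "ta (sg b) - sg b \<in> mx W" using t(1) unfolding inertia_def inert_def by blast
  from mx_add[OF W this y(2)] have "b - sg b \<in> mx W" unfolding t(2) by simp
  from mx_minus[OF r this] show False using b(3) by simp
 qed
 then obtain j where j: "sg (cf (rootpoly Q) j) - cf (rootpoly Q) j ~: mx W" by blast
 have "cf (rootpoly Q) j \<in> Fix (inertia F B W) B" using o(4) unfolding Q_def pk_def by blast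
 moreover have "unt W (sg (cf (rootpoly Q) j) - cf (rootpoly Q) j)"
  using rng_diff[OF r cW[OF s(1)] cW[OF aut_id(2)]] j unfolding unt_iff by blast
 moreover have "ALL g:aut F. g (cf (rootpoly Q) j) \<in> W" by (rule ballI, rule cW)
 ultimately show ?thesis by blast
qed

text \<open>Up to signs, the product over the inertia orbit of an element near 1 at W and near 0 at
  the other conjugate primes. Multiplying by its powers forces conjugates into the maximal ideal
  without changing values at W.\<close>

lemma inertia_field_idempotent:
 assumes ab: "ab F B" "fingen F B" and W: "prm W"
 obtains n where "n \<in> Fix (inertia F B W) B" "ALL g:aut F. g n \<in> W" "unt W n"
  "ALL g:aut F. \<not> decomp W B g --> g n \<in> mx W"
proof -
 note F = ab_basic(1)[OF ab(1)] and B = ab_basic(2)[OF ab(1)]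
 note r = prm_rng[OF W]
 have 1: "1 \<in> W Int B" using rng_1[OF r] fld_1[OF B] by blast
 obtain z where z: "z \<in> B" "z - 1 \<in> mx W" "ALL g:aut F. g z \<in> W" "ALL g:aut F. \<not> decomp W B g --> g z \<in> mx W"
  by (rule spread[OF ab W 1])
 note o = inertia_orbit[OF ab(1) W z(1)]
 define Q where "Q = (%g. g z) ` inertia F B W"
 define n where "n = poly (rootpoly Q) 0"
 have n: "n = (\<Prod>y\<in>Q. - y)" unfolding n_def by (simp add: poly_prod)
 have fZ: "fld (Fix (inertia F B W) B)" by (rule fld_Fix'[OF F B inertia_sub])
 have nZ: "n \<in> Fix (inertia F B W) B" unfolding n_def using o(4) unfolding Q_def by (intro fld_poly[OF fZ] fld_0[OF fZ])
 have gO: "g y \<in> W" if g: "g \<in> aut F" "y \<in> Q" for g y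
 proof -
  obtain ta where t: "ta \<in> inertia F B W" "g y = ta (g z)" using o(6)[OF g(1)] g(2) unfolding Q_def by blast
  thus ?thesis using inertia_comp_decomp(1)[OF ab(1) W ab_normal[OF ab(1) g(1) z(1)] t(1)] z(3) g(1) by simp
 qed
 have gn: "g n = (\<Prod>y\<in>Q. - g y)" if "g \<in> aut F" for g unfolding n aut_prod[OF that] aut_minus[OF that] ..
 have "g n \<in> W" if "g \<in> aut F" for g unfolding gn[OF that] by (intro rng_prod[OF r] rng_minus[OF r] gO that)
 moreover have "unt W n" unfolding n
 proof (rule unt_prod[OF r])
  fix y assume y: "y \<in> Q"
  have zW: "z \<in> W" using bspec[OF z(3) aut_id(2)] by simp
  have "y - 1 \<in> mx W" using mx_add[OF W o(5) z(2)] y zW unfolding Q_def by simp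
  hence "- 1 - (- y) \<in> mx W" by simp
  moreover have "unt W (- 1)" using unt_1[OF r] rng_minus[OF r] unfolding unt_def by simp
  ultimately show "unt W (- y)" using unt_cong[OF W] by blast
 qed
 moreover have "g n \<in> mx W" if g: "g \<in> aut F" "\<not> decomp W B g" for g
 proof -
  have zO: "finite Q" "z \<in> Q" using o(1,3) unfolding Q_def by auto
  have "g n = - g z * (\<Prod>y\<in>Q-{z}. - g y)" unfolding gn[OF g(1)] by (rule prod.remove[OF zO])
  moreover have "- g z \<in> mx W" using mx_minus[OF r] z(4) g by blast
  moreover have "(\<Prod>y\<in>Q-{z}. - g y) \<in> W" by (rule rng_prod[OF r], rule rng_minus[OF r], rule gO) (use g in auto)
  ultimately show ?thesis using mx_mult[OF r] by metis
 qed
 ultimately show thesis using that nZ by blast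
qed


lemma restr_imp: "f \<in> restr F Z ==> EX g. g \<in> aut F & f = restrict g Z" unfolding restr_def by blast

text \<open>The elements \<open>\<Prod>\<^sub>h (h c\<^sub>h - f c\<^sub>h)\<close> vanish for all non-trivial \<open>f\<close>; expanding this product
 gives finitely many pairs that invert the trace form up to a unit.\<close>

lemma trace_expansion:
 assumes ab: "ab F Z" and fin: "finite (restr F Z)"
  and A: "A = restr F Z - {restrict (%x. x) Z}" and c: "\<And>h. h \<in> A ==> c h \<in> Z" and x: "x \<in> Z"
 shows "x * (\<Prod>h\<in>A. h (c h) - c h) =
  (\<Sum>S\<in>Pow A. (\<Prod>h\<in>S. h (c h)) * (\<Sum>f\<in>restr F Z. f (x * (\<Prod>h\<in>A-S. - c h))))"
proof -
 let ?y = "%S. \<Prod>h\<in>A-S. - c h"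
 note Z = ab_basic(2)[OF ab]
 have fA: "finite A" unfolding A using fin by simp
 have idr: "restrict (%x. x) Z \<in> restr F Z" unfolding restr_def using aut_id(2) by blast
 have yZ: "?y S \<in> Z" for S by (intro fld_prod[OF Z] fld_minus[OF Z] c) auto
 have e: "(\<Sum>S\<in>Pow A. (\<Prod>h\<in>S. h (c h)) * f (x * ?y S)) =
   (if f = restrict (%x. x) Z then x * (\<Prod>h\<in>A. h (c h) - c h) else 0)" if f: "f \<in> restr F Z" for f
 proof -
  obtain g where g: "g \<in> aut F" "f = restrict g Z" using restr_imp[OF f] by blast
  have fxy: "f (x * ?y S) = g x * (\<Prod>h\<in>A-S. - g (c h))" for S
   unfolding g(2) using fld_mult[OF Z x yZ] by (simp add: aut_simps[OF g(1)])
  have "(\<Sum>S\<in>Pow A. (\<Prod>h\<in>S. h (c h)) * f (x * ?y S)) = g x * (\<Sum>S\<in>Pow A. (\<Prod>h\<in>S. h (c h)) * (\<Prod>h\<in>A-S. - g (c h)))"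
   unfolding fxy sum_distrib_left by (rule sum.cong[OF refl]) (simp only: mult.left_commute)
  also have "\<dots> = g x * (\<Prod>h\<in>A. h (c h) - g (c h))" unfolding prod_add[OF fA, symmetric] by simp
  also have "\<dots> = (if f = restrict (%x. x) Z then x * (\<Prod>h\<in>A. h (c h) - c h) else 0)"
  proof (cases "f = restrict (%x. x) Z")
   case True
   hence "ALL y:Z. g y = y" unfolding g(2) restrict_eq_iff .
   hence "g x = x" "(\<Prod>h\<in>A. h (c h) - g (c h)) = (\<Prod>h\<in>A. h (c h) - c h)" using x c by (auto intro!: prod.cong)
   thus ?thesis using True by simp
  next
   case False
   hence fa: "f \<in> A" using f unfolding A by blast
   have "f (c f) - g (c f) = 0" unfolding g(2) using c[OF fa] g(2) by simp
   hence "(\<Prod>h\<in>A. h (c h) - g (c h)) = 0" using fA fa by (subst prod_zero_iff) auto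
   thus ?thesis using False by simp
  qed
  finally show ?thesis .
 qed
 have "(\<Sum>S\<in>Pow A. (\<Prod>h\<in>S. h (c h)) * (\<Sum>f\<in>restr F Z. f (x * ?y S)))
   = (\<Sum>f\<in>restr F Z. \<Sum>S\<in>Pow A. (\<Prod>h\<in>S. h (c h)) * f (x * ?y S))" unfolding sum_distrib_left by (rule sum.swap)
 also have "\<dots> = (\<Sum>f\<in>restr F Z. if f = restrict (%x. x) Z then x * (\<Prod>h\<in>A. h (c h) - c h) else 0)"
  by (rule sum.cong[OF refl e])
 also have "\<dots> = x * (\<Prod>h\<in>A. h (c h) - c h)" using fin idr by simp
 finally show ?thesis ..
qed

text \<open>Up to the unit u, x is an integral combination of the t(i), so a dominant nonzero t(j)
  divides every term and hence x.\<close>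

lemma uram_expansion:
 assumes W: "prm W" and u: "unt W u" and x: "x ~= 0" and fin: "finite I"
  and e: "x * u = (\<Sum>i\<in>I. a i * t i)" and a: "ALL i:I. a i \<in> W" and t: "ALL i:I. t i \<in> F Int mx W"
 shows "EX t:F Int mx W. t ~= 0 & x / t \<in> W"
proof -
 note r = prm_rng[OF W]
 define J where "J = {i\<in>I. t i ~= 0}"
 have e': "x * u = (\<Sum>i\<in>J. a i * t i)" unfolding e J_def by (rule sum.mono_neutral_right[OF fin]) auto
 have "x * u ~= 0" using u x unfolding unt_def by simp
 hence J: "J ~= {}" using e' by auto
 have "finite J" unfolding J_def using fin by simp
 from ex_dominant[OF W this J] obtain j where j: "j \<in> J" "ALL i:J. t i / t j \<in> W" unfolding J_def by blast
 have "(\<Sum>i\<in>J. a i * (t i / t j)) \<in> W"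
  by (rule rng_sum[OF r], rule rng_mult[OF r]) (use j(2) a in "auto simp: J_def")
 moreover have "(\<Sum>i\<in>J. a i * (t i / t j)) = x * u / t j" unfolding e' by (simp add: sum_divide_distrib)
 ultimately have "x * u / t j * inverse u \<in> W" using u rng_mult[OF r] unfolding unt_def by metis
 moreover have "x * u / t j * inverse u = x / t j" using u unfolding unt_def by simp
 ultimately have "x / t j \<in> W" by metis
 moreover have "t j \<in> F Int mx W" "t j ~= 0" using t j(1) unfolding J_def by auto
 ultimately show ?thesis by blast
qed

text \<open>Elements separating the nontrivial automorphisms of the inertia field express x times a
  unit, by \<open>trace_expansion\<close>, through traces, which lie in F. These traces lie in the
  maximal ideal once all conjugates of x do.\<close>

theorem inertia_unramified:
 assumes ab: "ab F B" "fingen F B" and W: "prm W" shows "uram F (Fix (inertia F B W) B) W" unfolding uram_def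
proof (intro ballI impI)
 define Z where "Z = Fix (inertia F B W) B"
 fix x assume "x \<in> Fix (inertia F B W) B Int mx W" and x0: "x ~= 0"
 hence x: "x \<in> Z" "x \<in> mx W" unfolding Z_def by auto
 note F = ab_basic(1)[OF ab(1)] and B = ab_basic(2)[OF ab(1)]
 note r = prm_rng[OF W]
 have ZB: "Z <= B" unfolding Z_def Fix_def by blast
 have fZ: "fld Z" unfolding Z_def by (rule fld_Fix'[OF F B inertia_sub])
 have "F <= Z"
 proof
  fix y assume y: "y \<in> F"
  have "y \<in> B" using ab_basic(3)[OF ab(1)] y by blast
  moreover have "ALL h:inertia F B W. h y = y" by (rule ballI, rule aut_fixes[OF _ y]) (use inertia_sub in blast)
  ultimately show "y \<in> Z" unfolding Z_def Fix_def by blast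
 qed
 note abZ = ab_sub(1)[OF ab(1) fZ this ZB]
 have "restr F Z = (%f. restrict f Z) ` restr F B"
  unfolding restr_def image_image using ZB by (auto intro!: image_cong simp: Int_absorb1)
 hence fin: "finite (restr F Z)" using finite_restr[OF F ab(2)] by simp
 define A where "A = restr F Z - {restrict (%x. x) Z}"
 have "ALL f:A. EX c. c \<in> Z & (ALL g:aut F. g c \<in> W) & unt W (f c - c)"
 proof
  fix f assume "f \<in> A"
  then obtain g where g: "g \<in> aut F" "f = restrict g Z" "f ~= restrict (%x. x) Z" unfolding A_def using restr_imp by blast
  have "\<not> inert W B g"
  proof
   assume "inert W B g"
   hence "g \<in> inertia F B W" using g(1) unfolding inertia_def by blast
   hence "ALL x:Z. g x = x" unfolding Z_def Fix_def by blast
   thus False using g(2,3) unfolding restrict_eq_iff[symmetric] by blast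
  qed
  from inertia_field_separates[OF ab W g(1) this]
  obtain c where c: "c \<in> Z" "ALL g:aut F. g c \<in> W" "unt W (g c - c)" unfolding Z_def by blast
  have "f c = g c" unfolding g(2) using c(1) by simp
  thus "EX c. c \<in> Z & (ALL g:aut F. g c \<in> W) & unt W (f c - c)" using c by auto
 qed
 from bchoice[OF this] obtain c where
  c: "ALL f:A. c f \<in> Z & (ALL g:aut F. g (c f) \<in> W) & unt W (f (c f) - c f)" by blast
 define u where "u = (\<Prod>h\<in>A. h (c h) - c h)"
 have u: "unt W u" unfolding u_def by (rule unt_prod[OF r]) (use c in blast)
 obtain n where n: "n \<in> Z" "ALL g:aut F. g n \<in> W" "unt W n" "ALL g:aut F. \<not> decomp W B g --> g n \<in> mx W"
  unfolding Z_def by (rule inertia_field_idempotent[OF ab W])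
 obtain R where R: "finite R" "R <= aut F" "ALL h:aut F. EX r:R. ALL x:B. h x = r x"
  by (rule representatives[OF F ab(2) order_refl])
 define \<W> where "\<W> = (%g. pull g W) ` {g\<in>R. \<not> decomp W B g}"
 have "finite \<W>" unfolding \<W>_def using R(1) by simp
 moreover have "prm V & n \<in> mx V" if V: "V \<in> \<W>" for V
 proof -
  obtain g where g: "g \<in> R" "\<not> decomp W B g" "V = pull g W" using V unfolding \<W>_def by blast
  have "g \<in> aut F" using g(1) R(2) by blast
  thus ?thesis using pull_prm[OF _ W] pull_mx[of g F n W] n(4) g by simp
 qed
 moreover have n0: "n ~= 0" using n(3) unfolding unt_def by blast
 ultimately obtain N where N: "ALL V:\<W>. x * n ^ N \<in> mx V" using power_dominates_all by blast
 \<comment> \<open>At W this changes x only by a unit; at the conjugate primes different from W the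
   power of n brings it into the maximal ideal.\<close>
 define x' where "x' = x * n ^ N"
 have un: "unt W (n ^ N)" by (rule unt_power[OF r n(3)])
 have x': "x' \<in> Z" "x' ~= 0" "x' \<in> mx W" unfolding x'_def using x x0 n0 n(1) un mx_mult[OF r]
  by (auto intro!: fld_mult[OF fZ] fld_power[OF fZ] simp: unt_def)
 have gx: "g x' \<in> mx W" if g: "g \<in> aut F" for g
 proof (cases "decomp W B g")
  case True
  thus ?thesis using decomp_mx[OF True B g] x'(1,3) ZB by blast
 next
  case False
  obtain h where h: "h \<in> R" "ALL x:B. g x = h x" using R(3) g by blast
  have "\<not> decomp W B h" using False decomp_cong[of W B h g] h(2) by auto
  hence "x' \<in> mx (pull h W)" using N h(1) unfolding \<W>_def x'_def by blast
  moreover have "h \<in> aut F" using h(1) R(2) by blast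
  moreover have "x' \<in> B" using x'(1) ZB by blast
  ultimately show ?thesis using pull_mx[of h F x' W] h(2) by simp
 qed
 define t where "t S = (\<Sum>f\<in>restr F Z. f (x' * (\<Prod>h\<in>A-S. - c h)))" for S
 have cZ: "c h \<in> Z" if "h \<in> A" for h using c that by blast
 have yZ: "x' * (\<Prod>h\<in>A-S. - c h) \<in> Z" for S by (intro fld_mult[OF fZ x'(1)] fld_prod[OF fZ] fld_minus[OF fZ] cZ) auto
 have "t S \<in> F" for S unfolding t_def by (rule trace_in[OF abZ fin yZ])
 moreover have "t S \<in> mx W" for S unfolding t_def
 proof (rule mx_sum[OF W])
  fix f assume "f \<in> restr F Z"
  then obtain g where g: "g \<in> aut F" "f = restrict g Z" using restr_imp by blast
  have "f (x' * (\<Prod>h\<in>A-S. - c h)) = g x' * (\<Prod>h\<in>A-S. - g (c h))" unfolding g(2) using yZ by (simp add: aut_simps[OF g(1)])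
  also have "\<dots> \<in> mx W" by (rule mx_mult[OF r gx[OF g(1)]], rule rng_prod[OF r], rule rng_minus[OF r]) (use c g(1) in blast)
  finally show "f (x' * (\<Prod>h\<in>A-S. - c h)) \<in> mx W" .
 qed
 ultimately have tF: "ALL S:Pow A. t S \<in> F Int mx W" by blast
 have aW: "ALL S:Pow A. (\<Prod>h\<in>S. h (c h)) \<in> W"
 proof (intro ballI, rule rng_prod[OF r])
  fix S h assume "S \<in> Pow A" "h \<in> S"
  hence h: "h \<in> A" by blast
  obtain g where g: "g \<in> aut F" "h = restrict g Z" using h restr_imp unfolding A_def by blast
  show "h (c h) \<in> W" using c h g cZ[OF h] by (metis restrict_apply')
 qed
 have "x' * u = (\<Sum>S\<in>Pow A. (\<Prod>h\<in>S. h (c h)) * t S)"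
  unfolding u_def t_def by (rule trace_expansion[OF abZ fin A_def cZ x'(1)])
 from uram_expansion[OF W u x'(2) _ this aW tF] obtain s where
  s: "s \<in> F Int mx W" "s ~= 0" "x' / s \<in> W" using fin unfolding A_def by auto
 have "x' / s * inverse (n ^ N) \<in> W" using s(3) un rng_mult[OF r] unfolding unt_def by blast
 moreover have "x' / s * inverse (n ^ N) = x / s" unfolding x'_def using n0 by simp
 ultimately show "EX t:F Int mx W. t ~= 0 & x / t \<in> W" using s by metis
qed


subsection \<open>Hilbert class fields and genus fields\<close>

text \<open>All inertia groups of M/F and all decomposition groups above infinity are trivial: the
  admissibility condition for the Hilbert class field, in terms of Galois groups.\<close>

definition triv :: "'q::{field,finite} om set => 'q om set => bool"
 where "triv F M \<longleftrightarrow> (ALL sg:aut F. ALL W. prm W --> inert W M sg \<or> W Int kk = P_infinity & decomp W M sg --> (ALL x:M. sg x = x))"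

lemma trivD1: "triv F M ==> sg \<in> aut F ==> prm W ==> inert W M sg ==> x \<in> M ==> sg x = x" unfolding triv_def by blast

lemma trivD2: "triv F M ==> sg \<in> aut F ==> prm W ==> W Int kk = P_infinity ==> decomp W M sg ==> x \<in> M ==> sg x = x"
 unfolding triv_def by blast

definition piece :: "'q::{field,finite} om set => 'q om set => bool"
 where "piece F M \<longleftrightarrow> ab F M & fingen F M & triv F M"

lemma fingen_refl: "fld F ==> fingen F F" unfolding fingen_def by (rule exI[of _ "{}"]) (simp add: gen_fld)

lemma fingen_un:
 assumes "fingen F M" "fingen F N" shows "fingen F (gen (M Un N))"
proof -
 obtain S where S: "finite S" "M = gen (F Un S)" by (rule fingenE[OF assms(1)])
 obtain S' where S': "finite S'" "N = gen (F Un S')" by (rule fingenE[OF assms(2)])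
 have "gen (M Un N) = gen (F Un (S Un S'))"
 proof
  show "gen (M Un N) <= gen (F Un (S Un S'))"
   unfolding S(2) S'(2) by (intro gen_least fld_gen Un_least gen_mono) auto
  show "gen (F Un (S Un S')) <= gen (M Un N)"
   using gen_incl[of "F Un S"] gen_incl[of "F Un S'"] gen_incl[of "M Un N"] unfolding S(2) S'(2)
   by (intro gen_least fld_gen) blast
 qed
 thus ?thesis unfolding fingen_def using S(1) S'(1) by blast
qed

text \<open>M is generated over F by witnesses, one for each pair of representatives that differ on
  M; an automorphism fixing all witnesses fixes M.\<close>

lemma fingen_sub:
 assumes "ab F B" "fingen F B" "fld M" "F <= M" "M <= B" shows "fingen F M"
proof -
 note F = ab_basic(1)[OF assms(1)]
 have abM: "ab F M" by (rule ab_sub(1)[OF assms(1,3-5)])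
 have "restr F M = (%f. restrict f M) ` restr F B"
  unfolding restr_def image_image using assms(5) by (auto intro!: image_cong simp: Int_absorb1)
 hence "finite (restr F M)" using finite_restr[OF F assms(2)] by simp
 then obtain R where R: "finite R" "R <= aut F" "restr F M = (%sg. restrict sg M) ` R"
  unfolding restr_def by (metis finite_subset_image order_refl)
 define P where "P = {(sg, ta) \<in> R \<times> R. EX x:M. sg x ~= ta x}"
 have fP: "finite P" unfolding P_def using R(1) by (rule_tac finite_subset[of _ "R \<times> R"]) auto
 have "ALL p:P. EX x. x \<in> M & fst p x ~= snd p x" unfolding P_def by auto
 from bchoice[OF this] obtain w where w: "ALL p:P. w p \<in> M & fst p (w p) ~= snd p (w p)" by blast
 define N where "N = gen (F Un w ` P)"
 have NM: "N <= M" unfolding N_def by (rule gen_least[OF assms(3)]) (use w assms(4) in blast)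
 have fN: "fld N" "F <= N" unfolding N_def using fld_gen gen_incl by blast+
 have "M <= N"
 proof
  fix x assume x: "x \<in> M"
  have "fixd N x" unfolding fixd_def
  proof
   fix sg assume s: "sg \<in> aut N"
   have sF: "sg \<in> aut F" by (rule aut_mono[OF fN(2) s])
   have "restrict sg M \<in> restr F M" "restrict (%x. x) M \<in> restr F M" unfolding restr_def using sF aut_id(2) by blast+
   then obtain g h where g: "g \<in> R" "restrict sg M = restrict g M" and h: "h \<in> R" "restrict (%x. x) M = restrict h M"
    unfolding R(3) by blast
   have gs: "ALL y:M. sg y = g y" using g(2) unfolding restrict_eq_iff .
   have hs: "ALL y:M. y = h y" using h(2) unfolding restrict_eq_iff .
   have "(g, h) ~: P"
   proof
    assume p: "(g, h) \<in> P"
    hence "w (g, h) \<in> N" unfolding N_def by (intro subsetD[OF gen_incl] UnI2 imageI)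
    hence "sg (w (g, h)) = w (g, h)" by (rule aut_fixes[OF s])
    moreover have wM: "w (g, h) \<in> M" "g (w (g, h)) ~= h (w (g, h))" using bspec[OF w p] by simp_all
    ultimately show False using bspec[OF gs wM(1)] bspec[OF hs wM(1)] by metis
   qed
   hence "g x = h x" unfolding P_def using g(1) h(1) x by blast
   thus "sg x = x" using bspec[OF gs x] bspec[OF hs x] by metis
  qed
  thus "x \<in> N" by (rule ab_basic(4)[OF ab_sub(2)[OF abM fN NM] x])
 qed
 hence "M = N" using NM by blast
 thus ?thesis unfolding fingen_def N_def using fP by blast
qed

lemma triv_uram:
 assumes ab: "ab F M" "fingen F M" and t: "triv F M" and W: "prm W" shows "uram F M W"
proof -
 have "Fix (inertia F M W) M = M" unfolding Fix_def inertia_def using trivD1[OF t _ W] by blast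
 thus ?thesis using inertia_unramified[OF ab W] by simp
qed

text \<open>An automorphism inert on M is not directly known to be inert on B. The detour is through
  unramifiedness, which passes to subfields and gives trivial inertia back by
  \<open>uram_inert_trivial\<close>.\<close>

lemma triv_sub:
 assumes F: "ab kk F" "fingen kk F" and p: "piece F B" and M: "fld M" "F <= M" "M <= B" shows "triv F M"
 unfolding triv_def
proof (intro ballI allI impI)
 fix sg W x assume s: "sg \<in> aut F" and W: "prm W" and x: "x \<in> M"
  and d: "inert W M sg \<or> W Int kk = P_infinity & decomp W M sg"
 have B: "ab F B" "fingen F B" "triv F B" using p unfolding piece_def by auto
 from d show "sg x = x"
 proof
  assume i: "inert W M sg"
  have u: "uram F M W" by (rule uram_sub[OF triv_uram[OF B W] M(3)])
  obtain e where e: "e > 0" "ALL t:F Int mx W. t ~= 0 --> val W t \<ge> e" by (rule value_gap[OF F W])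
  have "sg ` M <= M" using ab_stable[OF ab_sub(1)[OF B(1) M]] s by blast
  thus ?thesis by (rule uram_inert_trivial[OF M(1,2) W u e s _ i x])
 next
  assume i: "W Int kk = P_infinity & decomp W M sg"
  have "ALL sg:aut F. decomp W B sg --> (ALL x:M. sg x = x)" using trivD2[OF B(3) _ W] i M(3) by blast
  thus ?thesis by (rule decomp_sub[OF B(1,2) M W _ s]) (use i x in auto)
 qed
qed

lemma piece_sub:
 assumes "ab kk F" "fingen kk F" "piece F B" "fld M" "F <= M" "M <= B" shows "piece F M"
 using triv_sub[OF assms] ab_sub(1)[of F B M] fingen_sub[of F B M] assms unfolding piece_def by blast

lemma fix_un:
 assumes "sg \<in> aut kk" "ALL x:M. sg x = x" "ALL x:N. sg x = x" "x \<in> gen (M Un N)" shows "sg x = x"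
 using gen_least[OF fld_fixed[OF assms(1)], of "M Un N"] assms by blast

lemma triv_un:
 assumes "triv F M" "triv F N" "fld F" shows "triv F (gen (M Un N))" unfolding triv_def
proof (intro ballI allI impI)
 fix sg W x assume s: "sg \<in> aut F" and W: "prm W" and x: "x \<in> gen (M Un N)"
  and d: "inert W (gen (M Un N)) sg \<or> W Int kk = P_infinity & decomp W (gen (M Un N)) sg"
 have sub: "M <= gen (M Un N)" "N <= gen (M Un N)" using gen_incl by blast+
 have "ALL x:M. sg x = x" "ALL x:N. sg x = x"
  using d inert_mono[OF _ sub(1)] inert_mono[OF _ sub(2)] decomp_mono[OF _ sub(1)] decomp_mono[OF _ sub(2)]
   trivD1[OF assms(1) s W] trivD1[OF assms(2) s W] trivD2[OF assms(1) s W] trivD2[OF assms(2) s W] by blast+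
 moreover have "sg \<in> aut kk" using s aut_fld[OF assms(3)] by blast
 ultimately show "sg x = x" using fix_un x by blast
qed

lemma piece_un: "piece F M ==> piece F N ==> piece F (gen (M Un N))"
 using ab_un[of F M N] fingen_un[of F M N] triv_un[of F M N] ab_basic(1)[of F M] unfolding piece_def by blast

lemma piece_refl: "fld F ==> piece F F" unfolding piece_def triv_def using ab_refl fingen_refl aut_fixes by blast

text \<open>The union of the finite admissible extensions. It is directed under composites, which
  makes it a field.\<close>

definition hilb :: "'q::{field,finite} om set => 'q om set" where "hilb F = \<Union>{M. piece F M}"

lemma directed_fld:
 assumes "\<M> ~= {}" "ALL M:\<M>. fld M" "ALL M:\<M>. ALL N:\<M>. gen (M Un N) \<in> \<M>"
 shows "fld (\<Union>\<M>)"
proof -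
 have "x + y \<in> \<Union>\<M> & x * y \<in> \<Union>\<M>" if "x \<in> \<Union>\<M>" "y \<in> \<Union>\<M>" for x y
 proof -
  obtain M N where M: "M \<in> \<M>" "x \<in> M" "N \<in> \<M>" "y \<in> N" using \<open>x \<in> \<Union>\<M>\<close> \<open>y \<in> \<Union>\<M>\<close> by blast
  have "x \<in> gen (M Un N)" "y \<in> gen (M Un N)" using gen_incl M by blast+
  hence "x + y \<in> gen (M Un N)" "x * y \<in> gen (M Un N)" using fld_add[OF fld_gen] fld_mult[OF fld_gen] by blast+
  thus ?thesis using M assms(3) by blast
 qed
 moreover have "kk <= \<Union>\<M>" using assms(1,2) fld_kk_sub by blast
 ultimately show ?thesis unfolding fld_def by blast
qed

lemma directed_ab:
 assumes "\<M> ~= {}" "ALL M:\<M>. ab F M" "ALL M:\<M>. ALL N:\<M>. gen (M Un N) \<in> \<M>"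
 shows "ab F (\<Union>\<M>)"
proof (rule abI')
 obtain M where M: "M \<in> \<M>" using assms(1) by blast
 hence aM: "ab F M" using assms(2) by blast
 show "fld F" "F <= \<Union>\<M>" using ab_basic(1,3)[OF aM] M by blast+
 show "fld (\<Union>\<M>)" by (rule directed_fld[OF assms(1) _ assms(3)]) (use assms(2) ab_basic(2) in blast)
 fix sg x assume s: "sg \<in> aut F" and "x \<in> \<Union>\<M>"
 then obtain N where N: "N \<in> \<M>" "x \<in> N" by blast
 hence aN: "ab F N" using assms(2) by blast
 show "sg x \<in> \<Union>\<M>" using ab_normal[OF aN s N(2)] N(1) by blast
 show "(sg \<circ> ta) x = (ta \<circ> sg) x" if "ta \<in> aut F" for ta using ab_commute[OF aN s that N(2)] by simp
next
 fix x assume x: "x \<in> \<Union>\<M>" "fixd F x"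
 then obtain N where N: "N \<in> \<M>" "x \<in> N" by blast
 thus "x \<in> F" using ab_basic(4)[of F N] assms(2) x(2) by blast
qed

lemma directed_finite:
 assumes "\<M> ~= {}" "ALL M:\<M>. ALL N:\<M>. gen (M Un N) \<in> \<M>" "finite S" "S <= \<Union>\<M>"
 shows "EX M:\<M>. S <= M" using assms(3,4)
proof (induction S rule: finite_induct)
 case (insert s S)
 then obtain M N where M: "M \<in> \<M>" "S <= M" "N \<in> \<M>" "s \<in> N" by auto
 have "gen (M Un N) \<in> \<M>" using M assms(2) by blast
 moreover have "insert s S <= gen (M Un N)" using M gen_incl[of "M Un N"] by blast
 ultimately show ?case by blast
qed (use assms(1) in auto)

lemma hilb_directed: "fld F ==> {M. piece F M} ~= {}" "ALL M:{M. piece F M}. ALL N:{M. piece F M}. gen (M Un N) \<in> {M. piece F M}"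
 using piece_refl piece_un by blast+

lemma hilb_piece:
 assumes F: "ab kk F" "fingen kk F" and M: "fld M" "F <= M" "M <= hilb F" "fingen F M" shows "piece F M"
proof -
 obtain S where S: "finite S" "M = gen (F Un S)" by (rule fingenE[OF M(4)])
 have "S <= M" using S(2) gen_incl by blast
 hence "S <= \<Union>{M. piece F M}" using M(3) unfolding hilb_def by blast
 from directed_finite[OF hilb_directed(1)[OF ab_basic(2)[OF F(1)]] hilb_directed(2) S(1) this]
 obtain N where N: "piece F N" "S <= N" by blast
 have aN: "ab F N" using N(1) unfolding piece_def by blast
 have "M <= N" unfolding S(2) using N(2) ab_basic(2,3)[OF aN] by (intro gen_least) blast+
 thus ?thesis by (rule piece_sub[OF F N(1) M(1,2)])
qed

lemma above_infinity:
 assumes "fld F" "P \<in> primes_above kk P_infinity F"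
 obtains W where "prm W" "P = W Int F" "W Int kk = P_infinity"
proof -
 have P: "P \<in> primes_of F" "P Int kk = P_infinity" using assms(2) unfolding primes_above_def by auto
 obtain W where W: "prm W" "P = W Int F" by (rule prime_extends[OF assms(1) P(1)])
 have "W Int kk = P_infinity" using P(2) W(2) fld_kk_sub[OF assms(1)] by blast
 thus thesis using that W by blast
qed

text \<open>The existence of a greatest admissible field has to be proved before
  \<open>GREATEST\<close> gives any information: the union of the finite pieces is admissible, and
  an admissible L is covered by the pieces F(x) with x in L.\<close>

theorem hilbert_class_field_eq:
 assumes F: "ab kk F" "fingen kk F" shows "hilbert_class_field F = hilb F" unfolding hilbert_class_field_def
proof (rule Greatest_equality)
 note fF = ab_basic(2)[OF F(1)]
 have abH: "ab F (hilb F)" unfolding hilb_def by (rule directed_ab[OF hilb_directed(1)[OF fF] _ hilb_directed(2)]) (simp add: piece_def)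
 note fH = ab_basic(2,3)[OF abH]
 have "uram F (hilb F) W" if W: "prm W" for W unfolding uram_def
 proof (intro ballI impI)
  fix x assume x: "x \<in> hilb F Int mx W" "x ~= 0"
  then obtain M where M: "piece F M" "x \<in> M" unfolding hilb_def by blast
  have "uram F M W" using triv_uram[OF _ _ _ W] M(1) unfolding piece_def by blast
  thus "EX t:F Int mx W. t ~= 0 & x / t \<in> W" using x M(2) unfolding uram_def by blast
 qed
 hence "unramified_everywhere F (hilb F)" unfolding unramified_everywhere_iff[OF fF fH] by blast
 moreover have "decomposes_fully F P (hilb F)" if P: "P \<in> primes_above kk P_infinity F" for P unfolding decomposes_fully_def
 proof (intro allI impI)
  fix M assume M: "finite_extension F M & M <= hilb F"
  obtain W where W: "prm W" "P = W Int F" "W Int kk = P_infinity" by (rule above_infinity[OF fF P])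
  note fe = finite_extension_fingen[OF fF conjunct1[OF M]]
  have p: "ab F M" "fingen F M" "triv F M" using hilb_piece[OF F fe(1,2) conjunct2[OF M] fe(3)] unfolding piece_def by auto
  show "card (primes_above F P M) = ext_degree F M" unfolding W(2) decomposed_iff[OF p(1,2) W(1)] using trivD2[OF p(3) _ W(1,3)] by blast
 qed
 ultimately show "abelian_extension F (hilb F) & unramified_everywhere F (hilb F) &
   (ALL P:primes_above kk P_infinity F. decomposes_fully F P (hilb F))" using abH unfolding abelian_extension_iff[OF fF] by blast
 fix L assume L: "abelian_extension F L & unramified_everywhere F L &
   (ALL P:primes_above kk P_infinity F. decomposes_fully F P L)"
 have abL: "ab F L" using L unfolding abelian_extension_iff[OF fF] by blast
 note fL = ab_basic(2,3)[OF abL]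
 have u: "uram F L W" if "prm W" for W using L that unfolding unramified_everywhere_iff[OF fF fL] by blast
 show "L <= hilb F"
 proof
  fix x assume x: "x \<in> L"
  define M where "M = gen (F Un {x})"
  have M: "fld M" "F <= M" "x \<in> M" unfolding M_def using fld_gen gen_incl[of "F Un {x}"] by auto
  have MsubL: "M <= L" unfolding M_def by (rule gen_least[OF fL(1)]) (use fL(2) x in blast)
  have abM: "ab F M" by (rule ab_sub(1)[OF abL M(1,2) MsubL])
  have fM: "fingen F M" unfolding fingen_def M_def by blast
  have "triv F M" unfolding triv_def
  proof (intro ballI allI impI)
   fix sg W y assume s: "sg \<in> aut F" and W: "prm W" and y: "y \<in> M"
    and d: "inert W M sg \<or> W Int kk = P_infinity & decomp W M sg"
   from d show "sg y = y"
   proof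
    assume i: "inert W M sg"
    obtain e where e: "e > 0" "ALL t:F Int mx W. t ~= 0 --> val W t \<ge> e" by (rule value_gap[OF F W])
    have "sg ` M <= M" using ab_stable[OF abM] s by blast
    thus ?thesis by (rule uram_inert_trivial[OF M(1,2) W uram_sub[OF u[OF W] MsubL] e s _ i y])
   next
    assume i: "W Int kk = P_infinity & decomp W M sg"
    have "W Int F \<in> primes_above kk P_infinity F"
     unfolding primes_above_def using trace_prime[OF W fF] i fld_kk_sub[OF fF] by blast
    hence "card (primes_above F (W Int F) M) = ext_degree F M"
     using L galois_degree(1)[OF abM fM] MsubL unfolding decomposes_fully_def by blast
    thus ?thesis unfolding decomposed_iff[OF abM fM W] using s i y by blast
   qed
  qed
  thus "x \<in> hilb F" unfolding hilb_def piece_def using abM fM M(3) by blast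
 qed
qed

text \<open>Again the greatest element is a directed union, now of pieces abelian over
  \<open>k\<close>. This permits arguments about finite extensions without first proving that the
  genus field is finite.\<close>

theorem genus_field_eq:
 assumes F: "ab kk F" "fingen kk F" shows "genus_field F = \<Union>{M. ab kk M & piece F M}" (is "_ = \<Union>?\<M>")
 unfolding genus_field_def
proof (rule Greatest_equality)
 note fF = ab_basic(2)[OF F(1)]
 have ne: "?\<M> ~= {}" using F(1) piece_refl[OF fF] by blast
 have dir: "ALL M:?\<M>. ALL N:?\<M>. gen (M Un N) \<in> ?\<M>" using ab_un piece_un by blast
 have abU: "ab kk (\<Union>?\<M>)" by (rule directed_ab[OF ne _ dir]) blast
 have "F <= \<Union>?\<M>" using F(1) piece_refl[OF fF] by blast
 moreover have "\<Union>?\<M> <= hilb F" unfolding hilb_def by blast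
 ultimately show "field_extension F (\<Union>?\<M>) & abelian_extension kk (\<Union>?\<M>) & \<Union>?\<M> <= hilbert_class_field F"
  unfolding abelian_extension_iff[OF fld_kk] field_extension_fld2[OF fF] hilbert_class_field_eq[OF F] using abU ab_basic(2)[OF abU] by blast
 fix E assume "field_extension F E & abelian_extension kk E & E <= hilbert_class_field F"
 hence E: "fld E" "F <= E" "ab kk E" "E <= hilb F"
  unfolding abelian_extension_iff[OF fld_kk] field_extension_fld2[OF fF] hilbert_class_field_eq[OF F] by auto
 show "E <= \<Union>?\<M>"
 proof
  fix x assume x: "x \<in> E"
  define M where "M = gen (F Un {x})"
  have M: "fld M" "F <= M" "x \<in> M" unfolding M_def using fld_gen gen_incl[of "F Un {x}"] by auto
  have ME: "M <= E" unfolding M_def by (rule gen_least[OF E(1)]) (use E(2) x in blast)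
  have fM: "fingen F M" unfolding fingen_def M_def by blast
  have "piece F M" by (rule hilb_piece[OF F M(1,2) _ fM]) (use ME E(4) in blast)
  moreover have "ab kk M" by (rule ab_sub(1)[OF E(3) M(1) fld_kk_sub[OF M(1)] ME])
  ultimately show "x \<in> \<Union>?\<M>" using M(3) by blast
 qed
qed

text \<open>An automorphism over K1 K2 that is inert, or in a decomposition group at infinity, on M
  K2 is so on M; hence it is trivial on M, and it fixes K2 anyway.\<close>

lemma genus_pieces_un:
 assumes K: "ab kk K1" "ab kk K2" and M: "ab kk M" "piece K1 M"
 shows "ab kk (gen (M Un K2))" "piece (gen (K1 Un K2)) (gen (M Un K2))"
proof -
 define K where "K = gen (K1 Un K2)"
 define N where "N = gen (M Un K2)"
 have p: "ab K1 M" "fingen K1 M" "triv K1 M" using M(2) unfolding piece_def by auto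
 note K1M = ab_basic(3)[OF p(1)]
 show abN: "ab kk (gen (M Un K2))" by (rule ab_un[OF M(1) K(2)])
 have KN: "fld K" "K <= N" "kk <= K" unfolding K_def N_def using fld_gen fld_kk_sub[OF fld_gen] K1M by (auto intro!: gen_mono)
 have abKN: "ab K N" using ab_sub(2)[OF abN KN(1,3)] KN(2) unfolding N_def by blast
 obtain S where S: "finite S" "M = gen (K1 Un S)" by (rule fingenE[OF p(2)])
 have "N = gen (K Un S)"
 proof
  have "S <= M" unfolding S(2) using gen_incl by blast
  hence "S <= N" unfolding N_def using gen_incl[of "M Un K2"] by blast
  thus "gen (K Un S) <= N" using KN(2) fld_gen unfolding N_def by (intro gen_least) auto
  have "M <= gen (K Un S)" unfolding S(2) K_def
   by (intro gen_least fld_gen) (use gen_incl[of "K1 Un K2"] gen_incl[of "gen (K1 Un K2) Un S"] in blast)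
  moreover have "K2 <= gen (K Un S)" unfolding K_def using gen_incl[of "K1 Un K2"] gen_incl[of "gen (K1 Un K2) Un S"] by blast
  ultimately show "N <= gen (K Un S)" unfolding N_def by (intro gen_least fld_gen) blast
 qed
 hence "fingen K N" unfolding fingen_def using S(1) by blast
 moreover have "triv K N" unfolding triv_def
 proof (intro ballI allI impI)
  fix sg W x assume s: "sg \<in> aut K" and W: "prm W" and x: "x \<in> N"
   and d: "inert W N sg \<or> W Int kk = P_infinity & decomp W N sg"
  have sub: "M <= N" "K1 <= K" "K2 <= K" unfolding N_def K_def using gen_incl by blast+
  have s1: "sg \<in> aut K1" by (rule aut_mono[OF sub(2) s])
  have "ALL x:M. sg x = x"
   using d inert_mono[OF _ sub(1)] decomp_mono[OF _ sub(1)] trivD1[OF p(3) s1 W] trivD2[OF p(3) s1 W] by blast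
  moreover have "ALL x:K2. sg x = x" using aut_fixes[OF s] sub(3) by blast
  ultimately show "sg x = x" by (rule fix_un[OF aut_mono[OF KN(3) s]]) (use x in "simp add: N_def")
 qed
 ultimately show "piece (gen (K1 Un K2)) (gen (M Un K2))" using abKN unfolding piece_def K_def N_def by blast
qed


subsection \<open>The primes of the constant field extension\<close>

text \<open>As t is transcendental over the constants, 1/t is not in \<open>FF\<close>[t], and
  Chevalley's theorem gives a prime at which 1/t is not integral.\<close>

lemma place_ex:
 assumes t: "t ~: FF"
 obtains W where "prm W" "t \<in> mx W"
proof -
 have tr: "f = 0" if "pk FF f" "poly f t = 0" for f using FF_root[OF that(1) _ that(2)] t by blast
 define R where "R = {poly f t | f. pk FF f}"
 have R: "rng R" unfolding rng_def
 proof (intro conjI ballI)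
  show "1 \<in> R" unfolding R_def using pkF_1 by (intro CollectI exI[of _ 1]) simp
  fix x assume "x \<in> R"
  then obtain f where f: "pk FF f" "x = poly f t" unfolding R_def by blast
  have "- x = poly (Polynomial.smult (-1) f) t" unfolding f(2) by simp
  thus "- x \<in> R" unfolding R_def using pkF_smult[OF FF_minus[OF FF_1] f(1)] by blast
  fix y assume "y \<in> R"
  then obtain g where g: "pk FF g" "y = poly g t" unfolding R_def by blast
  have "x + y = poly (f + g) t" "x * y = poly (f * g) t" unfolding f(2) g(2) by simp_all
  thus "x + y \<in> R" "x * y \<in> R" unfolding R_def using pkF_add[OF f(1) g(1)] pkF_mult[OF f(1) g(1)] by blast+
 qed
 have t0: "t ~= 0" using t FF_0 by auto
 have pX: "pk FF [:0, 1:]" using FF_0 FF_1 pkF_0 by (intro pkF_pCons) auto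
 have tR: "t \<in> R" unfolding R_def using pX by (intro CollectI exI[of _ "[:0, 1:]"]) simp
 have "inverse t ~: R"
 proof
  assume "inverse t \<in> R"
  then obtain f where f: "pk FF f" "inverse t = poly f t" unfolding R_def by blast
  have "pk FF (pCons (-1) f)" by (rule pkF_pCons[OF FF_minus[OF FF_1] f(1)])
  moreover have "poly (pCons (-1) f) t = 0" using t0 by (simp flip: f(2))
  ultimately have "pCons (-1) f = 0" by (rule tr)
  thus False by simp
 qed
 from chevalley[OF R tR t0 this] obtain W where W: "prm W" "R <= W" "inverse t ~: W" .
 show thesis by (rule that[OF W(1)]) (use W tR in "auto simp: mx_iff")
qed

lemma val_uniformizer:
 assumes W: "prm W" and t: "t \<in> mx W" "t ~= 0" "fracs t = kbar" shows "val W t = 1"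
proof -
 have u: "unif W \<in> kbar" "unif W ~= 0" using unif(2,3)[OF W] self_fracs[of "unif W"] by auto
 obtain e where e: "unt W (unif W / t powi e)" by (rule kbar_unit_part[OF W t u])
 have "t powi e ~= 0" using t(2) by simp
 hence "1 = of_int e * val W t"
  using val_unt[OF W e] val_divide[OF W u(2), of "t powi e"] val_unif[OF W] val_power_int[OF W t(2), of e] by simp
 moreover obtain d :: int where d: "val W t = of_int d" by (rule val_kbar_int[OF W _ t(2)]) (use t(3) self_fracs in blast)
 ultimately have "(of_int (e * d) :: rat) = of_int 1" by simp
 hence "e * d = 1" unfolding of_int_eq_iff .
 moreover have "d > 0" using val_pos[OF W t(1,2)] unfolding d by simp
 ultimately have "d = 1" using zmult_eq_1_iff by auto
 thus ?thesis using d by simp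
qed

lemma TT_nz: "TT - al ~= 0" if "al \<in> FF" for al :: "'q::{field,finite} om" using that TT_notin_FF by auto

lemma TT_0: "TT ~= (0 :: 'q::{field,finite} om)" using TT_nz[OF FF_0] by simp

lemma fracs_TT_minus: "al \<in> FF ==> fracs (TT - al) = kbar" using FF_shift_fracs[of al TT] unfolding kbar_def .

lemma fracs_TT_inv: "fracs (inverse TT) = kbar" unfolding kbar_def by (rule fracs_inverse_TT)

lemma val_TT_minus: "prm W ==> al \<in> FF ==> TT - al \<in> mx W ==> val W (TT - al) = 1"
 using val_uniformizer[of W "TT - al"] TT_nz[of al] fracs_TT_minus[of al] by blast

lemma finite_place_ex:
 assumes "al \<in> FF"
 obtains W where "prm W" "TT - al \<in> mx W"
proof (rule place_ex)
 show "TT - al ~: FF" using FF_add[OF _ assms, of "TT - al"] TT_notin_FF by auto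
qed

lemma mx_shift_unt:
 assumes W: "prm W" and t: "TT - al \<in> mx W" and b: "al \<in> FF" "be \<in> FF" "be ~= al" shows "unt W (TT - be)"
proof -
 have "unt W (al - be)" by (rule FF_unt[OF W FF_diff[OF b(1,2)]]) (use b(3) in simp)
 moreover have "(al - be) - (TT - be) \<in> mx W" using mx_minus[OF prm_rng[OF W] t] by simp
 ultimately show ?thesis by (rule unt_cong[OF W])
qed

text \<open>On \<open>kbar\<close> both primes measure the order at t = 0.\<close>

lemma kbar_place_unique:
 assumes W: "prm W" "prm W'" and t: "t \<in> mx W" "t \<in> mx W'" "t ~= 0" "fracs t = kbar"
 shows "W Int kbar = W' Int kbar"
proof (rule trace_sub_eq[OF W(2,1) fld_kbar, symmetric, THEN sym])
 show "W Int kbar <= W' Int kbar"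
 proof
  fix x assume x: "x \<in> W Int kbar"
  show "x \<in> W' Int kbar"
  proof (cases "x = 0")
   case True
   thus ?thesis using rng_0[OF prm_rng[OF W(2)]] fld_0[OF fld_kbar] by simp
  next
   case False
   obtain e where e: "ALL W. prm W & t \<in> mx W --> unt W (x / t powi e)"
    by (rule kbar_unit_part_uniform[OF t(3,4)]) (use x False in auto)
   have v: "val V x = of_int e" if V: "prm V" "t \<in> mx V" for V
   proof -
    have "t powi e ~= 0" using t(3) by simp
    moreover have "val V (x / t powi e) = 0" using val_unt[OF V(1)] e V by blast
    ultimately show ?thesis using val_divide[OF V(1) False, of "t powi e"] val_power_int[OF V(1) t(3), of e]
      val_uniformizer[OF V t(3,4)] by simp
   qed
   have "val W x \<ge> 0" using val_nonneg_iff[OF W(1) False] x by blast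
   hence "val W' x \<ge> 0" using v[OF W(1) t(1)] v[OF W(2) t(2)] by simp
   thus ?thesis using val_nonneg_iff[OF W(2) False] x by blast
  qed
 qed
qed

lemma kk_kbar: "kk <= kbar" using fld_kk_sub[OF fld_kbar] .

text \<open>Reversing the coefficients writes f(T) as T^(dg f) times a polynomial in 1/T whose
  constant term is the leading coefficient of f, a unit.\<close>

lemma val_poly_inf:
 fixes W :: "'q::{field,finite} om set"
 assumes W: "prm W" "TT ~: W" and f: "pk FF f" "f ~= 0" shows "poly f TT ~= 0" "val W (poly f TT) = - of_nat (dg f)"
proof -
 note r = prm_rng[OF W(1)]
 show nz: "poly f TT ~= 0" using TT_trans[OF f(1)] f(2) by blast
 define i :: "'q om" where "i = inverse TT"
 have i: "i \<in> mx W" unfolding i_def by (rule prm_cases[OF W])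
 have i0: "i ~= 0" unfolding i_def using TT_0 by simp
 have "pk FF (reflect_poly f)" using f(1) FF_0 unfolding pk_def by (auto simp: coeff_reflect_poly)
 hence "pk W (reflect_poly f)" using pk_mono FF_sub_prm[OF W(1)] by blast
 hence "poly (reflect_poly f) 0 - poly (reflect_poly f) i \<in> mx W"
  by (rule poly_cong[OF W(1) _ rng_0[OF r] _ mx_sub[OF i]]) (use mx_minus[OF r i] in simp)
 moreover have "poly (reflect_poly f) 0 = Polynomial.lead_coeff f" by (simp add: poly_0_coeff_0)
 moreover have "unt W (Polynomial.lead_coeff f)" by (rule FF_unt[OF W(1)]) (use f in "auto simp: pk_def")
 ultimately have u: "unt W (poly (reflect_poly f) i)" using unt_cong[OF W(1)] by metis
 have "poly (reflect_poly f) i = i ^ dg f * poly f TT" using poly_reflect_poly_nz[OF i0, of f] unfolding i_def by simp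
 hence "0 = val W (i ^ dg f * poly f TT)" using val_unt[OF W(1) u] by simp
 also have "\<dots> = of_nat (dg f) * val W i + val W (poly f TT)"
  using val_mult[OF W(1) _ nz, of "i ^ dg f"] val_power[OF W(1) i0, of "dg f"] i0 by simp
 also have "val W i = 1" unfolding i_def by (rule val_uniformizer[OF W(1) prm_cases[OF W] _ fracs_TT_inv]) (use TT_0 in simp)
 finally show "val W (poly f TT) = - of_nat (dg f)" by simp
qed

lemma to_ac_Fract: "g ~= 0 ==> to_ac (Fract f g) = poly (map_poly cst f) TT / poly (map_poly cst g) TT"
proof -
 assume "g ~= 0"
 hence "Fract f g = Fract f 1 / Fract g 1" by simp
 thus ?thesis by (simp only: to_ac_divide to_ac_poly)
qed

lemma pk_cst: "pk FF (map_poly cst f)" "dg (map_poly cst f) = dg f" "map_poly cst f = 0 \<longleftrightarrow> f = 0"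
proof -
 have z: "cst x = 0 \<longleftrightarrow> x = 0" for x :: 'a by (metis cst_eq_iff cst_simps(1))
 show "pk FF (map_poly cst f)" using range_cst_FF FF_0 unfolding pk_def by (auto simp: coeff_map_poly cst_simps)
 show "dg (map_poly cst f) = dg f" by (rule degree_map_poly) (simp add: z)
 show "map_poly cst f = 0 \<longleftrightarrow> f = 0" by (rule map_poly_eq_0_iff) (simp_all add: z)
qed

lemma inf_prime_trace:
 fixes W :: "'q::{field,finite} om set"
 assumes W: "prm W" "TT ~: W" shows "W Int kk = P_infinity"
proof -
 have *: "to_ac (Fract f g) \<in> W \<longleftrightarrow> dg f \<le> dg g" if g: "g ~= 0" "f ~= 0" for f g :: "'q poly"
 proof -
  note vf = val_poly_inf[OF W pk_cst(1)[of f]] and vg = val_poly_inf[OF W pk_cst(1)[of g]]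
  have v: "val W (to_ac (Fract f g)) = of_nat (dg g) - of_nat (dg f)"
   using vf vg val_divide[OF W(1)] g unfolding to_ac_Fract[OF g(1)] by (simp add: pk_cst(2,3))
  have "to_ac (Fract f g) ~= 0" using vf vg g unfolding to_ac_Fract[OF g(1)] by (simp add: pk_cst(3))
  from val_nonneg_iff[OF W(1) this] show ?thesis unfolding v by simp
 qed
 show ?thesis
 proof
  show "W Int kk <= P_infinity"
  proof
   fix x assume x: "x \<in> W Int kk"
   then obtain r where r: "x = to_ac r" unfolding ratfun_field_def by blast
   obtain f g where fg: "r = Fract f g" "g ~= 0" by (cases r) auto
   have "dg f \<le> dg g" using *[OF fg(2), of f] x unfolding r fg(1) by (cases "f = 0") auto
   thus "x \<in> P_infinity" unfolding P_infinity_def r fg(1) using fg(2) by blast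
  qed
  show "P_infinity <= W Int kk"
  proof
   fix x :: "'q om" assume "x \<in> P_infinity"
   then obtain f g where fg: "x = to_ac (Fract f g)" "g ~= 0" "dg f \<le> dg g" unfolding P_infinity_def by blast
   have "x \<in> W"
   proof (cases "f = 0")
    case True
    thus ?thesis unfolding fg(1) to_ac_Fract[OF fg(2)] using rng_0[OF prm_rng[OF W(1)]] by simp
   next
    case False
    thus ?thesis unfolding fg(1) using *[OF fg(2) False] fg(3) by blast
   qed
   thus "x \<in> W Int kk" unfolding fg(1) ratfun_field_def by blast
  qed
 qed
qed

lemma inf_place_ex:
 obtains W :: "'q::{field,finite} om set" where "prm W" "TT ~: W"
proof -
 have "(inverse TT :: 'q om) ~: FF" using FF_inverse[of "inverse TT"] TT_notin_FF by auto
 from place_ex[OF this] obtain W :: "'q om set" where W: "prm W" "inverse TT \<in> mx W" .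
 show thesis by (rule that[OF W(1)]) (use W(2) TT_0 in "auto simp: mx_iff")
qed

subsection \<open>Roots of unity and eigenvectors\<close>

definition prim_root :: "nat => 'a::field => bool"
 where "prim_root m ze \<longleftrightarrow> (ALL k. ze ^ k = 1 \<longleftrightarrow> m dvd k)"

lemma prim_root_iff: "prim_root m ze ==> ze ^ k = 1 \<longleftrightarrow> m dvd k" unfolding prim_root_def by simp

lemma prim_root_power_m: "prim_root m ze ==> ze ^ m = 1" using prim_root_iff[of m ze m] by simp

lemma prim_root_nz: "prim_root m ze ==> m > 0 ==> ze ~= 0" using prim_root_power_m[of m ze] by (auto simp: power_0_left)

lemma ell_root_ex:
 fixes l :: nat
 assumes "Factorial_Ring.prime l" "of_nat l ~= (0 :: 'a::alg_closed_field)"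
 obtains et :: "'a::alg_closed_field" where "prim_root l et"
proof -
 have l: "l > 1" using assms(1) prime_gt_1_nat by blast
 define f :: "'a poly" where "f = (\<Sum>i<l. Polynomial.monom 1 i)"
 have pf: "poly f x = (\<Sum>i<l. x ^ i)" for x unfolding f_def by (simp add: poly_sum poly_monom)
 have c: "cf f i = (if i < l then 1 else 0)" for i unfolding f_def by (simp add: coeff_sum)
 have "dg f \<ge> 1" using l by (intro le_degree) (simp add: c)
 then obtain et where e: "poly f et = 0" using alg_closed_imp_poly_has_root[of f] by force
 have "(et - 1) * poly f et = et ^ l - 1" unfolding pf by (rule power_diff_1_eq[symmetric])
 hence el: "et ^ l = 1" using e by simp
 have e1: "et ~= 1" using e assms(2) unfolding pf by auto
 have "et ^ k = 1 \<longleftrightarrow> l dvd k" for k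
 proof
  assume k: "et ^ k = 1"
  show "l dvd k"
  proof (rule ccontr)
   assume "\<not> l dvd k"
   hence "coprime l k" using assms(1) prime_imp_coprime by blast
   then obtain a b where ab: "l * a = k * b + 1 \<or> k * a = l * b + 1"
    using coprime_bezout_strong[of l k] l by (metis coprime_bezout_strong coprime_commute less_irrefl)
   have "et ^ (l * a) = 1" "et ^ (k * b) = 1" "et ^ (k * a) = 1" "et ^ (l * b) = 1" using el k by (simp_all add: power_mult)
   thus False using ab e1 by (metis mult_1 power_add power_one_right)
  qed
 next
  assume "l dvd k"
  thus "et ^ k = 1" using el by (auto simp: power_mult)
 qed
 hence "prim_root l et" unfolding prim_root_def by simp
 thus thesis by (rule that)
qed

text \<open>Induction along m = l n with l prime: if l divides n, an l-th root of a primitive n-th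
  root of unity is primitive of order m; otherwise primitive roots of the coprime orders l and n are
  multiplied.\<close>

lemma prim_root_ex:
 fixes m :: nat
 assumes "m > 0" "of_nat m ~= (0 :: 'a::alg_closed_field)"
 obtains ze :: "'a::alg_closed_field" where "prim_root m ze"
proof -
 have "EX ze :: 'a. prim_root m ze" using assms
 proof (induction m rule: less_induct)
  case (less m)
  show ?case
  proof (cases "m = 1")
   case True
   thus ?thesis unfolding prim_root_def by (intro exI[of _ 1]) simp
  next
   case False
   then obtain l where l: "Factorial_Ring.prime l" "l dvd m" using prime_factor_nat by blast
   then obtain n where n: "m = l * n" by blast
   have l1: "l > 1" using l(1) prime_gt_1_nat by blast
   have nz: "of_nat l ~= (0::'a)" "of_nat n ~= (0::'a)" "n > 0" "n < m" using less.prems l1 unfolding n by auto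
   obtain xi :: 'a where x: "prim_root n xi" using less.IH[OF nz(4,3,2)] by blast
   show ?thesis
   proof (cases "l dvd n")
    case True
    then obtain n' where n': "n = l * n'" by blast
    obtain ze where z: "ze ^ l = xi" using nth_root_exists[of l xi] l1 by auto
    have "ze ^ k = 1 \<longleftrightarrow> m dvd k" for k
    proof
     assume k: "ze ^ k = 1"
     have "xi ^ k = 1" using k unfolding z[symmetric] by (metis power_mult mult.commute power_one)
     then obtain j where j: "k = n * j" using prim_root_iff[OF x] by blast
     have "xi ^ (n' * j) = 1" using k unfolding j n' z[symmetric] by (simp add: mult.assoc flip: power_mult)
     hence "n dvd n' * j" using prim_root_iff[OF x] by blast
     hence "l dvd j" unfolding n' using nz(3) n' by simp
     thus "m dvd k" unfolding n j by (metis mult.commute mult_dvd_mono dvd_refl)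
    next
     assume "m dvd k"
     then obtain j where j: "k = l * n * j" unfolding n by (rule dvdE)
     show "ze ^ k = 1" unfolding j using prim_root_power_m[OF x] by (simp add: power_mult z)
    qed
    hence "prim_root m ze" unfolding prim_root_def by simp
    thus ?thesis ..
   next
    case False
    hence cop: "coprime l n" using l(1) prime_imp_coprime by blast
    obtain et :: 'a where e: "prim_root l et" by (rule ell_root_ex[OF l(1) nz(1)])
    have "(xi * et) ^ k = 1 \<longleftrightarrow> m dvd k" for k
    proof
     assume k: "(xi * et) ^ k = 1"
     have "((xi * et) ^ k) ^ n = xi ^ (k * n) * et ^ (k * n)" by (simp add: power_mult_distrib power_mult)
     moreover have "xi ^ (k * n) = 1" using prim_root_iff[OF x, of "k * n"] by simp
     ultimately have "et ^ (k * n) = 1" using k by simp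
     hence "l dvd k * n" using prim_root_iff[OF e] by blast
     hence 1: "l dvd k" using cop coprime_dvd_mult_left_iff by blast
     have "((xi * et) ^ k) ^ l = xi ^ (k * l) * et ^ (k * l)" by (simp add: power_mult_distrib power_mult)
     moreover have "et ^ (k * l) = 1" using prim_root_iff[OF e, of "k * l"] by simp
     ultimately have "xi ^ (k * l) = 1" using k by simp
     hence "n dvd k * l" using prim_root_iff[OF x] by blast
     hence "n dvd k" using cop coprime_commute coprime_dvd_mult_left_iff by blast
     thus "m dvd k" unfolding n using 1 cop divides_mult by blast
    next
     assume "m dvd k"
     hence "n dvd k" "l dvd k" unfolding n by (auto dest: dvd_mult_left dvd_mult_right)
     thus "(xi * et) ^ k = 1" using prim_root_iff[OF x, of k] prim_root_iff[OF e, of k] unfolding power_mult_distrib by simp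
    qed
    hence "prim_root m (xi * et)" unfolding prim_root_def by simp
    thus ?thesis ..
   qed
  qed
 qed
 thus thesis using that by blast
qed

lemma prim_root_inj:
 assumes z: "prim_root m ze" "m > 0" shows "inj_on (%j. ze ^ j) {..<m}"
proof -
 have "a = b" if ab: "a < m" "b < m" "a \<le> b" "ze ^ a = ze ^ b" for a b
 proof -
  have "ze ^ b = ze ^ a * ze ^ (b - a)" using ab(3) by (simp flip: power_add)
  hence "ze ^ (b - a) = 1" using ab(4) prim_root_nz[OF z] by simp
  hence "m dvd b - a" using prim_root_iff[OF z(1)] by blast
  thus ?thesis using ab nat_dvd_not_less[of "b - a" m] by force
 qed
 thus ?thesis by (intro inj_onI) (metis lessThan_iff nat_le_linear)
qed

lemma unity_powers:
 fixes ze :: "'a::field"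
 assumes z: "prim_root m ze" "m > 0" and c: "c ^ m = 1"
 obtains j where "c = ze ^ j"
proof -
 define f :: "'a poly" where "f = Polynomial.monom 1 m - 1"
 have pf: "poly f x = 0 \<longleftrightarrow> x ^ m = 1" for x unfolding f_def by (simp add: poly_monom)
 have "cf f m = 1" unfolding f_def using z(2) by simp
 hence f0: "f ~= 0" by auto
 have "dg f \<le> m" unfolding f_def by (intro degree_diff_le) (auto simp: degree_monom_le)
 hence "card {x. poly f x = 0} \<le> m" using card_poly_roots_bound[OF f0] by simp
 moreover have "(ze ^ j) ^ m = 1" for j using prim_root_power_m[OF z(1)] by (metis power_mult mult.commute power_one)
 hence "(%j. ze ^ j) ` {..<m} <= {x. poly f x = 0}" unfolding pf by blast
 moreover have "card ((%j. ze ^ j) ` {..<m}) = m" using card_image[OF prim_root_inj[OF z]] by simp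
 ultimately have "(%j. ze ^ j) ` {..<m} = {x. poly f x = 0}" using poly_roots_finite[OF f0] by (intro card_seteq) auto
 moreover have "c \<in> {x. poly f x = 0}" using pf c by blast
 ultimately show thesis using that by blast
qed

text \<open>Lagrange resolvents of a sequence with \<open>v m = v 0\<close>: they add up to m times
  the initial term, and a shift multiplies the j-th one by ze^(-j), written as ze^((m-1) j) to keep
  natural exponents.\<close>

lemma eigen_sum:
 fixes ze :: "'a::field"
 assumes z: "prim_root m ze" "m > 0" and v: "v m = (v 0 :: 'a)" shows "(\<Sum>j<m. \<Sum>k<m. ze ^ (j * k) * v k) = of_nat m * v 0"
  and "(\<Sum>k<m. ze ^ (j * k) * v (Suc k)) = ze ^ ((m - 1) * j) * (\<Sum>k<m. ze ^ (j * k) * v k)"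
proof -
 have "(\<Sum>j<m. ze ^ (j * k)) = (if k = 0 then of_nat m else 0)" if k: "k < m" for k
 proof (cases "k = 0")
  case False
  have "\<not> m dvd k" using k False nat_dvd_not_less by blast
  hence n1: "ze ^ k ~= 1" using prim_root_iff[OF z(1)] by blast
  have "(ze ^ k - 1) * (\<Sum>j<m. (ze ^ k) ^ j) = (ze ^ k) ^ m - 1" by (rule power_diff_1_eq[symmetric])
  also have "\<dots> = 0" using prim_root_power_m[OF z(1)] by (simp add: mult.commute[of k] power_mult flip: power_mult[of _ k])
  finally have "(\<Sum>j<m. (ze ^ k) ^ j) = 0" using n1 by simp
  thus ?thesis using False by (simp add: power_mult mult.commute flip: power_mult)
 qed simp
 hence s: "(\<Sum>k<m. (\<Sum>j<m. ze ^ (j * k)) * v k) = (\<Sum>k<m. if k = 0 then of_nat m * v 0 else 0)" by (intro sum.cong) auto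
 have "(\<Sum>j<m. \<Sum>k<m. ze ^ (j * k) * v k) = (\<Sum>k<m. (\<Sum>j<m. ze ^ (j * k)) * v k)"
  unfolding sum_distrib_right by (rule sum.swap)
 thus "(\<Sum>j<m. \<Sum>k<m. ze ^ (j * k) * v k) = of_nat m * v 0" unfolding s using z(2) by simp
 define w where "w k = ze ^ (j * k) * v k" for k
 have "w m = w 0" unfolding w_def v using prim_root_power_m[OF z(1)] by (simp add: mult.commute[of j] power_mult)
 moreover have "(\<Sum>k<m. w (Suc k)) + w 0 = (\<Sum>k<m. w k) + w m"
  using sum.lessThan_Suc_shift[of w m] sum.lessThan_Suc[of w m] by (simp add: add.commute)
 ultimately have e: "(\<Sum>k<m. w (Suc k)) = (\<Sum>k<m. w k)" by simp
 have "(m - 1) * j + j = m * j" using z(2) by (cases m) simp_all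
 hence "ze ^ ((m - 1) * j) * ze ^ j = ze ^ (m * j)" by (simp only: power_add[symmetric])
 also have "\<dots> = 1" using prim_root_power_m[OF z(1)] by (simp add: power_mult)
 finally have "ze ^ ((m - 1) * j) * ze ^ j = 1" .
 hence "v (Suc k) * ze ^ (j * k) = ze ^ ((m - 1) * j) * w (Suc k)" for k unfolding w_def by (simp add: power_add mult_ac)
 hence "(\<Sum>k<m. ze ^ (j * k) * v (Suc k)) = ze ^ ((m - 1) * j) * (\<Sum>k<m. w k)"
  unfolding e[symmetric] sum_distrib_left by (simp add: mult.commute)
 thus "(\<Sum>k<m. ze ^ (j * k) * v (Suc k)) = ze ^ ((m - 1) * j) * (\<Sum>k<m. ze ^ (j * k) * v k)" unfolding w_def .
qed

definition eig :: "'a::field => ('a => 'a) set => 'a => bool"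
 where "eig ze S y \<longleftrightarrow> (ALL g:S. EX j. g y = ze ^ j * y)"

lemma funpow_commute: "g \<in> aut F ==> h \<in> aut F ==> ab F L ==> y \<in> L ==> h ((g ^^ k) y) = (g ^^ k) (h y)"
 using ab_commute[of F L h "g ^^ k" y] aut_funpow by blast

text \<open>Finitely many representatives of the group are diagonalised one at a time. The
  resolvents of y with respect to g are eigenvectors of g and, by commutativity, remain eigenvectors
  of the automorphisms already treated; y is their average.\<close>

theorem eigenvectors_generate:
 fixes L :: "'q::{field,finite} om set"
 assumes ab: "ab F L" "fingen F L" and m: "m > 0" "of_nat m ~= (0 :: 'q om)"
  and ex: "ALL g:aut F. ALL y:L. (g ^^ m) y = y" and z: "prim_root m ze" "ze \<in> F" and N: "fld N"
  and e: "ALL y:L. eig ze (aut F) y --> y \<in> N" shows "L <= N"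
proof -
 note L = ab_basic(2)[OF ab(1)]
 have zj: "ze ^ j \<in> F" "ze ^ j \<in> L" for j using fld_power[OF ab_basic(1)[OF ab(1)] z(2)] ab_basic(3)[OF ab(1)] by blast+
 have nL: "inverse (of_nat m) \<in> L" by (rule fld_inverse[OF L fld_of_nat[OF L]])
 obtain R where R: "finite R" "R <= aut F" "ALL h:aut F. EX r:R. ALL x:L. h x = r x"
  by (rule representatives[OF ab_basic(1)[OF ab(1)] ab(2) order_refl])
 have "(ALL y:L. eig ze S y --> y \<in> N) --> L <= N" if "finite S" "S <= aut F" for S using that
 proof (induction S rule: finite_induct)
  case empty
  thus ?case unfolding eig_def by blast
 next
  case (insert g S)
  have g: "g \<in> aut F" and S: "S <= aut F" using insert.prems by auto
  show ?case
  proof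
   assume A: "ALL y:L. eig ze (insert g S) y --> y \<in> N"
   have "y \<in> N" if y: "y \<in> L" "eig ze S y" for y
   proof -
    define v where "v k = (g ^^ k) y" for k
    have vL: "v k \<in> L" for k unfolding v_def by (rule ab_normal[OF ab(1) aut_funpow[OF g] y(1)])
    define w where "w j = (\<Sum>k<m. ze ^ (j * k) * v k)" for j
    have wL: "w j \<in> L" for j unfolding w_def by (rule fld_sum[OF L], rule fld_mult[OF L zj(2) vL])
    have vm: "v m = v 0" unfolding v_def using ex g y(1) by simp
    have gw: "g (w j) = ze ^ ((m - 1) * j) * w j" for j
    proof -
     have "g (w j) = (\<Sum>k<m. ze ^ (j * k) * v (Suc k))" unfolding w_def aut_sum[OF g] aut_mult[OF g] aut_fixes[OF g zj(1)] v_def by simp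
     thus ?thesis using eigen_sum(2)[OF z(1) m(1) vm] unfolding w_def by simp
    qed
    have "EX i. h (w j) = ze ^ i * w j" if h: "h \<in> S" for h j
    proof -
     have ha: "h \<in> aut F" using h S by blast
     obtain i where i: "h y = ze ^ i * y" using y(2) h unfolding eig_def by blast
     have "h (v k) = ze ^ i * v k" for k
      unfolding v_def funpow_commute[OF g ha ab(1) y(1)] i aut_mult[OF aut_funpow[OF g]] aut_fixes[OF aut_funpow[OF g] zj(1)] ..
     hence "h (w j) = ze ^ i * w j"
      unfolding w_def aut_sum[OF ha] aut_mult[OF ha] aut_fixes[OF ha zj(1)] sum_distrib_left by (simp add: mult.left_commute)
     thus ?thesis by blast
    qed
    hence "eig ze (insert g S) (w j)" for j using gw unfolding eig_def by blast
    hence "w j \<in> N" for j using A wL by blast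
    hence "(\<Sum>j<m. w j) \<in> N" by (intro fld_sum[OF N])
    hence "inverse (of_nat m) * (\<Sum>j<m. w j) \<in> N" by (intro fld_mult[OF N] fld_inverse[OF N] fld_of_nat[OF N])
    moreover have "(\<Sum>j<m. w j) = of_nat m * y" unfolding w_def eigen_sum(1)[OF z(1) m(1) vm] by (simp add: v_def)
    ultimately show ?thesis using m(2) by (simp add: mult.assoc[symmetric])
   qed
   thus "L <= N" using insert.IH S by blast
  qed
 qed
 moreover have "ALL y:L. eig ze R y --> y \<in> N"
 proof (intro ballI impI)
  fix y assume y: "y \<in> L" "eig ze R y"
  have "eig ze (aut F) y" unfolding eig_def
  proof
   fix g :: "'q om => 'q om" assume "g \<in> aut F"
   then obtain r where "r \<in> R" "g y = r y" using R(3) y(1) by blast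
   thus "EX j. g y = ze ^ j * y" using y(2) unfolding eig_def by metis
  qed
  thus "y \<in> N" using e y(1) by blast
 qed
 ultimately show ?thesis using R(1,2) by blast
qed

subsection \<open>Exponents\<close>

definition expo :: "nat => 'q::{field,finite} om set => bool"
 where "expo n L \<longleftrightarrow> (ALL g:aut kk. ALL y:L. (g ^^ n) y = y)"

lemma funpow_fix: "f y = y ==> (f ^^ k) y = y" by (induction k) auto

lemma funpow_dvd_fix:
 assumes "(f ^^ d) y = y" "d dvd n" shows "(f ^^ n) y = y"
proof -
 obtain k where "n = d * k" using assms(2) by blast
 thus ?thesis using funpow_fix[of "f ^^ d" y k] assms(1) by (simp add: funpow_mult)
qed

lemma expo_dvd: "expo d L ==> d dvd n ==> expo n L" unfolding expo_def using funpow_dvd_fix by metis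

lemma funpow_coprime_fix:
 assumes "(f ^^ a) y = y" "(f ^^ b) y = y" "coprime a b" "a > 0" shows "f y = y"
proof -
 obtain i j where ij: "a * i = b * j + gcd a b" using bezout_nat[of a b] assms(4) by auto
 have "(f ^^ (a * i)) y = y" "(f ^^ (b * j)) y = y" using assms(1,2) funpow_dvd_fix by (metis dvd_triv_left)+
 moreover have "(f ^^ (a * i)) y = f ((f ^^ (b * j)) y)" using assms(3) by (simp add: ij)
 ultimately show ?thesis by simp
qed

lemma expo_gen:
 assumes "expo n K" "expo n L" shows "expo n (gen (K Un L))" unfolding expo_def
proof (intro ballI)
 fix g :: "'a om => 'a om" and x assume g: "g \<in> aut kk" and x: "x \<in> gen (K Un L)"
 show "(g ^^ n) x = x" by (rule fix_un[OF aut_funpow[OF g] _ _ x]) (use assms g in "auto simp: expo_def")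
qed

lemma funpow_comp_ab:
 assumes L: "ab F L" and g: "g \<in> aut F" "h \<in> aut F" and x: "x \<in> L" shows "((g \<circ> h) ^^ n) x = (g ^^ n) ((h ^^ n) x)"
proof (induction n)
 case (Suc n)
 have "h ((g ^^ n) ((h ^^ n) x)) = (g ^^ n) (h ((h ^^ n) x))"
  by (rule ab_commute[OF L g(2) aut_funpow[OF g(1)] ab_normal[OF L aut_funpow[OF g(2)] x]])
 thus ?case using Suc by simp
qed simp

lemma funpow_agree:
 assumes M: "ab F M" and s: "sg \<in> aut F" "ALL x:M. sg x = f x" and x: "x \<in> M" shows "(sg ^^ k) x = (f ^^ k) x"
proof (induction k)
 case (Suc k)
 have "(sg ^^ k) x \<in> M" by (rule ab_normal[OF M aut_funpow[OF s(1)] x])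
 thus ?case using s(2) Suc by simp
qed simp

text \<open>The subgroup of n-th powers in Gal(B/k); its fixed field in B is the largest subfield of
  exponent n.\<close>

definition powers :: "nat => 'q::{field,finite} om set => ('q om => 'q om) set"
 where "powers n B = {h\<in>aut kk. EX g:aut kk. ALL x:B. h x = (g ^^ n) x}"

lemma powers_I: "g \<in> aut kk ==> g ^^ n \<in> powers n B" unfolding powers_def using aut_funpow by blast

lemma subgrp_powers:
 fixes B :: "'q::{field,finite} om set"
 assumes B: "ab kk B" shows "powers n B <= aut kk" "subgrp (powers n B)" "ALL h:powers n B. h ` B <= B"
proof -
 show 1: "powers n B <= aut kk" unfolding powers_def by blast
 show "ALL h:powers n B. h ` B <= B" using 1 ab_stable[OF B] by blast
 have "(%x. x) \<in> powers n B"
  unfolding powers_def using aut_id(2)[of kk] funpow_fix[of "%x::'q om. x", OF refl, of n] by (auto intro!: bexI[of _ "%x. x"])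
 moreover have "h1 \<circ> h2 \<in> powers n B" if h: "h1 \<in> powers n B" "h2 \<in> powers n B" for h1 h2
 proof -
  obtain g1 g2 where g: "g1 \<in> aut kk" "g2 \<in> aut kk" "ALL x:B. h1 x = (g1 ^^ n) x" "ALL x:B. h2 x = (g2 ^^ n) x"
   using h unfolding powers_def by blast
  have "(h1 \<circ> h2) x = ((g1 \<circ> g2) ^^ n) x" if x: "x \<in> B" for x
   using funpow_comp_ab[OF B g(1,2) x, of n] g(3,4) x ab_normal[OF B aut_funpow[OF g(2)] x] by simp
  moreover have "h1 \<circ> h2 \<in> aut kk" "g1 \<circ> g2 \<in> aut kk" using h 1 g(1,2) aut_comp by blast+
  ultimately show ?thesis unfolding powers_def by blast
 qed
 ultimately show "subgrp (powers n B)" unfolding subgrp_def by blast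
qed

lemma fingen_kk:
 assumes "fingen kk M"
 obtains S where "finite S" "M = gen S"
proof -
 obtain S where S: "finite S" "M = gen (kk Un S)" by (rule fingenE[OF assms])
 have "gen (kk Un S) <= gen S" by (rule gen_least[OF fld_gen]) (use fld_kk_sub[OF fld_gen, of S] gen_incl[of S] in blast)
 hence "gen (kk Un S) = gen S" using gen_mono[of S "kk Un S"] by blast
 thus thesis using S that by simp
qed

lemma artin_kk:
 assumes B: "ab kk B" "fingen kk B" and H: "H <= aut kk" "subgrp H" and s: "sg \<in> aut kk" "ALL x:Fix H B. sg x = x"
 obtains h where "h \<in> H" "ALL x:B. sg x = h x"
proof -
 obtain S where S: "finite S" "B = gen S" by (rule fingen_kk[OF B(2)])
 show thesis
 proof (rule artin[OF S(1) H _ s(1)])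
  fix h x assume "h \<in> H" "x \<in> S"
  thus "h x \<in> gen S" using ab_normal[OF B(1), of h x] H(1) gen_incl[of S] unfolding S(2) by blast
 qed (use s(2) that in "auto simp: S(2)")
qed

lemma power_root:
 assumes B: "ab kk B" "fingen kk B" and s: "sg \<in> aut kk" "ALL x:Fix (powers n B) B. sg x = x"
 obtains g where "g \<in> aut kk" "ALL x:B. sg x = (g ^^ n) x"
 by (rule artin_kk[OF B subgrp_powers(1,2)[OF B(1)] s]) (use that in "auto simp: powers_def")

lemma Fix_powers:
 assumes B: "ab kk B" "fingen kk B" shows "ab kk (Fix (powers n B) B)" "fingen kk (Fix (powers n B) B)" "expo n (Fix (powers n B) B)"
proof -
 have f: "fld (Fix (powers n B) B)" by (rule fld_Fix[OF ab_basic(2)[OF B(1)] subgrp_powers(1)[OF B(1)]])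
 have s: "Fix (powers n B) B <= B" unfolding Fix_def by blast
 show "ab kk (Fix (powers n B) B)" by (rule ab_sub(1)[OF B(1) f fld_kk_sub[OF f] s])
 show "fingen kk (Fix (powers n B) B)" by (rule fingen_sub[OF B f fld_kk_sub[OF f] s])
 show "expo n (Fix (powers n B) B)" unfolding expo_def Fix_def using powers_I by blast
qed

lemma expo_degree:
 fixes K :: "'q::{field,finite} om set"
 assumes K: "ab kk K" "fingen kk K" shows "ext_degree kk K > 0" "expo (ext_degree kk K) K"
proof -
 let ?r = "%f. restrict f K"
 define G where "G = \<lparr>carrier = restr kk K, monoid.mult = (%f g. ?r (f \<circ> g)), one = ?r (%x. x)\<rparr>"
 have c: "carrier G = restr kk K" unfolding G_def by simp
 have m: "?r g \<otimes>\<^bsub>G\<^esub> ?r h = ?r (g \<circ> h)" if "h \<in> aut kk" for g h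
  unfolding G_def using ab_normal[OF K(1) that] by (auto simp: restrict_def)
 have o: "\<one>\<^bsub>G\<^esub> = ?r (%x. x)" unfolding G_def by simp
 have "group G"
 proof (rule groupI)
  fix x y assume "x \<in> carrier G" "y \<in> carrier G"
  then obtain g h where "g \<in> aut kk" "h \<in> aut kk" "x = ?r g" "y = ?r h" unfolding c restr_def by blast
  thus "x \<otimes>\<^bsub>G\<^esub> y \<in> carrier G" unfolding c restr_def using m[of h g] aut_comp by auto
 next
  show "\<one>\<^bsub>G\<^esub> \<in> carrier G" unfolding o c restr_def using aut_id(2) by blast
 next
  fix x y z assume "x \<in> carrier G" "y \<in> carrier G" "z \<in> carrier G"
  then obtain g h k where g: "g \<in> aut kk" "h \<in> aut kk" "k \<in> aut kk" "x = ?r g" "y = ?r h" "z = ?r k"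
   unfolding c restr_def by blast
  show "x \<otimes>\<^bsub>G\<^esub> y \<otimes>\<^bsub>G\<^esub> z = x \<otimes>\<^bsub>G\<^esub> (y \<otimes>\<^bsub>G\<^esub> z)"
   unfolding g m[OF g(2)] m[OF g(3)] m[OF aut_comp[OF g(2,3)]] by (simp add: comp_assoc)
 next
  fix x assume "x \<in> carrier G"
  then obtain g where g: "g \<in> aut kk" "x = ?r g" unfolding c restr_def by blast
  show "\<one>\<^bsub>G\<^esub> \<otimes>\<^bsub>G\<^esub> x = x" unfolding o g(2) m[OF g(1)] by (simp add: comp_def)
  have "?r (ainv g) \<otimes>\<^bsub>G\<^esub> x = \<one>\<^bsub>G\<^esub>"
   unfolding o g(2) m[OF g(1)] using aut_inv_apply(2)[OF g(1)] by (simp add: comp_def)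
  moreover have "?r (ainv g) \<in> carrier G" unfolding c restr_def using aut_inv[OF g(1)] by blast
  ultimately show "EX y:carrier G. y \<otimes>\<^bsub>G\<^esub> x = \<one>\<^bsub>G\<^esub>" by blast
 qed
 then interpret group G .
 have d: "ext_degree kk K = Coset.order G" unfolding Coset.order_def c by (rule galois_degree(2)[OF K])
 have fin: "finite (carrier G)" unfolding c by (rule finite_restr[OF fld_kk K(2)])
 show "ext_degree kk K > 0" unfolding d using order_gt_0_iff_finite fin by blast
 show "expo (ext_degree kk K) K" unfolding expo_def
 proof (intro ballI)
  fix g :: "'q om => 'q om" and y assume g: "g \<in> aut kk" and y: "y \<in> K"
  have "?r g [^]\<^bsub>G\<^esub> (k::nat) = ?r (g ^^ k)" for k
  proof (induction k)
   case (Suc k)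
   thus ?case using m[OF g, of "g ^^ k"] by (simp only: nat_pow_Suc funpow_Suc_right)
  qed (auto simp: o id_def)
  moreover have "?r g \<in> carrier G" unfolding c restr_def using g by blast
  ultimately have "?r (g ^^ ext_degree kk K) = ?r (%x. x)" using pow_order_eq_1 unfolding d o by metis
  thus "(g ^^ ext_degree kk K) y = y" using restrict_eq_iff y by metis
 qed
qed

text \<open>Triviality on the fixed field of the a-th powers makes \<open>sg\<close> an a-th power,
  so \<open>sg^b\<close> is trivial on B; likewise \<open>sg^a\<close>, and a and b are
  coprime.\<close>

lemma split_exponent:
 assumes B: "ab kk B" "fingen kk B" and e: "expo (a * b) B" "coprime a b" "a > 0" and s: "sg \<in> aut kk"
  and A: "ALL x:Fix (powers a B) B. sg x = x" "ALL x:Fix (powers b B) B. sg x = x" and x: "x \<in> B" shows "sg x = x"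
proof -
 obtain g where g: "g \<in> aut kk" "ALL x:B. sg x = (g ^^ a) x" by (rule power_root[OF B s A(1)])
 obtain h where h: "h \<in> aut kk" "ALL x:B. sg x = (h ^^ b) x" by (rule power_root[OF B s A(2)])
 show ?thesis
 proof (rule funpow_coprime_fix[OF _ _ _ e(3)])
  show "(sg ^^ a) x = x"
   unfolding funpow_agree[OF B(1) s h(2) x] funpow_mult using e(1) h(1) x unfolding expo_def by (simp add: mult.commute)
  show "(sg ^^ b) x = x" unfolding funpow_agree[OF B(1) s g(2) x] funpow_mult using e(1) g(1) x unfolding expo_def by simp
 qed (use e(2) in simp)
qed

subsection \<open>Factorisation in the constant field extension\<close>

lemma poly_FF_factor:
 assumes "pk FF f" "f ~= 0"
 obtains A n where "finite A" "A <= FF" "poly f x = Polynomial.lead_coeff f * (\<Prod>al\<in>A. (x - al) ^ n al)"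
proof -
 obtain A where A: "f = Polynomial.smult (Polynomial.lead_coeff f) (\<Prod>a\<in>#A. [:- a, 1:])"
  using alg_closed_imp_factorization[OF assms(2)] by blast
 have e: "poly f x = Polynomial.lead_coeff f * (\<Prod>a\<in>#A. x - a)" for x by (subst A) (simp add: poly_prod_mset_linear)
 have "set_mset A <= FF"
 proof
  fix a assume "a \<in># A"
  hence "(\<Prod>b\<in>#A. a - b) = 0" by (auto simp: prod_mset_zero_iff)
  thus "a \<in> FF" using FF_root[OF assms] e[of a] by simp
 qed
 moreover have "(\<Prod>a\<in>#A. x - a) = (\<Prod>a\<in>set_mset A. (x - a) ^ count A a)" by (rule image_prod_mset_multiplicity)
 ultimately show thesis using that[of "set_mset A" "count A"] e[of x] by simp
qed

lemma kbar_factor: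
 assumes "x \<in> kbar" "x ~= 0"
 obtains c A e where "c \<in> FF" "c ~= 0" "finite A" "A <= FF" "x = c * (\<Prod>al\<in>A. (TT - al) powi e al)"
proof -
 obtain a b where ab: "pk FF a" "pk FF b" "poly b TT ~= 0" "x = poly a TT / poly b TT"
  using fracsE assms(1) unfolding kbar_def by metis
 have n0: "a ~= 0" "b ~= 0" using ab(3,4) assms(2) by auto
 obtain A n where A: "finite A" "A <= FF" "poly a TT = Polynomial.lead_coeff a * (\<Prod>al\<in>A. (TT - al) ^ n al)"
  by (rule poly_FF_factor[OF ab(1) n0(1)])
 obtain B m where B: "finite B" "B <= FF" "poly b TT = Polynomial.lead_coeff b * (\<Prod>al\<in>B. (TT - al) ^ m al)"
  by (rule poly_FF_factor[OF ab(2) n0(2)])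
 let ?e = "%al. (if al \<in> A then int (n al) else 0) - (if al \<in> B then int (m al) else 0)"
 have ext: "(\<Prod>al\<in>C. (TT - al) ^ k al) = (\<Prod>al\<in>A Un B. (TT - al) powi (if al \<in> C then int (k al) else 0))"
  if "C <= A Un B" for C k using that A(1) B(1) by (intro prod.mono_neutral_cong_left) auto
 have "x = (Polynomial.lead_coeff a / Polynomial.lead_coeff b) * (\<Prod>al\<in>A Un B. (TT - al) powi ?e al)"
 proof -
  have "(\<Prod>al\<in>A Un B. (TT - al) powi ?e al) = (\<Prod>al\<in>A. (TT - al) ^ n al) / (\<Prod>al\<in>B. (TT - al) ^ m al)"
   unfolding ext[OF Un_upper1] ext[OF Un_upper2] prod_dividef[symmetric] using A(2) B(2) TT_nz by (intro prod.cong refl power_int_diff) auto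
  thus ?thesis unfolding ab(4) A(3) B(3) by simp
 qed
 moreover have "Polynomial.lead_coeff a / Polynomial.lead_coeff b \<in> FF" using ab(1,2) FF_divide unfolding pk_def by blast
 ultimately show thesis using that[of _ "A Un B" ?e] A(1,2) B(1,2) n0 by simp
qed

lemma val_prod: "prm W ==> (\<And>i. i \<in> A ==> f i ~= 0) ==> val W (prod f A) = (\<Sum>i\<in>A. val W (f i))"
 by (induction A rule: infinite_finite_induct) (auto simp: val_mult val_1)

lemma val_factor:
 assumes W: "prm W" and c: "c \<in> FF" "c ~= 0" and A: "finite A" "A <= FF" shows "be \<in> FF ==> TT - be \<in> mx W ==>
   val W (c * (\<Prod>al\<in>A. (TT - al) powi e al)) = (if be \<in> A then of_int (e be) else 0)"
  and "TT ~: W ==> val W (c * (\<Prod>al\<in>A. (TT - al) powi e al)) = - of_int (\<Sum>al\<in>A. e al)"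
proof -
 have nz: "TT - al ~= 0" "(TT - al) powi e al ~= 0" if "al \<in> A" for al using that A(2) TT_nz[of al] by auto
 have 1: "val W (c * (\<Prod>al\<in>A. (TT - al) powi e al)) = (\<Sum>al\<in>A. of_int (e al) * val W (TT - al))"
  using nz A(1) c val_unt[OF W FF_unt[OF W c]] by (simp add: val_mult[OF W] val_prod[OF W] val_power_int[OF W])
 { assume b: "be \<in> FF" "TT - be \<in> mx W"
  have "of_int (e al) * val W (TT - al) = (if al = be then of_int (e be) else 0)" if a: "al \<in> A" for al
   using val_TT_minus[OF W b] val_unt[OF W mx_shift_unt[OF W b(2,1)]] a A(2) by auto
  hence "(\<Sum>al\<in>A. of_int (e al) * val W (TT - al)) = (\<Sum>al\<in>A. if al = be then of_int (e be) else 0)"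
   by (intro sum.cong) auto
  also have "\<dots> = (if be \<in> A then of_int (e be) else 0)" using A(1) by (simp add: sum.delta)
  finally show "val W (c * (\<Prod>al\<in>A. (TT - al) powi e al)) = (if be \<in> A then of_int (e be) else 0)" unfolding 1 . }
 { assume T: "TT ~: W"
  have "val W (TT - al) = -1" if a: "al \<in> A" for al
  proof -
   have "pk FF [:- al, 1:]" using a A(2) FF_minus[of al] FF_0 FF_1 by (auto simp: pk_def coeff_pCons split: nat.split)
   from val_poly_inf(2)[OF W T this] show ?thesis by simp
  qed
  thus "val W (c * (\<Prod>al\<in>A. (TT - al) powi e al)) = - of_int (\<Sum>al\<in>A. e al)" unfolding 1 by (simp add: sum_negf) }
qed

subsection \<open>Exponents of genus fields\<close>

lemma of_nat_card_0: "of_nat CARD('q) = (0 :: 'q::{field,finite} om)"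
proof -
 have c: "cst (of_nat n) = (of_nat n :: 'q om)" for n by (induction n) (simp_all add: cst_simps)
 have "(\<Sum>x\<in>(UNIV :: 'q set). x + 1) = (\<Sum>x\<in>UNIV. x)"
  by (rule sum.reindex_bij_betw[of "%x. x + 1" UNIV UNIV "%x. x"]) (auto intro!: bij_betwI[of _ _ _ "%x. x - 1"])
 hence "(of_nat CARD('q) :: 'q) = 0" by (simp add: sum.distrib)
 thus ?thesis using c[of "CARD('q)"] cst_simps(1) by metis
qed

lemma card_q_gt_1: "CARD('q::{field,finite}) > 1"
proof -
 have "card {0, 1 :: 'q} \<le> CARD('q)" by (intro card_mono) auto
 thus ?thesis by simp
qed

lemma q_minus_1: shows "CARD('q::{field,finite}) - 1 > 0" "of_nat (CARD('q) - 1) ~= (0 :: 'q om)"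
proof -
 show "CARD('q) - 1 > 0" using card_q_gt_1[where 'q = 'q] by simp
 have "of_nat (CARD('q) - 1) = (- 1 :: 'q om)" using card_q_gt_1[where 'q = 'q] of_nat_card_0[where 'q = 'q] by (simp add: of_nat_diff)
 thus "of_nat (CARD('q) - 1) ~= (0 :: 'q om)" by simp
qed

text \<open>There are at most q - 1 such elements, and the q - 1 nonzero elements of F_q are among
  them.\<close>

lemma unity_in_kk:
 fixes c :: "'q::{field,finite} om"
 assumes "c ^ (CARD('q) - 1) = 1" shows "c \<in> kk"
proof -
 let ?m = "CARD('q) - 1"
 obtain ze :: "'q om" where z: "prim_root ?m ze" by (rule prim_root_ex[OF q_minus_1])
 have r: "{c::'q om. c ^ ?m = 1} = (%j. ze ^ j) ` {..<?m}"
 proof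
  show "(%j. ze ^ j) ` {..<?m} <= {c. c ^ ?m = 1}"
   using prim_root_power_m[OF z] by (auto simp: mult.commute[of _ "CARD('q) - Suc 0"] power_mult simp flip: power_mult)
   (simp add: mult.commute[of _ "CARD('q) - Suc 0"] power_mult)
  show "{c. c ^ ?m = 1} <= (%j. ze ^ j) ` {..<?m}"
  proof
   fix d :: "'q om" assume "d \<in> {c. c ^ ?m = 1}"
   then obtain j where j: "d = ze ^ j" using unity_powers[OF z q_minus_1(1)] by blast
   have "ze ^ j = (ze ^ ?m) ^ (j div ?m) * ze ^ (j mod ?m)" by (metis power_add power_mult mult_div_mod_eq)
   hence "d = ze ^ (j mod ?m)" using j prim_root_power_m[OF z] by simp
   thus "d \<in> (%j. ze ^ j) ` {..<?m}" using q_minus_1(1)[where 'q = 'q] by auto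
  qed
 qed
 hence fin: "finite {c::'q om. c ^ ?m = 1}" and "card {c::'q om. c ^ ?m = 1} \<le> ?m"
  using card_image_le[of "{..<?m}" "%j. ze ^ j"] by auto
 moreover have "card (cst ` (UNIV - {0::'q}) :: 'q om set) = ?m"
  by (subst card_image) (auto simp: inj_on_def cst_eq_iff card_Diff_singleton)
 moreover have "cst ` (UNIV - {0::'q}) <= {c::'q om. c ^ ?m = 1}" using cst_power_card by auto
 ultimately have "cst ` (UNIV - {0::'q}) = {c::'q om. c ^ ?m = 1}" by (metis card_seteq)
 moreover have "cst ` (UNIV - {0::'q}) <= (kk :: 'q om set)" using cst_in_kk by blast
 ultimately show ?thesis using assms by blast
qed

text \<open>Dividing by elements of \<open>k\<close>, whose values are integers, lowers the value by
  at least the gap e each time, so value 0 is reached after finitely many steps.\<close>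

lemma uram_val_int:
 assumes N: "ab kk N" "fingen kk N" and W: "prm W" "uram kk N W" and y: "y \<in> N" "y ~= 0" shows "val W y \<in> \<int>"
proof -
 obtain e where e: "e > 0" "ALL t:N Int mx W. t ~= 0 --> val W t \<ge> e" by (rule value_gap[OF N W(1)])
 have *: "y \<in> N ==> y ~= 0 ==> 0 \<le> val W y ==> val W y < of_nat n * e ==> val W y \<in> \<int>" for n y
 proof (induction n arbitrary: y)
  case (Suc n)
  show ?case
  proof (cases "val W y = 0")
   case False
   hence "y \<in> mx W" using Suc.prems val_pos_iff[OF W(1)] by force
   then obtain t where t: "t \<in> kk Int mx W" "t ~= 0" "y / t \<in> W" using W(2) Suc.prems unfolding uram_def by blast
   have tN: "t \<in> N" using t(1) ab_basic(3)[OF N(1)] by blast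
   have v: "val W (y / t) = val W y - val W t" by (rule val_divide[OF W(1) Suc.prems(2) t(2)])
   have "val W (y / t) \<in> \<int>"
   proof (rule Suc.IH)
    show "y / t \<in> N" by (rule fld_divide[OF ab_basic(2)[OF N(1)] Suc.prems(1) tN])
    show "0 \<le> val W (y / t)" using val_nonneg_iff[OF W(1)] t Suc.prems by simp
    have "val W t \<ge> e" using e(2) t tN by blast
    thus "val W (y / t) < of_nat n * e" using Suc.prems(4) unfolding v by (simp add: algebra_simps)
   qed (use t Suc.prems in auto)
   moreover have "val W t \<in> \<int>" using val_kbar_int[OF W(1) _ t(2)] kk_kbar t(1) by (metis IntD1 Ints_of_int subsetD)
   ultimately have "val W (y / t) + val W t \<in> \<int>" by (rule Ints_add)
   thus ?thesis unfolding v by simp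
  qed simp
 qed simp
 have **: "val W y \<in> \<int>" if "y \<in> N" "y ~= 0" "0 \<le> val W y" for y
 proof -
  obtain n where "val W y < of_nat n * e" using reals_Archimedean3[of e] e(1) ex_less_of_nat_mult by blast
  thus ?thesis using * that by blast
 qed
 show ?thesis
 proof (cases "val W y \<ge> 0")
  case False
  have "val W (inverse y) \<in> \<int>"
   using ** [of "inverse y"] fld_inverse[OF ab_basic(2)[OF N(1)] y(1)] y(2) False val_inverse[OF W(1) y(2)] by simp
  thus ?thesis unfolding val_inverse[OF W(1) y(2)] by (simp add: minus_in_Ints_iff)
 qed (rule **[OF y])
qed

lemma decomp_lift:
 assumes M: "ab F M" "fingen F M" and H: "H <= aut F" "subgrp H" and W: "prm W" and s: "sg \<in> aut F"
  and d: "decomp W (Fix H M) sg"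
 obtains ta where "ta \<in> aut F" "decomp W M ta" "ALL x:Fix H M. ta x = sg x"
proof -
 have st: "ALL h:H. h ` M <= M" using H(1) ab_stable[OF M(1)] by blast
 have "W Int Fix H M = pull sg W Int Fix H M" using d unfolding decomp_def .
 then obtain h where h: "h \<in> H" "W Int M = pull h (pull sg W) Int M"
  by (rule primes_conjugate[OF ab_basic(1,2)[OF M(1)] M(2) H st W pull_prm[OF s W]])
 show thesis
 proof
  show "sg \<circ> h \<in> aut F" using aut_comp[OF s] h(1) H(1) by blast
  show "decomp W M (sg \<circ> h)" unfolding decomp_def using h(2) unfolding pull_pull .
  show "ALL x:Fix H M. (sg \<circ> h) x = sg x" using h(1) unfolding Fix_def by auto
 qed
qed

text \<open>Values of y are integers, so m divides every exponent of T - al in y^m. Then y^m is a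
  constant times an m-th power in \<open>kbar\<close>, and constants have constant m-th
  roots.\<close>

lemma unramified_kummer_constant:
 assumes N: "ab kk N" "fingen kk N" and m: "m > 0" and u: "\<And>W. prm W ==> uram kk N W" and y: "y \<in> N" "y ^ m \<in> kk"
 shows "y \<in> kbar"
proof (cases "y = 0")
 case False
 have "y ^ m \<in> kbar" "y ^ m ~= 0" using y(2) kk_kbar False by auto
 from kbar_factor[OF this] obtain c A e
  where f: "c \<in> FF" "c ~= 0" "finite A" "A <= FF" "y ^ m = c * (\<Prod>al\<in>A. (TT - al) powi e al)" .
 have "int m dvd e al" if a: "al \<in> A" for al
 proof -
  have aF: "al \<in> FF" using a f(4) by blast
  obtain W where W: "prm W" "TT - al \<in> mx W" by (rule finite_place_ex[OF aF])
  obtain k where k: "val W y = of_int k" using uram_val_int[OF N W(1) u[OF W(1)] y(1) False] by (rule Ints_cases)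
  have "of_nat m * val W y = of_int (e al)"
   unfolding val_power[OF W(1) False, symmetric] f(5) using val_factor(1)[OF W(1) f(1-4) aF W(2)] a by simp
  hence "(of_int (e al) :: rat) = of_int (int m * k)" unfolding k by simp
  thus ?thesis by (metis dvd_triv_left of_int_eq_iff)
 qed
 hence e: "e al = int m * (e al div int m)" if "al \<in> A" for al using that by simp
 define g where "g = (\<Prod>al\<in>A. (TT - al) powi (e al div int m))"
 have "g ^ m = (\<Prod>al\<in>A. (TT - al) powi e al)" unfolding g_def prod_power_distrib
  by (intro prod.cong refl) (metis e mult.commute power_int_mult power_int_of_nat)
 hence ym: "y ^ m = c * g ^ m" using f(5) by simp
 have g0: "g ~= 0" using ym False m by (auto simp: power_0_left)
 have "(y / g) ^ m \<in> FF" using ym g0 f(1) by (simp add: power_divide)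
 hence "y / g \<in> kbar" using FF_nth_root[OF _ m] FF_kbar by blast
 moreover have "g \<in> kbar" unfolding g_def using f(4) FF_kbar kk_kbar TT_in_kk
  by (intro fld_prod[OF fld_kbar] fld_power_int[OF fld_kbar] fld_diff[OF fld_kbar]) blast+
 ultimately have "y / g * g \<in> kbar" by (rule fld_mult[OF fld_kbar])
 thus ?thesis using g0 by simp
qed (simp add: fld_0[OF fld_kbar])

text \<open>1/T is fixed by every automorphism and determines the prime of \<open>kbar\<close> at
  infinity.\<close>

lemma kbar_infinity_decomp:
 assumes W: "prm W" "TT ~: W" and s: "sg \<in> aut kk" shows "pull sg W Int kbar = W Int kbar"
proof -
 have t: "inverse TT \<in> mx W" by (rule prm_cases[OF W])
 moreover have "inverse TT \<in> mx (pull sg W)" unfolding pull_mx[OF s] aut_inverse[OF s] aut_fixes[OF s TT_in_kk] by (rule t)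
 ultimately show ?thesis using kbar_place_unique[OF pull_prm[OF s W(1)] W(1) _ _ _ fracs_TT_inv] TT_0 by simp
qed

text \<open>Let N be the largest subfield of M of exponent q - 1. The a-th power of an element that
  is inert, or in the decomposition group at infinity, fixes K, so it is trivial on M; as a is prime
  to q - 1, the element is trivial on N. Hence N is unramified, and Kummer theory places it in
  \<open>kbar\<close>. There every automorphism belongs to the decomposition group at infinity and
  lifts to such an element of M, so it is trivial on N. Triviality on N means being a (q-1)-th power
  on M.\<close>

theorem piece_exponent:
 fixes K M :: "'q::{field,finite} om set"
 assumes K: "ab kk K" "fingen kk K" "expo a K" "coprime a (CARD('q) - 1)" "a > 0"
  and M: "ab kk M" "fingen kk M" "triv K M" and s: "sg \<in> aut kk"
 shows "EX g:aut kk. ALL x:M. sg x = (g ^^ (CARD('q) - 1)) x"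
proof -
 let ?m = "CARD('q) - 1"
 define H :: "('q om => 'q om) set" where "H = powers ?m M"
 define N where "N = Fix H M"
 note H = subgrp_powers[OF M(1), of ?m, folded H_def]
 note N = Fix_powers[OF M(1,2), of ?m, folded H_def, folded N_def]
 have NM: "N <= M" unfolding N_def Fix_def by blast
 have key: "ALL x:N. sg x = x"
  if s: "sg \<in> aut kk" and W: "prm W" and d: "inert W M sg \<or> W Int kk = P_infinity & decomp W M sg"
  for sg :: "'q om => 'q om" and W
 proof
  fix x assume x: "x \<in> N"
  have "inert W M (sg ^^ n)" if "inert W M sg" for n
  proof (induction n)
   case (Suc n)
   show ?case unfolding funpow.simps
    by (rule inert_comp[OF that Suc W ab_basic(2)[OF M(1)] aut_funpow[OF s]]) (use ab_normal[OF M(1) aut_funpow[OF s]] in blast)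
  qed (simp add: id_def inert_id[OF prm_rng[OF W]])
  moreover have "decomp W M (sg ^^ n)" if "decomp W M sg" for n
  proof (induction n)
   case (Suc n)
   show ?case unfolding funpow.simps by (rule decomp_comp[OF that Suc]) (use ab_normal[OF M(1) aut_funpow[OF s]] in blast)
  qed (simp add: id_def decomp_id)
  moreover have "sg ^^ a \<in> aut K" using aut_funpow[OF s, of a] K(3) s unfolding expo_def aut_def by blast
  ultimately have "(sg ^^ a) x = x" using M(3) d W x NM unfolding triv_def by blast
  moreover have "(sg ^^ ?m) x = x" using N(3) s x unfolding expo_def by blast
  ultimately show "sg x = x" using K(4,5) by (rule funpow_coprime_fix)
 qed
 have u: "uram kk N W" if W: "prm W" for W
 proof -
  have "N <= Fix (inertia kk M W) M" using key[OF _ W] NM unfolding Fix_def inertia_def by blast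
  thus ?thesis using inertia_unramified[OF M(1,2) W] uram_sub by blast
 qed
 obtain ze :: "'q om" where z: "prim_root ?m ze" by (rule prim_root_ex[OF q_minus_1])
 have zk: "ze \<in> kk" by (rule unity_in_kk[OF prim_root_power_m[OF z]])
 have Nk: "N <= kbar"
 proof (rule eigenvectors_generate[OF N(1,2) q_minus_1 _ z zk fld_kbar])
  show "ALL g:aut kk. ALL y:N. (g ^^ ?m) y = y" using N(3) unfolding expo_def .
  show "ALL y:N. eig ze (aut kk) y --> y \<in> kbar"
  proof (intro ballI impI)
   fix y assume y: "y \<in> N" "eig ze (aut kk) y"
   have "g (y ^ ?m) = y ^ ?m" if g: "g \<in> aut kk" for g
   proof -
    obtain j where "g y = ze ^ j * y" using y(2) g unfolding eig_def by blast
    hence "g (y ^ ?m) = (ze ^ ?m) ^ j * y ^ ?m" by (simp add: aut_power[OF g] power_mult_distrib mult.commute flip: power_mult)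
    thus ?thesis using prim_root_power_m[OF z] by simp
   qed
   hence "y ^ ?m \<in> kk" using ab_basic(4)[OF N(1) fld_power[OF ab_basic(2)[OF N(1)] y(1)]] unfolding fixd_def by blast
   from unramified_kummer_constant[OF N(1,2) q_minus_1(1) u y(1) this] show "y \<in> kbar" by blast
  qed
 qed
 obtain W :: "'q om set" where W: "prm W" "TT ~: W" by (rule inf_place_ex)
 have "ALL x:N. ta x = x" if t: "ta \<in> aut kk" for ta :: "'q om => 'q om"
 proof -
  have "decomp W N ta" using kbar_infinity_decomp[OF W t] Nk unfolding decomp_def by blast
  then obtain ro where r: "ro \<in> aut kk" "decomp W M ro" "ALL x:N. ro x = ta x"
   by (rule decomp_lift[OF M(1,2) H(1,2) W(1) t, folded N_def])
  thus ?thesis using key[OF r(1) W(1)] inf_prime_trace[OF W] by metis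
 qed
 hence "ALL x:Fix (powers ?m M) M. sg x = x" using s unfolding N_def H_def by blast
 from power_root[OF M(1,2) s this] show ?thesis by blast
qed

text \<open>Here q stands for any positive number. If the least exponent n shared a factor d > 1
  with q, the field would have exponent n/d, every automorphism being a q-th power on M.\<close>

lemma exponent_reduce:
 assumes M: "ab kk M" "fingen kk M" and q: "0 < (q::nat)"
  and r: "\<And>sg. sg \<in> aut kk ==> EX g:aut kk. ALL x:M. sg x = (g ^^ q) x"
 obtains n where "n > 0" "coprime n q" "expo n M"
proof -
 define n where "n = (LEAST n. n > 0 & expo n M)"
 have n: "n > 0" "expo n M" using LeastI[of "%n. n > 0 & expo n M" "ext_degree kk M"] expo_degree[OF M] unfolding n_def by auto
 have "coprime n q"
 proof (rule ccontr)
  define d where "d = gcd n q"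
  assume "\<not> coprime n q"
  hence d: "d > 1" "d dvd n" "d dvd q" using n(1) unfolding d_def coprime_iff_gcd_eq_1 by (auto simp: nat_neq_iff gcd_nat.neutr_eq_iff)
  obtain a b where ab: "n = d * a" "q = d * b" using d(2,3) by blast
  have "expo a M" unfolding expo_def
  proof (intro ballI)
   fix sg :: "'a om => 'a om" and x assume s: "sg \<in> aut kk" and x: "x \<in> M"
   obtain g where g: "g \<in> aut kk" "ALL x:M. sg x = (g ^^ q) x" using r[OF s] by blast
   have "(sg ^^ k) x = ((g ^^ q) ^^ k) x" for k by (rule funpow_agree[OF M(1) s g(2) x])
   moreover have "(g ^^ (q * a)) x = x" by (rule funpow_dvd_fix[of n]) (use n(2) g(1) x ab in "auto simp: expo_def")
   ultimately show "(sg ^^ a) x = x" by (simp add: funpow_mult)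
  qed
  moreover have "0 < a" "a < n" using n(1) ab(1) d(1) by auto
  ultimately show False using not_less_Least[of a "%n. n > 0 & expo n M"] unfolding n_def by blast
 qed
 thus thesis using that n by blast
qed

subsection \<open>Fields ramified at one prime\<close>

text \<open>Unramified outside P, a prime of \<open>k\<close> given as a set. If P is not the trace
  of any prime, this means unramified everywhere; compare \<open>prime_of_good\<close>.\<close>

definition good :: "'q::{field,finite} om set => 'q om set => bool" where "good P L \<longleftrightarrow> ab kk L & fingen kk L &
  (ALL W. prm W --> W Int kk ~= P --> (ALL sg:aut kk. inert W L sg --> (ALL x:L. sg x = x)))"

lemma goodD: "good P L ==> prm W ==> W Int kk ~= P ==> sg \<in> aut kk ==> inert W L sg ==> x \<in> L ==> sg x = x"
 unfolding good_def by blast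

lemma aut_FF: "sg \<in> aut kk ==> c \<in> FF ==> sg c \<in> FF" unfolding FF_def by (auto simp flip: aut_power)

text \<open>A nonzero constant is a root of unity, on which automorphisms act by raising to
  powers.\<close>

lemma aut_FF_power:
 assumes c: "c \<in> FF" and s: "sg \<in> aut kk" "ta \<in> aut kk" shows "sg (ta c) = ta (sg c)"
proof (cases "c = 0")
 case False
 obtain N where N: "N > 0" "c ^ N = 1" by (rule FF_unity[OF c False])
 define m where "m = (LEAST n. n > 0 & c ^ n = 1)"
 have m: "m > 0" "c ^ m = 1" using LeastI[of "%n. n > 0 & c ^ n = 1" N] N unfolding m_def by auto
 have red: "c ^ k = c ^ (k mod m)" for k
 proof -
  have "c ^ k = (c ^ m) ^ (k div m) * c ^ (k mod m)" by (metis power_add power_mult mult_div_mod_eq)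
  thus ?thesis using m(2) by simp
 qed
 have "prim_root m c" unfolding prim_root_def
 proof (intro allI iffI)
  fix k assume "c ^ k = 1"
  hence "c ^ (k mod m) = 1" using red[of k] by simp
  thus "m dvd k" using not_less_Least[of "k mod m" "%n. n > 0 & c ^ n = 1"] mod_less_divisor[OF m(1), of k]
   unfolding m_def[symmetric] by (auto simp: dvd_eq_mod_eq_0)
 qed (use m(2) in "auto simp: power_mult")
 note u = this
 have sm: "sg c ^ m = 1" "ta c ^ m = 1"
  unfolding aut_power[OF s(1), symmetric] aut_power[OF s(2), symmetric] m(2) by (rule aut_1[OF s(1)], rule aut_1[OF s(2)])
 obtain i where i: "sg c = c ^ i" by (rule unity_powers[OF u m(1) sm(1)])
 obtain j where j: "ta c = c ^ j" by (rule unity_powers[OF u m(1) sm(2)])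
 show ?thesis unfolding i j aut_power[OF s(1)] aut_power[OF s(2)] by (simp add: power_mult[symmetric] mult.commute)
qed (simp add: aut_0[OF s(1)] aut_0[OF s(2)])

lemma ab_kbar: "ab kk (kbar :: 'q::{field,finite} om set)"
proof -
 have g: "kbar = gen (kk Un FF :: 'q om set)"
 proof
  show "kbar <= gen (kk Un FF :: 'q om set)" unfolding kbar_gen by (rule gen_mono) blast
  show "gen (kk Un FF) <= (kbar :: 'q om set)" by (rule gen_least[OF fld_kbar]) (use kk_kbar FF_kbar in blast)
 qed
 show ?thesis unfolding g
 proof (rule abI[OF fld_kk])
  fix sg :: "'q om => 'q om" and s :: "'q om" assume s: "sg \<in> aut kk" "s \<in> kk Un FF"
  thus "sg s \<in> gen (kk Un FF)" using aut_FF[OF s(1)] aut_fixes[OF s(1)] gen_incl[of "kk Un FF"] by (metis UnE UnI1 UnI2 subsetD)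
 next
  fix x :: "'q om" assume x: "x \<in> gen (kk Un FF)" "fixd kk x"
  show "x \<in> kk" by (rule sep_fixed[OF fld_kk _ x]) (rule sepp_FF)
 next
  fix sg ta :: "'q om => 'q om" and s :: "'q om" assume s: "sg \<in> aut kk" "ta \<in> aut kk" "s \<in> kk Un FF"
  thus "(sg \<circ> ta) s = (ta \<circ> sg) s" using aut_FF_power[OF _ s(1,2)] aut_fixes[OF s(1)] aut_fixes[OF s(2)] by auto
 qed blast
qed

lemma inert_FF:
 assumes "prm W" "inert W L sg" "sg \<in> aut kk" "c \<in> FF" "c \<in> L" shows "sg c = c"
 by (rule FF_cong[OF assms(1) aut_FF[OF assms(3,4)] assms(4)])
  (use assms(2,4,5) FF_sub_prm[OF assms(1)] in "auto simp: inert_def")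

text \<open>Adding orbits makes the field normal, and inertia has to be tested on S only, since
  automorphisms commute on B.\<close>

lemma good_orbits:
 assumes B: "ab kk B" and S: "finite S" "S <= B"
  and f: "\<And>W sg. prm W ==> W Int kk ~= P ==> sg \<in> aut kk ==> inert W (gen (kk Un (\<Union>s\<in>S. orb kk s))) sg ==> ALL s:S. sg s = s"
 shows "good P (gen (kk Un (\<Union>s\<in>S. orb kk s)))"
proof -
 let ?L = "gen (kk Un (\<Union>s\<in>S. orb kk s))"
 have sub: "?L <= B" by (intro gen_least[OF ab_basic(2)[OF B]] Un_least ab_basic(3)[OF B] UN_least ab_orb[OF B] subsetD[OF S(2)])
 have "ab kk ?L" by (rule ab_sub(1)[OF B fld_gen fld_kk_sub[OF fld_gen] sub])
 moreover have "fingen kk ?L" unfolding fingen_def using S(1) finite_orb[OF fld_kk] by (intro exI[of _ "\<Union>s\<in>S. orb kk s"]) auto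
 moreover have "sg x = x" if W: "prm W" "W Int kk ~= P" and s: "sg \<in> aut kk" "inert W ?L sg" and x: "x \<in> ?L" for W sg x
 proof -
  have "sg y = y" if y: "y \<in> kk Un (\<Union>s\<in>S. orb kk s)" for y
  proof (cases "y \<in> kk")
   case False
   then obtain s g where g: "s \<in> S" "g \<in> aut kk" "y = g s" using y unfolding orb_def by auto
   have "sg s = s" using f[OF W s] g(1) by blast
   thus ?thesis unfolding g(3) using ab_commute[OF B s(1) g(2), of s] S(2) g(1) by auto
  qed (rule aut_fixes[OF s(1)])
  thus ?thesis by (rule aut_eq_gen[OF s(1) aut_id(2) _ x])
 qed
 ultimately show ?thesis unfolding good_def by blast
qed

lemma mem_orbits: "s \<in> S ==> s \<in> gen (kk Un (\<Union>s\<in>S. orb kk s))"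
 by (rule subsetD[OF gen_incl]) (rule UnI2, erule UN_I, rule orb_self)

text \<open>Inertia fixes constants because distinct constants are incongruent, so a constant
  extension may be attached to any P.\<close>

lemma good_constants:
 assumes "finite C" "C <= FF"
 obtains L where "good P L" "C <= L"
proof -
 have "good P (gen (kk Un (\<Union>s\<in>C. orb kk s)))"
 proof (rule good_orbits[OF ab_kbar assms(1)])
  show "C <= kbar" using assms(2) FF_kbar by blast
  fix W sg assume W: "prm W" "sg \<in> aut kk" "inert W (gen (kk Un (\<Union>s\<in>C. orb kk s))) sg"
  show "ALL s:C. sg s = s" by (intro ballI inert_FF[OF W(1,3,2)] subsetD[OF assms(2)] mem_orbits)
 qed
 thus thesis by (rule that) (rule subsetI, rule mem_orbits)
qed

lemma infinity_congruence:
 assumes W: "prm W" "TT ~: W" and g: "g \<in> aut kk" and x: "x \<in> kbar" "x - 1 \<in> mx W" shows "g x - 1 \<in> mx W"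
proof -
 have "mx (pull g W) Int kbar = mx W Int kbar" unfolding max_ideal_trace[OF fld_kbar, symmetric] kbar_infinity_decomp[OF W g] ..
 hence "x - 1 \<in> mx (pull g W)" using x(2) fld_diff[OF fld_kbar x(1) fld_1[OF fld_kbar]] by auto
 thus ?thesis unfolding pull_mx[OF g] by (simp add: aut_diff[OF g] aut_1[OF g])
qed

lemma mult_cong_1:
 assumes W: "prm W" and "x - c \<in> mx W" "y - d \<in> mx W" "x \<in> W" "d \<in> W" shows "x * y - c * d \<in> mx W"
proof -
 have "x * (y - d) + (x - c) * d \<in> mx W" using assms by (intro mx_add[OF W] mx_mult2[OF prm_rng[OF W]] mx_mult[OF prm_rng[OF W]])
 thus ?thesis by (simp add: algebra_simps)
qed

lemma cong_1_unt:
 assumes "prm W" "x - 1 \<in> mx W" shows "unt W x"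
proof (rule unt_cong[OF assms(1) unt_1[OF prm_rng[OF assms(1)]]])
 show "1 - x \<in> mx W" using mx_minus[OF prm_rng[OF assms(1)] assms(2)] by simp
qed

lemma power_cong:
 assumes W: "prm W" and x: "x - c \<in> mx W" "x \<in> W" "c \<in> W" shows "x ^ n - c ^ n \<in> mx W" using mx_power_diff[OF W x(2,3,1)] .

lemma divide_cong:
 assumes W: "prm W" and x: "x - 1 \<in> mx W" "y - 1 \<in> mx W" shows "x / y - 1 \<in> mx W"
proof -
 have y: "unt W y" by (rule cong_1_unt[OF W x(2)])
 have "inverse y * (x - 1 - (y - 1)) \<in> mx W"
  by (intro mx_mult2[OF prm_rng[OF W]] mx_diff[OF W] x) (use y in "auto simp: unt_def")
 moreover have "y ~= 0" using y unfolding unt_def by blast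
 ultimately show ?thesis by (simp add: field_simps)
qed

lemma unity_cong:
 assumes W: "prm W" and m: "m > 0" and x: "x ^ m = y ^ m" "x - c \<in> mx W" "y - c \<in> mx W" "c \<in> FF" "c ~= 0" shows "x = y"
proof -
 have u: "unt W x" "unt W y"
  by (rule unt_cong[OF W FF_unt[OF W x(4,5)]]; use mx_minus[OF prm_rng[OF W] x(2)] mx_minus[OF prm_rng[OF W] x(3)] in simp)+
 have n0: "y ~= 0" using u unfolding unt_def by blast
 have "(x / y) ^ m = 1" unfolding power_divide x(1) using n0 by simp
 hence "(x / y) ^ m \<in> FF" using FF_1 by metis
 hence F: "x / y \<in> FF" by (rule FF_nth_root[OF _ m])
 have "inverse y * (x - c - (y - c)) \<in> mx W"
  using mx_mult2[OF prm_rng[OF W] _ mx_diff[OF W x(2,3)], of "inverse y"] u(2) unfolding unt_def by blast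
 hence "x / y - 1 \<in> mx W" using n0 by (simp add: field_simps)
 hence "x / y = 1" by (rule FF_cong[OF W F FF_1])
 thus ?thesis using n0 by simp
qed

text \<open>Normalising \<open>u\<close> to be congruent to \<open>1\<close> at infinity, \<open>g u\<close> is congruent to a root of unity
 \<open>c\<^sub>g\<close>, and \<open>g h u\<close> and \<open>h g u\<close> are both congruent to \<open>c\<^sub>h ^ r\<^sub>g * c\<^sub>g ^ r\<^sub>h\<close>.\<close>

lemma kummer_ab:
 fixes u v ze :: "'q::{field,finite} om"
 assumes m: "m > 0" "of_nat m ~= (0 :: 'q om)" and z: "prim_root m ze"
  and W: "prm W" "TT ~: W" and v: "v \<in> kbar" "u ^ m = v" and u: "u - 1 \<in> mx W"
  and r: "\<And>g. g \<in> aut kk ==> EX r. g ze = ze ^ r & (EX ro:kbar. g v = v ^ r * ro ^ m)"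
 shows "ab kk (gen (kbar Un {u}))"
proof -
 let ?B = "gen (kbar Un {u})"
 have zF: "ze \<in> FF" by (rule FF_nth_root[OF _ m(1)]) (simp add: prim_root_power_m[OF z] FF_1)
 have u1: "unt W u" by (rule cong_1_unt[OF W(1) u])
 hence u0: "u ~= 0" unfolding unt_def by blast
 hence v0: "v ~= 0" using v(2) by auto
 have v1: "v - 1 \<in> mx W" using power_cong[OF W(1) u, of m] u1 rng_1[OF prm_rng[OF W(1)]] v(2) unfolding unt_def by simp
 have act: "EX c r ro. c ^ m = 1 & (ALL z. z ^ m = 1 --> g z = z ^ r) & ro \<in> kbar & ro - 1 \<in> mx W & g u = c * (u ^ r * ro)"
  if g: "g \<in> aut kk" for g
 proof -
  obtain r ro where a: "g ze = ze ^ r" "ro \<in> kbar" "g v = v ^ r * ro ^ m" using r[OF g] by blast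
  have "g u ^ m = g v" using aut_power[OF g, of u m] v(2) by simp
  also have "\<dots> = (u ^ r * ro) ^ m"
  proof -
   have "(u ^ r) ^ m = v ^ r" unfolding v(2)[symmetric] by (simp add: mult.commute flip: power_mult)
   thus ?thesis unfolding a(3) power_mult_distrib by simp
  qed
  finally have e: "g u ^ m = (u ^ r * ro) ^ m" .
  have gv: "g v - 1 \<in> mx W" by (rule infinity_congruence[OF W g v(1) v1])
  have "unt W (g v)" by (rule cong_1_unt[OF W(1) gv])
  hence "unt W (u ^ r * ro)" using unt_power_iff[OF W(1) _ m(1), of "u ^ r * ro"] e \<open>g u ^ m = g v\<close> by metis
  from unt_divide[OF prm_rng[OF W(1)] this unt_power[OF prm_rng[OF W(1)] u1, of r]] have r1: "unt W ro" using u0 by simp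
  define d where "d = res W ro"
  have d: "d \<in> FF" "ro - d \<in> mx W" using res[OF W(1)] r1 unfolding d_def unt_def by blast+
  have d0: "d ~= 0" using d(2) r1 unfolding unt_iff by auto
  have ur: "u ^ r - 1 \<in> mx W" using power_cong[OF W(1) u, of r] u1 rng_1[OF prm_rng[OF W(1)]] unfolding unt_def by simp
  have "u ^ r * ro - 1 * d \<in> mx W"
   by (rule mult_cong_1[OF W(1) ur d(2)]) (use unt_power[OF prm_rng[OF W(1)] u1, of r] d(1) FF_sub_prm[OF W(1)] in "auto simp: unt_def")
  hence "(u ^ r * ro) ^ m - d ^ m \<in> mx W"
   by (intro power_cong[OF W(1)]) (use \<open>unt W (u ^ r * ro)\<close> d(1) FF_sub_prm[OF W(1)] in "auto simp: unt_def")
  hence "g v - d ^ m \<in> mx W" using e \<open>g u ^ m = g v\<close> by simp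
  from mx_diff[OF W(1) gv this] have "d ^ m = 1" using FF_cong[OF W(1) FF_power[OF d(1)] FF_1] by simp
  \<comment> \<open>The residue d of \<open>ro\<close> is moved into the root of unity, so that the
    remaining factor \<open>ro / d\<close> in \<open>kbar\<close> is congruent to 1.\<close>
  define c where "c = g u / (u ^ r * ro) * d"
  have "c ^ m = 1" unfolding c_def using e u0 r1 \<open>d ^ m = 1\<close> by (auto simp: power_mult_distrib power_divide unt_def)
  moreover have "ro / d \<in> kbar" by (rule fld_divide[OF fld_kbar a(2)]) (use d(1) FF_kbar in blast)
  moreover have "ro / d - 1 \<in> mx W"
  proof -
   have "inverse d * (ro - d) \<in> mx W"
    by (rule mx_mult2[OF prm_rng[OF W(1)] _ d(2)]) (use FF_inverse[OF d(1)] FF_sub_prm[OF W(1)] in blast)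
   thus ?thesis using d0 by (simp add: field_simps)
  qed
  moreover have "g u = c * (u ^ r * (ro / d))" unfolding c_def using u0 r1 d0 by (auto simp: unt_def)
  moreover have "g z = z ^ r" if x: "z ^ m = 1" for z
  proof -
   obtain j where "z = ze ^ j" by (rule unity_powers[OF z m(1) x])
   thus ?thesis using a(1) by (simp add: aut_power[OF g] flip: power_mult) (simp add: mult.commute)
  qed
  ultimately show ?thesis by blast
 qed
 have unF: "c \<in> FF" "c ~= 0" if "c ^ m = 1" for c :: "'q om"
  using that FF_nth_root[OF _ m(1), of c] FF_1 m(1) by (auto simp: power_0_left)
 have comm: "g (h u) - b ^ r * a ^ s \<in> mx W"
  if g: "g \<in> aut kk" and h: "h \<in> aut kk"
   and A: "a ^ m = 1" "ALL z. z ^ m = 1 --> g z = z ^ r" "ro - 1 \<in> mx W" "g u = a * (u ^ r * ro)"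
   and B: "b ^ m = 1" "pp \<in> kbar" "pp - 1 \<in> mx W" "h u = b * (u ^ s * pp)" for g h a b r s ro pp
 proof -
  note R = prm_rng[OF W(1)]
  have aW: "a \<in> W" "b ^ r \<in> W" "a ^ s \<in> W" using unF A(1) B(1) FF_sub_prm[OF W(1)] rng_power[OF R] by blast+
  have ur: "u ^ r - 1 \<in> mx W" using power_cong[OF W(1) u, of r] u1 rng_1[OF R] unfolding unt_def by simp
  have "u ^ r * ro - 1 * 1 \<in> mx W"
   by (rule mult_cong_1[OF W(1) ur A(3)]) (use unt_power[OF R u1, of r] rng_1[OF R] in "auto simp: unt_def")
  hence "a * (u ^ r * ro - 1) \<in> mx W" using mx_mult2[OF R aW(1)] by simp
  hence gu: "g u - a \<in> mx W" unfolding A(4) by (simp add: algebra_simps)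
  have guW: "g u \<in> W" using rng_add[OF R mx_sub[OF gu] aW(1)] by simp
  have gp: "g pp - 1 \<in> mx W" by (rule infinity_congruence[OF W g B(2,3)])
  have "g u ^ s * g pp - a ^ s * 1 \<in> mx W"
   by (rule mult_cong_1[OF W(1) power_cong[OF W(1) gu guW aW(1)] gp rng_power[OF R guW] rng_1[OF R]])
  hence "b ^ r * (g u ^ s * g pp - a ^ s) \<in> mx W" using mx_mult2[OF R aW(2)] by simp
  moreover have "g (h u) = b ^ r * (g u ^ s * g pp)" unfolding B(4) aut_mult[OF g] aut_power[OF g] using A(2) B(1) by simp
  ultimately show ?thesis by (simp add: algebra_simps)
 qed
 have uB: "u \<in> ?B" and kB: "kbar <= ?B" using gen_incl[of "kbar Un {u}"] by blast+
 show ?thesis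
 proof (rule abI[OF fld_kk])
  show "kk <= kbar Un {u}" using kk_kbar by blast
  fix sg :: "'q om => 'q om" and s assume s: "sg \<in> aut kk" "s \<in> kbar Un {u}"
  show "sg s \<in> ?B"
  proof (cases "s = u")
   case True
   obtain c r ro where a: "c ^ m = 1" "ro \<in> kbar" "sg u = c * (u ^ r * ro)" using act[OF s(1)] by blast
   have "c \<in> ?B" "ro \<in> ?B" using unF(1)[OF a(1)] a(2) FF_kbar kB by blast+
   thus ?thesis unfolding True a(3) using uB by (intro fld_mult[OF fld_gen] fld_power[OF fld_gen])
  qed (use s ab_normal[OF ab_kbar s(1)] kB in blast)
 next
  fix x assume x: "x \<in> ?B" "fixd kk x"
  have "sepp kbar u"
  proof (rule sepp_root)
   let ?f = "Polynomial.monom 1 m + [:- v:]"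
   show "pk kbar ?f"
    by (intro pk_add[OF fld_kbar] pk_monom[OF fld_kbar] fld_1[OF fld_kbar] pk_pCons[OF fld_minus[OF fld_kbar v(1)]] pk_0[OF fld_kbar])
   have dm: "dg ?f = m" using m(1) by (subst degree_add_eq_left) (auto simp: degree_monom_eq)
   show "Polynomial.lead_coeff ?f = 1" unfolding dm using m(1) by (simp add: coeff_pCons split: nat.split)
   fix x assume "poly ?f x = 0"
   hence "x ^ m = v" by (simp add: poly_monom)
   hence "x ~= 0" using v0 m(1) by (auto simp: power_0_left)
   thus "poly (pderiv ?f) x ~= 0" using m(2) by (simp add: pderiv_add pderiv_monom poly_monom pderiv_pCons)
  next
   show "poly (Polynomial.monom 1 m + [:- v:]) u = 0" using v(2) by (simp add: poly_monom)
  qed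
  hence "x \<in> kbar" by (intro sep_fixed[OF fld_kbar _ x(1) fixd_mono[OF x(2) kk_kbar]]) auto
  thus "x \<in> kk" by (rule ab_basic(4)[OF ab_kbar _ x(2)])
 next
  fix g h :: "'q om => 'q om" and s assume g: "g \<in> aut kk" "h \<in> aut kk" and s: "s \<in> kbar Un {u}"
  show "(g \<circ> h) s = (h \<circ> g) s"
  proof (cases "s = u")
   case True
   obtain a r ro where A: "a ^ m = 1" "ALL z. z ^ m = 1 --> g z = z ^ r" "ro \<in> kbar" "ro - 1 \<in> mx W" "g u = a * (u ^ r * ro)"
    using act[OF g(1)] by blast
   obtain b s pp where B: "b ^ m = 1" "ALL z. z ^ m = 1 --> h z = z ^ s" "pp \<in> kbar" "pp - 1 \<in> mx W" "h u = b * (u ^ s * pp)"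
    using act[OF g(2)] by blast
   have "g (h u) ^ m = h (g u) ^ m" using ab_commute[OF ab_kbar g v(1)] unfolding v(2)[symmetric] aut_power[OF g(1)] aut_power[OF g(2)] .
   moreover have "g (h u) - b ^ r * a ^ s \<in> mx W" by (rule comm[OF g A(1,2,4,5) B(1,3,4,5)])
   moreover have "h (g u) - b ^ r * a ^ s \<in> mx W" using comm[OF g(2,1) B(1,2,4,5) A(1,3,4,5)] by (simp add: mult.commute)
   moreover have "b ^ r * a ^ s \<in> FF" "b ^ r * a ^ s ~= 0" using unF[OF A(1)] unF[OF B(1)] FF_mult FF_power by auto
   ultimately have "g (h u) = h (g u)" by (rule unity_cong[OF W(1) m(1)])
   thus ?thesis unfolding True by simp
  qed (use s ab_commute[OF ab_kbar g] in auto)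
 qed
qed

lemma prod_cong_1:
 assumes W: "prm W" and f: "\<And>i. i \<in> A ==> f i - 1 \<in> mx W" shows "prod f A - 1 \<in> mx W" using f
proof (induction A rule: infinite_finite_induct)
 case (insert i A)
 have "f i * prod f A - 1 * 1 \<in> mx W"
  by (rule mult_cong_1[OF W]) (use insert cong_1_unt[OF W] rng_1[OF prm_rng[OF W]] in "auto simp: unt_def")
 thus ?case using insert.hyps by simp
qed (auto simp: mx_0[OF prm_rng[OF W]])

lemma power_int_cong_1:
 assumes W: "prm W" and x: "x - 1 \<in> mx W" shows "x powi k - 1 \<in> mx W"
proof -
 have p: "x ^ n - 1 \<in> mx W" for n using power_cong[OF W x, of n] cong_1_unt[OF W x] rng_1[OF prm_rng[OF W]] unfolding unt_def by simp
 have "1 / x ^ n - 1 \<in> mx W" for n by (rule divide_cong[OF W _ p]) (simp add: mx_0[OF prm_rng[OF W]])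
 thus ?thesis using p by (auto simp: power_int_def field_simps)
qed

lemma power_int_sum: "(x :: 'a::field) ~= 0 ==> x powi (sum e A) = (\<Prod>i\<in>A. x powi e i)"
 by (induction A rule: infinite_finite_induct) (auto simp: power_int_add)

text \<open>As m divides the degree of f, division by an m-th power from \<open>k\<close> makes the
  radicand congruent to 1 at infinity. Infinity is then unramified, and the root can be normalised
  as \<open>kummer_ab\<close> requires. At finite primes not above the prime of T - al, the radicand
  f is a unit, so only that prime can ramify.\<close>

lemma kummer_good:
 fixes ze al :: "'q::{field,finite} om" and e :: "'q om => int"
 assumes m: "m > 0" "of_nat m ~= (0 :: 'q om)" and z: "prim_root m ze"
  and a: "al \<in> FF" and f: "f = (\<Prod>be\<in>orb kk al. (TT - be) powi e be)" and d: "(\<Sum>be\<in>orb kk al. e be) = int m * d"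
  and r: "\<And>g. g \<in> aut kk ==> EX r. g ze = ze ^ r & (EX ro:kbar. g f = f ^ r * ro ^ m)"
 obtains P L y where "good P L" "y \<in> L" "y ^ m = f"
proof -
 let ?O = "orb kk al"
 have zF: "ze \<in> FF" by (rule FF_nth_root[OF _ m(1)]) (simp add: prim_root_power_m[OF z] FF_1)
 have O: "finite ?O" "?O <= FF" using finite_orb[OF fld_kk] aut_FF a unfolding orb_def by blast+
 have Tk: "TT \<in> kbar" using TT_in_kk kk_kbar by blast
 \<comment> \<open>The degree of f is m d, so f / t^m has degree 0.\<close>
 define t :: "'q om" where "t = TT powi d"
 have t: "t \<in> kk" "t ~= 0" unfolding t_def using fld_power_int[OF fld_kk TT_in_kk] TT_0 by auto
 have fk: "f \<in> kbar" unfolding f using O(2) FF_kbar Tk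
  by (intro fld_prod[OF fld_kbar] fld_power_int[OF fld_kbar] fld_diff[OF fld_kbar]) blast+
 define v where "v = f / t ^ m"
 have tk: "t \<in> kbar" using t(1) kk_kbar by blast
 have vk: "v \<in> kbar" unfolding v_def by (intro fld_divide[OF fld_kbar] fld_power[OF fld_kbar] fk tk)
 have v1: "v - 1 \<in> mx W" if W: "prm W" "TT ~: W" for W
 proof -
  have "t ^ m = TT powi (\<Sum>be\<in>?O. e be)" unfolding t_def d by (simp add: power_int_mult mult.commute[of "int m"])
  hence "t ^ m = (\<Prod>be\<in>?O. TT powi e be)" unfolding power_int_sum[OF TT_0] .
  hence "v = (\<Prod>be\<in>?O. ((TT - be) / TT) powi e be)" unfolding v_def f by (simp add: prod_dividef power_int_divide_distrib)
  moreover have "((TT - be) / TT) powi e be - 1 \<in> mx W" if "be \<in> ?O" for be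
  proof (rule power_int_cong_1[OF W(1)])
   have "- be * inverse TT \<in> mx W"
    by (rule mx_mult2[OF prm_rng[OF W(1)] _ prm_cases[OF W]]) (use that O(2) FF_minus FF_sub_prm[OF W(1)] in blast)
   thus "(TT - be) / TT - 1 \<in> mx W" using TT_0[where 'q = 'q] by (simp add: field_simps)
  qed
  ultimately show ?thesis using prod_cong_1[OF W(1), of ?O] by simp
 qed
 have T0: "TT ~= (0 :: 'q om)" by (rule TT_0)
 obtain W :: "'q om set" where W: "prm W" "TT ~: W" by (rule inf_place_ex)
 obtain u0 where u0: "u0 ^ m = v" using nth_root_exists[OF m(1)] by blast
 have u0u: "unt W u0" by (rule unt_power_iff[OF W(1) _ m(1)]) (simp add: u0 cong_1_unt[OF W(1) v1[OF W]])
 define c where "c = res W u0"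
 have c: "c \<in> FF" "u0 - c \<in> mx W" using res[OF W(1)] u0u unfolding c_def unt_def by blast+
 have c0: "c ~= 0" using c(2) u0u unfolding unt_iff by auto
 have cW: "c \<in> W" "u0 \<in> W" using c(1) FF_sub_prm[OF W(1)] u0u unfolding unt_def by blast+
 have "v - c ^ m \<in> mx W" using power_cong[OF W(1) c(2) cW(2,1), of m] u0 by simp
 from mx_diff[OF W(1) v1[OF W] this] have "c ^ m = 1" using FF_cong[OF W(1) FF_power[OF c(1)] FF_1] by simp
 define u where "u = u0 / c"
 have um: "u ^ m = v" unfolding u_def by (simp add: power_divide u0 \<open>c ^ m = 1\<close>)
 have u1: "u - 1 \<in> mx W"
 proof -
  have "inverse c * (u0 - c) \<in> mx W"
   by (rule mx_mult2[OF prm_rng[OF W(1)] _ c(2)]) (use FF_inverse[OF c(1)] FF_sub_prm[OF W(1)] in blast)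
  thus ?thesis using c0 unfolding u_def by (simp add: field_simps)
 qed
 have B: "ab kk (gen (kbar Un {u}))"
 proof (rule kummer_ab[OF m z W vk um u1])
  fix g :: "'q om => 'q om" assume g: "g \<in> aut kk"
  obtain r ro where a: "g ze = ze ^ r" "ro \<in> kbar" "g f = f ^ r * ro ^ m" using r[OF g] by blast
  have "t ^ r / t * ro \<in> kbar" by (intro fld_mult[OF fld_kbar] fld_divide[OF fld_kbar] fld_power[OF fld_kbar] tk a(2))
  moreover have "g v = v ^ r * (t ^ r / t * ro) ^ m"
  proof -
   have "g v = f ^ r * ro ^ m / t ^ m" unfolding v_def aut_divide[OF g] aut_power[OF g] aut_fixes[OF g t(1)] a(3) ..
   moreover have "(t ^ m) ^ r = (t ^ r) ^ m" by (simp add: mult.commute flip: power_mult)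
   ultimately show ?thesis unfolding v_def power_mult_distrib power_divide using t(2) by simp
  qed
  ultimately show "EX r. g ze = ze ^ r & (EX ro:kbar. g v = v ^ r * ro ^ m)" using a(1) by blast
 qed
 obtain W0 :: "'q om set" where W0: "prm W0" "TT - al \<in> mx W0" by (rule finite_place_ex[OF a])
 define S where "S = {u, al, ze}"
 define L where "L = gen (kk Un (\<Union>s\<in>S. orb kk s))"
 have LF: "fld L" unfolding L_def by (rule fld_gen)
 have SL: "S <= L" unfolding L_def using mem_orbits by blast
 have OL: "?O <= L" unfolding L_def by (rule subset_trans[OF _ gen_incl]) (auto simp: S_def)
 have yL: "u * t \<in> L" using SL t(1) fld_kk_sub[OF LF] unfolding S_def by (intro fld_mult[OF LF]) blast+
 have ym: "(u * t) ^ m = f" unfolding power_mult_distrib um v_def using t(2) by simp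
 have "good (W0 Int kk) L" unfolding L_def
 proof (rule good_orbits[OF B])
  show "finite S" unfolding S_def by simp
  show "S <= gen (kbar Un {u})" unfolding S_def using gen_incl[of "kbar Un {u}"] a zF FF_kbar by blast
 next
  fix V and sg :: "'q om => 'q om" assume V: "prm V" "V Int kk ~= W0 Int kk" and s: "sg \<in> aut kk" and i: "inert V (gen (kk Un (\<Union>s\<in>S. orb kk s))) sg"
  note i = i[folded L_def]
  have sF: "sg x = x" if "x \<in> FF" "x \<in> L" for x by (rule inert_FF[OF V(1) i s that])
  have sf: "sg f = f" unfolding f aut_prod[OF s] aut_power_int[OF s] aut_diff[OF s] aut_fixes[OF s TT_in_kk]
  proof (rule prod.cong[OF refl])
   fix be assume b: "be \<in> ?O"
   show "(TT - sg be) powi e be = (TT - be) powi e be" unfolding sF[OF subsetD[OF O(2) b] subsetD[OF OL b]] ..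
  qed
  have "sg (u * t) ^ m = (u * t) ^ m" unfolding aut_power[OF s, symmetric] ym by (rule sf)
  hence um': "sg u ^ m = u ^ m" unfolding aut_mult[OF s] aut_fixes[OF s t(1)] power_mult_distrib using t(2) by simp
  \<comment> \<open>At a finite prime u t is a unit because its m-th power f is; at infinity u
    itself is one. Both arise from u by a factor in \<open>k\<close>, so \<open>sg\<close>
    multiplies them by the same root of unity.\<close>
  obtain y' where y': "y' \<in> L" "unt V y'" "EX b:kk. b ~= 0 & y' = u * b"
  proof (cases "TT \<in> V")
   case True
   obtain ga where g: "ga \<in> FF" "TT - ga \<in> mx V" by (rule place_of_TT[OF V(1) True])
   have "ga ~: ?O"
   proof
    assume "ga \<in> ?O"
    then obtain h where h: "h \<in> aut kk" "ga = h al" unfolding orb_def by blast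
    have "TT - al \<in> mx (pull h V)" unfolding pull_mx[OF h(1)] aut_diff[OF h(1)] aut_fixes[OF h(1) TT_in_kk] using g(2) h(2) by simp
    from kbar_place_unique[OF pull_prm[OF h(1) V(1)] W0(1) this W0(2) TT_nz[OF a] fracs_TT_minus[OF a]]
    have "pull h V Int kk = W0 Int kk" using kk_kbar by blast
    thus False using V(2) pull_fixed[OF h(1)] by blast
   qed
   hence "unt V (TT - be)" if "be \<in> ?O" for be using that by (intro mx_shift_unt[OF V(1) g(2,1)] subsetD[OF O(2)]) auto
   hence "unt V f" unfolding f by (rule unt_prod[OF prm_rng[OF V(1)] unt_power_int[OF prm_rng[OF V(1)]]])
   hence "unt V ((u * t) ^ m)" unfolding ym .
   hence "unt V (u * t)" by (rule unt_power_iff[OF V(1) _ m(1)])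
   from that[OF yL this] show thesis using t by blast
  next
   case False
   have "unt V u" by (rule unt_power_iff[OF V(1) _ m(1)]) (simp add: um cong_1_unt[OF V(1) v1[OF V(1) False]])
   moreover have "u \<in> L" using SL unfolding S_def by blast
   ultimately show thesis using that[of u] kk_1 by (metis mult_1_right one_neq_zero)
  qed
  obtain b where b: "b \<in> kk" "b ~= 0" "y' = u * b" using y'(3) by blast
  have u0: "u ~= 0" using y'(2) b(3) unfolding unt_def by auto
  have cm: "(sg u / u) ^ m = 1" unfolding power_divide um' using u0 by simp
  hence "(sg u / u) ^ m \<in> FF" using FF_1 by metis
  hence F: "sg u / u \<in> FF" by (rule FF_nth_root[OF _ m(1)])
  have "sg y' - y' \<in> mx V" using i y'(1,2) unfolding inert_def unt_def by blast
  moreover have "sg y' = (sg u / u) * y'" unfolding b(3) aut_mult[OF s] aut_fixes[OF s b(1)] using u0 by simp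
  ultimately have "inverse y' * ((sg u / u) * y' - y') \<in> mx V" using mx_mult2[OF prm_rng[OF V(1)]] y'(2) unfolding unt_def by metis
  moreover have "inverse y' * ((sg u / u) * y' - y') = sg u / u - 1" using y'(2) unfolding unt_def by (simp add: field_simps)
  ultimately have "sg u / u - 1 \<in> mx V" by simp
  hence "sg u / u = 1" by (rule FF_cong[OF V(1) F FF_1])
  hence "sg u = u" using u0 by simp
  thus "ALL s:S. sg s = s" using sF a zF SL unfolding S_def by auto
 qed
 from that[OF this yL ym] show thesis .
qed

lemma prim_root_cong:
 assumes z: "prim_root m ze" and d: "int m dvd int a - int b" shows "ze ^ a = ze ^ b"
proof -
 have *: "ze ^ a = ze ^ b" if "b \<le> a" "int m dvd int a - int b" for a b
 proof -
  have "m dvd a - b" using that by (metis int_dvd_int_iff of_nat_diff)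
  hence "ze ^ b * ze ^ (a - b) = ze ^ b" using prim_root_iff[OF z] by simp
  thus ?thesis using that(1) by (simp flip: power_add)
 qed
 show ?thesis using *[of b a] *[of a b] d dvd_minus_iff[of "int m" "int b - int a"] by (cases "b \<le> a") auto
qed

lemma prod_shift:
 assumes g: "g \<in> aut kk" and A: "finite A" "g ` A <= A"
 shows "g (\<Prod>al\<in>A. (TT - al) powi e al) = (\<Prod>al\<in>A. (TT - al) powi e (ainv g al))"
  and "(\<Sum>al\<in>A. e (ainv g al)) = (\<Sum>al\<in>A. e al)"
proof -
 have i: "inj_on g A" using aut_inj[OF g] by (auto intro: inj_onI)
 hence b: "bij_betw g A A" unfolding bij_betw_def using endo_inj_surj[OF A i] by blast
 show "g (\<Prod>al\<in>A. (TT - al) powi e al) = (\<Prod>al\<in>A. (TT - al) powi e (ainv g al))"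
  using prod.reindex_bij_betw[OF b, of "%al. (TT - al) powi e (ainv g al)"]
  by (simp add: aut_prod[OF g] aut_power_int[OF g] aut_diff[OF g] aut_fixes[OF g TT_in_kk] aut_inv_apply(2)[OF g])
 show "(\<Sum>al\<in>A. e (ainv g al)) = (\<Sum>al\<in>A. e al)"
  using sum.reindex_bij_betw[OF b, of "%al. e (ainv g al)"] by (simp add: aut_inv_apply(2)[OF g])
qed

lemma orb_eq: "be \<in> orb F al ==> orb F be = orb F al"
proof
 assume b: "be \<in> orb F al"
 show "orb F be <= orb F al" by (rule orb_subset) (rule orb_stable[OF _ b])
 obtain g where g: "g \<in> aut F" "be = g al" using b unfolding orb_def by blast
 have "al = ainv g be" using aut_inv_apply(2)[OF g(1)] g(2) by simp
 hence "al \<in> orb F be" unfolding orb_def using aut_inv[OF g(1)] by blast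
 show "orb F al <= orb F be" by (rule orb_subset) (rule orb_stable[OF _ \<open>al \<in> orb F be\<close>])
qed

text \<open>The hypothesis on r says that ze^D is Galois invariant. It therefore lies in F_q, so its
  order divides both m and q - 1, which are coprime.\<close>

lemma orbit_degree:
 fixes ze :: "'q::{field,finite} om"
 assumes m: "m > 0" "coprime m (CARD('q) - 1)" and z: "prim_root m ze" "ze \<in> FF"
  and r: "\<And>g. g \<in> aut kk ==> EX r. g ze = ze ^ r & int m dvd (int r - 1) * D" shows "int m dvd D"
proof -
 \<comment> \<open>D may be negative; i is its residue modulo m as a natural exponent.\<close>
 define i where "i = nat (D mod int m)"
 have i: "int i = D mod int m" "i < m" using m(1) unfolding i_def by (auto simp: nat_less_iff)
 have "g (ze ^ i) = ze ^ i" if g: "g \<in> aut kk" for g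
 proof -
  obtain r where r: "g ze = ze ^ r" "int m dvd (int r - 1) * D" using r[OF g] by blast
  have "int m dvd (int r - 1) * int i" using r(2) unfolding i(1) by (metis dvd_eq_mod_eq_0 mod_mult_right_eq)
  hence "int m dvd int (r * i) - int i" by (simp add: algebra_simps)
  from prim_root_cong[OF z(1) this] show ?thesis unfolding aut_power[OF g] r(1) by (simp add: power_mult)
 qed
 hence "ze ^ i \<in> kk" using ab_basic(4)[OF ab_kbar, of "ze ^ i"] FF_power[OF z(2), of i] FF_kbar unfolding fixd_def by blast
 hence "ze ^ i \<in> range cst" using FF_inter_kk FF_power[OF z(2), of i] by blast
 then obtain a where a: "ze ^ i = cst a" by blast
 have "a ~= 0" using a prim_root_nz[OF z(1) m(1)] cst_simps(1) by (metis power_not_zero)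
 hence "ze ^ (i * (CARD('q) - 1)) = 1" using cst_power_card a by (metis power_mult)
 hence "m dvd i * (CARD('q) - 1)" using prim_root_iff[OF z(1)] by blast
 hence "m dvd i" using m(2) by (simp add: coprime_dvd_mult_left_iff)
 hence "i = 0" using i(2) by (auto dest: dvd_imp_le)
 thus ?thesis using i(1) by auto
qed

text \<open>It suffices to treat eigenvectors y over \<open>kbar\<close>, for which y^m is a
  constant times a product of powers of the T - al. Commutativity over \<open>k\<close> makes the
  exponents of conjugate zeros proportional modulo m, with the factor r by which g acts on
  \<open>ze\<close>. Split into Galois orbits, each partial product has degree divisible by m by
  \<open>orbit_degree\<close> and an m-th root in a good field by \<open>kummer_good\<close>. The
  product of these roots differs from y by a constant, which \<open>sg\<close> also fixes.\<close>

theorem tame_fixed: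
 fixes E :: "'q::{field,finite} om set"
 assumes E: "ab kk E" "fingen kk E" "expo m E" and m: "m > 0" "of_nat m ~= (0 :: 'q om)" "coprime m (CARD('q) - 1)"
  and s: "sg \<in> aut kk" "\<And>P L x. good P L ==> x \<in> L ==> sg x = x" and x: "x \<in> E" shows "sg x = x"
proof -
 define L where "L = gen (kbar Un E)"
 have Lk: "ab kbar L" unfolding L_def by (rule ab_translate[OF E(1) fld_kbar kk_kbar])
 have Lkk: "ab kk L" unfolding L_def by (rule ab_un[OF ab_kbar E(1)])
 have kL: "kbar <= L" "E <= L" unfolding L_def using gen_incl by blast+
 have aa: "g \<in> aut kk" if "g \<in> aut kbar" for g :: "'q om => 'q om" using aut_mono[OF kk_kbar that] .
 obtain S where S: "finite S" "E = gen S" by (rule fingen_kk[OF E(2)])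
 have "L = gen (kbar Un S)"
 proof
  show "gen (kbar Un S) <= L" unfolding L_def S(2) by (rule gen_mono) (use gen_incl in blast)
  show "L <= gen (kbar Un S)" unfolding L_def S(2)
   by (intro gen_least[OF fld_gen] Un_least gen_mono) (use gen_incl[of "kbar Un S"] in auto)
 qed
 hence fL: "fingen kbar L" unfolding fingen_def using S(1) by blast
 have ex: "ALL g:aut kbar. ALL y:L. (g ^^ m) y = y"
 proof (intro ballI)
  fix g :: "'q om => 'q om" and y assume g: "g \<in> aut kbar" and y: "y \<in> L"
  show "(g ^^ m) y = y"
  proof (rule fix_un[OF aut_funpow[OF aa[OF g]] _ _ y[unfolded L_def]])
   show "ALL x:kbar. (g ^^ m) x = x" using aut_fixes[OF aut_funpow[OF g]] by blast
   show "ALL x:E. (g ^^ m) x = x" using E(3) aa[OF g] unfolding expo_def by blast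
  qed
 qed
 obtain ze :: "'q om" where z: "prim_root m ze" by (rule prim_root_ex[OF m(1,2)])
 have zF: "ze \<in> FF" by (rule FF_nth_root[OF _ m(1)]) (simp add: prim_root_power_m[OF z] FF_1)
 have zk: "ze \<in> kbar" using zF FF_kbar by blast
 have sF: "sg c = c" if c: "c \<in> FF" for c
 proof -
  obtain L :: "'q om set" where "good {} L" "{c} <= L" by (rule good_constants[of "{c}"]) (use c in auto)
  thus ?thesis using s(2) by blast
 qed
 have "L <= {x. sg x = x}"
 proof (rule eigenvectors_generate[OF Lk fL m(1,2) ex z zk fld_fixed[OF s(1)]], intro ballI impI CollectI)
  fix y assume y: "y \<in> L" "eig ze (aut kbar) y"
  show "sg y = y"
  proof (cases "y = 0")
   case y0: False
   have "g (y ^ m) = y ^ m" if g: "g \<in> aut kbar" for g :: "'q om => 'q om"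
   proof -
    obtain j where "g y = ze ^ j * y" using y(2) g unfolding eig_def by blast
    hence "g (y ^ m) = (ze ^ m) ^ j * y ^ m" by (simp add: aut_power[OF g] power_mult_distrib mult.commute flip: power_mult)
    thus ?thesis using prim_root_power_m[OF z] by simp
   qed
   hence "y ^ m \<in> kbar" using ab_basic(4)[OF Lk fld_power[OF ab_basic(2)[OF Lk] y(1)]] unfolding fixd_def by blast
   moreover have "y ^ m ~= 0" using y0 by simp
   ultimately obtain c A0 e0 where f: "c \<in> FF" "c ~= 0" "finite A0" "A0 <= FF"
    "y ^ m = c * (\<Prod>al\<in>A0. (TT - al) powi e0 al)" by (rule kbar_factor)
   obtain c0 where c0: "c0 ^ m = c" using nth_root_exists[OF m(1)] by blast
   have c0F: "c0 \<in> FF" by (rule FF_nth_root[OF _ m(1)]) (simp add: c0 f(1))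
   have c00: "c0 ~= 0" using c0 f(2) m(1) by (auto simp: power_0_left)
   define A where "A = (\<Union>al\<in>A0. orb kk al)"
   \<comment> \<open>The exponents are extended by 0 to the Galois-stable set A.\<close>
   define e where "e al = (if al \<in> A0 then e0 al else 0)" for al
   have Aorb: "orb kk al <= A" if a: "al \<in> A" for al
   proof -
    obtain ga where "ga \<in> A0" "al \<in> orb kk ga" using a unfolding A_def by (rule UN_E)
    thus ?thesis unfolding A_def using orb_eq[of al kk ga] by (simp add: UN_upper)
   qed
   have A: "finite A" "A <= FF" "A0 <= A" unfolding A_def
   proof -
    show "finite (\<Union>al\<in>A0. orb kk al)" using f(3) by (intro finite_UN_I finite_orb[OF fld_kk])
    show "(\<Union>al\<in>A0. orb kk al) <= FF" by (rule UN_least, rule orb_subset, rule aut_FF) (simp_all add: subsetD[OF f(4)])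
    show "A0 <= (\<Union>al\<in>A0. orb kk al)" by (rule subsetI) (erule UN_I, rule orb_self)
   qed
   have As: "g ` A <= A" if "g \<in> aut kk" for g :: "'q om => 'q om"
    by (rule image_subsetI) (rule subsetD[OF Aorb orbI[OF that]])
   define y1 where "y1 = y / c0"
   have c0L: "c0 \<in> L" using c0F FF_kbar kL(1) by blast
   have y1L: "y1 \<in> L" unfolding y1_def by (rule fld_divide[OF ab_basic(2)[OF Lk] y(1) c0L])
   have y10: "y1 ~= 0" unfolding y1_def using y0 c00 by simp
   have y1m: "y1 ^ m = (\<Prod>al\<in>A. (TT - al) powi e al)"
   proof -
    have "y1 ^ m = (\<Prod>al\<in>A0. (TT - al) powi e0 al)" unfolding y1_def power_divide c0 f(5) using f(2) by simp
    also have "\<dots> = (\<Prod>al\<in>A. (TT - al) powi e al)" by (rule prod.mono_neutral_cong_left[OF A(1,3)]) (auto simp: e_def)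
    finally show ?thesis .
   qed
   have key: "EX r. g ze = ze ^ r & (ALL be:A. int m dvd e (ainv g be) - int r * e be)" if g: "g \<in> aut kk" for g :: "'q om => 'q om"
   proof -
    have "g ze ^ m = 1" unfolding aut_power[OF g, symmetric] prim_root_power_m[OF z] by (rule aut_1[OF g])
    then obtain r where r: "g ze = ze ^ r" by (rule unity_powers[OF z m(1)])
    \<comment> \<open>\<open>g y1\<close> and \<open>y1 ^ r\<close> are multiplied by the same root
      of unity under each element of \<open>aut kbar\<close>, so their quotient lies in
      \<open>kbar\<close> and has integral values.\<close>
    define w where "w = g y1 / y1 ^ r"
    have gL: "g y1 \<in> L" by (rule ab_normal[OF Lkk g y1L])
    have wL: "w \<in> L" unfolding w_def by (intro fld_divide[OF ab_basic(2)[OF Lk]] fld_power[OF ab_basic(2)[OF Lk]] gL y1L)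
    have "h w = w" if h: "h \<in> aut kbar" for h :: "'q om => 'q om"
    proof -
     obtain j where j: "h y = ze ^ j * y" using y(2) h unfolding eig_def by blast
     have hc: "h c0 = c0" using aut_fixes[OF h] c0F FF_kbar by blast
     have hy: "h y1 = ze ^ j * y1" unfolding y1_def aut_divide[OF h] j hc by simp
     have "h (g y1) = g (h y1)" by (rule ab_commute[OF Lkk aa[OF h] g y1L])
     also have "\<dots> = (ze ^ j) ^ r * g y1" unfolding hy aut_mult[OF g] aut_power[OF g] r by (simp add: mult.commute flip: power_mult)
     finally have "h (g y1) = (ze ^ j) ^ r * g y1" .
     thus ?thesis unfolding w_def aut_divide[OF h] aut_power[OF h] hy power_mult_distrib using prim_root_nz[OF z m(1)] by simp
    qed
    hence wk: "w \<in> kbar" using ab_basic(4)[OF Lk wL] unfolding fixd_def by blast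
    have w0: "w ~= 0" unfolding w_def using y10 aut_eq_0[OF g] by simp
    have "int m dvd e (ainv g be) - int r * e be" if b: "be \<in> A" for be
    proof -
     have bF: "be \<in> FF" using b A(2) by blast
     obtain W where W: "prm W" "TT - be \<in> mx W" by (rule finite_place_ex[OF bF])
     obtain k where k: "val W w = of_int k" by (rule val_kbar_int[OF W(1) wk w0])
     have v: "val W (\<Prod>al\<in>A. (TT - al) powi e' al) = of_int (e' be)" for e'
      using val_factor(1)[OF W(1) FF_1 one_neq_zero A(1,2) bF W(2), of e'] b by simp
     have "w ^ m = g (y1 ^ m) / (y1 ^ m) ^ r" unfolding w_def power_divide aut_power[OF g] by (simp add: mult.commute flip: power_mult)
     moreover have "y1 ^ m ~= 0" "g (y1 ^ m) ~= 0" using y10 aut_eq_0[OF g] by auto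
     ultimately have "of_nat m * val W w = val W (g (y1 ^ m)) - of_nat r * val W (y1 ^ m)"
      using val_power[OF W(1) w0, of m] val_divide[OF W(1)] val_power[OF W(1), of "y1 ^ m" r] by simp
     hence "(of_int (int m * k) :: rat) = of_int (e (ainv g be) - int r * e be)" unfolding y1m prod_shift(1)[OF g A(1) As[OF g]] v k by simp
     thus ?thesis by (metis dvd_triv_left of_int_eq_iff)
    qed
    thus ?thesis using r by blast
   qed
   have "EX w. w ^ m = (\<Prod>al\<in>Q. (TT - al) powi e al) & sg w = w" if Q: "Q \<in> orb kk ` A" for Q
   proof -
    obtain al where a: "al \<in> A" "Q = orb kk al" using Q by blast
    have OA: "Q <= A" unfolding a(2) by (rule Aorb[OF a(1)])
    have Of: "finite Q" unfolding a(2) by (rule finite_orb[OF fld_kk])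
    have Os: "g ` Q <= Q" if "g \<in> aut kk" for g :: "'q om => 'q om" unfolding a(2) using orb_stable[OF that] by blast
    have sm: "EX r k. g ze = ze ^ r & (ALL be:Q. e (ainv g be) = int r * e be + int m * k be)" if g: "g \<in> aut kk" for g :: "'q om => 'q om"
    proof -
     obtain r where r: "g ze = ze ^ r" "ALL be:A. int m dvd e (ainv g be) - int r * e be" using key[OF g] by blast
     have "e (ainv g be) = int r * e be + int m * ((e (ainv g be) - int r * e be) div int m)" if "be \<in> Q" for be
      using r(2) that OA by auto
     thus ?thesis using r(1) by (intro exI[of _ r] exI[of _ "%be. (e (ainv g be) - int r * e be) div int m"]) blast
    qed
    have "int m dvd (\<Sum>be\<in>Q. e be)"
    proof (rule orbit_degree[OF m(1,3) z zF])
     fix g :: "'q om => 'q om" assume g: "g \<in> aut kk"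
     obtain r k where r: "g ze = ze ^ r" "ALL be:Q. e (ainv g be) = int r * e be + int m * k be" using sm[OF g] by blast
     have "(\<Sum>be\<in>Q. e be) = (\<Sum>be\<in>Q. e (ainv g be))" by (rule prod_shift(2)[OF g Of Os[OF g], symmetric])
     also have "\<dots> = (\<Sum>be\<in>Q. int r * e be + int m * k be)" using r(2) by (intro sum.cong) auto
     also have "\<dots> = int r * (\<Sum>be\<in>Q. e be) + int m * (\<Sum>be\<in>Q. k be)" by (simp add: sum.distrib sum_distrib_left)
     finally have "(int r - 1) * (\<Sum>be\<in>Q. e be) = int m * (- (\<Sum>be\<in>Q. k be))" by (simp add: left_diff_distrib)
     hence "int m dvd (int r - 1) * (\<Sum>be\<in>Q. e be)" by (rule dvdI)
     with r(1) show "EX r. g ze = ze ^ r & int m dvd (int r - 1) * (\<Sum>be\<in>Q. e be)" by blast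
    qed
    then obtain d where d: "(\<Sum>be\<in>orb kk al. e be) = int m * d" unfolding a(2) by blast
    have aF: "al \<in> FF" using a(1) A(2) by blast
    obtain P L y where y: "good P L" "y \<in> L" "y ^ m = (\<Prod>be\<in>orb kk al. (TT - be) powi e be)"
    proof (rule kummer_good[OF m(1,2) z aF refl d])
     fix g :: "'q om => 'q om" assume g: "g \<in> aut kk"
     obtain r k where r: "g ze = ze ^ r" "ALL be:Q. e (ainv g be) = int r * e be + int m * k be" using sm[OF g] by blast
     define ro where "ro = (\<Prod>be\<in>Q. (TT - be) powi k be)"
     have Tn: "TT - be ~= 0" if "be \<in> Q" for be using TT_nz[OF subsetD[OF subset_trans[OF OA A(2)] that]] .
     have "ro \<in> kbar" unfolding ro_def by (intro fld_prod[OF fld_kbar] fld_power_int[OF fld_kbar] fld_diff[OF fld_kbar])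
       (use OA A(2) FF_kbar kk_kbar TT_in_kk in blast)+
     moreover have "g (\<Prod>be\<in>Q. (TT - be) powi e be) = (\<Prod>be\<in>Q. (TT - be) powi e be) ^ r * ro ^ m"
      unfolding prod_shift(1)[OF g Of Os[OF g]] ro_def prod_power_distrib prod.distrib[symmetric]
     proof (rule prod.cong[OF refl])
      fix be assume b: "be \<in> Q"
      have "e (ainv g be) = e be * int r + k be * int m" using r(2) b by (simp add: mult.commute)
      thus "(TT - be) powi e (ainv g be) = ((TT - be) powi e be) ^ r * ((TT - be) powi k be) ^ m"
       using Tn[OF b] by (simp add: power_int_add power_int_mult)
     qed
     ultimately show "EX r. g ze = ze ^ r & (EX ro:kbar. g (\<Prod>be\<in>orb kk al. (TT - be) powi e be)
       = (\<Prod>be\<in>orb kk al. (TT - be) powi e be) ^ r * ro ^ m)" using r(1) unfolding a(2) by blast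
    qed
    thus ?thesis using s(2)[OF y(1,2)] unfolding a(2) by blast
   qed
   then obtain w where w: "\<And>Q. Q \<in> orb kk ` A ==> w Q ^ m = (\<Prod>al\<in>Q. (TT - al) powi e al) & sg (w Q) = w Q" by metis
   define Y where "Y = (\<Prod>Q\<in>orb kk ` A. w Q)"
   have sY: "sg Y = Y" unfolding Y_def aut_prod[OF s(1)] using w by (intro prod.cong) auto
   have U: "\<Union>(orb kk ` A) = A"
   proof
    show "\<Union>(orb kk ` A) <= A" using Aorb by blast
    show "A <= \<Union>(orb kk ` A)" by (rule subsetI) (rule UnionI[OF imageI], assumption, rule orb_self)
   qed
   have "Y ^ m = (\<Prod>Q\<in>orb kk ` A. \<Prod>al\<in>Q. (TT - al) powi e al)"
    unfolding Y_def prod_power_distrib using w by (intro prod.cong) auto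
   also have "\<dots> = (\<Prod>al\<in>\<Union>(orb kk ` A). (TT - al) powi e al)"
   proof (rule prod.Union_disjoint[unfolded comp_def, symmetric])
    show "ALL Q:orb kk ` A. finite Q" using finite_orb[OF fld_kk] by blast
    show "ALL Q:orb kk ` A. ALL Q':orb kk ` A. Q ~= Q' --> Q Int Q' = {}" using orb_eq by blast
   qed
   finally have Ym: "Y ^ m = y1 ^ m" unfolding U y1m .
   hence Y0: "Y ~= 0" using y10 m(1) by (auto simp: power_0_left)
   have "(y1 / Y) ^ m = 1" unfolding power_divide Ym using y10 by simp
   hence "(y1 / Y) ^ m \<in> FF" using FF_1 by metis
   hence "y1 / Y \<in> FF" by (rule FF_nth_root[OF _ m(1)])
   hence "c0 * (y1 / Y) \<in> FF" by (rule FF_mult[OF c0F])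
   moreover have "y = c0 * (y1 / Y) * Y" unfolding y1_def using Y0 c00 by simp
   ultimately show ?thesis using sF sY aut_mult[OF s(1)] by metis
  qed (simp add: aut_0[OF s(1)])
 qed
 thus ?thesis using x kL(2) by blast
qed

subsection \<open>Artin--Schreier towers\<close>

definition wp :: "'q::{field,finite} om => 'q om" where "wp x = x ^ CHAR('q om) - x"

definition PF :: "'q::{field,finite} om set" where "PF = of_nat ` {..<CHAR('q om)}"

lemma wp_add: "wp (x + y) = wp x + wp y" and wp_diff: "wp (x - y) = wp x - wp y"
 and wp_0: "wp 0 = (0 :: 'q::{field,finite} om)" for x y :: "'q::{field,finite} om"
 using charp_add[of x y 1] charp_diff[of x y 1] charp_gt_1[where 'q = 'q] by (auto simp: wp_def power_0_left)

lemma aut_wp: "sg \<in> aut F ==> sg (wp x) = wp (sg x)" by (simp add: wp_def aut_diff aut_power)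

lemma wp_of_nat: "wp (of_nat n :: 'q::{field,finite} om) = 0"
proof (induction n)
 case (Suc n)
 have "wp (1 :: 'q om) = 0" by (simp add: wp_def)
 thus ?case using Suc wp_add[of "1 :: 'q om" "of_nat n"] by simp
qed (simp add: wp_0)

lemma wp_poly:
 fixes a :: "'q::{field,finite} om"
 defines "f \<equiv> Polynomial.monom 1 CHAR('q om) + [:- a, -1:]"
 shows "poly f x = wp x - a" "dg f = CHAR('q om)" "Polynomial.lead_coeff f = 1" "pderiv f = [:-1:]"
proof -
 note p = charp_gt_1[where 'q = 'q]
 show "poly f x = wp x - a" unfolding f_def wp_def by (simp add: poly_monom)
 show d: "dg f = CHAR('q om)" unfolding f_def using p by (subst degree_add_eq_left) (auto simp: degree_monom_eq)
 show "Polynomial.lead_coeff f = 1" unfolding d unfolding f_def using p by (simp add: coeff_pCons coeff_eq_0 split: nat.split)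
 show "pderiv f = [:-1:]" unfolding f_def pderiv_add pderiv_monom by (simp add: pderiv_pCons)
qed

lemma wp_root: obtains x :: "'q::{field,finite} om" where "wp x = a"
proof -
 have "dg (Polynomial.monom 1 CHAR('q om) + [:- a, -1:]) > 0" unfolding wp_poly(2) using charp_gt_1[where 'q = 'q] by simp
 from alg_closed_imp_poly_has_root[OF this] show thesis using that unfolding wp_poly(1) by auto
qed

lemma of_nat_ch: "(of_nat i :: 'q::{field,finite} om) = of_nat j \<longleftrightarrow> int CHAR('q om) dvd int i - int j"
 using of_int_eq_0_iff_char_dvd[where 'a = "'q om", of "int i - int j"] by simp

lemma PF_inj: "inj_on (of_nat :: nat => 'q::{field,finite} om) {..<CHAR('q om)}"
proof (rule inj_onI)
 fix i j assume "i \<in> {..<CHAR('q om)}" "j \<in> {..<CHAR('q om)}" "(of_nat i :: 'q om) = of_nat j"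
 thus "i = j" unfolding of_nat_ch using zdvd_not_zless by (auto dest!: zdvd_imp_le[rotated] simp: mod_eq_dvd_iff[symmetric])
qed

lemma PF_eq: "PF = {z :: 'q::{field,finite} om. wp z = 0}"
proof (rule card_seteq)
 have n0: "Polynomial.monom 1 CHAR('q om) + [:- 0, -1:] ~= (0 :: 'q om poly)"
  using wp_poly(2)[where a = "0 :: 'q om"] charp_gt_1[where 'q = 'q] by auto
 show "finite {z :: 'q om. wp z = 0}" using poly_roots_finite[OF n0] unfolding wp_poly(1) by simp
 show "PF <= {z :: 'q om. wp z = 0}" unfolding PF_def using wp_of_nat by blast
 show "card {z :: 'q om. wp z = 0} \<le> card (PF :: 'q om set)"
  using card_poly_roots_bound[OF n0] unfolding wp_poly(1,2) PF_def card_image[OF PF_inj] by simp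
qed

lemma wp_eq:
 assumes "wp x = wp y"
 obtains j where "x = y + of_nat j"
proof -
 have "x - y \<in> PF" unfolding PF_eq using assms by (simp add: wp_diff)
 thus thesis using that unfolding PF_def by (metis add.commute diff_add_cancel imageE)
qed

lemma PF_closed:
 shows "x \<in> PF ==> y \<in> PF ==> x + y \<in> PF" "x \<in> PF ==> y \<in> PF ==> x - y \<in> PF" "0 \<in> PF" "x \<in> PF ==> - x \<in> PF"
 unfolding PF_eq using wp_diff[of 0 x] by (auto simp: wp_add wp_diff wp_0)

lemma PF_kk: "PF <= kk" unfolding PF_def using fld_of_nat[OF fld_kk] by blast

text \<open>For \<open>x ~= 0\<close> this is \<open>wp x / x\<close>; the sum of its translates by the prime field is the value at \<open>x\<close>
 of the derivative of \<open>X ^ p - X\<close>.\<close>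

definition ww :: "'q::{field,finite} om => 'q om" where "ww x = (\<Prod>s\<in>PF - {0}. x - s)"

lemma ww_trace:
 fixes x :: "'q::{field,finite} om" shows "(\<Sum>j<CHAR('q om). ww (x + of_nat j)) = -1"
proof -
 let ?R = "PF :: 'q om set"
 let ?f = "Polynomial.monom 1 CHAR('q om) + [:- 0, -1:] :: 'q om poly"
 have rt: "{x. poly ?f x = 0} = ?R" unfolding wp_poly(1) PF_eq by simp
 have f: "?f = rootpoly ?R" using separable_rootpoly[OF wp_poly(3)[of "0 :: 'q om"]] unfolding rt wp_poly(4) by simp
 have "poly (pderiv ?f) x = (\<Sum>r\<in>?R. \<Prod>s\<in>?R - {r}. x - s)"
  unfolding f pderiv_prod by (simp add: poly_sum poly_prod pderiv_pCons)
 hence 1: "(\<Sum>r\<in>?R. \<Prod>s\<in>?R - {r}. x - s) = -1" unfolding wp_poly(4) by simp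
 have "ww (x + r) = (\<Prod>s\<in>?R - {- r}. x - s)" if r: "r \<in> ?R" for r unfolding ww_def
  by (rule prod.reindex_bij_witness[of _ "%s. s + r" "%s. s - r"]) (use r PF_closed in "auto simp: eq_neg_iff_add_eq_0")
 hence "(\<Sum>r\<in>?R. ww (x + r)) = (\<Sum>r\<in>?R. \<Prod>s\<in>?R - {- r}. x - s)" by simp
 also have "\<dots> = (\<Sum>r\<in>?R. \<Prod>s\<in>?R - {r}. x - s)"
  by (rule sum.reindex_bij_witness[of _ uminus uminus]) (auto simp: PF_closed)
 finally show ?thesis unfolding 1 unfolding PF_def sum.reindex[OF PF_inj] by simp
qed

definition Int_off :: "'q::{field,finite} om set => 'q om set"
 where "Int_off P = {x. ALL W. prm W --> W Int kk ~= P --> x \<in> W}"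

lemma Int_off_rng: "rng (Int_off P)" unfolding rng_def Int_off_def using prm_rng by (auto intro: rng_1 rng_add rng_mult rng_minus)

lemma Int_off_aut:
 assumes "sg \<in> aut kk" "x \<in> Int_off P" shows "sg x \<in> Int_off P"
 using assms(2) pull_prm[OF assms(1)] pull_fixed[OF assms(1)] unfolding Int_off_def mem_Collect_eq by (metis pull_iff)

text \<open>At a pole of x, dividing x^p - x by x^p would put 1 into the maximal ideal.\<close>

lemma Int_off_wp:
 fixes x :: "'q::{field,finite} om"
 assumes "wp x \<in> Int_off P" shows "x \<in> Int_off P" unfolding Int_off_def
proof (intro CollectI allI impI, rule ccontr)
 let ?p = "CHAR('q om)"
 fix W assume W: "prm W" "W Int kk ~= P" and x: "x ~: W"
 note R = prm_rng[OF W(1)] and p = charp_gt_1[where 'q = 'q]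
 have u: "inverse x \<in> mx W" by (rule prm_cases[OF W(1) x])
 have x0: "x ~= 0" using x rng_0[OF R] by auto
 have "wp x \<in> W" using assms W unfolding Int_off_def by blast
 hence "wp x * inverse x ^ ?p \<in> mx W" using mx_mult2[OF R _ mx_power[OF R u]] p by simp
 moreover have "inverse x ^ (?p - 1) \<in> mx W" using mx_power[OF R u] p by simp
 moreover have "wp x * inverse x ^ ?p + inverse x ^ (?p - 1) = 1" using x0 p unfolding wp_def by (cases ?p) (auto simp: field_simps)
 ultimately show False using mx_add[OF W(1)] mx_1[OF R] by metis
qed

lemma of_nat_Int_off: "of_nat n \<in> Int_off P"
 by (induction n) (auto intro: rng_0[OF Int_off_rng] rng_1[OF Int_off_rng] rng_add[OF Int_off_rng])

text \<open>\<open>L/k\<close> is cyclic of degree \<open>N\<close>, generated by \<open>sg\<close> and ramified only at \<open>P\<close>; the element \<open>b\<close> of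
 trace \<open>1\<close>, integral outside \<open>P\<close>, makes Albert's construction of the next layer explicit.\<close>

definition cyc :: "'q::{field,finite} om set => nat => 'q om set => ('q om => 'q om) => 'q om => bool"
 where "cyc P N L sg b \<longleftrightarrow> good P L & sg \<in> aut kk & (ALL g:aut kk. EX i. ALL x:L. g x = (sg ^^ i) x) &
  (ALL k. (ALL x:L. (sg ^^ k) x = x) \<longleftrightarrow> N dvd k) & b \<in> L & b \<in> Int_off P & (\<Sum>i<N. (sg ^^ i) b) = 1"

lemma sum_split: "(\<Sum>i<p * N. f i) = (\<Sum>i<(N::nat). \<Sum>j<p. f (i + N * j) :: 'a::comm_monoid_add)"
proof (induction p)
 case (Suc p)
 have "sum f {0..<p * N} + sum f {p * N..<N + p * N} = sum f {0..<N + p * N}" by (rule sum.atLeastLessThan_concat) auto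
 moreover have "sum f {0 + p * N..<N + p * N} = (\<Sum>i=0..<N. f (i + p * N))" by (rule sum.shift_bounds_nat_ivl)
 ultimately have "(\<Sum>i<Suc p * N. f i) = (\<Sum>i<p * N. f i) + (\<Sum>i<N. f (i + p * N))" by (simp add: lessThan_atLeast0)
 thus ?case using Suc by (simp add: sum.distrib mult.commute)
qed simp

text \<open>Any automorphism agrees with a power of \<open>sg\<close> on L and then differs from it
  on x by an element of the prime field, which a power of \<open>sg^N\<close> supplies; so the group
  stays cyclic, now of order p N. Inertia outside P moves x by an element of the prime field lying
  in the maximal ideal, that is by 0. The element of trace 1 comes from \<open>ww_trace\<close>,
  whose value -1 explains the sign.\<close>

theorem cyc_step:
 fixes x :: "'q::{field,finite} om"
 assumes c: "cyc P N L sg b" "N > 0" and a: "wp x \<in> L" "wp x \<in> Int_off P"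
  and s: "sg x \<in> gen (L Un {x})" "(sg ^^ N) x = x + 1" shows "cyc P (CHAR('q om) * N) (gen (L Un {x})) sg (- (b * ww x))"
proof -
 let ?p = "CHAR('q om)" and ?L = "gen (L Un {x})"
 have g: "good P L" and sa: "sg \<in> aut kk" and cy: "ALL g:aut kk. EX i. ALL x:L. g x = (sg ^^ i) x"
  and o: "\<And>k. (ALL x:L. (sg ^^ k) x = x) \<longleftrightarrow> N dvd k" and b: "b \<in> L" "b \<in> Int_off P" "(\<Sum>i<N. (sg ^^ i) b) = 1"
  using c(1) unfolding cyc_def by blast+
 have abL: "ab kk L" "fingen kk L" using g unfolding good_def by blast+
 note L = ab_basic(2)[OF abL(1)]
 have LL: "L <= ?L" "x \<in> ?L" using gen_incl[of "L Un {x}"] by blast+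
 note sk = aut_funpow[OF sa]
 have sN: "(sg ^^ (N * j)) x = x + of_nat j" for j
 proof (induction j)
  case (Suc j)
  have "(sg ^^ (N * Suc j)) x = (sg ^^ N) ((sg ^^ (N * j)) x)" by (simp add: funpow_add)
  thus ?case unfolding Suc aut_add[OF sk] aut_of_nat[OF sk] s(2) by simp
 qed simp
 have sNL: "(sg ^^ (N * j)) y = y" if "y \<in> L" for y j using o[of "N * j"] that by simp
 have xI: "x \<in> Int_off P" by (rule Int_off_wp[OF a(2)])
 have cy': "EX i. ALL y:?L. g y = (sg ^^ i) y" if g: "g \<in> aut kk" for g
 proof -
  obtain i where i: "ALL x:L. g x = (sg ^^ i) x" using cy g by blast
  have "wp (g x) = wp ((sg ^^ i) x)" using i a(1) unfolding aut_wp[OF g, symmetric] aut_wp[OF sk, symmetric] by blast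
  then obtain j where j: "g x = (sg ^^ i) x + of_nat j" by (rule wp_eq)
  have "g y = (sg ^^ (i + N * j)) y" if "y \<in> L Un {x}" for y using that i sNL[of y j] unfolding funpow_add comp_apply
   by (auto simp: sN aut_add[OF sk] aut_of_nat[OF sk] j)
  hence "ALL y:?L. g y = (sg ^^ (i + N * j)) y" using aut_eq_gen[OF g sk] by blast
  thus ?thesis by blast
 qed
 have stab: "sg y \<in> ?L" if "y \<in> ?L" for y
  by (rule aut_gen_subset[OF sa _ fld_gen that]) (use s(1) ab_normal[OF abL(1) sa] LL(1) in blast)
 hence stab: "(sg ^^ k) y \<in> ?L" if "y \<in> ?L" for y k using that by (induction k) auto
 have ab: "ab kk ?L"
 proof (rule abI[OF fld_kk])
  show "kk <= L Un {x}" using ab_basic(3)[OF abL(1)] by blast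
  fix ta :: "'q om => 'q om" and y assume t: "ta \<in> aut kk" and y: "y \<in> L Un {x}"
  have yL: "y \<in> ?L" using y gen_incl[of "L Un {x}"] by blast
  obtain i where "ta y = (sg ^^ i) y" using cy'[OF t] yL by blast
  thus "ta y \<in> ?L" using stab[OF yL] by simp
 next
  fix y assume y: "y \<in> ?L" "fixd kk y"
  have "sepp L x"
  proof (rule sepp_root[OF _ wp_poly(3)])
   show "pk L (Polynomial.monom 1 ?p + [:- wp x, -1:])"
    by (intro pk_add[OF L] pk_monom[OF L] pk_pCons pk_0[OF L] fld_minus[OF L] fld_1[OF L] a(1))
  qed (unfold wp_poly(1,4), auto)
  hence "y \<in> L" by (intro sep_fixed[OF L _ y(1) fixd_mono[OF y(2) ab_basic(3)[OF abL(1)]]]) auto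
  thus "y \<in> kk" by (rule ab_basic(4)[OF abL(1) _ y(2)])
 next
  fix ta ro :: "'q om => 'q om" and y assume t: "ta \<in> aut kk" "ro \<in> aut kk" and y: "y \<in> L Un {x}"
  have yL: "y \<in> ?L" using y gen_incl[of "L Un {x}"] by blast
  obtain i j where i: "ALL y:?L. ta y = (sg ^^ i) y" and j: "ALL y:?L. ro y = (sg ^^ j) y" using cy' t by metis
  show "(ta \<circ> ro) y = (ro \<circ> ta) y"
   using i j yL stab[OF yL] by (simp add: add.commute flip: funpow_add[THEN fun_cong, unfolded comp_apply])
 qed
 obtain S where S: "finite S" "L = gen S" by (rule fingen_kk[OF abL(2)])
 have "?L = gen (kk Un (S Un {x}))"
 proof
  show "?L <= gen (kk Un (S Un {x}))" unfolding S(2)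
   by (intro gen_least[OF fld_gen] Un_least gen_mono) (use gen_incl[of "kk Un (S Un {x})"] in auto)
  show "gen (kk Un (S Un {x})) <= ?L"
   by (rule gen_least[OF fld_gen]) (use LL gen_incl[of S] S(2) ab_basic(3)[OF ab] in auto)
 qed
 hence fin: "fingen kk ?L" unfolding fingen_def using S(1) by blast
 have "ta y = y" if W: "prm W" "W Int kk ~= P" and t: "ta \<in> aut kk" "inert W ?L ta" and y: "y \<in> ?L" for W ta y
 proof (rule fix_un[OF t(1) _ _ y])
  show tL: "ALL y:L. ta y = y" using goodD[OF g W t(1) inert_mono[OF t(2) LL(1)]] by blast
  have "wp (ta x) = wp x" using tL a(1) unfolding aut_wp[OF t(1), symmetric] by blast
  then obtain j where j: "ta x = x + of_nat j" by (rule wp_eq)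
  have "x \<in> W" using xI W unfolding Int_off_def by blast
  hence "ta x - x \<in> mx W" using t(2) LL(2) unfolding inert_def by blast
  hence "of_nat j \<in> mx W" unfolding j by simp
  moreover have "(of_nat j :: 'q om) \<in> FF" by (induction j) (auto intro: FF_0 FF_1 FF_add)
  ultimately show "ALL y:{x}. ta y = y" using FF_mx[OF W(1)] j by simp
 qed
 hence good: "good P ?L" unfolding good_def using ab fin by blast
 have ord: "(ALL y:?L. (sg ^^ k) y = y) \<longleftrightarrow> ?p * N dvd k" for k
 proof
  assume A: "ALL y:?L. (sg ^^ k) y = y"
  hence "N dvd k" using o LL(1) by blast
  then obtain j where j: "k = N * j" by blast
  have "of_nat j = (of_nat 0 :: 'q om)" using A LL(2) sN[of j] unfolding j by force
  hence "?p dvd j" unfolding of_nat_ch by simp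
  thus "?p * N dvd k" unfolding j by (simp add: mult.commute)
 next
  assume "?p * N dvd k"
  then obtain j where j: "k = N * (?p * j)" by (metis dvdE mult.assoc mult.commute)
  have "ALL y:{x}. (sg ^^ k) y = y" unfolding j using sN[of "?p * j"] by simp
  moreover have "ALL y:L. (sg ^^ k) y = y" unfolding j using sNL by blast
  ultimately show "ALL y:?L. (sg ^^ k) y = y" using fix_un[OF sk] by blast
 qed
 let ?b = "- (b * ww x)"
 have PFL: "s \<in> ?L" "s \<in> Int_off P" if "s \<in> PF" for s :: "'q om"
  using that PF_kk ab_basic(3)[OF ab] of_nat_Int_off unfolding PF_def by auto
 have bL: "?b \<in> ?L" unfolding ww_def using b(1) LL PFL
  by (intro fld_minus[OF fld_gen] fld_mult[OF fld_gen] fld_prod[OF fld_gen] fld_diff[OF fld_gen]) auto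
 have bI: "?b \<in> Int_off P" unfolding ww_def using b(2) xI PFL
  by (intro rng_minus[OF Int_off_rng] rng_mult[OF Int_off_rng] rng_prod[OF Int_off_rng] rng_diff[OF Int_off_rng]) auto
 have "(sg ^^ (i + N * j)) ?b = (sg ^^ i) (- b) * (sg ^^ i) (ww (x + of_nat j))" for i j
 proof -
  have "(sg ^^ (N * j)) (ww x) = ww (x + of_nat j)" unfolding ww_def aut_prod[OF sk] aut_diff[OF sk] sN
   by (rule prod.cong[OF refl]) (use PF_kk aut_fixes[OF sk] in auto)
  hence "(sg ^^ (N * j)) ?b = - b * ww (x + of_nat j)" by (simp add: aut_minus[OF sk] aut_mult[OF sk] sNL[OF b(1)])
  thus ?thesis unfolding funpow_add comp_apply by (simp only: aut_mult[OF sk])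
 qed
 hence "(\<Sum>i<?p * N. (sg ^^ i) ?b) = (\<Sum>i<N. (sg ^^ i) (- b) * (sg ^^ i) (\<Sum>j<?p. ww (x + of_nat j)))"
  unfolding sum_split by (simp add: sum_distrib_left aut_sum[OF sk])
 also have "\<dots> = 1" unfolding ww_trace using b(3) by (simp add: aut_minus[OF sk] aut_1[OF sk])
 finally show ?thesis unfolding cyc_def using good sa cy' ord bL bI by blast
qed

text \<open>The trace of \<open>wp b\<close> is \<open>wp 1 = 0\<close>, so additive Hilbert 90
  solves \<open>sg a = a + wp b\<close>; the element b of trace 1 makes a solution explicit and
  integral outside P. A root x of \<open>wp x = a\<close> satisfies \<open>sg x = x + b + j\<close>
  with j in the prime field, so \<open>sg^N\<close> moves it by 1 + N j = 1, as p divides N.\<close>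

theorem cyc_extend:
 fixes L :: "'q::{field,finite} om set"
 assumes c: "cyc P N L sg b" "N > 0" "CHAR('q om) dvd N"
 obtains L' b' where "cyc P (CHAR('q om) * N) L' sg b'" "L <= L'"
proof -
 have g: "good P L" and sa: "sg \<in> aut kk" and b: "b \<in> L" "b \<in> Int_off P" "(\<Sum>i<N. (sg ^^ i) b) = 1"
  and o: "\<And>k. (ALL x:L. (sg ^^ k) x = x) \<longleftrightarrow> N dvd k" using c(1) unfolding cyc_def by blast+
 have abL: "ab kk L" using g unfolding good_def by blast
 note L = ab_basic(2)[OF abL]
 note sk = aut_funpow[OF sa]
 have bk: "(sg ^^ k) b \<in> L" "(sg ^^ k) b \<in> Int_off P" for k using ab_normal[OF abL sk b(1)] Int_off_aut[OF sk b(2)] .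
 define S where "S i = (\<Sum>j<i. (sg ^^ j) (wp b))" for i
 define a where "a = - (\<Sum>i<N. S i * (sg ^^ i) b)"
 have wk: "(sg ^^ k) (wp b) \<in> L" "(sg ^^ k) (wp b) \<in> Int_off P" for k unfolding aut_wp[OF sk] unfolding wp_def
  by (intro fld_diff[OF L] fld_power[OF L] bk, intro rng_diff[OF Int_off_rng] rng_power[OF Int_off_rng] bk)
 have aL: "a \<in> L" unfolding a_def S_def by (intro fld_minus[OF L] fld_sum[OF L] fld_mult[OF L] wk bk)
 have aI: "a \<in> Int_off P" unfolding a_def S_def
  by (intro rng_minus[OF Int_off_rng] rng_sum[OF Int_off_rng] rng_mult[OF Int_off_rng] wk bk)
 have wsum: "wp (sum f A) = (\<Sum>i\<in>A. wp (f i))" for f :: "nat => 'q om" and A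
  by (induction A rule: infinite_finite_induct) (auto simp: wp_add wp_0)
 have SN: "S N = 0"
 proof -
  have "S N = wp (\<Sum>i<N. (sg ^^ i) b)" unfolding S_def wsum aut_wp[OF sk] ..
  thus ?thesis unfolding b(3) by (simp add: wp_def)
 qed
 have S: "sg (S i) = S (Suc i) - wp b" for i unfolding S_def aut_sum[OF sa] sum.lessThan_Suc_shift by simp
 have bN: "(sg ^^ N) b = b" using o[of N] b(1) by simp
 have "sg a = - (\<Sum>i<N. S (Suc i) * (sg ^^ Suc i) b) + wp b * (\<Sum>i<N. (sg ^^ Suc i) b)"
  unfolding a_def aut_minus[OF sa] aut_sum[OF sa] aut_mult[OF sa] S by (simp add: left_diff_distrib sum_subtractf sum_distrib_left)
 also have "(\<Sum>i<N. S (Suc i) * (sg ^^ Suc i) b) = (\<Sum>i<N. S i * (sg ^^ i) b)"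
  using sum.lessThan_Suc_shift[of "%i. S i * (sg ^^ i) b" N] SN by (simp add: S_def)
 also have "(\<Sum>i<N. (sg ^^ Suc i) b) = 1" using sum.lessThan_Suc_shift[of "%i. (sg ^^ i) b" N] b(3) bN by simp
 finally have sa': "sg a = a + wp b" by (simp add: a_def)
 obtain x where x: "wp x = a" by (rule wp_root)
 have "wp (sg x) = wp (x + b)" unfolding aut_wp[OF sa, symmetric] x sa' wp_add ..
 then obtain j where j: "sg x = x + b + of_nat j" by (rule wp_eq)
 have "(sg ^^ i) x = x + (\<Sum>l<i. (sg ^^ l) b) + of_nat (i * j)" for i
 proof (induction i)
  case (Suc i)
  have "(sg ^^ Suc i) x = sg x + (\<Sum>l<i. (sg ^^ Suc l) b) + of_nat (i * j)"
   unfolding funpow.simps comp_apply Suc aut_add[OF sa] aut_sum[OF sa] aut_of_nat[OF sa] by simp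
  thus ?case unfolding j sum.lessThan_Suc_shift by simp
 qed simp
 moreover have "(of_nat (N * j) :: 'q om) = of_nat 0" unfolding of_nat_ch using c(3) by auto
 ultimately have sN: "(sg ^^ N) x = x + 1" using b(3) by simp
 let ?L = "gen (L Un {x})"
 have LL: "L <= ?L" "x \<in> ?L" using gen_incl[of "L Un {x}"] by blast+
 have "sg x \<in> ?L" unfolding j using LL b(1) by (intro fld_add[OF fld_gen] fld_of_nat[OF fld_gen]) auto
 from cyc_step[OF c(1,2) _ _ this sN] show thesis using that LL(1) aL aI x by blast
qed

lemma mult_inverse_ch:
 fixes j :: nat
 assumes "(of_nat j :: 'q::{field,finite} om) ~= 0"
 obtains k where "(of_nat (k * j) :: 'q om) = 1"
proof -
 let ?p = "CHAR('q om)"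
 have "\<not> ?p dvd j" using assms by (simp add: of_nat_eq_0_iff_char_dvd)
 hence c: "coprime j ?p" using prime_char[where 'q = 'q] prime_imp_coprime coprime_commute by metis
 have "j ~= 0" using assms by (cases j) auto
 then obtain k l where "j * k = ?p * l + gcd j ?p" using bezout_nat by metis
 hence "k * j = ?p * l + 1" using c by (simp add: mult.commute)
 hence "(of_nat (k * j) :: 'q om) = of_nat 1" unfolding of_nat_ch by simp
 thus thesis using that by simp
qed

text \<open>The trivial extension with N = 1 and b = 1 serves as starting layer, and an automorphism
  moving x is replaced by a power of it that moves x by exactly 1.\<close>

theorem cyc_start:
 fixes x :: "'q::{field,finite} om"
 assumes a: "wp x \<in> kk" "wp x \<in> Int_off P" and x: "x ~: kk"
 obtains sg L b where "cyc P CHAR('q om) L sg b" "x \<in> L"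
proof -
 have "sepp kk x"
 proof (rule sepp_root[OF _ wp_poly(3)])
  show "pk kk (Polynomial.monom 1 CHAR('q om) + [:- wp x, -1:])"
   by (intro pk_add[OF fld_kk] pk_monom[OF fld_kk] pk_pCons pk_0[OF fld_kk] fld_minus[OF fld_kk] fld_1[OF fld_kk] a(1))
 qed (unfold wp_poly(1,4), auto)
 moreover have "x \<in> gen (kk Un {x})" using gen_incl[of "kk Un {x}"] by blast
 ultimately have "\<not> fixd kk x" using sep_fixed[OF fld_kk, of "{x}" x] x by blast
 then obtain g where g: "g \<in> aut kk" "g x ~= x" unfolding fixd_def by blast
 have "wp (g x) = wp x" unfolding aut_wp[OF g(1), symmetric] by (rule aut_fixes[OF g(1) a(1)])
 then obtain j where j: "g x = x + of_nat j" by (rule wp_eq)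
 have "(of_nat j :: 'q om) ~= 0" using j g(2) by auto
 then obtain k where k: "(of_nat (k * j) :: 'q om) = 1" by (rule mult_inverse_ch)
 have "(g ^^ i) x = x + of_nat (i * j)" for i by (induction i) (auto simp: aut_add[OF g(1)] aut_of_nat[OF g(1)] aut_mult[OF g(1)] j)
 hence s: "(g ^^ k) x = x + 1" using k by simp
 have sa: "g ^^ k \<in> aut kk" by (rule aut_funpow[OF g(1)])
 have fx: "(f ^^ i) y = y" if "f \<in> aut kk" "y \<in> kk" for f i and y :: "'q om" using aut_fixes[OF aut_funpow[OF that(1)] that(2)] .
 have "good P kk" unfolding good_def using ab_refl[OF fld_kk] fingen_refl[OF fld_kk] aut_fixes by blast
 hence c: "cyc P 1 kk (g ^^ k) 1"
  unfolding cyc_def using sa fx[OF sa] rng_1[OF Int_off_rng] kk_1 aut_fixes[of _ kk] by (auto intro!: exI[of _ 0])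
 have "(g ^^ k) x \<in> gen (kk Un {x})" unfolding s
  by (rule fld_add[OF fld_gen \<open>x \<in> gen (kk Un {x})\<close> fld_1[OF fld_gen]])
 from cyc_step[OF c _ a this] show thesis using that s \<open>x \<in> gen (kk Un {x})\<close> by simp
qed

text \<open>The identity (sg - 1)^p = sg^p - 1 in characteristic p, transported from polynomials
  whose coefficients are fixed by \<open>sg\<close>.\<close>

lemma difference_powers:
 fixes y :: "'q::{field,finite} om"
 assumes s: "sg \<in> aut kk"
 defines "D \<equiv> %y. sg y - y" shows "(D ^^ CHAR('q om)) y = (sg ^^ CHAR('q om)) y - y"
proof -
 let ?p = "CHAR('q om)" and ?f = "%n. [:-1, 1:] ^ n :: 'q om poly"
 have cF: "sg (cf (?f n) i) = cf (?f n) i" for n i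
  using pk_power[OF fld_kk, of "[:-1, 1:]" n] pk_pCons[of "-1" kk "[:1:]"] pk_pCons[of 1 kk 0] pk_0[OF fld_kk] kk_1 kk_minus[OF kk_1]
   aut_fixes[OF s] unfolding pk_def by blast
 have "(D ^^ n) y = (\<Sum>i\<le>n. cf (?f n) i * (sg ^^ i) y)" for n
 proof (induction n)
  case (Suc n)
  have c: "cf (?f (Suc n)) i = (case i of 0 => 0 | Suc j => cf (?f n) j) - cf (?f n) i" for i by (simp add: coeff_pCons split: nat.split)
  have "dg (?f n) \<le> n" using degree_power_le[of "[:-1, 1 :: 'q om:]" n] by simp
  hence z: "cf (?f n) (Suc n) = 0" by (simp add: coeff_eq_0)
  have "(D ^^ Suc n) y = sg ((D ^^ n) y) - (D ^^ n) y" by (simp add: D_def)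
  also have "\<dots> = (\<Sum>i\<le>n. cf (?f n) i * (sg ^^ Suc i) y) - (\<Sum>i\<le>n. cf (?f n) i * (sg ^^ i) y)"
   unfolding Suc by (simp add: aut_sum[OF s] aut_mult[OF s] cF)
  also have "\<dots> = (\<Sum>i\<le>Suc n. (case i of 0 => 0 | Suc j => cf (?f n) j) * (sg ^^ i) y) - (\<Sum>i\<le>Suc n. cf (?f n) i * (sg ^^ i) y)"
   unfolding sum.atMost_Suc_shift[of "%i. (case i of 0 => 0 | Suc j => cf (?f n) j) * (sg ^^ i) y"]
    sum.atMost_Suc[of "%i. cf (?f n) i * (sg ^^ i) y"] z by simp
  also have "\<dots> = (\<Sum>i\<le>Suc n. cf (?f (Suc n)) i * (sg ^^ i) y)" unfolding c by (simp only: left_diff_distrib sum_subtractf)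
  finally show ?case .
 qed simp
 \<comment> \<open>The polynomial identity is read off from equality of values on the infinite
   ambient field.\<close>
 moreover have "?f ?p = Polynomial.monom 1 ?p - 1"
 proof -
  have "poly (?f ?p) x = poly (Polynomial.monom 1 ?p - 1) x" for x using charp_diff[of x 1 1] by (simp add: poly_power poly_monom)
  hence "{x. poly (?f ?p - (Polynomial.monom 1 ?p - 1)) x = 0} = UNIV" by simp
  hence "\<not> finite {x. poly (?f ?p - (Polynomial.monom 1 ?p - 1)) x = 0}"
   using infinite_kk[where 'q = 'q] finite_subset[OF subset_UNIV] by metis
  thus ?thesis using poly_roots_finite by (metis eq_iff_diff_eq_0)
 qed
 ultimately have "(D ^^ ?p) y = (\<Sum>i\<le>?p. (if i = ?p then (sg ^^ i) y else 0) - (if i = 0 then (sg ^^ i) y else 0))"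
  by (auto intro!: sum.cong simp: left_diff_distrib)
 thus ?thesis by (simp add: sum_subtractf sum.delta)
qed

text \<open>Let N be a subfield of least degree on which \<open>sg\<close> is nontrivial. For any
  nontrivial g, the fixed field of its powers is smaller, so \<open>sg\<close> fixes it and is a
  power of g by Artin's theorem; hence \<open>sg\<close> generates the group. The operator sg - 1 is
  nilpotent, so there is w whose image D w is nonzero and fixed by \<open>sg\<close>. Then w / D w
  is moved by 1, and its value under \<open>wp\<close> lies in \<open>k\<close>.\<close>

theorem as_element:
 fixes A :: "'q::{field,finite} om set"
 assumes A: "ab kk A" "fingen kk A" "expo CHAR('q om) A" and s: "sg \<in> aut kk" and y: "y \<in> A" "sg y ~= y"
 obtains x where "x \<in> A" "wp x \<in> kk" "sg x ~= x"
proof -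
 define Q where "Q N \<longleftrightarrow> fld N & N <= A & (EX y:N. sg y ~= y)" for N
 have "Q A" unfolding Q_def using ab_basic(2)[OF A(1)] y by blast
 then obtain N where N: "Q N" "\<And>M. Q M ==> card (restr kk N) \<le> card (restr kk M)"
  using ex_has_least_nat[of Q A "%N. card (restr kk N)"] by metis
 have NA: "fld N" "N <= A" using N(1) unfolding Q_def by blast+
 have abN: "ab kk N" by (rule ab_sub(1)[OF A(1) NA(1) fld_kk_sub[OF NA(1)] NA(2)])
 have finN: "fingen kk N" by (rule fingen_sub[OF A(1,2) NA(1) fld_kk_sub[OF NA(1)] NA(2)])
 obtain z where z: "z \<in> N" "sg z ~= z" using N(1) unfolding Q_def by blast
 let ?p = "CHAR('q om)"
 have ex: "(f ^^ (?p * k)) y = y" if "f \<in> aut kk" "y \<in> N" for f y k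
  by (rule funpow_dvd_fix[of ?p]) (use A(3) that NA(2) in "auto simp: expo_def")
 have cy: "EX k. ALL x:N. g x = (sg ^^ k) x" if g: "g \<in> aut kk" for g
 proof (cases "ALL x:N. g x = x")
  case True
  thus ?thesis by (intro exI[of _ 0]) simp
 next
  case False
  define H where "H = range (%i. g ^^ i)"
  have H: "H <= aut kk" unfolding H_def using aut_funpow[OF g] by blast
  have "(%x. x) \<in> H" unfolding H_def by (rule range_eqI[of _ _ 0]) (auto simp: id_def)
  hence sH: "subgrp H" unfolding subgrp_def H_def by (auto simp flip: funpow_add)
  let ?M = "Fix H N"
  have M: "fld ?M" "?M <= N" using fld_Fix[OF NA(1) H] unfolding Fix_def by auto
  have "g \<in> H" unfolding H_def by (rule range_eqI[of _ _ 1]) (auto simp: comp_def)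
  hence gM: "ALL x:?M. g x = x" unfolding Fix_def by blast
  have "restr kk ?M = (%f. restrict f ?M) ` restr kk N" unfolding restr_def image_image using M(2) by (simp add: Int_absorb1)
  moreover have "\<not> inj_on (%f. restrict f ?M) (restr kk N)"
  proof
   assume i: "inj_on (%f. restrict f ?M) (restr kk N)"
   have "restrict (restrict g N) ?M = restrict (restrict (%x. x) N) ?M" using gM M(2) by (auto simp: restrict_def)
   hence "restrict g N = restrict (%x. x) N" using inj_onD[OF i] g aut_id(2) unfolding restr_def by blast
   thus False using False unfolding restrict_eq_iff by blast
  qed
  ultimately have "card (restr kk ?M) < card (restr kk N)"
   using card_image_le[OF finite_restr[OF fld_kk finN]] eq_card_imp_inj_on[OF finite_restr[OF fld_kk finN]] by (metis le_neq_implies_less)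
  hence "\<not> Q ?M" using N(2) by (metis leD)
  hence "ALL x:?M. sg x = x" unfolding Q_def using M NA(2) by blast
  from artin_kk[OF abN finN H sH s this] obtain i where i: "ALL x:N. sg x = (g ^^ i) x" unfolding H_def by blast
  have "(of_nat i :: 'q om) ~= 0"
  proof
   assume "(of_nat i :: 'q om) = 0"
   then obtain l where "i = ?p * l" unfolding of_nat_eq_0_iff_char_dvd by blast
   thus False using i z ex[OF g z(1), of l] by auto
  qed
  then obtain k where k: "(of_nat (k * i) :: 'q om) = of_nat 1" using mult_inverse_ch by (metis of_nat_1)
  have "(sg ^^ k) x = g x" if x: "x \<in> N" for x
  proof -
   have sx: "(sg ^^ k) x = (g ^^ (i * k)) x" using funpow_agree[OF abN s i x, of k] by (simp add: funpow_mult)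
   have d: "int ?p dvd int (i * k) - 1" using k unfolding of_nat_ch by (simp add: mult.commute)
   have "i * k ~= 0" using k by (metis mult.commute of_nat_0 of_nat_1 zero_neq_one)
   hence "?p dvd i * k - 1" using d by (metis One_nat_def Suc_leI int_dvd_int_iff not_gr0 of_nat_1 of_nat_diff)
   then obtain l where "i * k - 1 = ?p * l" by blast
   hence "i * k = Suc (?p * l)" using \<open>i * k ~= 0\<close> by linarith
   thus ?thesis unfolding sx using ex[OF g x, of l] by simp
  qed
  thus ?thesis by metis
 qed
 define D where "D = (%y. sg y - y)"
 define n where "n = (LEAST n. (D ^^ n) z = 0)"
 have "(D ^^ ?p) z = 0" unfolding D_def difference_powers[OF s] using ex[OF s z(1), of 1] by simp
 hence n: "(D ^^ n) z = 0" unfolding n_def by (rule LeastI)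
 have nl: "(D ^^ k) z ~= 0" if "k < n" for k using not_less_Least that unfolding n_def by blast
 have "z ~= 0" using z(2) aut_0[OF s] by auto
 hence "n ~= 0" "n ~= 1" using n z(2) unfolding D_def by (auto intro: ccontr)
 then obtain k where k: "n = Suc (Suc k)" by (metis One_nat_def not0_implies_Suc)
 define w where "w = (D ^^ k) z"
 have w: "D (D w) = 0" "D w ~= 0" using n nl[of "Suc k"] unfolding w_def k by auto
 have "(D ^^ k) z \<in> N" for k by (induction k) (auto simp: D_def z(1) intro!: fld_diff[OF NA(1)] ab_normal[OF abN s])
 hence wN: "w \<in> N" "D w \<in> N" unfolding w_def by (blast, metis comp_apply funpow.simps(2))
 define x where "x = w / D w"
 have "sg (D w) = D w" "sg w = w + D w" using w(1) unfolding D_def by auto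
 hence sx: "sg x = x + 1" unfolding x_def aut_divide[OF s] using w(2) by (simp add: add_divide_distrib)
 have xN: "x \<in> N" unfolding x_def by (rule fld_divide[OF NA(1) wN])
 have sw: "sg (wp x) = wp x" unfolding aut_wp[OF s] sx wp_add by (simp add: wp_def)
 have wN: "wp x \<in> N" unfolding wp_def by (intro fld_diff[OF NA(1)] fld_power[OF NA(1)] xN)
 have "g (wp x) = wp x" if "g \<in> aut kk" for g using cy[OF that] wN funpow_fix[of sg "wp x", OF sw] by metis
 hence "wp x \<in> kk" using ab_basic(4)[OF abN wN] unfolding fixd_def by blast
 moreover have "sg x ~= x" unfolding sx by simp
 ultimately show thesis using that xN NA(2) by blast
qed

subsection \<open>Partial fractions\<close>

abbreviation pv :: "'q::{field,finite} poly => 'q om" where "pv f \<equiv> to_ac (Fract f 1)"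

lemma pv_simps: "pv (f + g) = pv f + pv g" "pv (f * g) = pv f * pv g" "pv 1 = 1" "pv f = 0 \<longleftrightarrow> f = 0"
 "g ~= 0 ==> to_ac (Fract f g) = pv f / pv g" using TT_trans[OF pk_cst(1), of f] pk_cst(3)[of f]
 by (auto simp: to_ac_poly to_ac_Fract simp flip: One_fract_def) (simp_all flip: to_ac_poly to_ac_add to_ac_mult)

lemma pv_prm: "prm W ==> TT \<in> W ==> pv f \<in> W" unfolding to_ac_poly by (rule poly_FF_prm[OF _ pk_cst(1)])

text \<open>Irreducibility through degrees of divisors, the form in which
  \<open>partial_fractions\<close> obtains it for a divisor of least positive degree.\<close>

definition irr :: "'a::field poly => bool"
 where "irr pp \<longleftrightarrow> dg pp > 0 & (ALL d. d dvd pp --> dg d = 0 \<or> dg d = dg pp)"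

lemma irr_bezout:
 fixes pp h :: "'a::field poly"
 assumes p: "irr pp" and h: "\<not> pp dvd h"
 obtains s t where "s * pp + t * h = 1"
proof -
 define I where "I d \<longleftrightarrow> d ~= 0 & (EX s t. d = s * pp + t * h)" for d
 have p0: "pp ~= 0" using p unfolding irr_def by auto
 have "I pp" unfolding I_def using p0 by (metis add.right_neutral mult_1 mult_zero_left)
 then obtain d where d: "I d" "\<And>e. I e ==> dg d \<le> dg e" using ex_has_least_nat[of I pp dg] by metis
 obtain s t where st: "d = s * pp + t * h" and d0: "d ~= 0" using d(1) unfolding I_def by blast
 have dv: "d dvd u * pp + v * h" for u v
 proof (rule ccontr)
  let ?z = "u * pp + v * h"
  assume n: "\<not> d dvd ?z"
  define k where "k = ?z div d"
  have "?z mod d = ?z - k * d" unfolding k_def by (rule minus_div_mult_eq_mod[symmetric])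
  also have "\<dots> = (u - k * s) * pp + (v - k * t) * h" unfolding st by (simp add: algebra_simps)
  finally have "?z mod d = (u - k * s) * pp + (v - k * t) * h" .
  hence "I (?z mod d)" unfolding I_def using n by (auto simp: dvd_eq_mod_eq_0)
  thus False using d(2) degree_mod_less[OF d0, of ?z] n by (force simp: dvd_eq_mod_eq_0)
 qed
 have "d dvd pp" "d dvd h" using dv[of 1 0] dv[of 0 1] by auto
 then obtain c where c: "pp = d * c" by blast
 have "dg d ~= dg pp"
 proof
  assume "dg d = dg pp"
  hence "dg c = 0" using c p0 by (auto simp: degree_mult_eq)
  then obtain k where k: "c = [:k:]" by (rule degree_eq_zeroE)
  have "k ~= 0" using c k p0 by auto
  hence "d = pp * [:inverse k:]" unfolding c k by (simp add: mult.commute)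
  thus False using h \<open>d dvd h\<close> by (metis dvd_triv_left dvd_trans)
 qed
 hence "dg d = 0" using p \<open>d dvd pp\<close> unfolding irr_def by blast
 then obtain k where k: "d = [:k:]" by (rule degree_eq_zeroE)
 have "[:inverse k:] * s * pp + [:inverse k:] * t * h = [:inverse k:] * d" unfolding st by (simp only: distrib_left mult.assoc)
 also have "\<dots> = 1" using d0 unfolding k by (simp add: one_pCons)
 finally show thesis by (rule that)
qed

lemma irr_unt:
 assumes W: "prm W" "TT \<in> W" and p: "irr pp" "pv pp \<in> mx W" and h: "\<not> pp dvd h" shows "unt W (pv h)"
proof -
 note R = prm_rng[OF W(1)]
 obtain s t where st: "s * pp + t * h = 1" by (rule irr_bezout[OF p(1) h])
 have "pv s * pv pp + pv t * pv h = 1" unfolding pv_simps(1,2)[symmetric] st pv_simps(3) ..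
 hence "pv h ~: mx W" using mx_add[OF W(1) mx_mult2[OF R pv_prm[OF W] p(2)] mx_mult2[OF R pv_prm[OF W]]] mx_1[OF R] by metis
 thus ?thesis unfolding unt_iff using pv_prm[OF W] by blast
qed

text \<open>With a denominator of least degree, pp does not divide both parts of the fraction. If it
  divided the denominator, x would have a pole at W; so the denominator is a unit at W'.\<close>

lemma irr_prime_sub:
 assumes W: "prm W" "TT \<in> W" "prm W'" "TT \<in> W'" and p: "irr pp" "pv pp \<in> mx W" "pv pp \<in> mx W'"
 shows "W Int kk <= W'"
proof
 fix x assume x: "x \<in> W Int kk"
 define Q where "Q v \<longleftrightarrow> v ~= 0 & (EX u. x = pv u / pv v)" for v
 obtain r where r: "x = to_ac r" using x unfolding ratfun_field_def by blast
 obtain f g where "r = Fract f g" "g ~= 0" by (cases r) auto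
 hence "Q g" unfolding Q_def r using pv_simps(5) by blast
 then obtain v where v: "Q v" "\<And>w. Q w ==> dg v \<le> dg w" using ex_has_least_nat[of Q g dg] by metis
 obtain u where u: "x = pv u / pv v" and v0: "v ~= 0" using v(1) unfolding Q_def by blast
 show "x \<in> W'"
 proof (cases "pp dvd v")
  case False
  have "unt W' (pv v)" by (rule irr_unt[OF W(3,4) p(1,3) False])
  thus ?thesis unfolding u divide_inverse unt_def using rng_mult[OF prm_rng[OF W(3)] pv_prm[OF W(3,4)]] by blast
 next
  case True
  then obtain v' where v': "v = pp * v'" by blast
  have p0: "pp ~= 0" "v' ~= 0" using v0 v' by auto
  have "\<not> pp dvd u"
  proof
   assume "pp dvd u"
   then obtain u' where u': "u = pp * u'" by blast
   have "Q v'" unfolding Q_def u u' v' pv_simps(2) using p0 pv_simps(4)[of pp] by auto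
   from v(2)[OF this] show False using p0 p(1) unfolding v' irr_def by (simp add: degree_mult_eq)
  qed
  hence "unt W (pv u)" by (rule irr_unt[OF W(1,2) p(1,2)])
  moreover have "pv v \<in> mx W" unfolding v' pv_simps(2) by (rule mx_mult[OF prm_rng[OF W(1)] p(2) pv_prm[OF W(1,2)]])
  moreover have "pv u = x * pv v" unfolding u using v0 pv_simps(4)[of v] by simp
  ultimately show ?thesis using mx_mult2[OF prm_rng[OF W(1)], of x "pv v"] x unfolding unt_iff by auto
 qed
qed

lemma irr_power_bezout:
 fixes pp v :: "'a::field poly"
 assumes st: "s * pp + t * v = 1" shows "EX a b. a * pp ^ n + b * v = 1"
proof (induction n)
 case (Suc n)
 then obtain a b where ab: "a * pp ^ n + b * v = 1" by blast
 have "(a * s) * pp ^ Suc n + (a * pp ^ n * t + b * (s * pp + t * v)) * v = (a * pp ^ n + b * v) * (s * pp + t * v)"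
  by (simp add: algebra_simps)
 thus ?case unfolding ab st by auto
qed (auto intro: exI[of _ 0] exI[of _ 1])

text \<open>Sums of elements of \<open>k\<close>, each with poles at no more than one prime.\<close>

definition pf :: "'q::{field,finite} om => bool"
 where "pf a \<longleftrightarrow> (EX xs. a = sum_list xs & (ALL x:set xs. x \<in> kk & (EX P. x \<in> Int_off P)))"

lemma pf_add: "pf a ==> pf b ==> pf (a + b)" unfolding pf_def by (metis (no_types, lifting) UnE set_append sum_list_append)

lemma pf_single: "a \<in> kk ==> a \<in> Int_off P ==> pf a" unfolding pf_def by (rule exI[of _ "[a]"]) auto

lemma pv_kk: "pv f / pv g \<in> kk" by (intro fld_divide[OF fld_kk]) (auto simp: ratfun_field_def)

lemma pf_poly: "pf (pv f)"
proof (rule pf_single)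
 show "pv f \<in> Int_off P_infinity" unfolding Int_off_def using pv_prm inf_prime_trace by blast
qed (auto simp: ratfun_field_def)

text \<open>Division with remainder separates a polynomial, with pole at infinity only, from a
  fraction that is integral at infinity and has poles only where pp vanishes, which is a single
  prime by \<open>irr_prime_sub\<close>.\<close>

lemma pf_prime_power:
 fixes pp r :: "'q::{field,finite} poly"
 assumes p: "irr pp" shows "pf (pv r / pv (pp ^ e))"
proof -
 have p0: "pp ^ e ~= 0" using p unfolding irr_def by auto
 let ?q = "r div pp ^ e" and ?r = "r mod pp ^ e"
 let ?x = "pv ?r / pv (pp ^ e)"
 have "pv r = pv ?q * pv (pp ^ e) + pv ?r" unfolding pv_simps(1,2)[symmetric] div_mult_mod_eq ..
 hence "pv r / pv (pp ^ e) = pv ?q + ?x" using p0 pv_simps(4)[of "pp ^ e"] by (simp add: add_divide_distrib)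
 moreover have "EX P. ALL W. prm W --> W Int kk ~= P --> ?x \<in> W"
 proof -
  have *: "TT \<in> W & pv pp \<in> mx W" if W: "prm W" "?x ~: W" for W
  proof -
   have T: "TT \<in> W"
   proof (rule ccontr)
    assume T: "TT ~: W"
    have "dg ?r \<le> dg (pp ^ e)" using degree_mod_less[OF p0, of r] by auto
    hence "?x \<in> P_infinity" unfolding P_infinity_def pv_simps(5)[OF p0, symmetric] using p0 by blast
    thus False using inf_prime_trace[OF W(1) T] W(2) by blast
   qed
   have "pv pp \<in> mx W"
   proof (rule ccontr)
    assume "pv pp ~: mx W"
    hence u: "unt W (pv pp)" unfolding unt_iff using pv_prm[OF W(1) T] by blast
    have "pv (pp ^ e) = pv pp ^ e" by (induction e) (simp_all add: pv_simps(2,3))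
    hence "unt W (pv (pp ^ e))" using unt_power[OF prm_rng[OF W(1)] u] by simp
    thus False using W(2) rng_mult[OF prm_rng[OF W(1)] pv_prm[OF W(1) T]] unfolding divide_inverse unt_def by blast
   qed
   thus ?thesis using T by blast
  qed
  show ?thesis
  proof (cases "EX W. prm W & ?x ~: W")
   case True
   then obtain W0 where W0: "prm W0" "?x ~: W0" by blast
   have "W Int kk = W0 Int kk" if "prm W" "?x ~: W" for W
    using irr_prime_sub[OF _ _ _ _ p] *[OF that] *[OF W0] that(1) W0(1) by blast
   thus ?thesis by blast
  qed blast
 qed
 hence "pf ?x" using pf_single[OF pv_kk] unfolding Int_off_def by blast
 ultimately show ?thesis using pf_add[OF pf_poly] by metis
qed

text \<open>Induction on the degree of the denominator: a divisor of least positive degree is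
  irreducible, and its full power is split off by a Bezout relation.\<close>

theorem partial_fractions:
 fixes a :: "'q::{field,finite} om"
 assumes "a \<in> kk" shows "pf a"
proof -
 have *: "g ~= 0 ==> pf (pv f / pv g)" for f g :: "'q poly"
 proof (induction "dg g" arbitrary: f g rule: less_induct)
  case less
  show ?case
  proof (cases "dg g = 0")
   case True
   then obtain c where c: "g = [:c:]" by (rule degree_eq_zeroE)
   have "g * [:inverse c:] = 1" using less.prems unfolding c by (simp add: one_pCons)
   hence "pv g * pv [:inverse c:] = 1" using pv_simps(2,3) by metis
   hence "pv f / pv g = pv (f * [:inverse c:])" unfolding pv_simps(2) by (simp add: divide_inverse inverse_unique)
   thus ?thesis using pf_poly by metis
  next
   case False
   define Q where "Q d \<longleftrightarrow> d dvd g & dg d > 0" for d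
   have "Q g" unfolding Q_def using False by auto
   then obtain pp where q: "Q pp" "\<And>d. Q d ==> dg pp \<le> dg d" using ex_has_least_nat[of Q g dg] by metis
   have pg: "pp dvd g" and pd: "dg pp > 0" using q(1) unfolding Q_def by blast+
   have p0: "pp ~= 0" using pd by auto
   have p: "irr pp" unfolding irr_def using q(2) pd pg dvd_trans dvd_imp_degree_le[OF _ p0] unfolding Q_def by (metis le_antisym not_gr0)
   have bd: "e \<le> dg g" if "pp ^ e dvd g" for e
   proof -
    have "e \<le> e * dg pp" using pd by (cases "dg pp") auto
    also have "\<dots> \<le> dg g" using dvd_imp_degree_le[OF that less.prems] by (simp add: degree_power_eq[OF p0])
    finally show ?thesis .
   qed
   define e where "e = (GREATEST e. pp ^ e dvd g)"
   have e: "pp ^ e dvd g" unfolding e_def by (rule GreatestI_nat[of _ 1 "dg g"]) (use pg bd in auto)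
   have em: "k \<le> e" if "pp ^ k dvd g" for k unfolding e_def by (rule Greatest_le_nat[of _ k "dg g"]) (use that bd in auto)
   have e1: "e \<ge> 1" using em[of 1] pg by simp
   obtain v where v: "g = pp ^ e * v" using e by blast
   have v0: "v ~= 0" using v less.prems by auto
   have "\<not> pp dvd v"
   proof
    assume "pp dvd v"
    hence "pp ^ Suc e dvd g" unfolding v by (simp add: mult_dvd_mono mult.commute)
    from em[OF this] show False by simp
   qed
   then obtain s t where "s * pp + t * v = 1" by (rule irr_bezout[OF p])
   then obtain a b where ab: "a * pp ^ e + b * v = 1" using irr_power_bezout by metis
   have "dg v < dg g" unfolding v using v0 p0 e1 pd by (simp add: degree_mult_eq degree_power_eq)
   hence 1: "pf (pv (f * a) / pv v)" by (rule less.hyps) (rule v0)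
   have "pv a * pv (pp ^ e) + pv b * pv v = 1" unfolding pv_simps(1,2)[symmetric] ab pv_simps(3) ..
   hence "pv f = pv f * (pv a * pv (pp ^ e) + pv b * pv v)" by simp
   moreover have "pv (pp ^ e) ~= 0" "pv v ~= 0" unfolding pv_simps(4) using p0 v0 by auto
   ultimately have "pv f / pv g = pv (f * a) / pv v + pv (f * b) / pv (pp ^ e)" unfolding v pv_simps(2) by (simp add: field_simps)
   thus ?thesis using pf_add[OF 1 pf_prime_power[OF p]] by metis
  qed
 qed
 obtain r where r: "a = to_ac r" using assms unfolding ratfun_field_def by blast
 obtain f g where "r = Fract f g" "g ~= 0" by (cases r) auto
 thus ?thesis unfolding r using * pv_simps(5) by metis
qed

subsection \<open>Extensions of exponent a power of the characteristic\<close>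

text \<open>Cyclic layers to which \<open>cyc_extend\<close> applies; divisibility of the degree by
  p is the condition for a next layer.\<close>

definition tw :: "'q::{field,finite} om set => bool"
 where "tw L \<longleftrightarrow> (EX P N sg b. cyc P N L sg b & N > 0 & CHAR('q om) dvd N)"

definition fx :: "('a => 'a) => 'a set set => bool" where "fx t \<L> \<longleftrightarrow> (ALL L:\<L>. ALL y:L. t y = y)"

lemma fx_Un: "fx t (\<L> Un \<M>) \<longleftrightarrow> fx t \<L> & fx t \<M>" unfolding fx_def by blast

lemma tw_good: "tw L ==> EX P. good P L" unfolding tw_def cyc_def by blast

text \<open>On the next layer t is some \<open>sg^i\<close>. If its p-th power is trivial there, p N
  divides p i, so N divides i and t is trivial on L. One layer of the tower thus pays for one p-th
  power.\<close>

lemma tw_extend: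
 fixes L :: "'q::{field,finite} om set"
 assumes "tw L"
 shows "EX L'. tw L' & (ALL t:aut kk. (ALL x:L'. (t ^^ CHAR('q om)) x = x) --> (ALL x:L. t x = x))"
proof -
 let ?p = "CHAR('q om)"
 obtain P N sg b where c: "cyc P N L sg b" "N > 0" "?p dvd N" using assms unfolding tw_def by blast
 obtain L' b' where c': "cyc P (?p * N) L' sg b'" "L <= L'" by (rule cyc_extend[OF c])
 have p: "?p > 0" using charp_gt_1[where 'q = 'q] by simp
 have L': "tw L'" unfolding tw_def using c' c(2) p by (metis dvd_triv_left nat_0_less_mult_iff)
 have ab: "ab kk L'" using c'(1) unfolding cyc_def good_def by blast
 have "t x = x" if t: "t \<in> aut kk" "ALL x:L'. (t ^^ ?p) x = x" and x: "x \<in> L" for t x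
 proof -
  obtain i where i: "ALL x:L'. t x = (sg ^^ i) x" using c'(1) t(1) unfolding cyc_def by blast
  have "(sg ^^ (i * ?p)) x = x" if "x \<in> L'" for x using funpow_agree[OF ab t(1) i that, of ?p] t(2) that by (simp add: funpow_mult)
  hence "?p * N dvd i * ?p" using c'(1) unfolding cyc_def by blast
  hence "N dvd i" using p by (simp add: mult.commute[of ?p])
  hence "(sg ^^ i) x = x" using c(1) x unfolding cyc_def by blast
  thus ?thesis using i x c'(2) by auto
 qed
 thus ?thesis using L' by blast
qed

text \<open>Partial fractions write \<open>wp x\<close> as a sum of terms with poles at one prime
  each. Up to the prime field, x is the sum of roots y of the corresponding equations, and each y
  lies in \<open>k\<close> or starts a tower.\<close>

lemma as_tower:
 fixes x :: "'q::{field,finite} om"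
 assumes "wp x \<in> kk"
 shows "EX \<L>. finite \<L> & (ALL L:\<L>. tw L) & (ALL t:aut kk. fx t \<L> --> t x = x)"
proof -
 have "ALL a:set xs. a \<in> kk & (EX P. a \<in> Int_off P) ==> wp x = sum_list xs ==>
   EX \<L>. finite \<L> & (ALL L:\<L>. tw L) & (ALL t:aut kk. fx t \<L> --> t x = x)" for xs
 proof (induction xs arbitrary: x)
  case Nil
  hence "wp x = wp 0" by (simp add: wp_0)
  then obtain j where "x = 0 + of_nat j" by (rule wp_eq)
  thus ?case using aut_of_nat by (intro exI[of _ "{}"]) auto
 next
  case (Cons a xs)
  obtain y where y: "wp y = a" by (rule wp_root)
  obtain P where a: "a \<in> kk" "a \<in> Int_off P" using Cons.prems(1) by auto
  have "wp (x - y) = sum_list xs" unfolding wp_diff y using Cons.prems(2) by simp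
  then obtain \<L> where L: "finite \<L>" "ALL L:\<L>. tw L" "ALL t:aut kk. fx t \<L> --> t (x - y) = x - y"
   using Cons.IH[of "x - y"] Cons.prems(1) by auto
  obtain \<M> where M: "finite \<M>" "ALL L:\<M>. tw L" "ALL t:aut kk. fx t \<M> --> t y = y"
  proof (cases "y \<in> kk")
   case True
   thus thesis using that[of "{}"] aut_fixes by blast
  next
   case False
   obtain sg M b where c: "cyc P CHAR('q om) M sg b" "y \<in> M" by (rule cyc_start[OF _ _ False]) (use a y in auto)
   have "tw M" unfolding tw_def using c(1) charp_gt_1[where 'q = 'q] by (metis dvd_refl less_trans zero_less_one)
   thus thesis using that[of "{M}"] c(2) unfolding fx_def by blast
  qed
  have "t x = x" if "t \<in> aut kk" "fx t (\<L> Un \<M>)" for t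
  proof -
   have "t (x - y) = x - y" "t y = y" using L(3) M(3) that unfolding fx_Un by blast+
   thus ?thesis unfolding aut_diff[OF that(1)] by simp
  qed
  moreover have "finite (\<L> Un \<M>)" "ALL L:\<L> Un \<M>. tw L" using L(1,2) M(1,2) by auto
  ultimately show ?case by blast
 qed
 moreover obtain xs where "wp x = sum_list xs" "ALL a:set xs. a \<in> kk & (EX P. a \<in> Int_off P)"
  using partial_fractions[OF assms] unfolding pf_def by blast
 ultimately show ?thesis by blast
qed

text \<open>For each nontrivial restriction f there is an Artin--Schreier element moved by f and a
  finite family of towers controlling it. The union over the finite Galois group excludes all
  nontrivial restrictions.\<close>

lemma exponent_p_towers:
 fixes A :: "'q::{field,finite} om set"
 assumes A: "ab kk A" "fingen kk A" "expo CHAR('q om) A"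
 shows "EX \<L>. finite \<L> & (ALL L:\<L>. tw L) & (ALL t:aut kk. fx t \<L> --> (ALL x:A. t x = x))"
proof -
 have "EX \<L>. finite \<L> & (ALL L:\<L>. tw L) & (ALL t:aut kk. fx t \<L> --> restrict t A = f --> (ALL x:A. t x = x))" (is "EX \<L>. ?P f \<L>")
  if f: "f \<in> restr kk A" for f
 proof (cases "ALL x:A. f x = x")
  case True
  thus ?thesis by (intro exI[of _ "{}"]) (auto simp: restrict_def)
 next
  case False
  obtain g where g: "g \<in> aut kk" "f = restrict g A" using f unfolding restr_def by blast
  then obtain y where y: "y \<in> A" "g y ~= y" using False by auto
  obtain x where x: "x \<in> A" "wp x \<in> kk" "g x ~= x" by (rule as_element[OF A g(1) y])
  obtain \<L> where L: "finite \<L>" "ALL L:\<L>. tw L" "ALL t:aut kk. fx t \<L> --> t x = x" using as_tower[OF x(2)] by blast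
  have "t x = g x" if "restrict t A = f" for t using that x(1) unfolding g(2) restrict_eq_iff by blast
  hence "?P f \<L>" using L x(3) by metis
  thus ?thesis by blast
 qed
 then obtain F where F: "\<And>f. f \<in> restr kk A ==> ?P f (F f)" by metis
 have "ALL x:A. t x = x" if t: "t \<in> aut kk" "fx t (\<Union>(F ` restr kk A))" for t
 proof -
  have r: "restrict t A \<in> restr kk A" unfolding restr_def using t(1) by blast
  moreover have "fx t (F (restrict t A))" using t(2) r unfolding fx_def by blast
  ultimately show ?thesis using F[OF r] t(1) by blast
 qed
 moreover have "finite (\<Union>(F ` restr kk A))" using finite_restr[OF fld_kk A(2)] F by blast
 moreover have "ALL L:\<Union>(F ` restr kk A). tw L" using F by blast
 ultimately show ?thesis by blast
qed

text \<open>By induction on j, \<open>sg\<close> is on E the p^j-th power of an automorphism trivial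
  on any prescribed finite family of towers. In the step this is applied to the next layers of the
  family and to towers controlling the exponent-p part of a field B containing E and those layers.
  Triviality on that part gives a p-th root u on B, and triviality of u^p on the next layers makes u
  trivial on the family. For j = n the exponent of E makes the power trivial.\<close>

theorem wild_fixed:
 fixes E :: "'q::{field,finite} om set"
 assumes E: "ab kk E" "fingen kk E" "expo (CHAR('q om) ^ n) E"
  and s: "sg \<in> aut kk" "\<And>P L x. good P L ==> x \<in> L ==> sg x = x" and x: "x \<in> E" shows "sg x = x"
proof -
 let ?p = "CHAR('q om)"
 have "EX t:aut kk. (ALL x:E. sg x = (t ^^ (?p ^ j)) x) & fx t \<L>" if "finite \<L>" "ALL L:\<L>. tw L" for \<L> j
  using that
 proof (induction j arbitrary: \<L>)
  case 0
  have "fx sg \<L>" unfolding fx_def using tw_good 0(2) s(2) by blast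
  thus ?case using s(1) by (intro bexI[of _ sg]) auto
 next
  case (Suc j)
  obtain Z where Z: "\<And>L. L \<in> \<L> ==> tw (Z L) & (ALL t:aut kk. (ALL x:Z L. (t ^^ ?p) x = x) --> (ALL x:L. t x = x))"
   using tw_extend Suc.prems(2) by metis
  have U: "finite \<M> ==> ALL L:\<M>. tw L ==> EX B. ab kk B & fingen kk B & E <= B & (ALL L:\<M>. L <= B)" for \<M> :: "'q om set set"
  proof (induction rule: finite_induct)
   case (insert L \<M>)
   then obtain B where B: "ab kk B" "fingen kk B" "E <= B" "ALL L:\<M>. L <= B" by auto
   have "ab kk L" "fingen kk L" using insert.prems tw_good unfolding good_def by blast+
   hence "ab kk (gen (B Un L))" "fingen kk (gen (B Un L))" using B ab_un fingen_un by blast+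
   moreover have "B <= gen (B Un L)" "L <= gen (B Un L)" using gen_incl by blast+
   ultimately show ?case using B(3,4) subset_trans[of _ B "gen (B Un L)"] by (intro exI[of _ "gen (B Un L)"]) auto
  qed (use E in blast)
  obtain B where B: "ab kk B" "fingen kk B" "E <= B" "ALL L:Z ` \<L>. L <= B"
   using U[of "Z ` \<L>"] Z Suc.prems(1) by blast
  note A = Fix_powers[OF B(1,2), of ?p]
  obtain \<N> where N: "finite \<N>" "ALL L:\<N>. tw L" "ALL t:aut kk. fx t \<N> --> (ALL x:Fix (powers ?p B) B. t x = x)"
   using exponent_p_towers[OF A] by blast
  obtain t where t: "t \<in> aut kk" "ALL x:E. sg x = (t ^^ (?p ^ j)) x" "fx t (Z ` \<L>)" "fx t \<N>"
   using Suc.IH[of "Z ` \<L> Un \<N>"] Suc.prems(1) Z N(1,2) unfolding fx_Un by blast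
  have "ALL x:Fix (powers ?p B) B. t x = x" using N(3) t(1,4) by blast
  from power_root[OF B(1,2) t(1) this] obtain u where u: "u \<in> aut kk" "ALL x:B. t x = (u ^^ ?p) x" .
  have "ALL x:Z L. (u ^^ ?p) x = x" if "L \<in> \<L>" for L using t(3) that u(2) B(4) unfolding fx_def by (metis imageI subsetD)
  hence "fx u \<L>" unfolding fx_def using Z u(1) by blast
  moreover have "sg x = (u ^^ (?p ^ Suc j)) x" if x: "x \<in> E" for x
   using t(2) x funpow_agree[OF B(1) t(1) u(2), of x "?p ^ j"] B(3) by (auto simp: funpow_mult)
  ultimately show ?case using u(1) by blast
 qed
 from this[of "{}" n] obtain t where "t \<in> aut kk" "ALL x:E. sg x = (t ^^ (?p ^ n)) x" by auto
 thus ?thesis using E(3) x unfolding expo_def by auto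
qed

subsection \<open>Composition of genus fields\<close>

text \<open>Primes over the same prime of \<open>k\<close> are conjugate, and conjugation is trivial
  in an abelian group.\<close>

lemma conjugate_place:
 assumes B: "ab kk B" "fingen kk B" and W: "prm W" "prm W'" "W Int kk = W' Int kk" and u: "u \<in> aut kk"
 shows "inert W B u ==> inert W' B u" "decomp W B u ==> decomp W' B u"
proof -
 have fB: "fld B" by (rule ab_basic(2)[OF B(1)])
 have "W' Int Fix (aut kk) B = W Int Fix (aut kk) B" unfolding Fix_aut[OF B(1)] using W(3) by simp
 from primes_conjugate[OF fld_kk fB B(2) order_refl subgrp_aut ab_stable[OF B(1)] W(2,1) this]
 obtain h where h: "h \<in> aut kk" "W' Int B = pull h W Int B" .
 have hW: "x \<in> W' \<longleftrightarrow> h x \<in> W" if "x \<in> B" for x using h(2) that unfolding pull_def by blast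
 have hB: "h x \<in> B" if "x \<in> B" for x by (rule ab_normal[OF B(1) h(1) that])
 have uB: "u x \<in> B" if "x \<in> B" for x by (rule ab_normal[OF B(1) u that])
 have c: "h (u x) = u (h x)" if "x \<in> B" for x by (rule ab_commute[OF B(1) h(1) u that])
 show "decomp W B u ==> decomp W' B u" using hW hB uB c unfolding decomp_def pull_def by (auto simp: set_eq_iff)
 assume i: "inert W B u"
 have "mx W' Int B = mx (pull h W) Int B" unfolding max_ideal_trace[OF fB, symmetric] h(2) ..
 hence m: "x \<in> mx W' \<longleftrightarrow> h x \<in> mx W" if "x \<in> B" for x using that pull_mx[OF h(1), of x W] by blast
 show "inert W' B u" unfolding inert_def
 proof
  fix x assume x: "x \<in> W' Int B"
  hence "u (h x) - h x \<in> mx W" using i hW hB unfolding inert_def by blast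
  thus "u x - x \<in> mx W'" using x m[of "u x - x"] fld_diff[OF fB uB, of x x] c[of x] by (simp add: aut_diff[OF h(1)])
 qed
qed

text \<open>Each automorphism of L that is not inert at W gets a witness, and C consists of the
  residues of the witnesses. A decomposition element fixing C moves no witness modulo W, so it is
  inert on L, hence trivial because W is unramified in L.\<close>

lemma good_residues:
 fixes L :: "'q::{field,finite} om set"
 assumes g: "good P L" "P ~= W Int kk" and W: "prm W"
 obtains C where "finite C" "C <= FF" "ALL B g. fld B --> L Un C <= B --> g \<in> aut kk --> decomp W B g -->
  (ALL c:C. g c = c) --> (ALL x:L. g x = x)"
proof -
 have ab: "ab kk L" "fingen kk L" using g(1) unfolding good_def by blast+
 define A where "A = {f\<in>restr kk L. EX x:W Int L. f x - x ~: mx W}"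
 have "ALL f:A. EX x. x \<in> W Int L & f x - x ~: mx W" unfolding A_def by blast
 from bchoice[OF this] obtain xi where x: "ALL f:A. xi f \<in> W Int L & f (xi f) - xi f ~: mx W" ..
 define C where "C = (%f. res W (xi f)) ` A"
 have C: "finite C" unfolding C_def A_def using finite_restr[OF fld_kk ab(2)] by simp
 have CF: "C <= FF" unfolding C_def using res(1)[OF W] x by auto
 show thesis
 proof (rule that[OF C CF], intro allI impI ballI)
  fix B and g :: "'q om => 'q om" and y
  assume B: "fld B" "L Un C <= B" and g': "g \<in> aut kk" "decomp W B g" "ALL c:C. g c = c" and y: "y \<in> L"
  have "inert W L g"
  proof (rule ccontr)
   assume n: "\<not> inert W L g"
   define f where "f = restrict g L"
   have f: "f \<in> A" unfolding A_def f_def restr_def using n g'(1) unfolding inert_def by auto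
   define z where "z = xi f"
   have z: "z \<in> W" "z \<in> L" "g z - z ~: mx W" using bspec[OF x f] unfolding z_def[symmetric] unfolding f_def by auto
   define c where "c = res W z"
   have c: "c \<in> C" unfolding C_def c_def z_def using f by blast
   have zc: "z - c \<in> mx W" unfolding c_def by (rule res(2)[OF W z(1)])
   have "z - c \<in> B" using z(2) c B(2) by (intro fld_diff[OF B(1)]) blast+
   hence "g (z - c) \<in> mx W" using decomp_mx[OF g'(2) B(1) g'(1)] zc by blast
   hence "g (z - c) - (z - c) \<in> mx W" by (rule mx_diff[OF W _ zc])
   thus False using z(3) g'(3) c by (simp add: aut_diff[OF g'(1)])
  qed
  thus "g y = y" using goodD[OF g(1) W] g(2) g'(1) y by blast
 qed
qed

text \<open>The fixed field of a group H containing all inertia and infinite decomposition elements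
  is admissible over K: it lies in every inertia field, and decomposition elements of the fixed
  field lift to B. This bounds the genus field from below by an explicit fixed field.\<close>

lemma genus_subset:
 assumes K: "ab kk K" "fingen kk K" and B: "ab kk B" "fingen kk B" "K <= B" and H: "H <= aut K" "subgrp H"
  and c: "\<And>W w. prm W ==> w \<in> aut K ==> inert W B w \<or> W Int kk = P_infinity & decomp W B w ==> w \<in> H"
 shows "Fix H B <= genus_field K"
proof -
 let ?N = "Fix H B"
 note KF = ab_basic(2)[OF K(1)]
 have kK: "kk <= K" by (rule ab_basic(3)[OF K(1)])
 have Hk: "H <= aut kk" using H(1) aut_mono[OF kK] by blast
 have N: "fld ?N" "K <= ?N" "?N <= B" "kk <= ?N"
  using fld_Fix[OF ab_basic(2)[OF B(1)] Hk] kK B(3) H(1) aut_fixes unfolding Fix_def by blast+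
 have KB: "ab K B" by (rule ab_sub(2)[OF B(1) KF kK B(3)])
 obtain S where S: "finite S" "B = gen S" by (rule fingen_kk[OF B(2)])
 have "B = gen (K Un S)" unfolding S(2) using gen_incl[of S] B(3) unfolding S(2) by (intro antisym gen_mono gen_least fld_gen) auto
 hence fB: "fingen K B" unfolding fingen_def using S(1) by blast
 have KN: "ab K ?N" by (rule ab_sub(1)[OF KB N(1-3)])
 have t: "triv K ?N" unfolding triv_def
 proof (intro ballI allI impI)
  fix w W x assume w: "w \<in> aut K" and W: "prm W" and x: "x \<in> ?N"
   and d: "inert W ?N w \<or> W Int kk = P_infinity & decomp W ?N w"
  show "w x = x"
  proof (cases "inert W ?N w")
   case True
   have "?N <= Fix (inertia K B W) B" using c[OF W] unfolding Fix_def inertia_def by blast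
   from uram_sub[OF inertia_unramified[OF KB fB W] this] have u: "uram K ?N W" .
   obtain e where e: "e > 0" "ALL t:K Int mx W. t ~= 0 --> val W t \<ge> e" by (rule value_gap[OF K W])
   show ?thesis by (rule uram_inert_trivial[OF N(1,2) W u e w _ True x]) (use ab_normal[OF KN w] in blast)
  next
   case False
   hence d: "W Int kk = P_infinity" "decomp W ?N w" using d by auto
   obtain v where v: "v \<in> aut K" "decomp W B v" "ALL x:?N. v x = w x" by (rule decomp_lift[OF KB fB H W w d(2)])
   have "v \<in> H" by (rule c[OF W v(1)]) (use v(2) d(1) in blast)
   thus ?thesis using v(3) x unfolding Fix_def by force
  qed
 qed
 have "piece K ?N" unfolding piece_def using KN fingen_sub[OF KB fB N(1-3)] t by blast
 moreover have "ab kk ?N" by (rule ab_sub(1)[OF B(1) N(1,4,3)])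
 ultimately show ?thesis unfolding genus_field_eq[OF K] by blast
qed

text \<open>An automorphism fixing all good fields is trivial on the largest subfields of M of
  exponent p^k and of exponent m, hence on M by \<open>split_exponent\<close>. So M lies in the
  composite of all good fields, and finite generation leaves finitely many of them.\<close>

lemma compositum_good:
 fixes M :: "'q::{field,finite} om set"
 assumes M: "ab kk M" "fingen kk M" and n: "n > 0" "coprime n (CARD('q) - 1)" "expo n M"
 obtains \<L> where "finite \<L>" "ALL L:\<L>. EX P. good P L" "M <= gen (\<Union>\<L>)"
proof -
 let ?G = "gen (kk Un \<Union>{L. EX P. good P L})" and ?p = "CHAR('q om)"
 have p: "Factorial_Ring.prime ?p" by (rule prime_char)
 have "M <= ?G"
 proof
  fix x assume x: "x \<in> M"
  have f: "fixd ?G x" unfolding fixd_def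
  proof
   fix sg :: "'q om => 'q om" assume s: "sg \<in> aut ?G"
   have sk: "sg \<in> aut kk" using aut_mono[OF fld_kk_sub[OF fld_gen] s] .
   have sL: "sg x = x" if "good P L" "x \<in> L" for P L x
    using aut_fixes[OF s] that gen_incl[of "kk Un \<Union>{L. EX P. good P L}"] by blast
   obtain k m where km: "\<not> ?p dvd m" "n = ?p ^ k * m" using multiplicity_decompose'[of n ?p] n(1) p by (metis not_prime_unit not_gr0)
   have c: "coprime (?p ^ k) m" using km(1) p by (metis coprime_power_left_iff prime_imp_coprime)
   have m: "m > 0" "of_nat m ~= (0 :: 'q om)" "coprime m (CARD('q) - 1)" using km n(1,2) by (auto simp: of_nat_eq_0_iff_char_dvd)
   note F = Fix_powers[OF M]
   show "sg x = x"
   proof (rule split_exponent[OF M _ c _ sk _ _ x])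
    show "expo (?p ^ k * m) M" using n(3) km(2) by simp
    show "?p ^ k > 0" using p prime_gt_0_nat by simp
    show "ALL x:Fix (powers (?p ^ k) M) M. sg x = x" by (rule ballI, rule wild_fixed[OF F sk], rule sL, assumption+)
    show "ALL x:Fix (powers m M) M. sg x = x" by (rule ballI, rule tame_fixed[OF F m sk], rule sL, assumption+)
   qed
  qed
  have "x \<in> gen (?G Un M)" by (rule subsetD[OF gen_incl], rule UnI2, rule x)
  from ab_fixed[OF M(1) fld_gen fld_kk_sub[OF fld_gen] this f] show "x \<in> ?G" .
 qed
 note MG = this
 obtain S where S: "finite S" "M = gen S" by (rule fingen_kk[OF M(2)])
 have "ALL s:S. EX T. finite T & T <= kk Un \<Union>{L. EX P. good P L} & s \<in> gen T"
 proof
  fix s assume "s \<in> S"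
  hence "s \<in> ?G" using MG gen_incl[of S] unfolding S(2) by (meson subsetD)
  then obtain T where "finite T" "T <= kk Un \<Union>{L. EX P. good P L}" "s \<in> gen T" by (rule gen_finite)
  thus "EX T. finite T & T <= kk Un \<Union>{L. EX P. good P L} & s \<in> gen T" by (intro exI conjI)
 qed
 from bchoice[OF this] obtain T where T: "ALL s:S. finite (T s) & T s <= kk Un \<Union>{L. EX P. good P L} & s \<in> gen (T s)" ..
 have "good {} (kk :: 'q om set)" unfolding good_def using ab_refl[OF fld_kk] fingen_refl[OF fld_kk] aut_fixes by blast
 hence "ALL t:\<Union>(T ` S). EX L. (EX P. good P L) & t \<in> L" using T by blast
 from bchoice[OF this] obtain L where L: "ALL t:\<Union>(T ` S). (EX P. good P (L t)) & t \<in> L t" ..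
 have "gen (T s) <= gen (\<Union>(L ` \<Union>(T ` S)))" if "s \<in> S" for s using that L by (intro gen_mono) blast
 hence "M <= gen (\<Union>(L ` \<Union>(T ` S)))" unfolding S(2) by (intro gen_least fld_gen) (use T in blast)
 moreover have "finite (L ` \<Union>(T ` S))" using S(1) T by blast
 ultimately show thesis using that[of "L ` \<Union>(T ` S)"] L by blast
qed
text \<open>If P is not the trace of a prime, L is unramified everywhere and any prime may take its
  place.\<close>

lemma prime_of_good:
 fixes L :: "'q::{field,finite} om set"
 assumes "good P L" shows "EX W. prm W & good (W Int kk) L"
proof (cases "EX W. prm W & W Int kk = P")
 case False
 hence "good Q L" for Q using assms unfolding good_def by blast
 moreover obtain W :: "'q om set" where "prm W" by (rule inf_place_ex)
 ultimately show ?thesis by blast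
qed (use assms in blast)

text \<open>An automorphism s fixing both genus fields acts on B as an element of
  \<open>H K1\<close> and as one of \<open>H K2\<close>. The components v1 and v2 at infinity agree
  on the fields attached to infinity, hence on the constants stored there, and
  \<open>good_residues\<close> extends this to B. So v1 fixes K1 and K2 and, as a decomposition
  element, is trivial on M. The finite components then agree too and are trivial on M, and s is the
  product of all components.\<close>

theorem compositum_of_genus_fields:
 fixes K1 K2 M :: "'q::{field,finite} om set"
 assumes K1: "ab kk K1" "fingen kk K1" and K2: "ab kk K2" "fingen kk K2" and M: "ab kk M" "fingen kk M"
  and KM: "K1 <= M" "K2 <= M" and t: "triv (gen (K1 Un K2)) M" and n: "n > 0" "coprime n (CARD('q) - 1)" "expo n M"
 shows "M <= gen (genus_field K1 Un genus_field K2)"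
proof -
 obtain W0 :: "'q om set" where W0: "prm W0" "TT ~: W0" by (rule inf_place_ex)
 define P0 where "P0 = W0 Int kk"
 have P0: "P0 = P_infinity" unfolding P0_def by (rule inf_prime_trace[OF W0])
 obtain \<M> where MM: "finite \<M>" "ALL L:\<M>. EX P. good P L" "M <= gen (\<Union>\<M>)" by (rule compositum_good[OF M n])
 have "ALL L:\<M>. EX W. prm W & good (W Int kk) L" using MM(2) prime_of_good by blast
 from bchoice[OF this] obtain V where V: "ALL L:\<M>. prm (V L) & good (V L Int kk) L" ..
 let ?ok = "%L C. finite C & C <= FF & (ALL B g. fld B --> L Un C <= B --> g \<in> aut kk --> decomp W0 B g -->
  (ALL c:C. g c = c) --> (ALL x:L. g x = x))"
 have "EX C. V L Int kk ~= P0 --> ?ok L C" if L: "L \<in> \<M>" for L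
 proof (cases "V L Int kk = P0")
  case False
  obtain C where "?ok L C" by (rule good_residues[of "V L Int kk" L W0]) (use V L False W0(1) in "auto simp: P0_def")
  thus ?thesis by blast
 qed blast
 hence "ALL L:\<M>. EX C. V L Int kk ~= P0 --> ?ok L C" by blast
 from bchoice[OF this] obtain C where C: "ALL L:\<M>. V L Int kk ~= P0 --> ?ok L (C L)" ..
 \<comment> \<open>The constants that detect decomposition elements on the fields not attached to
   infinity. The field containing them is attached to infinity, where v1 and v2 are known to
   agree.\<close>
 define D where "D = \<Union>(C ` {L\<in>\<M>. V L Int kk ~= P0})"
 have "finite D" "D <= FF" unfolding D_def using C MM(1) by auto
 then obtain L0 where L0: "good P0 L0" "D <= L0" by (rule good_constants)
 define \<L> where "\<L> = insert L0 \<M>"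
 \<comment> \<open>\<open>L0\<close> is attached to infinity even if it already occurs in the family
   with another prime.\<close>
 define U where "U = (%L. if L = L0 then W0 else V L)"
 let ?P = "%L. U L Int kk"
 have UU: "prm (U L)" "good (?P L) L" if "L \<in> \<L>" for L using that V L0(1) W0(1) unfolding \<L>_def U_def P0_def by auto
 have lab: "ab kk L" if "L \<in> \<L>" for L using UU(2)[OF that] unfolding good_def by blast
 define B where "B = gen (kk Un \<Union>\<L>)"
 have B: "ab kk B" unfolding B_def by (rule ab_gen_Union[OF fld_kk lab])
 have LB: "L <= B" if "L \<in> \<L>" for L unfolding B_def using gen_incl[of "kk Un \<Union>\<L>"] that by blast
 have fB: "fld B" unfolding B_def by (rule fld_gen)
 have MB: "M <= B" using MM(3) unfolding B_def \<L>_def by (rule subset_trans) (rule gen_mono, blast)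
 have "fingen kk (gen (kk Un \<Union>\<N>))" if "finite \<N>" "\<N> <= \<L>" for \<N> using that
 proof (induction rule: finite_induct)
  case empty
  show ?case by (simp add: gen_fld[OF fld_kk] fingen_refl[OF fld_kk])
 next
  case (insert L \<N>)
  have "fingen kk (gen (gen (kk Un \<Union>\<N>) Un L))"
   using fingen_un[OF _ , of kk _ L] insert UU(2)[of L] unfolding good_def by blast
  moreover have "gen (gen (kk Un \<Union>\<N>) Un L) = gen (kk Un \<Union>(insert L \<N>))"
  proof
   show "gen (gen (kk Un \<Union>\<N>) Un L) <= gen (kk Un \<Union>(insert L \<N>))"
    by (intro gen_least fld_gen Un_least gen_mono) (use gen_incl[of "kk Un \<Union>(insert L \<N>)"] in auto)
   show "gen (kk Un \<Union>(insert L \<N>)) <= gen (gen (kk Un \<Union>\<N>) Un L)"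
    by (rule gen_mono) (use gen_incl[of "kk Un \<Union>\<N>"] in auto)
  qed
  ultimately show ?case by simp
 qed
 hence finB: "fingen kk B" unfolding B_def using MM(1) unfolding \<L>_def by blast
 define I where "I = (%P u. EX W. prm W & W Int kk = P & inert W B u)"
 have I_all: "inert W B u" if "I P u" "prm W" "W Int kk = P" "u \<in> aut kk" for P u W
  using that conjugate_place(1)[OF B finB _ that(2) _ that(4)] unfolding I_def by metis
 have I_L: "u x = x" if a: "I P u" "u \<in> aut kk" "L \<in> \<L>" "?P L ~= P" "x \<in> L" for P u L x
 proof -
  obtain W where W: "prm W" "W Int kk = P" "inert W B u" using a(1) unfolding I_def by blast
  show ?thesis by (rule goodD[OF UU(2)[OF a(3)] W(1) _ a(2) inert_mono[OF W(3) LB[OF a(3)]] a(5)]) (use W(2) a(4) in blast)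
 qed
 have eqB: "ALL x:B. f x = g x" if "f \<in> aut kk" "g \<in> aut kk" "\<And>L x. L \<in> \<L> ==> x \<in> L ==> f x = g x" for f g
 proof
  fix x assume "x \<in> B"
  thus "f x = g x" unfolding B_def
   by (rule aut_eq_gen[OF that(1,2), rotated]) (use that(3) aut_fixes[OF that(1)] aut_fixes[OF that(2)] in auto)
 qed
 \<comment> \<open>The group generated in Gal(B/K) by inertia groups and the decomposition group at
   infinity, written by components. Since v acts on all factors, the action on a field attached to
   another prime Q is u v rather than u alone.\<close>
 define H where "H K = {h\<in>aut K. EX v:aut K. decomp W0 B v & (ALL L:\<L>. ?P L = P0 --> (ALL x:L. h x = v x)) &
  (ALL Q:?P ` \<L>. Q ~= P0 --> (EX u:aut K. I Q u & (ALL L:\<L>. ?P L = Q --> (ALL x:L. h x = u (v x)))))}" for K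
 have HE: "EX v:aut K. decomp W0 B v & (ALL L:\<L>. ?P L = P0 --> (ALL x:L. h x = v x)) &
   (EX u. ALL Q:?P ` \<L>. Q ~= P0 --> u Q \<in> aut K & I Q (u Q) & (ALL L:\<L>. ?P L = Q --> (ALL x:L. h x = u Q (v x))))"
  if h: "h \<in> H K" for h K
 proof -
  obtain v where v: "v \<in> aut K" "decomp W0 B v" "ALL L:\<L>. ?P L = P0 --> (ALL x:L. h x = v x)"
   and u: "ALL Q:?P ` \<L>. Q ~= P0 --> (EX u:aut K. I Q u & (ALL L:\<L>. ?P L = Q --> (ALL x:L. h x = u (v x))))"
   using h unfolding H_def mem_Collect_eq by (elim conjE bexE)
  have "ALL Q:?P ` \<L>. EX u. Q ~= P0 --> u \<in> aut K & I Q u & (ALL L:\<L>. ?P L = Q --> (ALL x:L. h x = u (v x)))"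
  proof
   fix Q assume Q: "Q \<in> ?P ` \<L>"
   show "EX u. Q ~= P0 --> u \<in> aut K & I Q u & (ALL L:\<L>. ?P L = Q --> (ALL x:L. h x = u (v x)))"
    using bspec[OF u Q] by (cases "Q = P0") auto
  qed
  from bchoice[OF this] show ?thesis using v by (intro bexI[of _ v] conjI)
 qed
 have I_id: "I Q (%x. x)" if "Q \<in> ?P ` \<L>" for Q using that UU(1) inert_id[OF prm_rng] unfolding I_def by blast
 have sub: "Fix (H K) B <= genus_field K" "subgrp (H K)" "H K <= aut kk" if K: "ab kk K" "fingen kk K" "K <= B" for K
 proof -
  have Hk: "H K <= aut K" unfolding H_def by blast
  have ka: "f \<in> aut K ==> f \<in> aut kk" for f using aut_mono[OF ab_basic(3)[OF K(1)]] by blast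
  show "H K <= aut kk" using Hk ka by blast
  have "(%x. x) \<in> H K" unfolding H_def using aut_id(2) decomp_id I_id by blast
  moreover have "g \<circ> h \<in> H K" if gh: "g \<in> H K" "h \<in> H K" for g h
  proof -
   obtain v u where v: "v \<in> aut K" "decomp W0 B v" "ALL L:\<L>. ?P L = P0 --> (ALL x:L. g x = v x)"
    "ALL Q:?P ` \<L>. Q ~= P0 --> u Q \<in> aut K & I Q (u Q) & (ALL L:\<L>. ?P L = Q --> (ALL x:L. g x = u Q (v x)))"
    using HE[OF gh(1)] by (elim bexE conjE exE)
   obtain v' u' where v': "v' \<in> aut K" "decomp W0 B v'" "ALL L:\<L>. ?P L = P0 --> (ALL x:L. h x = v' x)"
    "ALL Q:?P ` \<L>. Q ~= P0 --> u' Q \<in> aut K & I Q (u' Q) & (ALL L:\<L>. ?P L = Q --> (ALL x:L. h x = u' Q (v' x)))"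
    using HE[OF gh(2)] by (elim bexE conjE exE)
   have a: "g \<circ> h \<in> aut K" "v \<circ> v' \<in> aut K" using gh Hk v(1) v'(1) aut_comp by blast+
   have st: "f x \<in> L" if "f \<in> aut K" "L \<in> \<L>" "x \<in> L" for f L x by (rule ab_normal[OF lab[OF that(2)] ka[OF that(1)] that(3)])
   have "decomp W0 B (v \<circ> v')" by (rule decomp_comp[OF v(2) v'(2)]) (use ab_normal[OF B ka[OF v'(1)]] in blast)
   moreover have "ALL L:\<L>. ?P L = P0 --> (ALL x:L. (g \<circ> h) x = (v \<circ> v') x)"
    using v(3) v'(3) st[OF v'(1)] by simp
   moreover have "ALL Q:?P ` \<L>. Q ~= P0 --> (EX u:aut K. I Q u & (ALL L:\<L>. ?P L = Q --> (ALL x:L. (g \<circ> h) x = u ((v \<circ> v') x))))"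
   proof (intro ballI impI)
    fix Q assume Q: "Q \<in> ?P ` \<L>" "Q ~= P0"
    have u: "u Q \<in> aut K" "I Q (u Q)" "ALL L:\<L>. ?P L = Q --> (ALL x:L. g x = u Q (v x))" using mp[OF bspec[OF v(4) Q(1)] Q(2)] by blast+
    have u': "u' Q \<in> aut K" "I Q (u' Q)" "ALL L:\<L>. ?P L = Q --> (ALL x:L. h x = u' Q (v' x))" using mp[OF bspec[OF v'(4) Q(1)] Q(2)] by blast+
    obtain W where W: "prm W" "W Int kk = Q" "inert W B (u' Q)" using u'(2) unfolding I_def by blast
    have "inert W B (u Q \<circ> u' Q)"
     by (rule inert_comp[OF I_all[OF u(2) W(1,2) ka[OF u(1)]] W(3,1) fB u'(1)]) (use ab_normal[OF B ka[OF u'(1)]] in blast)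
    hence "I Q (u Q \<circ> u' Q)" unfolding I_def using W by blast
    moreover have "(g \<circ> h) x = (u Q \<circ> u' Q) ((v \<circ> v') x)" if x: "L \<in> \<L>" "?P L = Q" "x \<in> L" for L x
    proof -
     have vx: "v' x \<in> L" by (rule st[OF v'(1) x(1,3)])
     have "(g \<circ> h) x = u Q (v (u' Q (v' x)))" using u(3) u'(3) x st[OF u'(1) x(1) vx] by simp
     also have "v (u' Q (v' x)) = u' Q (v (v' x))" by (rule ab_commute[OF lab[OF x(1)] ka[OF v(1)] ka[OF u'(1)] vx])
     finally show ?thesis by simp
    qed
    moreover have "u Q \<circ> u' Q \<in> aut K" by (rule aut_comp[OF u(1) u'(1)])
    ultimately show "EX u:aut K. I Q u & (ALL L:\<L>. ?P L = Q --> (ALL x:L. (g \<circ> h) x = u ((v \<circ> v') x)))" by blast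
   qed
   ultimately show ?thesis unfolding H_def using a by blast
  qed
  ultimately show sg: "subgrp (H K)" unfolding subgrp_def by blast
  have dH: "w \<in> H K" if w: "w \<in> aut K" "decomp W0 B w" for w unfolding H_def using w I_id aut_id(2) by blast
  have "w \<in> H K" if W: "prm W" and w: "w \<in> aut K" and d: "inert W B w \<or> W Int kk = P_infinity & decomp W B w" for W w
  proof (cases "W Int kk = P0")
   case True
   have "decomp W B w" using d inert_decomp[OF _ W fB w] by blast
   hence "decomp W0 B w" using conjugate_place(2)[OF B finB W W0(1) _ ka[OF w]] True unfolding P0_def by blast
   thus ?thesis by (rule dH[OF w])
  next
   case False
   hence i: "I (W Int kk) w" unfolding I_def using d W P0 by blast
   have "EX u:aut K. I Q u & (ALL L:\<L>. ?P L = Q --> (ALL x:L. w x = u x))" if Q: "Q \<in> ?P ` \<L>" for Q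
   proof (cases "Q = W Int kk")
    case True
    thus ?thesis using i w by blast
   next
    case False
    thus ?thesis using I_id[OF Q] I_L[OF i ka[OF w]] aut_id(2) by blast
   qed
   moreover have "ALL L:\<L>. ?P L = P0 --> (ALL x:L. w x = x)" using I_L[OF i ka[OF w]] False by metis
   ultimately show ?thesis unfolding H_def by (intro CollectI conjI w bexI[of _ "%x. x"] decomp_id aut_id(2)) auto
  qed
  thus "Fix (H K) B <= genus_field K" by (rule genus_subset[OF K(1,2) B finB K(3) Hk sg])
 qed
 let ?G = "gen (genus_field K1 Un genus_field K2)"
 note s1 = sub[OF K1 subset_trans[OF KM(1) MB]] and s2 = sub[OF K2 subset_trans[OF KM(2) MB]]
 have key: "s x = x" if s: "s \<in> aut kk" "ALL x:?G. s x = x" and xM: "x \<in> M" for s x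
 proof -
  have G: "genus_field K1 <= ?G" "genus_field K2 <= ?G" using gen_incl by blast+
  obtain h1 where h1: "h1 \<in> H K1" "ALL x:B. s x = h1 x"
   by (rule artin_kk[OF B finB s1(3,2) s(1)]) (use s(2) s1(1) G(1) in blast)
  obtain h2 where h2: "h2 \<in> H K2" "ALL x:B. s x = h2 x"
   by (rule artin_kk[OF B finB s2(3,2) s(1)]) (use s(2) s2(1) G(2) in blast)
  obtain v1 u1 where v1: "v1 \<in> aut K1" "decomp W0 B v1" "ALL L:\<L>. ?P L = P0 --> (ALL x:L. h1 x = v1 x)"
   "ALL Q:?P ` \<L>. Q ~= P0 --> u1 Q \<in> aut K1 & I Q (u1 Q) & (ALL L:\<L>. ?P L = Q --> (ALL x:L. h1 x = u1 Q (v1 x)))"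
   using HE[OF h1(1)] by (elim bexE conjE exE)
  obtain v2 u2 where v2: "v2 \<in> aut K2" "decomp W0 B v2" "ALL L:\<L>. ?P L = P0 --> (ALL x:L. h2 x = v2 x)"
   "ALL Q:?P ` \<L>. Q ~= P0 --> u2 Q \<in> aut K2 & I Q (u2 Q) & (ALL L:\<L>. ?P L = Q --> (ALL x:L. h2 x = u2 Q (v2 x)))"
   using HE[OF h2(1)] by (elim bexE conjE exE)
  have k1: "f \<in> aut K1 ==> f \<in> aut kk" for f using aut_mono[OF ab_basic(3)[OF K1(1)]] by blast
  have k2: "f \<in> aut K2 ==> f \<in> aut kk" for f using aut_mono[OF ab_basic(3)[OF K2(1)]] by blast
  have hh: "h1 x = h2 x" if "L \<in> \<L>" "x \<in> L" for L x using h1(2) h2(2) LB[OF that(1)] that(2) by fastforce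
  \<comment> \<open>The discrepancy between the two components at infinity: a decomposition element
    that fixes \<open>L0\<close> and hence the constants in D.\<close>
  define w where "w = ainv v1 \<circ> v2"
  have w: "w \<in> aut kk" unfolding w_def by (rule aut_comp[OF aut_inv[OF k1[OF v1(1)]] k2[OF v2(1)]])
  have wx: "w x = x" if "v1 x = v2 x" for x unfolding w_def using that aut_inv_apply(2)[OF k1[OF v1(1)], of x] by simp
  have xw: "v1 x = v2 x" if "w x = x" for x using that aut_inv_apply(1)[OF k1[OF v1(1)], of "v2 x"] unfolding w_def by simp
  have "ainv v1 x \<in> W0 \<longleftrightarrow> x \<in> W0" if "x \<in> B" for x
   using decompD[OF v1(2) ab_ainv[OF B k1[OF v1(1)] that]] aut_inv_apply(1)[OF k1[OF v1(1)]] by simp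
  hence "decomp W0 B (ainv v1)" unfolding decomp_def pull_def by blast
  hence dw: "decomp W0 B w" unfolding w_def by (rule decomp_comp[OF _ v2(2)]) (use ab_normal[OF B k2[OF v2(1)]] in blast)
  have wP: "w x = x" if "L \<in> \<L>" "?P L = P0" "x \<in> L" for L x by (rule wx) (use v1(3) v2(3) hh[OF that(1,3)] that in metis)
  have L0L: "L0 \<in> \<L>" "?P L0 = P0" unfolding \<L>_def U_def P0_def by auto
  have "w x = x" if L: "L \<in> \<L>" "x \<in> L" for L x
  proof (cases "?P L = P0")
   case False
   hence LM: "L \<in> \<M>" "V L Int kk ~= P0" using L(1) L0L unfolding \<L>_def U_def by (auto split: if_splits)
   have CD: "C L <= L0" using LM L0(2) unfolding D_def by blast
   have "ALL c:C L. w c = c" using wP[OF L0L] CD by blast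
   moreover have "L Un C L <= B" using LB[OF L(1)] LB[OF L0L(1)] CD by blast
   ultimately show ?thesis using C LM fB w dw L(2) by blast
  qed (use wP L in blast)
  hence vv: "ALL x:B. v1 x = v2 x" using eqB[OF k1[OF v1(1)] k2[OF v2(1)]] xw by blast
  have toK: "f \<in> aut (gen (K1 Un K2))" if f: "f \<in> aut K1" "g \<in> aut K2" "ALL x:B. f x = g x" for f g
   by (rule aut_gen[OF k1[OF f(1)]]) (use f aut_fixes[OF f(1)] aut_fixes[OF f(2)] KM(2) MB in auto)
  have vM: "v1 x = x" if "x \<in> M" for x
   by (rule trivD2[OF t toK[OF v1(1) v2(1) vv] W0(1) _ decomp_mono[OF v1(2) MB] that]) (use P0 in "simp add: P0_def")
  have uu: "u1 Q \<in> aut kk & I Q (u1 Q) & (ALL x:M. u1 Q x = x)" if Q: "Q \<in> ?P ` \<L>" "Q ~= P0" for Q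
  proof -
   have a: "u1 Q \<in> aut K1" "I Q (u1 Q)" "ALL L:\<L>. ?P L = Q --> (ALL x:L. h1 x = u1 Q (v1 x))"
    using mp[OF bspec[OF v1(4) Q(1)] Q(2)] by blast+
   have b: "u2 Q \<in> aut K2" "I Q (u2 Q)" "ALL L:\<L>. ?P L = Q --> (ALL x:L. h2 x = u2 Q (v2 x))"
    using mp[OF bspec[OF v2(4) Q(1)] Q(2)] by blast+
   have "u1 Q x = u2 Q x" if L: "L \<in> \<L>" "x \<in> L" for L x
   proof (cases "?P L = Q")
    case True
    \<comment> \<open>Since v1 and v2 agree on B, both h1 and h2 can be evaluated at the same
      preimage y of x, which isolates u1 and u2.\<close>
    define y where "y = ainv v1 x"
    have y: "y \<in> L" "v1 y = x" unfolding y_def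
     using ab_ainv[OF lab[OF L(1)] k1[OF v1(1)] L(2)] aut_inv_apply(1)[OF k1[OF v1(1)]] by auto
    have "v2 y = x" using vv y LB[OF L(1)] by fastforce
    thus ?thesis using a(3) b(3) L(1) True y hh[OF L(1) y(1)] by metis
   next
    case False
    show ?thesis using I_L[OF a(2) k1[OF a(1)] L(1) False L(2)] I_L[OF b(2) k2[OF b(1)] L(1) False L(2)] by simp
   qed
   from eqB[OF k1[OF a(1)] k2[OF b(1)] this] have "u1 Q \<in> aut (gen (K1 Un K2))" by (rule toK[OF a(1) b(1)])
   moreover obtain W where "prm W" "inert W B (u1 Q)" using a(2) unfolding I_def by blast
   ultimately have "ALL x:M. u1 Q x = x" using trivD1[OF t] inert_mono[OF _ MB] by blast
   thus ?thesis using a(2) k1[OF a(1)] by blast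
  qed
  \<comment> \<open>The finite components are multiplied one by one. Each acts only on the fields
    attached to its own prime, so on every field a single component is visible.\<close>
  have pr: "EX w:aut kk. (ALL x:M. w x = x) & (ALL L:\<L>. ALL x:L. w x = (if ?P L \<in> \<Q> then u1 (?P L) x else x))"
   if "finite \<Q>" "\<Q> <= ?P ` \<L> - {P0}" for \<Q> using that
  proof (induction rule: finite_induct)
   case empty
   show ?case by (rule bexI[of _ "%x. x"]) (auto simp: aut_id(2))
  next
   case (insert Q \<Q>)
   then obtain w where w: "w \<in> aut kk" "ALL x:M. w x = x" "ALL L:\<L>. ALL x:L. w x = (if ?P L \<in> \<Q> then u1 (?P L) x else x)" by auto
   have "Q \<in> ?P ` \<L>" "Q ~= P0" using insert.prems by auto
   hence u: "u1 Q \<in> aut kk" "I Q (u1 Q)" "ALL x:M. u1 Q x = x" using uu[of Q] by blast+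
   have "(u1 Q \<circ> w) x = (if ?P L \<in> insert Q \<Q> then u1 (?P L) x else x)" if L: "L \<in> \<L>" "x \<in> L" for L x
   proof (cases "?P L = Q")
    case True
    thus ?thesis using w(3) L insert.hyps(2) by simp
   next
    case False
    have "w x \<in> L" by (rule ab_normal[OF lab[OF L(1)] w(1) L(2)])
    hence "u1 Q (w x) = w x" by (rule I_L[OF u(2,1) L(1) False])
    thus ?thesis using w(3) L False by auto
   qed
   moreover have "ALL x:M. (u1 Q \<circ> w) x = x" using w(2) u(3) by simp
   moreover have "u1 Q \<circ> w \<in> aut kk" by (rule aut_comp[OF u(1) w(1)])
   ultimately show ?case by (intro bexI[of _ "u1 Q \<circ> w"] conjI ballI) auto
  qed
  have "finite (?P ` \<L> - {P0})" using MM(1) unfolding \<L>_def by simp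
  from pr[OF this order_refl] obtain z where z: "z \<in> aut kk" "ALL x:M. z x = x"
   "ALL L:\<L>. ALL x:L. z x = (if ?P L \<in> ?P ` \<L> - {P0} then u1 (?P L) x else x)" by (elim bexE conjE)
  have "s x = (z \<circ> v1) x" if L: "L \<in> \<L>" "x \<in> L" for L x
  proof -
   have "v1 x \<in> L" by (rule ab_normal[OF lab[OF L(1)] k1[OF v1(1)] L(2)])
   moreover have "s x = h1 x" using h1(2) LB[OF L(1)] L(2) by blast
   ultimately show ?thesis using z(3) v1(3,4) L by (cases "?P L = P0") auto
  qed
  from eqB[OF s(1) aut_comp[OF z(1) k1[OF v1(1)]] this] have "s x = z (v1 x)" using xM MB by auto
  thus ?thesis using vM[OF xM] z(2) xM by simp
 qed
 show ?thesis
 proof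
  fix x assume x: "x \<in> M"
  have f: "fixd ?G x" unfolding fixd_def using key[OF _ _ x] aut_fixes[of _ ?G] aut_mono[OF fld_kk_sub[OF fld_gen]] by blast
  have "x \<in> gen (?G Un M)" by (rule subsetD[OF gen_incl], rule UnI2, rule x)
  from ab_fixed[OF M(1) fld_gen fld_kk_sub[OF fld_gen] this f] show "x \<in> ?G" .
 qed
qed

lemma fingen_trans:
 assumes "fingen kk K" "fingen K M" shows "fingen kk M"
proof -
 obtain R where R: "finite R" "K = gen R" by (rule fingen_kk[OF assms(1)])
 obtain S where S: "finite S" "M = gen (K Un S)" by (rule fingenE[OF assms(2)])
 have "M = gen (kk Un (R Un S))"
 proof
  show "M <= gen (kk Un (R Un S))" unfolding S(2) R(2)
   by (intro gen_least[OF fld_gen] Un_least gen_mono) (use gen_incl[of "kk Un (R Un S)"] in auto)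
  show "gen (kk Un (R Un S)) <= M" unfolding S(2) R(2) by (intro gen_least[OF fld_gen] Un_least fld_kk_sub[OF fld_gen])
    (use gen_incl[of "gen R Un S"] gen_incl[of R] in auto)
 qed
 thus ?thesis unfolding fingen_def using R(1) S(1) by blast
qed

lemma fld_genus:
 assumes F: "ab kk F" "fingen kk F" shows "fld (genus_field F)" unfolding genus_field_eq[OF F]
proof (rule directed_fld)
 show "{M. ab kk M & piece F M} ~= {}" using F(1) piece_refl[OF ab_basic(2)[OF F(1)]] by blast
 show "ALL M:{M. ab kk M & piece F M}. fld M" using ab_basic(2) by blast
 show "ALL M:{M. ab kk M & piece F M}. ALL N:{M. ab kk M & piece F M}. gen (M Un N) \<in> {M. ab kk M & piece F M}"
  using ab_un piece_un by blast
qed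

lemma genus_field_mono:
 assumes K: "ab kk K1" "fingen kk K1" "ab kk K2" "fingen kk K2" shows "genus_field K1 <= genus_field (gen (K1 Un K2))"
proof
 fix x assume "x \<in> genus_field K1"
 then obtain M where M: "ab kk M" "piece K1 M" "x \<in> M" unfolding genus_field_eq[OF K(1,2)] by blast
 have "x \<in> gen (M Un K2)" using gen_incl[of "M Un K2"] M(3) by blast
 thus "x \<in> genus_field (gen (K1 Un K2))"
  unfolding genus_field_eq[OF ab_un[OF K(1,3)] fingen_un[OF K(2,4)]] using genus_pieces_un[OF K(1,3) M(1,2)] by blast
qed

theorem corollary6p4:
  fixes K1 K2 :: "'q::{field,finite} ratfun_closure set"
  assumes "finite_extension ratfun_field K1" and "abelian_extension ratfun_field K1"
    and "finite_extension ratfun_field K2" and "abelian_extension ratfun_field K2"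
    and "coprime (ext_degree ratfun_field K1) (CARD('q) - 1)"
    and "coprime (ext_degree ratfun_field K2) (CARD('q) - 1)"
  shows "composite (genus_field K1) (genus_field K2) = genus_field (composite K1 K2)"
proof -
 have K1: "ab kk K1" "fingen kk K1" and K2: "ab kk K2" "fingen kk K2"
  using assms(1-4) finite_extension_fingen(3)[OF fld_kk] abelian_extension_iff[OF fld_kk] by blast+
 let ?K = "gen (K1 Un K2)" and ?G = "gen (genus_field K1 Un genus_field K2)"
 have K: "ab kk ?K" "fingen kk ?K" by (rule ab_un[OF K1(1) K2(1)], rule fingen_un[OF K1(2) K2(2)])
 have "genus_field ?K <= ?G"
 proof
  fix x assume "x \<in> genus_field ?K"
  then obtain M where M: "ab kk M" "piece ?K M" "x \<in> M" unfolding genus_field_eq[OF K] by blast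
  have p: "?K <= M" "fingen ?K M" "triv ?K M" using M(2) ab_basic(3) unfolding piece_def by blast+
  have fM: "fingen kk M" by (rule fingen_trans[OF K(2) p(2)])
  \<comment> \<open>An exponent of Gal(K1 K2 / k), not its degree: this is the form in which
    \<open>piece_exponent\<close> uses coprimality to q - 1.\<close>
  let ?a = "ext_degree kk K1 * ext_degree kk K2"
  have a: "?a > 0" "coprime ?a (CARD('q) - 1)" using assms(5,6) expo_degree(1)[OF K1] expo_degree(1)[OF K2] by auto
  have "expo ?a ?K" by (rule expo_gen[OF expo_dvd[OF expo_degree(2)[OF K1]] expo_dvd[OF expo_degree(2)[OF K2]]]) auto
  note a = a this
  obtain n where n: "n > 0" "coprime n (CARD('q) - 1)" "expo n M"
   by (rule exponent_reduce[OF M(1) fM q_minus_1(1) piece_exponent[OF K a(3,2,1) M(1) fM p(3)]])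
  have KM: "K1 <= M" "K2 <= M" using p(1) gen_incl[of "K1 Un K2"] by blast+
  from compositum_of_genus_fields[OF K1 K2 M(1) fM KM p(3) n] show "x \<in> ?G" using M(3) by blast
 qed
 moreover have "?G <= genus_field ?K"
 proof (rule gen_least[OF fld_genus[OF K]], rule Un_least)
  show "genus_field K1 <= genus_field ?K" by (rule genus_field_mono[OF K1 K2])
  show "genus_field K2 <= genus_field ?K" using genus_field_mono[OF K2 K1] by (simp add: Un_commute)
 qed
 ultimately show ?thesis unfolding composite_gen[OF ab_basic(2)[OF K1(1)] ab_basic(2)[OF K2(1)]]
   composite_gen[OF fld_genus[OF K1] fld_genus[OF K2]] by blast
qed

end
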